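(* Let $n\ge0$, let $\mathcal C$ be an $n$-Frobenius category, $M,N\in\mathcal C$, and let $\Omega M\to Q\to M$ and $\Omega N\to P\to N$ be conflations with $Q,P$ $n$-projective. Let $(\mathcal C_{\mathcal P},T)$ be the phantom stable category of $\mathcal C$. Then the induced map $$\Omega:\mathcal C_{\mathcal P}(M,N)\to\mathcal C_{\mathcal P}(\Omega M,\Omega N),\qquad (\bar\gamma,\delta_N)\mapsto(\theta(\bar\gamma),\delta_{\Omega N}),$$ is an isomorphism, where $\theta$ is the composite of the natural isomorphisms $$\operatorname{Ext}^n(M,\Omega^nN)/\mathcal P\;\cong\;\operatorname{Ext}^{n+1}(M,\Omega^{n+1}N)\;\cong\;\operatorname{Ext}^n(\Omega M,\Omega^{n+1}N)/\mathcal P$$ described in the context.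
   Context: Let $\mathcal A$ be an abelian category and $\mathcal C$ a full additive extension-closed subcategory with the inherited exact structure: conflations are short exact sequences of $\mathcal A$ with all terms in $\mathcal C$ (first map an inflation, second a deflation). Conflations of length $t\ge1$ are exact sequences spliced from $t$ conflations; $\operatorname{Ext}^t(A,B)=\operatorname{Ext}^t_{\mathcal C}(A,B)$ is the abelian group (Baer sum) of equivalence classes of conflations $B\to X_{t-1}\to\cdots\to X_0\to A$ of length $t$; $\operatorname{Ext}^0=\operatorname{Hom}_{\mathcal C}$. $g\gamma$ and $\gamma h$ denote push-out along $g$ and pull-back along $h$ (compositions if $t=0$). $P\in\mathcal C$ is $n$-projective (resp. $n$-injective) if $\operatorname{Ext}^i(P,-)=0$ (resp. $\operatorname{Ext}^i(-,P)=0$) on $\mathcal C$ for all $i>n$; $\mathcal C$ is $n$-Frobenius if every object has a deflation from an $n$-projective and an inflation into an $n$-injective, and the $n$-projectives coincide with the $n$-injectives. $\mathcal P(X,Y)\subseteq\operatorname{Ext}^n(X,Y)$ is the subgroup of elements $\eta f$ with $f:X\to P'$, $P'$ $n$-projective, $\eta\in\operatorname{Ext}^n(P',Y)$; bars denote classes modulo $\mathcal P$. A unit conflation of length $k$ is one of the form $\Omega^kN\to P_{k-1}\to\cdots\to P_0\to N$ with all $P_i$ $n$-projective. $\Sigma$ is the class of quasi-invertible morphisms: those $f:A\to B$ such that $\operatorname{Ext}^{n+1}(X,A)\to\operatorname{Ext}^{n+1}(X,B)$, $\gamma\mapsto f\gamma$, is an isomorphism for all $X\in\mathcal C$ (equivalently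 the analogous condition with pull-backs). The phantom stable category $\mathcal C_{\mathcal P}$ has the same objects as $\mathcal C$. For $n\ge1$, $\mathcal C_{\mathcal P}(M,N)=\operatorname{Hom}_{\mathcal C_{\mathcal P}}(M,N)$ is the set of pairs $(\bar\gamma,\delta_N)$, with $\delta_N$ a unit conflation $\Omega^nN\to\cdots\to N$ of length $n$ and $\bar\gamma\in\operatorname{Ext}^n(M,\Omega^nN)/\mathcal P$, modulo the relation $(\bar\gamma,\delta_N)\sim(\bar\gamma',\delta_N')$ if $a\gamma-b\gamma'\in\mathcal P$ for inflations $a,b\in\Sigma$ with $a\delta_N=b\delta_N'$ a unit conflation. For each fixed $\delta_N$, every class contains a unique element with second component $\delta_N$, so $\mathcal C_{\mathcal P}(M,N)$ is identified with the abelian group $\operatorname{Ext}^n(M,\Omega^nN)/\mathcal P$. For $n=0$, $\mathcal C_{\mathcal P}(M,N)=\operatorname{Hom}_{\mathcal C}(M,N)/\mathcal P(M,N)$. For the map $\Omega$: choose conflations $\Omega^{i+1}N\to P_i\to\Omega^iN$ with $P_i$ $n$-projective for $0\le i\le n$ ($\Omega^0N=N$), where for $i=0$ the given conflation $\Omega N\to P\to N$ is used, and set $\delta_N:\Omega^nN\to P_{n-1}\to\cdots\to P_0\to N$ and $\delta_{\Omega N}:\Omega^{n+1}N\to P_n\to\cdots\to P_1\to\Omega N$. The first isomorphism in $\theta$ is induced by the connecting map $\operatorname{Ext}^n(M,\Omega^nN)\to\operatorname{Ext}^{n+1}(M,\Omega^{n+1}N)$ of the conflation $\Omega^{n+1}N\to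 P_n\to\Omega^nN$; the second is the inverse of the isomorphism $\operatorname{Ext}^n(\Omega M,\Omega^{n+1}N)/\mathcal P\to\operatorname{Ext}^{n+1}(M,\Omega^{n+1}N)$ induced by the connecting map of $\Omega M\to Q\to M$. *)

theory Defs
  imports "HOL-Algebra.Coset"
begin

section \<open>Abelian categories\<close>

text \<open>Every arrow carries its source and target; \<open>g \<cdot> f\<close> is \<open>g\<close> after \<open>f\<close>. Composites and sums
  of arrows that do not match are arbitrary.\<close>

record ('o, 'm) category_data =
  objs :: "'o set"
  arrs :: "'m set"
  src :: "'m \<Rightarrow> 'o"
  tgt :: "'m \<Rightarrow> 'o"
  cmp :: "'m \<Rightarrow> 'm \<Rightarrow> 'm" (infixl \<open>\<cdot>\<index>\<close> 70)
  idn :: "'o \<Rightarrow> 'm"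
  plus_arr :: "'m \<Rightarrow> 'm \<Rightarrow> 'm" (infixl \<open>\<boxplus>\<index>\<close> 65)
  zero_arr :: "'o \<Rightarrow> 'o \<Rightarrow> 'm"

definition Hom :: "('o, 'm) category_data \<Rightarrow> 'o \<Rightarrow> 'o \<Rightarrow> 'm set" where
  "Hom \<A> X Y = {f \<in> arrs \<A>. src \<A> f = X \<and> tgt \<A> f = Y}"

definition is_zero_object :: "('o, 'm) category_data \<Rightarrow> 'o \<Rightarrow> bool" where
  "is_zero_object \<A> Z \<longleftrightarrow> Z \<in> objs \<A> \<and>
     (\<forall>X\<in>objs \<A>. (\<exists>!f. f \<in> Hom \<A> Z X) \<and> (\<exists>!f. f \<in> Hom \<A> X Z))"

definition is_biproduct ::
  "('o, 'm) category_data \<Rightarrow> 'o \<Rightarrow> 'o \<Rightarrow> 'o \<Rightarrow> 'm \<Rightarrow> 'm \<Rightarrow> 'm \<Rightarrow> 'm \<Rightarrow> bool" where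
  "is_biproduct \<A> X Y S i j p q \<longleftrightarrow> S \<in> objs \<A> \<and>
     i \<in> Hom \<A> X S \<and> j \<in> Hom \<A> Y S \<and> p \<in> Hom \<A> S X \<and> q \<in> Hom \<A> S Y \<and>
     p \<cdot>\<^bsub>\<A>\<^esub> i = idn \<A> X \<and> q \<cdot>\<^bsub>\<A>\<^esub> j = idn \<A> Y \<and>
     p \<cdot>\<^bsub>\<A>\<^esub> j = zero_arr \<A> Y X \<and> q \<cdot>\<^bsub>\<A>\<^esub> i = zero_arr \<A> X Y \<and>
     (i \<cdot>\<^bsub>\<A>\<^esub> p) \<boxplus>\<^bsub>\<A>\<^esub> (j \<cdot>\<^bsub>\<A>\<^esub> q) = idn \<A> S"

definition is_kernel :: "('o, 'm) category_data \<Rightarrow> 'm \<Rightarrow> 'm \<Rightarrow> bool" where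
  "is_kernel \<A> f k \<longleftrightarrow> f \<in> arrs \<A> \<and> k \<in> arrs \<A> \<and> tgt \<A> k = src \<A> f \<and>
     f \<cdot>\<^bsub>\<A>\<^esub> k = zero_arr \<A> (src \<A> k) (tgt \<A> f) \<and>
     (\<forall>h\<in>arrs \<A>. tgt \<A> h = src \<A> f \<and> f \<cdot>\<^bsub>\<A>\<^esub> h = zero_arr \<A> (src \<A> h) (tgt \<A> f) \<longrightarrow>
        (\<exists>!u. u \<in> Hom \<A> (src \<A> h) (src \<A> k) \<and> k \<cdot>\<^bsub>\<A>\<^esub> u = h))"

definition is_cokernel :: "('o, 'm) category_data \<Rightarrow> 'm \<Rightarrow> 'm \<Rightarrow> bool" where
  "is_cokernel \<A> f c \<longleftrightarrow> f \<in> arrs \<A> \<and> c \<in> arrs \<A> \<and> src \<A> c = tgt \<A> f \<and>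
     c \<cdot>\<^bsub>\<A>\<^esub> f = zero_arr \<A> (src \<A> f) (tgt \<A> c) \<and>
     (\<forall>h\<in>arrs \<A>. src \<A> h = tgt \<A> f \<and> h \<cdot>\<^bsub>\<A>\<^esub> f = zero_arr \<A> (src \<A> f) (tgt \<A> h) \<longrightarrow>
        (\<exists>!u. u \<in> Hom \<A> (tgt \<A> c) (tgt \<A> h) \<and> u \<cdot>\<^bsub>\<A>\<^esub> c = h))"

definition is_mono :: "('o, 'm) category_data \<Rightarrow> 'm \<Rightarrow> bool" where
  "is_mono \<A> f \<longleftrightarrow> f \<in> arrs \<A> \<and>
     (\<forall>X\<in>objs \<A>. \<forall>u\<in>Hom \<A> X (src \<A> f). \<forall>v\<in>Hom \<A> X (src \<A> f).
        f \<cdot>\<^bsub>\<A>\<^esub> u = f \<cdot>\<^bsub>\<A>\<^esub> v \<longrightarrow> u = v)"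

definition is_epi :: "('o, 'm) category_data \<Rightarrow> 'm \<Rightarrow> bool" where
  "is_epi \<A> f \<longleftrightarrow> f \<in> arrs \<A> \<and>
     (\<forall>X\<in>objs \<A>. \<forall>u\<in>Hom \<A> (tgt \<A> f) X. \<forall>v\<in>Hom \<A> (tgt \<A> f) X.
        u \<cdot>\<^bsub>\<A>\<^esub> f = v \<cdot>\<^bsub>\<A>\<^esub> f \<longrightarrow> u = v)"

locale abelian_category =
  fixes \<A> :: "('o, 'm) category_data" (structure)
  assumes src_closed: "f \<in> arrs \<A> \<Longrightarrow> src \<A> f \<in> objs \<A>"
    and tgt_closed: "f \<in> arrs \<A> \<Longrightarrow> tgt \<A> f \<in> objs \<A>"
    and idn_closed: "X \<in> objs \<A> \<Longrightarrow> idn \<A> X \<in> Hom \<A> X X"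
    and cmp_closed: "f \<in> Hom \<A> X Y \<Longrightarrow> g \<in> Hom \<A> Y Z \<Longrightarrow> g \<cdot> f \<in> Hom \<A> X Z"
    and cmp_assoc: "f \<in> Hom \<A> X Y \<Longrightarrow> g \<in> Hom \<A> Y Z \<Longrightarrow> h \<in> Hom \<A> Z W \<Longrightarrow>
      (h \<cdot> g) \<cdot> f = h \<cdot> (g \<cdot> f)"
    and cmp_idn: "f \<in> Hom \<A> X Y \<Longrightarrow> f \<cdot> idn \<A> X = f"
    and idn_cmp: "f \<in> Hom \<A> X Y \<Longrightarrow> idn \<A> Y \<cdot> f = f"
    and hom_comm_group: "X \<in> objs \<A> \<Longrightarrow> Y \<in> objs \<A> \<Longrightarrow>
      comm_group \<lparr>carrier = Hom \<A> X Y, mult = plus_arr \<A>, one = zero_arr \<A> X Y\<rparr>"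
    and cmp_plus: "f \<in> Hom \<A> X Y \<Longrightarrow> g \<in> Hom \<A> Y Z \<Longrightarrow> g' \<in> Hom \<A> Y Z \<Longrightarrow>
      (g \<boxplus> g') \<cdot> f = (g \<cdot> f) \<boxplus> (g' \<cdot> f)"
    and plus_cmp: "f \<in> Hom \<A> X Y \<Longrightarrow> f' \<in> Hom \<A> X Y \<Longrightarrow> g \<in> Hom \<A> Y Z \<Longrightarrow>
      g \<cdot> (f \<boxplus> f') = (g \<cdot> f) \<boxplus> (g \<cdot> f')"
    and ex_zero_object: "\<exists>Z. is_zero_object \<A> Z"
    and ex_biproduct: "X \<in> objs \<A> \<Longrightarrow> Y \<in> objs \<A> \<Longrightarrow> \<exists>S i j p q. is_biproduct \<A> X Y S i j p q"
    and ex_kernel: "f \<in> arrs \<A> \<Longrightarrow> \<exists>k. is_kernel \<A> f k"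
    and ex_cokernel: "f \<in> arrs \<A> \<Longrightarrow> \<exists>c. is_cokernel \<A> f c"
    and mono_is_kernel: "is_mono \<A> k \<Longrightarrow> \<exists>f. is_kernel \<A> f k"
    and epi_is_cokernel: "is_epi \<A> c \<Longrightarrow> \<exists>f. is_cokernel \<A> f c"

definition short_exact :: "('o, 'm) category_data \<Rightarrow> 'm \<Rightarrow> 'm \<Rightarrow> bool" where
  "short_exact \<A> i p \<longleftrightarrow> is_kernel \<A> p i \<and> is_cokernel \<A> i p"

definition is_pushout :: "('o, 'm) category_data \<Rightarrow> 'm \<Rightarrow> 'm \<Rightarrow> 'm \<Rightarrow> 'm \<Rightarrow> bool" where
  \<comment> \<open>\<open>u \<cdot> f = v \<cdot> g\<close> is the pushout square of the span \<open>(f, g)\<close>\<close>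
  "is_pushout \<A> f g u v \<longleftrightarrow> f \<in> arrs \<A> \<and> g \<in> arrs \<A> \<and> src \<A> f = src \<A> g \<and>
     u \<in> arrs \<A> \<and> v \<in> Hom \<A> (tgt \<A> g) (tgt \<A> u) \<and> src \<A> u = tgt \<A> f \<and> u \<cdot>\<^bsub>\<A>\<^esub> f = v \<cdot>\<^bsub>\<A>\<^esub> g \<and>
     (\<forall>T\<in>objs \<A>. \<forall>x\<in>Hom \<A> (tgt \<A> f) T. \<forall>y\<in>Hom \<A> (tgt \<A> g) T. x \<cdot>\<^bsub>\<A>\<^esub> f = y \<cdot>\<^bsub>\<A>\<^esub> g \<longrightarrow>
        (\<exists>!w. w \<in> Hom \<A> (tgt \<A> u) T \<and> w \<cdot>\<^bsub>\<A>\<^esub> u = x \<and> w \<cdot>\<^bsub>\<A>\<^esub> v = y))"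

definition is_pullback :: "('o, 'm) category_data \<Rightarrow> 'm \<Rightarrow> 'm \<Rightarrow> 'm \<Rightarrow> 'm \<Rightarrow> bool" where
  \<comment> \<open>\<open>f \<cdot> u = g \<cdot> v\<close> is the pullback square of the cospan \<open>(f, g)\<close>\<close>
  "is_pullback \<A> f g u v \<longleftrightarrow> f \<in> arrs \<A> \<and> g \<in> arrs \<A> \<and> tgt \<A> f = tgt \<A> g \<and>
     u \<in> arrs \<A> \<and> v \<in> Hom \<A> (src \<A> u) (src \<A> g) \<and> tgt \<A> u = src \<A> f \<and> f \<cdot>\<^bsub>\<A>\<^esub> u = g \<cdot>\<^bsub>\<A>\<^esub> v \<and>
     (\<forall>T\<in>objs \<A>. \<forall>x\<in>Hom \<A> T (src \<A> f). \<forall>y\<in>Hom \<A> T (src \<A> g). f \<cdot>\<^bsub>\<A>\<^esub> x = g \<cdot>\<^bsub>\<A>\<^esub> y \<longrightarrow>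
        (\<exists>!w. w \<in> Hom \<A> T (src \<A> u) \<and> u \<cdot>\<^bsub>\<A>\<^esub> w = x \<and> v \<cdot>\<^bsub>\<A>\<^esub> w = y))"


section \<open>Extension-closed subcategories and conflations\<close>

text \<open>A full subcategory is given by its set \<open>\<C>\<close> of objects.\<close>

definition ext_closed_additive_subcategory :: "('o, 'm) category_data \<Rightarrow> 'o set \<Rightarrow> bool" where
  "ext_closed_additive_subcategory \<A> \<C> \<longleftrightarrow> \<C> \<subseteq> objs \<A> \<and>
     (\<exists>Z\<in>\<C>. is_zero_object \<A> Z) \<and>
     (\<forall>X\<in>\<C>. \<forall>Y\<in>\<C>. \<exists>S\<in>\<C>. \<exists>i j p q. is_biproduct \<A> X Y S i j p q) \<and>
     (\<forall>i p. short_exact \<A> i p \<and> src \<A> i \<in> \<C> \<and> tgt \<A> p \<in> \<C> \<longrightarrow> tgt \<A> i \<in> \<C>)"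

definition conflation :: "('o, 'm) category_data \<Rightarrow> 'o set \<Rightarrow> 'm \<Rightarrow> 'm \<Rightarrow> bool" where
  "conflation \<A> \<C> i p \<longleftrightarrow> short_exact \<A> i p \<and> src \<A> i \<in> \<C> \<and> tgt \<A> i \<in> \<C> \<and> tgt \<A> p \<in> \<C>"

definition inflation :: "('o, 'm) category_data \<Rightarrow> 'o set \<Rightarrow> 'm \<Rightarrow> bool" where
  "inflation \<A> \<C> i \<longleftrightarrow> (\<exists>p. conflation \<A> \<C> i p)"

text \<open>All lists are ordered from right to left: a conflation of length \<open>t\<close>
  \<open>B \<rightarrow> X\<^sub>t\<^sub>-\<^sub>1 \<rightarrow> \<dots> \<rightarrow> X\<^sub>0 \<rightarrow> A\<close> is the list of its \<open>t + 1\<close> arrows, starting with \<open>X\<^sub>0 \<rightarrow> A\<close>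
  and ending with \<open>B \<rightarrow> X\<^sub>t\<^sub>-\<^sub>1\<close>. Likewise the conflations \<open>K\<^sub>k\<^sub>+\<^sub>1 \<rightarrow> X\<^sub>k \<rightarrow> K\<^sub>k\<close> to be spliced are
  listed as pairs (inflation, deflation), starting with the one ending in \<open>K\<^sub>0 = A\<close>.\<close>

definition spliceable :: "('o, 'm) category_data \<Rightarrow> 'o set \<Rightarrow> ('m \<times> 'm) list \<Rightarrow> bool" where
  "spliceable \<A> \<C> cs \<longleftrightarrow> (\<forall>(i, p)\<in>set cs. conflation \<A> \<C> i p) \<and>
     (\<forall>k. Suc k < length cs \<longrightarrow> tgt \<A> (snd (cs ! Suc k)) = src \<A> (fst (cs ! k)))"

fun splice_conflations :: "('o, 'm) category_data \<Rightarrow> ('m \<times> 'm) list \<Rightarrow> 'm list" where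
  "splice_conflations \<A> [] = []"
| "splice_conflations \<A> [(i, p)] = [p, i]"
| "splice_conflations \<A> ((i, p) # (j, q) # cs) =
     p # (i \<cdot>\<^bsub>\<A>\<^esub> q) # tl (splice_conflations \<A> ((j, q) # cs))"

definition long_conflation ::
  "('o, 'm) category_data \<Rightarrow> 'o set \<Rightarrow> nat \<Rightarrow> 'o \<Rightarrow> 'o \<Rightarrow> 'm list \<Rightarrow> bool" where
  "long_conflation \<A> \<C> t A B E \<longleftrightarrow>
     (\<exists>cs. cs \<noteq> [] \<and> length cs = t \<and> spliceable \<A> \<C> cs \<and>
        tgt \<A> (snd (hd cs)) = A \<and> src \<A> (fst (last cs)) = B \<and> E = splice_conflations \<A> cs)"


section \<open>Yoneda Ext groups\<close>

text \<open>Objects of \<open>B \<rightarrow> X\<^sub>t\<^sub>-\<^sub>1 \<rightarrow> \<dots> \<rightarrow> X\<^sub>0 \<rightarrow> A\<close>: index \<open>0\<close> is \<open>A\<close>, index \<open>k + 1\<close> is \<open>X\<^sub>k\<close>, index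
  \<open>t + 1\<close> is \<open>B\<close>.\<close>

definition seq_obj :: "('o, 'm) category_data \<Rightarrow> 'm list \<Rightarrow> nat \<Rightarrow> 'o" where
  "seq_obj \<A> E k = (case k of 0 \<Rightarrow> tgt \<A> (E ! 0) | Suc j \<Rightarrow> src \<A> (E ! j))"

definition yoneda_morphism :: "('o, 'm) category_data \<Rightarrow> 'm list \<Rightarrow> 'm list \<Rightarrow> bool" where
  \<comment> \<open>a morphism of long conflations which is the identity on both ends\<close>
  "yoneda_morphism \<A> E F \<longleftrightarrow> length F = length E \<and>
     (\<exists>\<phi>. (\<forall>k\<le>length E. \<phi> k \<in> Hom \<A> (seq_obj \<A> E k) (seq_obj \<A> F k)) \<and>
          (\<forall>k<length E. F ! k \<cdot>\<^bsub>\<A>\<^esub> \<phi> (Suc k) = \<phi> k \<cdot>\<^bsub>\<A>\<^esub> E ! k) \<and>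
          \<phi> 0 = idn \<A> (seq_obj \<A> E 0) \<and> \<phi> (length E) = idn \<A> (seq_obj \<A> E (length E)))"

definition yoneda_step ::
  "('o, 'm) category_data \<Rightarrow> 'o set \<Rightarrow> nat \<Rightarrow> 'o \<Rightarrow> 'o \<Rightarrow> ('m list \<times> 'm list) set" where
  "yoneda_step \<A> \<C> t A B =
     {(E, F). long_conflation \<A> \<C> t A B E \<and> long_conflation \<A> \<C> t A B F \<and> yoneda_morphism \<A> E F}"

definition yoneda_class :: "('o, 'm) category_data \<Rightarrow> 'o set \<Rightarrow> 'm list \<Rightarrow> 'm list set" where
  "yoneda_class \<A> \<C> E =
     (let R = yoneda_step \<A> \<C> (length E - 1) (tgt \<A> (hd E)) (src \<A> (last E))
      in (R \<union> R\<inverse>)\<^sup>* `` {E})"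

text \<open>An element of \<open>Ext\<^sup>t\<close> is an arrow if \<open>t = 0\<close>, and otherwise an equivalence class of
  conflations of length \<open>t\<close>.\<close>

datatype 'm ext = Ext_arr 'm | Ext_class "'m list set"

definition ext_of :: "('o, 'm) category_data \<Rightarrow> 'o set \<Rightarrow> 'm list \<Rightarrow> 'm ext" where
  "ext_of \<A> \<C> E = Ext_class (yoneda_class \<A> \<C> E)"

definition Ext :: "('o, 'm) category_data \<Rightarrow> 'o set \<Rightarrow> nat \<Rightarrow> 'o \<Rightarrow> 'o \<Rightarrow> 'm ext set" where
  "Ext \<A> \<C> t A B =
     (if t = 0 then Ext_arr ` Hom \<A> A B else ext_of \<A> \<C> ` {E. long_conflation \<A> \<C> t A B E})"

definition pushout_seq :: "('o, 'm) category_data \<Rightarrow> 'm \<Rightarrow> 'm list \<Rightarrow> 'm list \<Rightarrow> bool" where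
  \<comment> \<open>\<open>F\<close> arises from \<open>E\<close> by forming the pushout of \<open>g\<close> and the inflation at the left end\<close>
  "pushout_seq \<A> g E F \<longleftrightarrow> (let t = length E - 1 in
     1 \<le> t \<and> length F = length E \<and> (\<forall>k<t - 1. F ! k = E ! k) \<and>
     F ! (t - 1) \<in> Hom \<A> (tgt \<A> (F ! t)) (tgt \<A> (E ! (t - 1))) \<and>
     F ! (t - 1) \<cdot>\<^bsub>\<A>\<^esub> F ! t = zero_arr \<A> (src \<A> (F ! t)) (tgt \<A> (E ! (t - 1))) \<and>
     (\<exists>u. is_pushout \<A> (E ! t) g u (F ! t) \<and> F ! (t - 1) \<cdot>\<^bsub>\<A>\<^esub> u = E ! (t - 1)))"

definition pullback_seq :: "('o, 'm) category_data \<Rightarrow> 'm \<Rightarrow> 'm list \<Rightarrow> 'm list \<Rightarrow> bool" where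
  \<comment> \<open>\<open>F\<close> arises from \<open>E\<close> by forming the pullback of \<open>h\<close> and the deflation at the right end\<close>
  "pullback_seq \<A> h E F \<longleftrightarrow>
     2 \<le> length E \<and> length F = length E \<and> (\<forall>k. 2 \<le> k \<and> k < length E \<longrightarrow> F ! k = E ! k) \<and>
     F ! 1 \<in> Hom \<A> (src \<A> (E ! 1)) (src \<A> (F ! 0)) \<and>
     F ! 0 \<cdot>\<^bsub>\<A>\<^esub> F ! 1 = zero_arr \<A> (src \<A> (E ! 1)) (tgt \<A> (F ! 0)) \<and>
     (\<exists>v. is_pullback \<A> (E ! 0) h v (F ! 0) \<and> v \<cdot>\<^bsub>\<A>\<^esub> F ! 1 = E ! 1)"

fun ext_push :: "('o, 'm) category_data \<Rightarrow> 'o set \<Rightarrow> 'm \<Rightarrow> 'm ext \<Rightarrow> 'm ext" where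
  "ext_push \<A> \<C> g (Ext_arr f) = Ext_arr (g \<cdot>\<^bsub>\<A>\<^esub> f)"
| "ext_push \<A> \<C> g (Ext_class c) =
     Ext_class (\<Union>{yoneda_class \<A> \<C> F | E F. E \<in> c \<and> pushout_seq \<A> g E F})"

fun ext_pull :: "('o, 'm) category_data \<Rightarrow> 'o set \<Rightarrow> 'm \<Rightarrow> 'm ext \<Rightarrow> 'm ext" where
  "ext_pull \<A> \<C> h (Ext_arr f) = Ext_arr (f \<cdot>\<^bsub>\<A>\<^esub> h)"
| "ext_pull \<A> \<C> h (Ext_class c) =
     Ext_class (\<Union>{yoneda_class \<A> \<C> F | E F. E \<in> c \<and> pullback_seq \<A> h E F})"

definition direct_sum_seq ::
  "('o, 'm) category_data \<Rightarrow> 'm list \<Rightarrow> 'm list \<Rightarrow> 'm list \<Rightarrow>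
   (nat \<Rightarrow> 'm) \<Rightarrow> (nat \<Rightarrow> 'm) \<Rightarrow> (nat \<Rightarrow> 'm) \<Rightarrow> (nat \<Rightarrow> 'm) \<Rightarrow> bool" where
  "direct_sum_seq \<A> E E' S i j p q \<longleftrightarrow> length E' = length E \<and> length S = length E \<and>
     (\<forall>k\<le>length E. is_biproduct \<A> (seq_obj \<A> E k) (seq_obj \<A> E' k) (seq_obj \<A> S k)
                     (i k) (j k) (p k) (q k)) \<and>
     (\<forall>k<length E. S ! k \<in> Hom \<A> (seq_obj \<A> S (Suc k)) (seq_obj \<A> S k) \<and>
        S ! k \<cdot>\<^bsub>\<A>\<^esub> i (Suc k) = i k \<cdot>\<^bsub>\<A>\<^esub> E ! k \<and> S ! k \<cdot>\<^bsub>\<A>\<^esub> j (Suc k) = j k \<cdot>\<^bsub>\<A>\<^esub> E' ! k)"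

definition is_baer_sum :: "('o, 'm) category_data \<Rightarrow> 'm list \<Rightarrow> 'm list \<Rightarrow> 'm list \<Rightarrow> bool" where
  \<comment> \<open>\<open>F\<close> is a Baer sum of \<open>E\<close> and \<open>E'\<close>: the direct sum pushed out along the codiagonal \<open>g\<close> and
     pulled back along the diagonal \<open>h\<close>\<close>
  "is_baer_sum \<A> E E' F \<longleftrightarrow> (\<exists>S i j p q g h G.
     direct_sum_seq \<A> E E' S i j p q \<and>
     g \<in> Hom \<A> (seq_obj \<A> S (length E)) (seq_obj \<A> E (length E)) \<and>
     g \<cdot>\<^bsub>\<A>\<^esub> i (length E) = idn \<A> (seq_obj \<A> E (length E)) \<and>
     g \<cdot>\<^bsub>\<A>\<^esub> j (length E) = idn \<A> (seq_obj \<A> E (length E)) \<and>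
     h \<in> Hom \<A> (seq_obj \<A> E 0) (seq_obj \<A> S 0) \<and>
     p 0 \<cdot>\<^bsub>\<A>\<^esub> h = idn \<A> (seq_obj \<A> E 0) \<and> q 0 \<cdot>\<^bsub>\<A>\<^esub> h = idn \<A> (seq_obj \<A> E 0) \<and>
     pushout_seq \<A> g S G \<and> pullback_seq \<A> h G F)"

fun ext_plus :: "('o, 'm) category_data \<Rightarrow> 'o set \<Rightarrow> 'm ext \<Rightarrow> 'm ext \<Rightarrow> 'm ext" where
  "ext_plus \<A> \<C> (Ext_arr f) (Ext_arr g) = Ext_arr (f \<boxplus>\<^bsub>\<A>\<^esub> g)"
| "ext_plus \<A> \<C> (Ext_class c) (Ext_class c') =
     Ext_class (\<Union>{yoneda_class \<A> \<C> F | E E' F. E \<in> c \<and> E' \<in> c' \<and> is_baer_sum \<A> E E' F})"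
| "ext_plus \<A> \<C> _ _ = undefined"

definition ext_group ::
  "('o, 'm) category_data \<Rightarrow> 'o set \<Rightarrow> nat \<Rightarrow> 'o \<Rightarrow> 'o \<Rightarrow> 'm ext monoid" where
  "ext_group \<A> \<C> t A B =
     \<lparr>carrier = Ext \<A> \<C> t A B, mult = ext_plus \<A> \<C>,
      one = (THE z. z \<in> Ext \<A> \<C> t A B \<and> (\<forall>x\<in>Ext \<A> \<C> t A B. ext_plus \<A> \<C> z x = x))\<rparr>"


section \<open>\<open>n\<close>-Frobenius categories\<close>

definition n_projective :: "('o, 'm) category_data \<Rightarrow> 'o set \<Rightarrow> nat \<Rightarrow> 'o \<Rightarrow> bool" where
  "n_projective \<A> \<C> n P \<longleftrightarrow> P \<in> \<C> \<and>
     (\<forall>i>n. \<forall>X\<in>\<C>. carrier (ext_group \<A> \<C> i P X) = {\<one>\<^bsub>ext_group \<A> \<C> i P X\<^esub>})"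

definition n_injective :: "('o, 'm) category_data \<Rightarrow> 'o set \<Rightarrow> nat \<Rightarrow> 'o \<Rightarrow> bool" where
  "n_injective \<A> \<C> n I \<longleftrightarrow> I \<in> \<C> \<and>
     (\<forall>i>n. \<forall>X\<in>\<C>. carrier (ext_group \<A> \<C> i X I) = {\<one>\<^bsub>ext_group \<A> \<C> i X I\<^esub>})"

definition n_Frobenius :: "('o, 'm) category_data \<Rightarrow> 'o set \<Rightarrow> nat \<Rightarrow> bool" where
  "n_Frobenius \<A> \<C> n \<longleftrightarrow>
     (\<forall>X\<in>\<C>. \<exists>i p. conflation \<A> \<C> i p \<and> tgt \<A> p = X \<and> n_projective \<A> \<C> n (src \<A> p)) \<and>
     (\<forall>X\<in>\<C>. \<exists>i p. conflation \<A> \<C> i p \<and> src \<A> i = X \<and> n_injective \<A> \<C> n (tgt \<A> i)) \<and>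
     (\<forall>X\<in>\<C>. n_projective \<A> \<C> n X \<longleftrightarrow> n_injective \<A> \<C> n X)"

definition proj_subgroup ::
  "('o, 'm) category_data \<Rightarrow> 'o set \<Rightarrow> nat \<Rightarrow> 'o \<Rightarrow> 'o \<Rightarrow> 'm ext set" where
  "proj_subgroup \<A> \<C> n X Y =
     {ext_pull \<A> \<C> f \<eta> | f \<eta> P. n_projective \<A> \<C> n P \<and> f \<in> Hom \<A> X P \<and> \<eta> \<in> Ext \<A> \<C> n P Y}"

definition ext_mod_proj ::
  "('o, 'm) category_data \<Rightarrow> 'o set \<Rightarrow> nat \<Rightarrow> 'o \<Rightarrow> 'o \<Rightarrow> 'm ext set monoid" where
  "ext_mod_proj \<A> \<C> n X Y = ext_group \<A> \<C> n X Y Mod proj_subgroup \<A> \<C> n X Y"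

definition ext_bar ::
  "('o, 'm) category_data \<Rightarrow> 'o set \<Rightarrow> nat \<Rightarrow> 'o \<Rightarrow> 'o \<Rightarrow> 'm ext \<Rightarrow> 'm ext set" where
  "ext_bar \<A> \<C> n X Y \<gamma> = proj_subgroup \<A> \<C> n X Y #>\<^bsub>ext_group \<A> \<C> n X Y\<^esub> \<gamma>"

definition unit_conflation ::
  "('o, 'm) category_data \<Rightarrow> 'o set \<Rightarrow> nat \<Rightarrow> nat \<Rightarrow> 'o \<Rightarrow> 'o \<Rightarrow> 'm list \<Rightarrow> bool" where
  "unit_conflation \<A> \<C> n k N K \<delta> \<longleftrightarrow> long_conflation \<A> \<C> k N K \<delta> \<and>
     (\<forall>j<k. n_projective \<A> \<C> n (src \<A> (\<delta> ! j)))"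

definition quasi_invertible :: "('o, 'm) category_data \<Rightarrow> 'o set \<Rightarrow> nat \<Rightarrow> 'm \<Rightarrow> bool" where
  "quasi_invertible \<A> \<C> n f \<longleftrightarrow> f \<in> arrs \<A> \<and> src \<A> f \<in> \<C> \<and> tgt \<A> f \<in> \<C> \<and>
     (\<forall>X\<in>\<C>. ext_push \<A> \<C> f \<in> iso (ext_group \<A> \<C> (n + 1) X (src \<A> f))
                                   (ext_group \<A> \<C> (n + 1) X (tgt \<A> f)))"


section \<open>Morphism groups of the phantom stable category\<close>

text \<open>For \<open>n = 0\<close> there is only one unit conflation of length \<open>n\<close>, written \<open>[]\<close>, with
  \<open>\<Omega>\<^sup>0N = N\<close>, and pairs are related only if they are equal; so the class of \<open>(x, [])\<close> is
  \<open>{(x, [])}\<close> and the morphism group is a copy of \<open>Hom(M, N)/\<P>(M, N)\<close>.\<close>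

definition syzygy :: "('o, 'm) category_data \<Rightarrow> 'o \<Rightarrow> 'm list \<Rightarrow> 'o" where
  "syzygy \<A> N \<delta> = (if \<delta> = [] then N else src \<A> (last \<delta>))"

definition phantom_pairs ::
  "('o, 'm) category_data \<Rightarrow> 'o set \<Rightarrow> nat \<Rightarrow> 'o \<Rightarrow> 'o \<Rightarrow> ('m ext set \<times> 'm list) set" where
  "phantom_pairs \<A> \<C> n M N =
     {(x, \<delta>). (if n = 0 then \<delta> = [] else unit_conflation \<A> \<C> n n N (syzygy \<A> N \<delta>) \<delta>) \<and>
              x \<in> carrier (ext_mod_proj \<A> \<C> n M (syzygy \<A> N \<delta>))}"

definition phantom_rel ::
  "('o, 'm) category_data \<Rightarrow> 'o set \<Rightarrow> nat \<Rightarrow> 'o \<Rightarrow> 'o \<Rightarrow>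
   (('m ext set \<times> 'm list) \<times> ('m ext set \<times> 'm list)) set" where
  "phantom_rel \<A> \<C> n M N =
     {((x, \<delta>), (x', \<delta>')). (x, \<delta>) \<in> phantom_pairs \<A> \<C> n M N \<and> (x', \<delta>') \<in> phantom_pairs \<A> \<C> n M N \<and>
        (if n = 0 then (x, \<delta>) = (x', \<delta>')
         else \<exists>Z a b \<epsilon>. a \<in> Hom \<A> (syzygy \<A> N \<delta>) Z \<and> b \<in> Hom \<A> (syzygy \<A> N \<delta>') Z \<and>
           inflation \<A> \<C> a \<and> quasi_invertible \<A> \<C> n a \<and>
           inflation \<A> \<C> b \<and> quasi_invertible \<A> \<C> n b \<and>
           unit_conflation \<A> \<C> n n N Z \<epsilon> \<and>
           ext_push \<A> \<C> a (ext_of \<A> \<C> \<delta>) = ext_of \<A> \<C> \<epsilon> \<and>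
           ext_push \<A> \<C> b (ext_of \<A> \<C> \<delta>') = ext_of \<A> \<C> \<epsilon> \<and>
           (\<exists>\<gamma>\<in>x. \<exists>\<gamma>'\<in>x'.
              ext_push \<A> \<C> a \<gamma> \<otimes>\<^bsub>ext_group \<A> \<C> n M Z\<^esub>
                inv\<^bsub>ext_group \<A> \<C> n M Z\<^esub> (ext_push \<A> \<C> b \<gamma>') \<in> proj_subgroup \<A> \<C> n M Z))}"

definition phantom_class ::
  "('o, 'm) category_data \<Rightarrow> 'o set \<Rightarrow> nat \<Rightarrow> 'o \<Rightarrow> 'o \<Rightarrow>
   'm ext set \<times> 'm list \<Rightarrow> ('m ext set \<times> 'm list) set" where
  "phantom_class \<A> \<C> n M N r = phantom_rel \<A> \<C> n M N `` {r}"

text \<open>The sum of two classes is computed on representatives with a common second component,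
  that is, it is transported from \<open>Ext\<^sup>n(M, \<Omega>\<^sup>nN)/\<P>\<close>; the union runs over all such
  representatives.\<close>

definition phantom_hom ::
  "('o, 'm) category_data \<Rightarrow> 'o set \<Rightarrow> nat \<Rightarrow> 'o \<Rightarrow> 'o \<Rightarrow> ('m ext set \<times> 'm list) set monoid" where
  "phantom_hom \<A> \<C> n M N =
     \<lparr>carrier = phantom_pairs \<A> \<C> n M N // phantom_rel \<A> \<C> n M N,
      mult = (\<lambda>u v. \<Union>{phantom_class \<A> \<C> n M N (x \<otimes>\<^bsub>ext_mod_proj \<A> \<C> n M (syzygy \<A> N \<delta>)\<^esub> y, \<delta>) |
                       x y \<delta>. (x, \<delta>) \<in> u \<and> (y, \<delta>) \<in> v}),
      one = \<Union>{phantom_class \<A> \<C> n M N (\<one>\<^bsub>ext_mod_proj \<A> \<C> n M (syzygy \<A> N \<delta>)\<^esub>, \<delta>) |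
               \<delta>. (\<one>\<^bsub>ext_mod_proj \<A> \<C> n M (syzygy \<A> N \<delta>)\<^esub>, \<delta>) \<in> phantom_pairs \<A> \<C> n M N}\<rparr>"


section \<open>The map \<open>\<Omega>\<close>\<close>

text \<open>Connecting maps of a conflation \<open>\<epsilon> = (i, p)\<close>, with the sign convention that they are the
  Yoneda products \<open>\<gamma> \<mapsto> \<epsilon>\<gamma>\<close> and \<open>\<eta> \<mapsto> \<eta>\<epsilon>\<close>; a product with an arrow is a pullback or pushout,
  a product with a long conflation is a splice.\<close>

fun connecting_cov :: "('o, 'm) category_data \<Rightarrow> 'o set \<Rightarrow> 'm \<times> 'm \<Rightarrow> 'm ext \<Rightarrow> 'm ext" where
  "connecting_cov \<A> \<C> (i, p) (Ext_arr f) = ext_pull \<A> \<C> f (ext_of \<A> \<C> [p, i])"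
| "connecting_cov \<A> \<C> (i, p) (Ext_class c) =
     Ext_class (\<Union>E\<in>c. yoneda_class \<A> \<C> (butlast E @ [last E \<cdot>\<^bsub>\<A>\<^esub> p, i]))"

fun connecting_con :: "('o, 'm) category_data \<Rightarrow> 'o set \<Rightarrow> 'm \<times> 'm \<Rightarrow> 'm ext \<Rightarrow> 'm ext" where
  "connecting_con \<A> \<C> (i, p) (Ext_arr f) = ext_push \<A> \<C> f (ext_of \<A> \<C> [p, i])"
| "connecting_con \<A> \<C> (i, p) (Ext_class c) =
     Ext_class (\<Union>E\<in>c. yoneda_class \<A> \<C> (p # (i \<cdot>\<^bsub>\<A>\<^esub> hd E) # tl E))"

definition induced_on_cosets :: "('b \<Rightarrow> 'c) \<Rightarrow> 'b set \<Rightarrow> 'c" where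
  \<comment> \<open>the common value of \<open>h\<close> on a coset, as in the library version of the first isomorphism theorem\<close>
  "induced_on_cosets h X = the_elem (h ` X)"

text \<open>\<open>c\<^sub>M\<close> is the conflation \<open>\<Omega>M \<rightarrow> Q \<rightarrow> M\<close> and \<open>cs\<close> lists the conflations
  \<open>\<Omega>\<^sup>i\<^sup>+\<^sup>1N \<rightarrow> P\<^sub>i \<rightarrow> \<Omega>\<^sup>iN\<close> for \<open>0 \<le> i \<le> n\<close>.\<close>

definition theta ::
  "('o, 'm) category_data \<Rightarrow> 'o set \<Rightarrow> nat \<Rightarrow> 'm \<times> 'm \<Rightarrow> ('m \<times> 'm) list \<Rightarrow>
   'm ext set \<Rightarrow> 'm ext set" where
  "theta \<A> \<C> n c\<^sub>M cs x =
     inv_into (carrier (ext_mod_proj \<A> \<C> n (src \<A> (fst c\<^sub>M)) (src \<A> (fst (cs ! n)))))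
       (induced_on_cosets (connecting_con \<A> \<C> c\<^sub>M))
       (induced_on_cosets (connecting_cov \<A> \<C> (cs ! n)) x)"

definition Omega_map ::
  "('o, 'm) category_data \<Rightarrow> 'o set \<Rightarrow> nat \<Rightarrow> 'm \<times> 'm \<Rightarrow> ('m \<times> 'm) list \<Rightarrow>
   ('m ext set \<times> 'm list) set \<Rightarrow> ('m ext set \<times> 'm list) set" where
  "Omega_map \<A> \<C> n c\<^sub>M cs u =
     \<Union>{phantom_class \<A> \<C> n (src \<A> (fst c\<^sub>M)) (src \<A> (fst (cs ! 0)))
          (theta \<A> \<C> n c\<^sub>M cs x, splice_conflations \<A> (tl cs)) | x. (x, splice_conflations \<A> (take n cs)) \<in> u}"

end

theory Submission
  imports Defs
begin

text \<open>A Yoneda class is a list of conflations modulo morphisms of such lists that are the identity at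
  both ends, and a morphism of lists with left end \<open>a\<close> and right end \<open>b\<close> from \<open>E\<close> to \<open>F\<close> gives
  \<open>a E = F b\<close>. From this single rule follow the bifunctoriality and the group structure of Ext, and
  the exactness of the long Ext sequences at the places where \<open>\<theta>\<close> needs it. When the
  middle term of a conflation is \<open>n\<close>-projective, hence \<open>n\<close>-injective, its connecting maps are surjective
  in degree \<open>n\<close> with kernel \<open>\<P>\<close>, and bijective in higher degrees; this gives \<open>\<theta>\<close>.

  To compare representatives \<open>(\<gamma>, \<delta>)\<close> of phantom morphisms \<open>M \<rightarrow> N\<close> for \<open>n \<ge> 1\<close>, fix a unit conflation
  \<open>\<nu>\<close> of length \<open>n + 1\<close> starting in \<open>M\<close> and ending in some \<open>L\<close>. The element \<open>z \<in> Ext\<^sup>n\<^sup>+\<^sup>1(L, N)\<close> with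
  \<open>\<delta> z = \<gamma> \<nu>\<close> exists and is unique, and it is a complete invariant of the class of \<open>(\<gamma>, \<delta>)\<close>, because any
  two unit conflations ending in \<open>N\<close> have a common push-out along quasi-invertible inflations. Hence for
  fixed \<open>\<delta>\<close> the classes form a copy of \<open>Ext\<^sup>n(M, \<Omega>\<^sup>nN)/\<P>\<close>, and \<open>\<Omega>\<close> becomes \<open>\<theta>\<close>.\<close>

section \<open>Abelian categories\<close>

definition opc :: "('o, 'm) category_data \<Rightarrow> ('o, 'm) category_data" where
  "opc \<A> = \<lparr>objs = objs \<A>, arrs = arrs \<A>, src = tgt \<A>, tgt = src \<A>,
     cmp = (\<lambda>g f. f \<cdot>\<^bsub>\<A>\<^esub> g), idn = idn \<A>, plus_arr = plus_arr \<A>,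
     zero_arr = (\<lambda>X Y. zero_arr \<A> Y X)\<rparr>"

lemma opc_simps [simp]:
  "objs (opc \<A>) = objs \<A>" "arrs (opc \<A>) = arrs \<A>" "src (opc \<A>) = tgt \<A>" "tgt (opc \<A>) = src \<A>"
  "g \<cdot>\<^bsub>opc \<A>\<^esub> f = f \<cdot>\<^bsub>\<A>\<^esub> g" "idn (opc \<A>) = idn \<A>" "plus_arr (opc \<A>) = plus_arr \<A>"
  "zero_arr (opc \<A>) X Y = zero_arr \<A> Y X"
  by (simp_all add: opc_def)

lemma Hom_opc [simp]: "Hom (opc \<A>) X Y = Hom \<A> Y X"
  by (auto simp: Hom_def)

lemma is_kernel_opc [simp]: "is_kernel (opc \<A>) = is_cokernel \<A>"
  by (auto simp: is_kernel_def is_cokernel_def fun_eq_iff)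

lemma is_cokernel_opc [simp]: "is_cokernel (opc \<A>) = is_kernel \<A>"
  by (auto simp: is_kernel_def is_cokernel_def fun_eq_iff)

lemma is_mono_opc [simp]: "is_mono (opc \<A>) = is_epi \<A>"
  by (auto simp: is_mono_def is_epi_def fun_eq_iff)

lemma is_epi_opc [simp]: "is_epi (opc \<A>) = is_mono \<A>"
  by (auto simp: is_mono_def is_epi_def fun_eq_iff)

lemma is_biproduct_opc [simp]: "is_biproduct (opc \<A>) X Y S i j p q = is_biproduct \<A> X Y S p q i j"
  by (auto simp: is_biproduct_def)

lemma is_zero_object_opc [simp]: "is_zero_object (opc \<A>) = is_zero_object \<A>"
  by (auto simp: is_zero_object_def fun_eq_iff)

lemma is_pushout_opc [simp]: "is_pushout (opc \<A>) f g u v = is_pullback \<A> f g u v"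
  by (simp add: is_pullback_def is_pushout_def)

lemma is_pullback_opc [simp]: "is_pullback (opc \<A>) f g u v = is_pushout \<A> f g u v"
  by (simp add: is_pullback_def is_pushout_def)

lemma short_exact_opc [simp]: "short_exact (opc \<A>) p i = short_exact \<A> i p"
  by (auto simp: short_exact_def)

context abelian_category
begin

lemma abelian_opc: "abelian_category (opc \<A>)"
proof (rule abelian_category.intro, goal_cases)
  case (8 X Y)
  then show ?case using hom_comm_group[of Y X] by simp
next
  case (12 X Y)
  from ex_biproduct[OF this[simplified]] show ?case by simp blast
qed (simp_all add: src_closed tgt_closed idn_closed cmp_closed cmp_assoc cmp_idn idn_cmp cmp_plus plus_cmp
   ex_zero_object ex_kernel ex_cokernel mono_is_kernel epi_is_cokernel)

lemma obj_src [simp]: "f \<in> arrs \<A> \<Longrightarrow> src \<A> f \<in> objs \<A>"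
  and obj_tgt [simp]: "f \<in> arrs \<A> \<Longrightarrow> tgt \<A> f \<in> objs \<A>"
  by (auto simp: src_closed tgt_closed)

lemma arr_idn [simp]:
  assumes "X \<in> objs \<A>" shows "idn \<A> X \<in> arrs \<A>" "src \<A> (idn \<A> X) = X" "tgt \<A> (idn \<A> X) = X"
  using idn_closed[OF assms] by (auto simp: Hom_def)

lemma arr_cmp [simp]:
  assumes "f \<in> arrs \<A>" "g \<in> arrs \<A>" "src \<A> g = tgt \<A> f"
  shows "g \<cdot> f \<in> arrs \<A>" "src \<A> (g \<cdot> f) = src \<A> f" "tgt \<A> (g \<cdot> f) = tgt \<A> g"
  using cmp_closed[of f _ _ g] assms by (auto simp: Hom_def)

lemma assoc [simp]:
  "\<lbrakk>f \<in> arrs \<A>; g \<in> arrs \<A>; h \<in> arrs \<A>; src \<A> g = tgt \<A> f; src \<A> h = tgt \<A> g\<rbrakk> \<Longrightarrow>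
    (h \<cdot> g) \<cdot> f = h \<cdot> (g \<cdot> f)"
  using cmp_assoc[of f _ _ g _ h] by (auto simp: Hom_def)

lemma cmp_id [simp]: "f \<in> arrs \<A> \<Longrightarrow> src \<A> f = X \<Longrightarrow> f \<cdot> idn \<A> X = f"
  and id_cmp [simp]: "f \<in> arrs \<A> \<Longrightarrow> tgt \<A> f = X \<Longrightarrow> idn \<A> X \<cdot> f = f"
  using cmp_idn[of f] idn_cmp[of f] by (auto simp: Hom_def)

abbreviation hom_group where
  "hom_group X Y \<equiv> \<lparr>carrier = Hom \<A> X Y, mult = plus_arr \<A>, one = zero_arr \<A> X Y\<rparr>"

lemma arr_zero [simp]:
  assumes "X \<in> objs \<A>" "Y \<in> objs \<A>"
  shows "zero_arr \<A> X Y \<in> arrs \<A>" "src \<A> (zero_arr \<A> X Y) = X" "tgt \<A> (zero_arr \<A> X Y) = Y"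
proof -
  interpret G: comm_group "hom_group X Y"
    by (rule hom_comm_group[OF assms])
  show "zero_arr \<A> X Y \<in> arrs \<A>" "src \<A> (zero_arr \<A> X Y) = X" "tgt \<A> (zero_arr \<A> X Y) = Y"
    using G.one_closed by (auto simp: Hom_def)
qed

lemma arr_plus [simp]:
  assumes "f \<in> arrs \<A>" "g \<in> arrs \<A>" "src \<A> g = src \<A> f" "tgt \<A> g = tgt \<A> f"
  shows "f \<boxplus> g \<in> arrs \<A>" "src \<A> (f \<boxplus> g) = src \<A> f" "tgt \<A> (f \<boxplus> g) = tgt \<A> f"
proof -
  interpret G: comm_group "hom_group (src \<A> f) (tgt \<A> f)"
    by (rule hom_comm_group) (use assms in auto)
  show "f \<boxplus> g \<in> arrs \<A>" "src \<A> (f \<boxplus> g) = src \<A> f" "tgt \<A> (f \<boxplus> g) = tgt \<A> f"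
    using G.m_closed[of f g] assms by (auto simp: Hom_def)
qed

definition ng :: "'m \<Rightarrow> 'm" where
  "ng f = inv\<^bsub>hom_group (src \<A> f) (tgt \<A> f)\<^esub> f"

lemma arr_ng [simp]:
  assumes "f \<in> arrs \<A>"
  shows "ng f \<in> arrs \<A>" "src \<A> (ng f) = src \<A> f" "tgt \<A> (ng f) = tgt \<A> f"
    "f \<boxplus> ng f = zero_arr \<A> (src \<A> f) (tgt \<A> f)" "ng f \<boxplus> f = zero_arr \<A> (src \<A> f) (tgt \<A> f)"
proof -
  interpret G: comm_group "hom_group (src \<A> f) (tgt \<A> f)"
    by (rule hom_comm_group) (use assms in auto)
  have f: "f \<in> Hom \<A> (src \<A> f) (tgt \<A> f)" using assms by (auto simp: Hom_def)
  show "ng f \<in> arrs \<A>" "src \<A> (ng f) = src \<A> f" "tgt \<A> (ng f) = tgt \<A> f"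
    "f \<boxplus> ng f = zero_arr \<A> (src \<A> f) (tgt \<A> f)" "ng f \<boxplus> f = zero_arr \<A> (src \<A> f) (tgt \<A> f)"
    using G.inv_closed[of f] G.r_inv[of f] G.l_inv[of f] f by (auto simp: Hom_def ng_def)
qed

lemma plus_comm:
  assumes "f \<in> arrs \<A>" "g \<in> arrs \<A>" "src \<A> g = src \<A> f" "tgt \<A> g = tgt \<A> f"
  shows "f \<boxplus> g = g \<boxplus> f"
proof -
  interpret G: comm_group "hom_group (src \<A> f) (tgt \<A> f)"
    by (rule hom_comm_group) (use assms in auto)
  show ?thesis using G.m_comm[of f g] assms by (auto simp: Hom_def)
qed

lemma plus_assoc:
  assumes "f \<in> arrs \<A>" "g \<in> arrs \<A>" "h \<in> arrs \<A>" "src \<A> g = src \<A> f" "tgt \<A> g = tgt \<A> f"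
    "src \<A> h = src \<A> f" "tgt \<A> h = tgt \<A> f"
  shows "(f \<boxplus> g) \<boxplus> h = f \<boxplus> (g \<boxplus> h)"
proof -
  interpret G: comm_group "hom_group (src \<A> f) (tgt \<A> f)"
    by (rule hom_comm_group) (use assms in auto)
  show ?thesis using G.m_assoc[of f g h] assms by (auto simp: Hom_def)
qed

lemma plus_zero [simp]:
  assumes "f \<in> arrs \<A>" "src \<A> f = X" "tgt \<A> f = Y"
  shows "f \<boxplus> zero_arr \<A> X Y = f" "zero_arr \<A> X Y \<boxplus> f = f"
proof -
  interpret G: comm_group "hom_group (src \<A> f) (tgt \<A> f)"
    by (rule hom_comm_group) (use assms in auto)
  show "f \<boxplus> zero_arr \<A> X Y = f" "zero_arr \<A> X Y \<boxplus> f = f"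
    using G.r_one[of f] G.l_one[of f] assms by (auto simp: Hom_def)
qed

lemma plus_cancel:
  assumes "f \<in> arrs \<A>" "g \<in> arrs \<A>" "h \<in> arrs \<A>" "src \<A> g = src \<A> f" "tgt \<A> g = tgt \<A> f"
    "src \<A> h = src \<A> f" "tgt \<A> h = tgt \<A> f" "f \<boxplus> g = f \<boxplus> h"
  shows "g = h"
proof -
  have "g = (ng f \<boxplus> f) \<boxplus> g" using assms(1-7) by simp
  also have "\<dots> = ng f \<boxplus> (f \<boxplus> g)" by (rule plus_assoc) (use assms(1-7) in simp_all)
  also have "\<dots> = ng f \<boxplus> (f \<boxplus> h)" using assms(8) by simp
  also have "\<dots> = (ng f \<boxplus> f) \<boxplus> h" by (rule plus_assoc[symmetric]) (use assms(1-7) in simp_all)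
  also have "\<dots> = h" using assms(1-7) by simp
  finally show ?thesis .
qed

lemma plus_ng_cancel [simp]:
  assumes "f \<in> arrs \<A>" "g \<in> arrs \<A>" "src \<A> g = src \<A> f" "tgt \<A> g = tgt \<A> f"
  shows "f \<boxplus> (ng f \<boxplus> g) = g" "ng f \<boxplus> (f \<boxplus> g) = g"
  using assms plus_assoc[of f "ng f" g] plus_assoc[of "ng f" f g] by simp_all

lemma plus_left_comm:
  assumes "f \<in> arrs \<A>" "g \<in> arrs \<A>" "h \<in> arrs \<A>" "src \<A> g = src \<A> f" "tgt \<A> g = tgt \<A> f"
    "src \<A> h = src \<A> f" "tgt \<A> h = tgt \<A> f"
  shows "f \<boxplus> (g \<boxplus> h) = g \<boxplus> (f \<boxplus> h)"
proof -
  have "f \<boxplus> (g \<boxplus> h) = (f \<boxplus> g) \<boxplus> h" by (rule plus_assoc[symmetric]) (simp_all add: assms)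
  also have "f \<boxplus> g = g \<boxplus> f" by (rule plus_comm) (simp_all add: assms)
  also have "(g \<boxplus> f) \<boxplus> h = g \<boxplus> (f \<boxplus> h)" by (rule plus_assoc) (simp_all add: assms)
  finally show ?thesis .
qed

lemma eq_of_diff:
  assumes "f \<in> arrs \<A>" "g \<in> arrs \<A>" "src \<A> g = src \<A> f" "tgt \<A> g = tgt \<A> f"
    "f \<boxplus> ng g = zero_arr \<A> (src \<A> f) (tgt \<A> f)"
  shows "f = g"
proof -
  have "g = (f \<boxplus> ng g) \<boxplus> g" using assms by simp
  also have "\<dots> = f" using assms(1-4) by (simp add: plus_assoc)
  finally show ?thesis by simp
qed

lemma cmp_plus_distr [simp]:
  "\<lbrakk>f \<in> arrs \<A>; g \<in> arrs \<A>; h \<in> arrs \<A>; src \<A> g = tgt \<A> f; src \<A> h = tgt \<A> f; tgt \<A> h = tgt \<A> g\<rbrakk> \<Longrightarrow>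
    (g \<boxplus> h) \<cdot> f = (g \<cdot> f) \<boxplus> (h \<cdot> f)"
  using cmp_plus[of f _ _ g _ h] by (auto simp: Hom_def)

lemma plus_cmp_distr [simp]:
  "\<lbrakk>f \<in> arrs \<A>; g \<in> arrs \<A>; h \<in> arrs \<A>; src \<A> g = src \<A> f; tgt \<A> g = tgt \<A> f; src \<A> h = tgt \<A> f\<rbrakk> \<Longrightarrow>
    h \<cdot> (f \<boxplus> g) = (h \<cdot> f) \<boxplus> (h \<cdot> g)"
  using plus_cmp[of f _ _ g h] by (auto simp: Hom_def)

lemma cmp_zero [simp]:
  assumes "f \<in> arrs \<A>" "src \<A> f = Y" "X \<in> objs \<A>"
  shows "f \<cdot> zero_arr \<A> X Y = zero_arr \<A> X (tgt \<A> f)"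
proof -
  let ?z = "f \<cdot> zero_arr \<A> X Y"
  have z: "?z \<in> arrs \<A>" "src \<A> ?z = X" "tgt \<A> ?z = tgt \<A> f" using assms by auto
  have "?z \<boxplus> ?z = f \<cdot> (zero_arr \<A> X Y \<boxplus> zero_arr \<A> X Y)"
    using assms by (subst plus_cmp_distr) auto
  also have "\<dots> = ?z \<boxplus> zero_arr \<A> X (tgt \<A> f)" using assms z by auto
  finally have *: "?z \<boxplus> ?z = ?z \<boxplus> zero_arr \<A> X (tgt \<A> f)" .
  show ?thesis by (rule plus_cancel[of ?z]) (use * z assms in simp_all)
qed

lemma zero_cmp [simp]:
  assumes "f \<in> arrs \<A>" "tgt \<A> f = Y" "Z \<in> objs \<A>"
  shows "zero_arr \<A> Y Z \<cdot> f = zero_arr \<A> (src \<A> f) Z"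
  using abelian_category.cmp_zero[OF abelian_opc, of f Y Z] assms by simp

lemma ng_unique:
  assumes "f \<in> arrs \<A>" "g \<in> arrs \<A>" "src \<A> g = src \<A> f" "tgt \<A> g = tgt \<A> f"
    "f \<boxplus> g = zero_arr \<A> (src \<A> f) (tgt \<A> f)"
  shows "ng f = g"
  by (rule plus_cancel[of f]) (use assms in auto)

lemma ng_cmp_left [simp]:
  assumes "f \<in> arrs \<A>" "g \<in> arrs \<A>" "src \<A> g = tgt \<A> f"
  shows "ng g \<cdot> f = ng (g \<cdot> f)"
proof -
  have *: "(g \<cdot> f) \<boxplus> (ng g \<cdot> f) = (g \<boxplus> ng g) \<cdot> f" using assms by (subst cmp_plus_distr) auto
  show ?thesis by (rule ng_unique[symmetric]) (use * assms in simp_all)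
qed

lemma ng_cmp_right [simp]:
  assumes "f \<in> arrs \<A>" "g \<in> arrs \<A>" "src \<A> g = tgt \<A> f"
  shows "g \<cdot> ng f = ng (g \<cdot> f)"
proof -
  have *: "(g \<cdot> f) \<boxplus> (g \<cdot> ng f) = g \<cdot> (f \<boxplus> ng f)" using assms by (subst plus_cmp_distr) auto
  show ?thesis by (rule ng_unique[symmetric]) (use * assms in simp_all)
qed

lemma ng_ng [simp]: "f \<in> arrs \<A> \<Longrightarrow> ng (ng f) = f"
  by (rule ng_unique) auto

lemma ng_zero [simp]: "X \<in> objs \<A> \<Longrightarrow> Y \<in> objs \<A> \<Longrightarrow> ng (zero_arr \<A> X Y) = zero_arr \<A> X Y"
  by (rule ng_unique) auto

lemma ng_plus [simp]:
  assumes "f \<in> arrs \<A>" "g \<in> arrs \<A>" "src \<A> g = src \<A> f" "tgt \<A> g = tgt \<A> f"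
  shows "ng (f \<boxplus> g) = ng f \<boxplus> ng g"
proof (rule ng_unique)
  have "(f \<boxplus> g) \<boxplus> (ng f \<boxplus> ng g) = f \<boxplus> (g \<boxplus> (ng f \<boxplus> ng g))" by (rule plus_assoc) (use assms in simp_all)
  also have "g \<boxplus> (ng f \<boxplus> ng g) = ng f \<boxplus> (g \<boxplus> ng g)" by (rule plus_left_comm) (use assms in simp_all)
  finally show "(f \<boxplus> g) \<boxplus> (ng f \<boxplus> ng g) = zero_arr \<A> (src \<A> (f \<boxplus> g)) (tgt \<A> (f \<boxplus> g))" using assms by simp
qed (use assms in simp_all)

lemma cmp_eq_reassoc:
  assumes "g \<cdot> f = g' \<cdot> f'" "h \<in> arrs \<A>" "f \<in> arrs \<A>" "g \<in> arrs \<A>" "f' \<in> arrs \<A>" "g' \<in> arrs \<A>"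
    "tgt \<A> h = src \<A> f" "tgt \<A> f = src \<A> g" "tgt \<A> h = src \<A> f'" "tgt \<A> f' = src \<A> g'"
  shows "g \<cdot> (f \<cdot> h) = g' \<cdot> (f' \<cdot> h)"
proof -
  have "g \<cdot> (f \<cdot> h) = (g \<cdot> f) \<cdot> h" using assms(2-) by simp
  also have "\<dots> = g' \<cdot> (f' \<cdot> h)" using assms by simp
  finally show ?thesis .
qed

lemma cmp_eq_reassoc1:
  assumes "g \<cdot> f = k" "h \<in> arrs \<A>" "f \<in> arrs \<A>" "g \<in> arrs \<A>"
    "tgt \<A> h = src \<A> f" "tgt \<A> f = src \<A> g"
  shows "g \<cdot> (f \<cdot> h) = k \<cdot> h"
  using assms by (metis assoc)

lemma is_epiI:
  assumes "p \<in> arrs \<A>"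
    "\<And>h. h \<in> arrs \<A> \<Longrightarrow> src \<A> h = tgt \<A> p \<Longrightarrow> h \<cdot> p = zero_arr \<A> (src \<A> p) (tgt \<A> h) \<Longrightarrow> h = zero_arr \<A> (tgt \<A> p) (tgt \<A> h)"
  shows "is_epi \<A> p"
  unfolding is_epi_def
proof (intro conjI ballI impI)
  fix X u v assume *: "u \<in> Hom \<A> (tgt \<A> p) X" "v \<in> Hom \<A> (tgt \<A> p) X" "u \<cdot> p = v \<cdot> p"
  have "u \<boxplus> ng v = zero_arr \<A> (tgt \<A> p) (tgt \<A> (u \<boxplus> ng v))"
    by (rule assms(2)) (use * assms(1) in \<open>auto simp: Hom_def\<close>)
  with * have "u \<boxplus> ng v = zero_arr \<A> (src \<A> u) (tgt \<A> u)" by (simp add: Hom_def)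
  from eq_of_diff[OF _ _ _ _ this] * show "u = v" by (simp add: Hom_def)
qed (fact assms(1))

lemma is_epiD:
  "\<lbrakk>is_epi \<A> p; u \<in> arrs \<A>; v \<in> arrs \<A>; src \<A> u = tgt \<A> p; src \<A> v = tgt \<A> p; tgt \<A> u = tgt \<A> v;
    u \<cdot> p = v \<cdot> p\<rbrakk> \<Longrightarrow> u = v"
  unfolding is_epi_def Hom_def by (metis (mono_tags, lifting) mem_Collect_eq obj_tgt)

lemma is_monoD:
  "\<lbrakk>is_mono \<A> p; u \<in> arrs \<A>; v \<in> arrs \<A>; tgt \<A> u = src \<A> p; tgt \<A> v = src \<A> p; src \<A> u = src \<A> v;
    p \<cdot> u = p \<cdot> v\<rbrakk> \<Longrightarrow> u = v"
  unfolding is_mono_def Hom_def by (metis (mono_tags, lifting) mem_Collect_eq obj_src)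

lemma cokernel_epi: "is_cokernel \<A> f p \<Longrightarrow> is_epi \<A> p"
proof (rule is_epiI)
  assume k: "is_cokernel \<A> f p"
  then show p: "p \<in> arrs \<A>" by (simp add: is_cokernel_def)
  fix h assume h: "h \<in> arrs \<A>" "src \<A> h = tgt \<A> p" "h \<cdot> p = zero_arr \<A> (src \<A> p) (tgt \<A> h)"
  have "\<exists>!u. u \<in> Hom \<A> (tgt \<A> p) (tgt \<A> (h \<cdot> p)) \<and> u \<cdot> p = h \<cdot> p"
    using k h p unfolding is_cokernel_def
    by (elim conjE, elim ballE[where x = "h \<cdot> p"]) simp_all
  moreover have "h \<in> Hom \<A> (tgt \<A> p) (tgt \<A> (h \<cdot> p)) \<and> h \<cdot> p = h \<cdot> p"
    "zero_arr \<A> (tgt \<A> p) (tgt \<A> h) \<in> Hom \<A> (tgt \<A> p) (tgt \<A> (h \<cdot> p)) \<and> zero_arr \<A> (tgt \<A> p) (tgt \<A> h) \<cdot> p = h \<cdot> p"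
    using h p by (auto simp: Hom_def)
  ultimately show "h = zero_arr \<A> (tgt \<A> p) (tgt \<A> h)" by blast
qed

lemma kernel_mono: "is_kernel \<A> f k \<Longrightarrow> is_mono \<A> k"
  using abelian_category.cokernel_epi[OF abelian_opc, of f k] by simp

lemma kernel_lift:
  assumes "is_kernel \<A> f k" "h \<in> arrs \<A>" "tgt \<A> h = src \<A> f" "f \<cdot> h = zero_arr \<A> (src \<A> h) (tgt \<A> f)"
  obtains u where "u \<in> arrs \<A>" "src \<A> u = src \<A> h" "tgt \<A> u = src \<A> k" "k \<cdot> u = h"
  using assms unfolding is_kernel_def Hom_def by blast

lemma short_exact_of_epi:
  assumes k: "is_kernel \<A> p i" and p: "is_epi \<A> p"
  shows "short_exact \<A> i p"
proof -
  obtain f where f: "is_cokernel \<A> f p" using epi_is_cokernel[OF p] by blast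
  have a: "f \<in> arrs \<A>" "p \<in> arrs \<A>" "src \<A> p = tgt \<A> f" "p \<cdot> f = zero_arr \<A> (src \<A> f) (tgt \<A> p)"
    using f by (auto simp: is_cokernel_def)
  have b: "i \<in> arrs \<A>" "tgt \<A> i = src \<A> p" "p \<cdot> i = zero_arr \<A> (src \<A> i) (tgt \<A> p)"
    using k by (auto simp: is_kernel_def)
  obtain u where u: "u \<in> arrs \<A>" "src \<A> u = src \<A> f" "tgt \<A> u = src \<A> i" "i \<cdot> u = f"
    using kernel_lift[OF k, of f] a b by auto
  have "is_cokernel \<A> i p"
    unfolding is_cokernel_def
  proof (intro conjI ballI impI)
    fix h assume h: "h \<in> arrs \<A>" "src \<A> h = tgt \<A> i \<and> h \<cdot> i = zero_arr \<A> (src \<A> i) (tgt \<A> h)"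
    have *: "h \<cdot> f = zero_arr \<A> (src \<A> f) (tgt \<A> h)"
      using cmp_eq_reassoc1[of h i _ u] u h b(1) by simp
    have "src \<A> h = tgt \<A> f" using h a(3) b(2) by simp
    with * f h(1) show "\<exists>!u. u \<in> Hom \<A> (tgt \<A> p) (tgt \<A> h) \<and> u \<cdot> p = h"
      unfolding is_cokernel_def by blast
  qed (use a b in auto)
  then show ?thesis using k by (simp add: short_exact_def)
qed

lemma ses_arr:
  assumes "short_exact \<A> i p"
  shows "i \<in> arrs \<A>" "p \<in> arrs \<A>" "src \<A> p = tgt \<A> i" "p \<cdot> i = zero_arr \<A> (src \<A> i) (tgt \<A> p)"
  using assms by (auto simp: short_exact_def is_kernel_def)

lemma ses_cmp0:
  assumes "short_exact \<A> i p" "f \<in> arrs \<A>" "tgt \<A> f = src \<A> i"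
  shows "p \<cdot> (i \<cdot> f) = zero_arr \<A> (src \<A> f) (tgt \<A> p)"
  using assms ses_arr[OF assms(1)] cmp_eq_reassoc1[of p i _ f] by simp

lemma ses_lift:
  assumes "short_exact \<A> i p" "h \<in> arrs \<A>" "tgt \<A> h = tgt \<A> i" "p \<cdot> h = zero_arr \<A> (src \<A> h) (tgt \<A> p)"
  obtains u where "u \<in> arrs \<A>" "src \<A> u = src \<A> h" "tgt \<A> u = src \<A> i" "i \<cdot> u = h"
proof -
  have k: "is_kernel \<A> p i" and t: "src \<A> p = tgt \<A> i"
    using assms(1) by (auto simp: short_exact_def is_kernel_def)
  show thesis by (rule kernel_lift[OF k assms(2) _ assms(4)]) (use t assms that in simp_all)
qed

lemma ses_colift:
  assumes "short_exact \<A> i p" "h \<in> arrs \<A>" "src \<A> h = tgt \<A> i" "h \<cdot> i = zero_arr \<A> (src \<A> i) (tgt \<A> h)"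
  obtains u where "u \<in> arrs \<A>" "src \<A> u = tgt \<A> p" "tgt \<A> u = tgt \<A> h" "u \<cdot> p = h"
  by (rule abelian_category.ses_lift[OF abelian_opc, of p i h])
    (use assms ses_arr[OF assms(1)] that in simp_all)

lemma ses_mono:
  assumes "short_exact \<A> i p" "u \<in> arrs \<A>" "v \<in> arrs \<A>" "tgt \<A> u = src \<A> i" "tgt \<A> v = src \<A> i"
    "src \<A> u = src \<A> v" "i \<cdot> u = i \<cdot> v"
  shows "u = v"
  using assms is_monoD[OF kernel_mono[of p i]] by (simp add: short_exact_def)

lemma ses_is_epi: "short_exact \<A> i p \<Longrightarrow> is_epi \<A> p"
  using cokernel_epi short_exact_def by metis

lemma ses_epi:
  assumes "short_exact \<A> i p" "u \<in> arrs \<A>" "v \<in> arrs \<A>" "src \<A> u = tgt \<A> p" "src \<A> v = tgt \<A> p"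
    "tgt \<A> u = tgt \<A> v" "u \<cdot> p = v \<cdot> p"
  shows "u = v"
  using assms is_epiD[OF ses_is_epi[OF assms(1)]] by simp

lemma is_kernelI:
  assumes "f \<in> arrs \<A>" "k \<in> arrs \<A>" "tgt \<A> k = src \<A> f" "f \<cdot> k = zero_arr \<A> (src \<A> k) (tgt \<A> f)"
    "\<And>h. h \<in> arrs \<A> \<Longrightarrow> tgt \<A> h = src \<A> f \<Longrightarrow> f \<cdot> h = zero_arr \<A> (src \<A> h) (tgt \<A> f) \<Longrightarrow>
       \<exists>u. u \<in> arrs \<A> \<and> src \<A> u = src \<A> h \<and> tgt \<A> u = src \<A> k \<and> k \<cdot> u = h"
    "\<And>u v. u \<in> arrs \<A> \<Longrightarrow> v \<in> arrs \<A> \<Longrightarrow> tgt \<A> u = src \<A> k \<Longrightarrow> tgt \<A> v = src \<A> k \<Longrightarrow> src \<A> u = src \<A> v \<Longrightarrow>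
       k \<cdot> u = k \<cdot> v \<Longrightarrow> u = v"
  shows "is_kernel \<A> f k"
  unfolding is_kernel_def Hom_def
proof (intro conjI ballI impI)
  fix h assume h: "h \<in> arrs \<A>" "tgt \<A> h = src \<A> f \<and> f \<cdot> h = zero_arr \<A> (src \<A> h) (tgt \<A> f)"
  obtain u where u: "u \<in> arrs \<A>" "src \<A> u = src \<A> h" "tgt \<A> u = src \<A> k" "k \<cdot> u = h"
    using assms(5) h by blast
  show "\<exists>!u. u \<in> {fa \<in> arrs \<A>. src \<A> fa = src \<A> h \<and> tgt \<A> fa = src \<A> k} \<and> k \<cdot> u = h"
    by (rule ex1I[of _ u]) (use u assms(6) in auto)
qed (use assms in auto)

lemma biprodD:
  assumes "is_biproduct \<A> X Y S i j p q"
  shows "X \<in> objs \<A>" "Y \<in> objs \<A>" "S \<in> objs \<A>"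
    "i \<in> arrs \<A>" "j \<in> arrs \<A>" "p \<in> arrs \<A>" "q \<in> arrs \<A>"
    "src \<A> i = X" "src \<A> j = Y" "src \<A> p = S" "src \<A> q = S" "tgt \<A> i = S" "tgt \<A> j = S" "tgt \<A> p = X" "tgt \<A> q = Y"
    "p \<cdot> i = idn \<A> X" "q \<cdot> j = idn \<A> Y" "p \<cdot> j = zero_arr \<A> Y X" "q \<cdot> i = zero_arr \<A> X Y"
    "(i \<cdot> p) \<boxplus> (j \<cdot> q) = idn \<A> S"
  using assms by (auto simp: is_biproduct_def Hom_def)

lemma biprod_cmp:
  assumes "is_biproduct \<A> X Y S i j p q" "f \<in> arrs \<A>"
  shows "tgt \<A> f = X \<Longrightarrow> p \<cdot> (i \<cdot> f) = f" "tgt \<A> f = Y \<Longrightarrow> q \<cdot> (j \<cdot> f) = f"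
    "tgt \<A> f = Y \<Longrightarrow> p \<cdot> (j \<cdot> f) = zero_arr \<A> (src \<A> f) X"
    "tgt \<A> f = X \<Longrightarrow> q \<cdot> (i \<cdot> f) = zero_arr \<A> (src \<A> f) Y"
  using assms(2) biprodD[OF assms(1)]
    cmp_eq_reassoc1[of p i _ f] cmp_eq_reassoc1[of q j _ f] cmp_eq_reassoc1[of p j _ f] cmp_eq_reassoc1[of q i _ f]
  by auto

lemma biprod_expand:
  assumes "is_biproduct \<A> X Y S i j p q" "f \<in> arrs \<A>" "tgt \<A> f = S"
  shows "(i \<cdot> (p \<cdot> f)) \<boxplus> (j \<cdot> (q \<cdot> f)) = f"
proof -
  note b = biprodD[OF assms(1)]
  have "f = ((i \<cdot> p) \<boxplus> (j \<cdot> q)) \<cdot> f" using b assms by simp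
  also have "\<dots> = (i \<cdot> (p \<cdot> f)) \<boxplus> (j \<cdot> (q \<cdot> f))" using b(1-15) assms by simp
  finally show ?thesis by simp
qed

lemma biprod_coexpand:
  assumes "is_biproduct \<A> X Y S i j p q" "f \<in> arrs \<A>" "src \<A> f = S"
  shows "(f \<cdot> i) \<cdot> p \<boxplus> (f \<cdot> j) \<cdot> q = f"
  using abelian_category.biprod_expand[OF abelian_opc, of X Y S p q i j f] assms by simp

lemma biprod_eqI:
  assumes "is_biproduct \<A> X Y S i j p q" "f \<in> arrs \<A>" "tgt \<A> f = S" "g \<in> arrs \<A>" "tgt \<A> g = S"
    "p \<cdot> f = p \<cdot> g" "q \<cdot> f = q \<cdot> g"
  shows "f = g"
  using assms biprod_expand by metis

lemma biprod_coeqI: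
  assumes "is_biproduct \<A> X Y S i j p q" "f \<in> arrs \<A>" "src \<A> f = S" "g \<in> arrs \<A>" "src \<A> g = S"
    "f \<cdot> i = g \<cdot> i" "f \<cdot> j = g \<cdot> j"
  shows "f = g"
  using assms biprod_coexpand by metis

lemma is_pullbackD:
  assumes "is_pullback \<A> p b v q"
  shows "p \<in> arrs \<A>" "b \<in> arrs \<A>" "v \<in> arrs \<A>" "q \<in> arrs \<A>" "tgt \<A> b = tgt \<A> p"
    "src \<A> q = src \<A> v" "tgt \<A> v = src \<A> p" "tgt \<A> q = src \<A> b" "p \<cdot> v = b \<cdot> q"
  using assms by (auto simp: is_pullback_def Hom_def)

lemma pullback_lift:
  assumes "is_pullback \<A> p b v q" "x \<in> arrs \<A>" "y \<in> arrs \<A>" "src \<A> y = src \<A> x"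
    "tgt \<A> x = src \<A> p" "tgt \<A> y = src \<A> b" "p \<cdot> x = b \<cdot> y"
  obtains w where "w \<in> arrs \<A>" "src \<A> w = src \<A> x" "tgt \<A> w = src \<A> v" "v \<cdot> w = x" "q \<cdot> w = y"
proof -
  have "src \<A> x \<in> objs \<A>" "x \<in> Hom \<A> (src \<A> x) (src \<A> p)" "y \<in> Hom \<A> (src \<A> x) (src \<A> b)"
    using assms by (auto simp: Hom_def)
  with assms(1,7) have "\<exists>!w. w \<in> Hom \<A> (src \<A> x) (src \<A> v) \<and> v \<cdot> w = x \<and> q \<cdot> w = y"
    unfolding is_pullback_def by blast
  then show thesis using that by (auto simp: Hom_def)
qed

lemma pullback_unique:
  assumes "is_pullback \<A> p b v q" "w \<in> arrs \<A>" "w' \<in> arrs \<A>" "src \<A> w = src \<A> w'"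
    "tgt \<A> w = src \<A> v" "tgt \<A> w' = src \<A> v" "v \<cdot> w = v \<cdot> w'" "q \<cdot> w = q \<cdot> w'"
  shows "w = w'"
proof -
  note d = is_pullbackD[OF assms(1)]
  have "src \<A> w \<in> objs \<A>" "v \<cdot> w \<in> Hom \<A> (src \<A> w) (src \<A> p)" "q \<cdot> w \<in> Hom \<A> (src \<A> w) (src \<A> b)"
    using assms d(1-8) by (simp_all add: Hom_def)
  moreover have "p \<cdot> (v \<cdot> w) = b \<cdot> (q \<cdot> w)"
    using cmp_eq_reassoc[OF d(9), of w] assms d by simp
  ultimately have "\<exists>!u. u \<in> Hom \<A> (src \<A> w) (src \<A> v) \<and> v \<cdot> u = v \<cdot> w \<and> q \<cdot> u = q \<cdot> w"
    using assms(1) unfolding is_pullback_def by blast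
  then show ?thesis using assms(2-) by (auto simp: Hom_def)
qed

lemma is_pullbackI:
  assumes "p \<in> arrs \<A>" "b \<in> arrs \<A>" "v \<in> arrs \<A>" "q \<in> arrs \<A>" "tgt \<A> b = tgt \<A> p"
    "src \<A> q = src \<A> v" "tgt \<A> v = src \<A> p" "tgt \<A> q = src \<A> b" "p \<cdot> v = b \<cdot> q"
    "\<And>x y. x \<in> arrs \<A> \<Longrightarrow> y \<in> arrs \<A> \<Longrightarrow> src \<A> y = src \<A> x \<Longrightarrow> tgt \<A> x = src \<A> p \<Longrightarrow> tgt \<A> y = src \<A> b \<Longrightarrow>
       p \<cdot> x = b \<cdot> y \<Longrightarrow> \<exists>w. w \<in> arrs \<A> \<and> src \<A> w = src \<A> x \<and> tgt \<A> w = src \<A> v \<and> v \<cdot> w = x \<and> q \<cdot> w = y"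
    "\<And>w w'. w \<in> arrs \<A> \<Longrightarrow> w' \<in> arrs \<A> \<Longrightarrow> src \<A> w = src \<A> w' \<Longrightarrow> tgt \<A> w = src \<A> v \<Longrightarrow> tgt \<A> w' = src \<A> v \<Longrightarrow>
       v \<cdot> w = v \<cdot> w' \<Longrightarrow> q \<cdot> w = q \<cdot> w' \<Longrightarrow> w = w'"
  shows "is_pullback \<A> p b v q"
  unfolding is_pullback_def
proof (intro conjI ballI impI)
  fix T x y assume *: "T \<in> objs \<A>" "x \<in> Hom \<A> T (src \<A> p)" "y \<in> Hom \<A> T (src \<A> b)" "p \<cdot> x = b \<cdot> y"
  then obtain w where w: "w \<in> arrs \<A>" "src \<A> w = src \<A> x" "tgt \<A> w = src \<A> v" "v \<cdot> w = x" "q \<cdot> w = y"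
    using assms(10)[of x y] by (auto simp: Hom_def)
  show "\<exists>!w. w \<in> Hom \<A> T (src \<A> v) \<and> v \<cdot> w = x \<and> q \<cdot> w = y"
    by (rule ex1I[of _ w]) (use w * assms(11) in \<open>auto simp: Hom_def\<close>)
qed (use assms in \<open>simp_all add: Hom_def\<close>)

lemma pullback_kernel:
  assumes pb: "is_pullback \<A> p b v q" and bp: "is_biproduct \<A> (src \<A> p) (src \<A> b) S i1 i2 p1 p2"
  shows "is_kernel \<A> ((p \<cdot> p1) \<boxplus> ng (b \<cdot> p2)) ((i1 \<cdot> v) \<boxplus> (i2 \<cdot> q))"
    (is "is_kernel \<A> ?f ?k")
proof -
  note d = is_pullbackD[OF pb] and e = biprodD[OF bp]
  note s [simp] = d(1-8) e(3-19) biprod_cmp[OF bp]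
  show ?thesis
  proof (rule is_kernelI)
    show "?f \<cdot> ?k = zero_arr \<A> (src \<A> ?k) (tgt \<A> ?f)" using d(9) by simp
  next
    fix h assume h [simp]: "h \<in> arrs \<A>" "tgt \<A> h = src \<A> ?f" and 0: "?f \<cdot> h = zero_arr \<A> (src \<A> h) (tgt \<A> ?f)"
    have t [simp]: "tgt \<A> h = S" using h(2) by simp
    have "p \<cdot> (p1 \<cdot> h) = b \<cdot> (p2 \<cdot> h)"
      by (rule eq_of_diff) (use 0 in simp_all)
    then obtain w where w [simp]: "w \<in> arrs \<A>" "src \<A> w = src \<A> h" "tgt \<A> w = src \<A> v" "v \<cdot> w = p1 \<cdot> h" "q \<cdot> w = p2 \<cdot> h"
      using pullback_lift[OF pb, of "p1 \<cdot> h" "p2 \<cdot> h"] by auto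
    have "?k \<cdot> w = h" using biprod_expand[OF bp, of h] by simp
    then show "\<exists>u. u \<in> arrs \<A> \<and> src \<A> u = src \<A> h \<and> tgt \<A> u = src \<A> ?k \<and> ?k \<cdot> u = h"
      by (intro exI[of _ w]) simp
  next
    fix u u' assume u: "u \<in> arrs \<A>" "u' \<in> arrs \<A>" "tgt \<A> u = src \<A> ?k" "tgt \<A> u' = src \<A> ?k"
      "src \<A> u = src \<A> u'" and eq: "?k \<cdot> u = ?k \<cdot> u'"
    then have [simp]: "tgt \<A> u = src \<A> v" "tgt \<A> u' = src \<A> v" "u \<in> arrs \<A>" "u' \<in> arrs \<A>" "src \<A> u = src \<A> u'" by simp_all
    have "p1 \<cdot> (?k \<cdot> u) = v \<cdot> u" "p1 \<cdot> (?k \<cdot> u') = v \<cdot> u'" "p2 \<cdot> (?k \<cdot> u) = q \<cdot> u" "p2 \<cdot> (?k \<cdot> u') = q \<cdot> u'"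
      by simp_all
    then show "u = u'" using eq by - (rule pullback_unique[OF pb], simp_all)
  qed simp_all
qed

lemma ex_pullback:
  assumes [simp]: "p \<in> arrs \<A>" "b \<in> arrs \<A>" "tgt \<A> b = tgt \<A> p"
  obtains v q where "is_pullback \<A> p b v q"
proof -
  obtain S i1 i2 p1 p2 where bp: "is_biproduct \<A> (src \<A> p) (src \<A> b) S i1 i2 p1 p2"
    using ex_biproduct[of "src \<A> p" "src \<A> b"] by auto
  note e [simp] = biprodD(3-19)[OF bp] biprod_cmp[OF bp]
  let ?f = "(p \<cdot> p1) \<boxplus> ng (b \<cdot> p2)"
  obtain k where k: "is_kernel \<A> ?f k" using ex_kernel[of ?f] by auto
  have [simp]: "k \<in> arrs \<A>" "tgt \<A> k = S" and 0: "?f \<cdot> k = zero_arr \<A> (src \<A> k) (tgt \<A> p)"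
    using k by (simp_all add: is_kernel_def)
  have "is_pullback \<A> p b (p1 \<cdot> k) (p2 \<cdot> k)"
  proof (rule is_pullbackI)
    show "p \<cdot> (p1 \<cdot> k) = b \<cdot> (p2 \<cdot> k)" by (rule eq_of_diff) (use 0 in simp_all)
  next
    fix x y assume [simp]: "x \<in> arrs \<A>" "y \<in> arrs \<A>" "src \<A> y = src \<A> x" "tgt \<A> x = src \<A> p" "tgt \<A> y = src \<A> b"
      "p \<cdot> x = b \<cdot> y"
    have "?f \<cdot> ((i1 \<cdot> x) \<boxplus> (i2 \<cdot> y)) = zero_arr \<A> (src \<A> x) (tgt \<A> p)" by simp
    then obtain w where "w \<in> arrs \<A>" "src \<A> w = src \<A> x" "tgt \<A> w = src \<A> k" "k \<cdot> w = (i1 \<cdot> x) \<boxplus> (i2 \<cdot> y)"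
      using kernel_lift[OF k, of "(i1 \<cdot> x) \<boxplus> (i2 \<cdot> y)"] by auto
    then show "\<exists>w. w \<in> arrs \<A> \<and> src \<A> w = src \<A> x \<and> tgt \<A> w = src \<A> (p1 \<cdot> k) \<and> (p1 \<cdot> k) \<cdot> w = x \<and> (p2 \<cdot> k) \<cdot> w = y"
      by (intro exI[of _ w]) simp
  next
    fix w w' assume [simp]: "w \<in> arrs \<A>" "w' \<in> arrs \<A>" "src \<A> w = src \<A> w'" and t: "tgt \<A> w = src \<A> (p1 \<cdot> k)" "tgt \<A> w' = src \<A> (p1 \<cdot> k)"
      and eq: "(p1 \<cdot> k) \<cdot> w = (p1 \<cdot> k) \<cdot> w'" "(p2 \<cdot> k) \<cdot> w = (p2 \<cdot> k) \<cdot> w'"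
    have [simp]: "tgt \<A> w = src \<A> k" "tgt \<A> w' = src \<A> k" using t by simp_all
    have "k \<cdot> w = k \<cdot> w'" by (rule biprod_eqI[OF bp]) (use eq in simp_all)
    then show "w = w'" using is_monoD[OF kernel_mono[OF k], of w w'] by simp
  qed simp_all
  then show thesis by (rule that)
qed

lemma pullback_MV:
  assumes pb: "is_pullback \<A> p b v q" and bp: "is_biproduct \<A> (src \<A> p) (src \<A> b) S i1 i2 p1 p2"
    and ep: "is_epi \<A> p"
  shows "short_exact \<A> ((i1 \<cdot> v) \<boxplus> (i2 \<cdot> q)) ((p \<cdot> p1) \<boxplus> ng (b \<cdot> p2))"
proof (rule short_exact_of_epi[OF pullback_kernel[OF pb bp]], rule is_epiI)
  note s [simp] = is_pullbackD(1-8)[OF pb] biprodD(1-19)[OF bp] biprod_cmp[OF bp]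
  let ?f = "(p \<cdot> p1) \<boxplus> ng (b \<cdot> p2)"
  fix h assume [simp]: "h \<in> arrs \<A>" and h: "src \<A> h = tgt \<A> ?f" "h \<cdot> ?f = zero_arr \<A> (src \<A> ?f) (tgt \<A> h)"
  have [simp]: "src \<A> h = tgt \<A> p" using h by simp
  have "h \<cdot> p = h \<cdot> (?f \<cdot> i1)" by simp
  also have "\<dots> = zero_arr \<A> (src \<A> p) (tgt \<A> h)" using cmp_eq_reassoc1[OF h(2), of i1] by simp
  finally show "h = zero_arr \<A> (tgt \<A> ?f) (tgt \<A> h)"
    by - (rule is_epiD[OF ep], simp_all)
qed (use is_pullbackD(1-8)[OF pb] biprodD(1-19)[OF bp] in simp)

lemma pullback_epi:
  assumes pb: "is_pullback \<A> p b v q" and ep: "is_epi \<A> p"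
  shows "is_epi \<A> q"
proof (rule is_epiI)
  note s [simp] = is_pullbackD(1-8)[OF pb]
  show "q \<in> arrs \<A>" by simp
  obtain S i1 i2 p1 p2 where bp: "is_biproduct \<A> (src \<A> p) (src \<A> b) S i1 i2 p1 p2"
    using ex_biproduct[of "src \<A> p" "src \<A> b"] by auto
  note e [simp] = biprodD(3-19)[OF bp] biprod_cmp[OF bp]
  fix h assume [simp]: "h \<in> arrs \<A>" "src \<A> h = tgt \<A> q" and h: "h \<cdot> q = zero_arr \<A> (src \<A> q) (tgt \<A> h)"
  let ?f = "(p \<cdot> p1) \<boxplus> ng (b \<cdot> p2)" and ?k = "(i1 \<cdot> v) \<boxplus> (i2 \<cdot> q)"
  have "(h \<cdot> p2) \<cdot> ?k = zero_arr \<A> (src \<A> v) (tgt \<A> h)" using h by simp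
  then obtain w where w [simp]: "w \<in> arrs \<A>" "src \<A> w = tgt \<A> p" "tgt \<A> w = tgt \<A> h" and wf: "w \<cdot> ?f = h \<cdot> p2"
    using ses_colift[OF pullback_MV[OF pb bp ep], of "h \<cdot> p2"] by auto
  have "w \<cdot> p = w \<cdot> (?f \<cdot> i1)" by simp
  also have "\<dots> = zero_arr \<A> (src \<A> p) (tgt \<A> w)" using cmp_eq_reassoc1[OF wf, of i1] by simp
  finally have w0: "w = zero_arr \<A> (tgt \<A> p) (tgt \<A> w)" by - (rule is_epiD[OF ep], simp_all)
  have "h = h \<cdot> (p2 \<cdot> i2)" by simp
  also have "\<dots> = (w \<cdot> ?f) \<cdot> i2" unfolding wf by (subst assoc) simp_all
  also have "\<dots> = zero_arr \<A> (tgt \<A> q) (tgt \<A> h)" by (subst w0) simp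
  finally show "h = zero_arr \<A> (tgt \<A> q) (tgt \<A> h)" .
qed

text \<open>In the next lemmas, \<open>(i, p)\<close> and \<open>(j, q)\<close> are the rows of a morphism with middle map \<open>m\<close>.\<close>

lemma pullback_ses:
  assumes se: "short_exact \<A> i p" and pb: "is_pullback \<A> p b m q"
    and j: "j \<in> arrs \<A>" "src \<A> j = src \<A> i" "tgt \<A> j = src \<A> q" "q \<cdot> j = zero_arr \<A> (src \<A> i) (tgt \<A> q)" "m \<cdot> j = i"
  shows "short_exact \<A> j q"
proof (rule short_exact_of_epi[OF _ pullback_epi[OF pb ses_is_epi[OF se]]], rule is_kernelI)
  note s [simp] = is_pullbackD(1-8)[OF pb] ses_arr[OF se] j
  { fix h assume [simp]: "h \<in> arrs \<A>" and h: "tgt \<A> h = src \<A> q" "q \<cdot> h = zero_arr \<A> (src \<A> h) (tgt \<A> q)"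
    have [simp]: "tgt \<A> h = src \<A> m" using h by simp
    have "p \<cdot> (m \<cdot> h) = zero_arr \<A> (src \<A> h) (tgt \<A> p)"
      using cmp_eq_reassoc[OF is_pullbackD(9)[OF pb], of h] h(2) by simp
    then obtain u where u [simp]: "u \<in> arrs \<A>" "src \<A> u = src \<A> h" "tgt \<A> u = src \<A> i" "i \<cdot> u = m \<cdot> h"
      using ses_lift[OF se, of "m \<cdot> h"] by auto
    have "j \<cdot> u = h"
      by (rule pullback_unique[OF pb]) (use h cmp_eq_reassoc1[OF j(4), of u] cmp_eq_reassoc1[OF j(5), of u] in simp_all)
    then show "\<exists>u. u \<in> arrs \<A> \<and> src \<A> u = src \<A> h \<and> tgt \<A> u = src \<A> j \<and> j \<cdot> u = h"
      by (intro exI[of _ u]) simp }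
  { fix u u' assume [simp]: "u \<in> arrs \<A>" "u' \<in> arrs \<A>" and t: "tgt \<A> u = src \<A> j" "tgt \<A> u' = src \<A> j" "src \<A> u = src \<A> u'" "j \<cdot> u = j \<cdot> u'"
    have "m \<cdot> (j \<cdot> u) = m \<cdot> (j \<cdot> u')" using t by simp
    then have "i \<cdot> u = i \<cdot> u'" using cmp_eq_reassoc1[OF j(5), of u] cmp_eq_reassoc1[OF j(5), of u'] t by simp
    then show "u = u'" using t by - (rule ses_mono[OF se], simp_all) }
qed (use is_pullbackD[OF pb] j in simp_all)

lemma ex_pullback_ses:
  assumes se: "short_exact \<A> i p" and [simp]: "b \<in> arrs \<A>" "tgt \<A> b = tgt \<A> p"
  obtains j q m where "short_exact \<A> j q" "is_pullback \<A> p b m q" "src \<A> j = src \<A> i" "m \<cdot> j = i"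
proof -
  note [simp] = ses_arr[OF se]
  obtain m q where pb: "is_pullback \<A> p b m q" using ex_pullback[of p b] by auto
  note [simp] = is_pullbackD(1-8)[OF pb]
  obtain j where j: "j \<in> arrs \<A>" "src \<A> j = src \<A> i" "tgt \<A> j = src \<A> m" "m \<cdot> j = i" "q \<cdot> j = zero_arr \<A> (src \<A> i) (src \<A> b)"
    using pullback_lift[OF pb, of i "zero_arr \<A> (src \<A> i) (src \<A> b)"] by auto
  show thesis by (rule that[of j q m]) (use pullback_ses[OF se pb, of j] j pb in simp_all)
qed

lemma pullback_of_ses_morphism:
  assumes se: "short_exact \<A> i p" and se': "short_exact \<A> j q"
    and b: "b \<in> arrs \<A>" "src \<A> b = tgt \<A> q" "tgt \<A> b = tgt \<A> p"
    and m: "m \<in> arrs \<A>" "src \<A> m = tgt \<A> j" "tgt \<A> m = tgt \<A> i"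
    and eq: "src \<A> j = src \<A> i" "m \<cdot> j = i" "p \<cdot> m = b \<cdot> q"
  shows "is_pullback \<A> p b m q"
proof (rule is_pullbackI)
  note s [simp] = ses_arr[OF se] ses_arr[OF se'] b m eq(1)
  have **: "w = w'" if [simp]: "w \<in> arrs \<A>" "w' \<in> arrs \<A>" "src \<A> w = src \<A> w'" "tgt \<A> w = src \<A> m" "tgt \<A> w' = src \<A> m"
      and w: "m \<cdot> w = m \<cdot> w'" "q \<cdot> w = q \<cdot> w'" for w w'
  proof -
    let ?d = "w \<boxplus> ng w'"
    have "q \<cdot> ?d = zero_arr \<A> (src \<A> ?d) (tgt \<A> q)" using w(2) by simp
    then obtain z where z [simp]: "z \<in> arrs \<A>" "src \<A> z = src \<A> w'" "tgt \<A> z = src \<A> j" and jz: "j \<cdot> z = ?d"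
      using ses_lift[OF se', of ?d] by auto
    have "i \<cdot> z = m \<cdot> ?d" using cmp_eq_reassoc1[OF eq(2), of z] jz by simp
    also have "\<dots> = zero_arr \<A> (src \<A> w') (tgt \<A> i)" using w(1) by simp
    finally have "z = zero_arr \<A> (src \<A> w') (src \<A> i)" by - (rule ses_mono[OF se], simp_all)
    then show ?thesis using jz by - (rule eq_of_diff, simp_all)
  qed
  show "w = w'" if "w \<in> arrs \<A>" "w' \<in> arrs \<A>" "src \<A> w = src \<A> w'" "tgt \<A> w = src \<A> m" "tgt \<A> w' = src \<A> m"
    "m \<cdot> w = m \<cdot> w'" "q \<cdot> w = q \<cdot> w'" for w w'
    using that by (rule **)
  { fix x y assume [simp]: "x \<in> arrs \<A>" "y \<in> arrs \<A>" "src \<A> y = src \<A> x" "tgt \<A> x = src \<A> p" "tgt \<A> y = src \<A> b"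
      and xy: "p \<cdot> x = b \<cdot> y"
    obtain j' e s where e: "short_exact \<A> j' e" and pb: "is_pullback \<A> q y s e"
      by (rule ex_pullback_ses[OF se', of y]) (simp, simp, blast)
    note [simp] = is_pullbackD(1-8)[OF pb]
    let ?d = "(x \<cdot> e) \<boxplus> ng (m \<cdot> s)"
    have "p \<cdot> (x \<cdot> e) = b \<cdot> (y \<cdot> e)" by (rule cmp_eq_reassoc[OF xy]) simp_all
    also have "\<dots> = b \<cdot> (q \<cdot> s)" using is_pullbackD(9)[OF pb] by simp
    also have "\<dots> = p \<cdot> (m \<cdot> s)" by (rule cmp_eq_reassoc[OF eq(3)[symmetric]]) simp_all
    finally have "p \<cdot> ?d = zero_arr \<A> (src \<A> ?d) (tgt \<A> p)" by simp
    then obtain z where z [simp]: "z \<in> arrs \<A>" "src \<A> z = src \<A> s" "tgt \<A> z = src \<A> i" and iz: "i \<cdot> z = ?d"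
      using ses_lift[OF se, of ?d] by auto
    let ?s = "s \<boxplus> (j \<cdot> z)"
    have ms: "m \<cdot> ?s = x \<cdot> e"
      using cmp_eq_reassoc1[OF eq(2), of z] iz plus_comm[of "m \<cdot> s" "?d"] by (simp add: plus_assoc)
    have qs: "q \<cdot> ?s = y \<cdot> e" using is_pullbackD(9)[OF pb] ses_cmp0[OF se', of z] by simp
    have [simp]: "tgt \<A> j' = src \<A> s" using ses_arr(3)[OF e] is_pullbackD(6)[OF pb] by metis
    note [simp] = ses_arr(1,2,4)[OF e]
    have "?s \<cdot> j' = zero_arr \<A> (src \<A> j') (tgt \<A> j)"
    proof (rule **)
      show "m \<cdot> (?s \<cdot> j') = m \<cdot> zero_arr \<A> (src \<A> j') (tgt \<A> j)"
        using cmp_eq_reassoc[OF ms, of j'] by simp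
      show "q \<cdot> (?s \<cdot> j') = q \<cdot> zero_arr \<A> (src \<A> j') (tgt \<A> j)"
        using cmp_eq_reassoc[OF qs, of j'] by simp
    qed simp_all
    then obtain w where w: "w \<in> arrs \<A>" "src \<A> w = src \<A> x" "tgt \<A> w = tgt \<A> j" "w \<cdot> e = ?s"
      using ses_colift[OF e, of ?s] by auto
    have "m \<cdot> w = x"
      by (rule ses_epi[OF e]) (use w ms in simp_all)
    moreover have "q \<cdot> w = y"
      by (rule ses_epi[OF e]) (use w qs in simp_all)
    ultimately show "\<exists>w. w \<in> arrs \<A> \<and> src \<A> w = src \<A> x \<and> tgt \<A> w = src \<A> m \<and> m \<cdot> w = x \<and> q \<cdot> w = y"
      using w by (intro exI[of _ w]) simp }
qed (use ses_arr[OF se] ses_arr[OF se'] assms in simp_all)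

lemma ses_along_inflation:
  assumes se: "short_exact \<A> i p" and se': "short_exact \<A> j q"
    and b: "short_exact \<A> b r" "src \<A> b = tgt \<A> q" "tgt \<A> b = tgt \<A> p"
    and m: "m \<in> arrs \<A>" "src \<A> m = tgt \<A> j" "tgt \<A> m = tgt \<A> i"
    and eq: "src \<A> j = src \<A> i" "m \<cdot> j = i" "p \<cdot> m = b \<cdot> q"
  shows "short_exact \<A> m (r \<cdot> p)"
proof (rule short_exact_of_epi)
  note s [simp] = ses_arr[OF se] ses_arr[OF se'] ses_arr[OF b(1)] b(2-3) m eq(1)
  have pb: "is_pullback \<A> p b m q" by (rule pullback_of_ses_morphism[OF se se' _ b(2,3) m eq]) simp
  show "is_epi \<A> (r \<cdot> p)"
  proof (rule is_epiI)
    fix h assume [simp]: "h \<in> arrs \<A>" and h: "src \<A> h = tgt \<A> (r \<cdot> p)" "h \<cdot> (r \<cdot> p) = zero_arr \<A> (src \<A> (r \<cdot> p)) (tgt \<A> h)"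
    have [simp]: "src \<A> h = tgt \<A> r" using h by simp
    have "h \<cdot> r = zero_arr \<A> (tgt \<A> p) (tgt \<A> h)" by (rule ses_epi[OF se]) (use h in simp_all)
    then have "h = zero_arr \<A> (tgt \<A> r) (tgt \<A> h)" by - (rule ses_epi[OF b(1)], simp_all)
    then show "h = zero_arr \<A> (tgt \<A> (r \<cdot> p)) (tgt \<A> h)" by simp
  qed simp
  show "is_kernel \<A> (r \<cdot> p) m"
  proof (rule is_kernelI)
    show "(r \<cdot> p) \<cdot> m = zero_arr \<A> (src \<A> m) (tgt \<A> (r \<cdot> p))"
      using ses_cmp0[OF b(1), of q] eq(3) by simp
  next
    fix u assume [simp]: "u \<in> arrs \<A>" and u: "tgt \<A> u = src \<A> (r \<cdot> p)" "(r \<cdot> p) \<cdot> u = zero_arr \<A> (src \<A> u) (tgt \<A> (r \<cdot> p))"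
    have [simp]: "tgt \<A> u = tgt \<A> i" using u by simp
    obtain v where v: "v \<in> arrs \<A>" "src \<A> v = src \<A> u" "tgt \<A> v = tgt \<A> q" "b \<cdot> v = p \<cdot> u"
      using ses_lift[OF b(1), of "p \<cdot> u"] u by auto
    then obtain w where "w \<in> arrs \<A>" "src \<A> w = src \<A> u" "tgt \<A> w = tgt \<A> j" "m \<cdot> w = u"
      using pullback_lift[OF pb, of u v] by auto
    then show "\<exists>w. w \<in> arrs \<A> \<and> src \<A> w = src \<A> u \<and> tgt \<A> w = src \<A> m \<and> m \<cdot> w = u"
      by (intro exI[of _ w]) simp
  next
    fix u v assume [simp]: "u \<in> arrs \<A>" "v \<in> arrs \<A>" and t: "tgt \<A> u = src \<A> m" "tgt \<A> v = src \<A> m" "src \<A> u = src \<A> v" "m \<cdot> u = m \<cdot> v"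
    have [simp]: "tgt \<A> u = tgt \<A> j" "tgt \<A> v = tgt \<A> j" using t by simp_all
    have "b \<cdot> (q \<cdot> u) = p \<cdot> (m \<cdot> u)" "b \<cdot> (q \<cdot> v) = p \<cdot> (m \<cdot> v)"
      by (rule cmp_eq_reassoc[OF eq(3)[symmetric]]; simp)+
    then have "b \<cdot> (q \<cdot> u) = b \<cdot> (q \<cdot> v)" using t by simp
    then have "q \<cdot> u = q \<cdot> v" using t(3) by - (rule ses_mono[OF b(1)], simp_all)
    with t show "u = v" by - (rule pullback_unique[OF pb], simp_all)
  qed simp_all
qed

lemma ses_biproduct: "is_biproduct \<A> X Y S i j p q \<Longrightarrow> short_exact \<A> i q"
proof (rule short_exact_of_epi)
  assume bp: "is_biproduct \<A> X Y S i j p q"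
  note [simp] = biprodD(1-19)[OF bp] biprod_cmp[OF bp]
  show "is_kernel \<A> q i"
  proof (rule is_kernelI)
    fix h assume [simp]: "h \<in> arrs \<A>" and h: "tgt \<A> h = src \<A> q" "q \<cdot> h = zero_arr \<A> (src \<A> h) (tgt \<A> q)"
    have [simp]: "tgt \<A> h = S" using h by simp
    have "i \<cdot> (p \<cdot> h) = h" using biprod_expand[OF bp, of h] h by simp
    then show "\<exists>u. u \<in> arrs \<A> \<and> src \<A> u = src \<A> h \<and> tgt \<A> u = src \<A> i \<and> i \<cdot> u = h"
      by (intro exI[of _ "p \<cdot> h"]) simp
  next
    fix u v assume [simp]: "u \<in> arrs \<A>" "v \<in> arrs \<A>" and t: "tgt \<A> u = src \<A> i" "tgt \<A> v = src \<A> i" "i \<cdot> u = i \<cdot> v"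
    have "p \<cdot> (i \<cdot> u) = p \<cdot> (i \<cdot> v)" using t by simp
    then show "u = v" using t(1,2) by simp
  qed simp_all
  show "is_epi \<A> q"
  proof (rule is_epiI)
    fix h assume [simp]: "h \<in> arrs \<A>" and h: "src \<A> h = tgt \<A> q" "h \<cdot> q = zero_arr \<A> (src \<A> q) (tgt \<A> h)"
    have [simp]: "src \<A> h = Y" using h by simp
    show "h = zero_arr \<A> (tgt \<A> q) (tgt \<A> h)"
      using cmp_eq_reassoc1[OF h(2), of j] by simp
  qed simp
qed

lemma ses_direct_sum:
  assumes se: "short_exact \<A> i p" and se': "short_exact \<A> i' p'"
    and K: "is_biproduct \<A> (src \<A> i) (src \<A> i') SK iK jK pK qK"
    and X: "is_biproduct \<A> (tgt \<A> i) (tgt \<A> i') SX iX jX pX qX"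
    and A: "is_biproduct \<A> (tgt \<A> p) (tgt \<A> p') SA iA jA pA qA"
  shows "short_exact \<A> (((iX \<cdot> i) \<cdot> pK) \<boxplus> ((jX \<cdot> i') \<cdot> qK)) (((iA \<cdot> p) \<cdot> pX) \<boxplus> ((jA \<cdot> p') \<cdot> qX))"
    (is "short_exact \<A> ?i ?p")
proof (rule short_exact_of_epi)
  note s [simp] = ses_arr(1-3)[OF se] ses_arr(1-3)[OF se'] biprodD(1-19)[OF K] biprodD(1-19)[OF X] biprodD(1-19)[OF A]
    biprod_cmp[OF K] biprod_cmp[OF X] biprod_cmp[OF A] ses_cmp0[OF se] ses_cmp0[OF se']
  show "is_kernel \<A> ?p ?i"
  proof (rule is_kernelI)
    show "?p \<cdot> ?i = zero_arr \<A> (src \<A> ?i) (tgt \<A> ?p)" by simp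
  next
    fix h assume [simp]: "h \<in> arrs \<A>" and h: "tgt \<A> h = src \<A> ?p" and 0: "?p \<cdot> h = zero_arr \<A> (src \<A> h) (tgt \<A> ?p)"
    have [simp]: "tgt \<A> h = SX" using h by simp
    have "pA \<cdot> (?p \<cdot> h) = zero_arr \<A> (src \<A> h) (tgt \<A> p)" unfolding 0 by simp
    moreover have "qA \<cdot> (?p \<cdot> h) = zero_arr \<A> (src \<A> h) (tgt \<A> p')" unfolding 0 by simp
    ultimately have "p \<cdot> (pX \<cdot> h) = zero_arr \<A> (src \<A> h) (tgt \<A> p)" "p' \<cdot> (qX \<cdot> h) = zero_arr \<A> (src \<A> h) (tgt \<A> p')"
      by simp_all
    note 1 = this
    obtain u where u [simp]: "u \<in> arrs \<A>" "src \<A> u = src \<A> h" "tgt \<A> u = src \<A> i" "i \<cdot> u = pX \<cdot> h"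
      by (rule ses_lift[OF se, of "pX \<cdot> h"]) (use 1 in simp_all)
    obtain u' where u' [simp]: "u' \<in> arrs \<A>" "src \<A> u' = src \<A> h" "tgt \<A> u' = src \<A> i'" "i' \<cdot> u' = qX \<cdot> h"
      by (rule ses_lift[OF se', of "qX \<cdot> h"]) (use 1 in simp_all)
    have "?i \<cdot> ((iK \<cdot> u) \<boxplus> (jK \<cdot> u')) = h" using biprod_expand[OF X, of h] by simp
    then show "\<exists>u. u \<in> arrs \<A> \<and> src \<A> u = src \<A> h \<and> tgt \<A> u = src \<A> ?i \<and> ?i \<cdot> u = h"
      by (intro exI[of _ "(iK \<cdot> u) \<boxplus> (jK \<cdot> u')"]) simp
  next
    fix u v assume [simp]: "u \<in> arrs \<A>" "v \<in> arrs \<A>" and t: "tgt \<A> u = src \<A> ?i" "tgt \<A> v = src \<A> ?i" "src \<A> u = src \<A> v" "?i \<cdot> u = ?i \<cdot> v"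
    have [simp]: "tgt \<A> u = SK" "tgt \<A> v = SK" "src \<A> u = src \<A> v" using t by simp_all
    have "pX \<cdot> (?i \<cdot> u) = pX \<cdot> (?i \<cdot> v)" "qX \<cdot> (?i \<cdot> u) = qX \<cdot> (?i \<cdot> v)" using t(4) by simp_all
    then have "i \<cdot> (pK \<cdot> u) = i \<cdot> (pK \<cdot> v)" "i' \<cdot> (qK \<cdot> u) = i' \<cdot> (qK \<cdot> v)" by simp_all
    note 1 = this
    have "pK \<cdot> u = pK \<cdot> v" by (rule ses_mono[OF se]) (use 1 in simp_all)
    moreover have "qK \<cdot> u = qK \<cdot> v" by (rule ses_mono[OF se']) (use 1 in simp_all)
    ultimately show "u = v" by - (rule biprod_eqI[OF K], simp_all)
  qed simp_all
  show "is_epi \<A> ?p"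
  proof (rule is_epiI)
    fix h assume [simp]: "h \<in> arrs \<A>" and h: "src \<A> h = tgt \<A> ?p" and 0: "h \<cdot> ?p = zero_arr \<A> (src \<A> ?p) (tgt \<A> h)"
    have [simp]: "src \<A> h = SA" using h by simp
    have "h \<cdot> (iA \<cdot> p) = h \<cdot> (?p \<cdot> iX)" "h \<cdot> (jA \<cdot> p') = h \<cdot> (?p \<cdot> jX)" by simp_all
    then have "(h \<cdot> iA) \<cdot> p = zero_arr \<A> (tgt \<A> i) (tgt \<A> h)" "(h \<cdot> jA) \<cdot> p' = zero_arr \<A> (tgt \<A> i') (tgt \<A> h)"
      using cmp_eq_reassoc1[OF 0, of iX] cmp_eq_reassoc1[OF 0, of jX] by simp_all
    then have "h \<cdot> iA = zero_arr \<A> (tgt \<A> p) (tgt \<A> h)" "h \<cdot> jA = zero_arr \<A> (tgt \<A> p') (tgt \<A> h)"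
      using ses_epi[OF se, of "h \<cdot> iA" "zero_arr \<A> (tgt \<A> p) (tgt \<A> h)"]
        ses_epi[OF se', of "h \<cdot> jA" "zero_arr \<A> (tgt \<A> p') (tgt \<A> h)"] by simp_all
    then show "h = zero_arr \<A> (tgt \<A> ?p) (tgt \<A> h)" by - (rule biprod_coeqI[OF A], simp_all)
  qed simp
qed

end

section \<open>Conflations and their morphisms\<close>

lemma conflation_opc [simp]: "conflation (opc \<A>) \<C> p i = conflation \<A> \<C> i p"
proof -
  have "short_exact \<A> i p \<Longrightarrow> tgt \<A> i = src \<A> p"
    by (simp add: short_exact_def is_kernel_def)
  then show ?thesis by (auto simp: conflation_def)
qed

locale ext_cat = abelian_category \<A> for \<A> :: "('o, 'm) category_data" (structure) +
  fixes \<C> :: "'o set"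
  assumes subcat: "ext_closed_additive_subcategory \<A> \<C>"
begin

lemma ext_cat_opc: "ext_cat (opc \<A>) \<C>"
proof (rule ext_cat.intro[OF abelian_opc], unfold_locales)
  have "\<exists>S\<in>\<C>. \<exists>i j p q. is_biproduct \<A> X Y S p q i j" if "X \<in> \<C>" "Y \<in> \<C>" for X Y
    using subcat that unfolding ext_closed_additive_subcategory_def by meson
  moreover have "tgt \<A> i \<in> \<C>" if "short_exact \<A> i p" "src \<A> i \<in> \<C>" "tgt \<A> p \<in> \<C>" for i p
    using subcat that unfolding ext_closed_additive_subcategory_def by meson
  ultimately show "ext_closed_additive_subcategory (opc \<A>) \<C>"
    using subcat ses_arr(3) by (auto simp: ext_closed_additive_subcategory_def)
qed

abbreviation conf where "conf c \<equiv> conflation \<A> \<C> (fst c) (snd c)"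
abbreviation kob where "kob c \<equiv> src \<A> (fst c)"
abbreviation mob where "mob c \<equiv> tgt \<A> (fst c)"
abbreviation cob where "cob c \<equiv> tgt \<A> (snd c)"

lemma C_obj [simp]: "X \<in> \<C> \<Longrightarrow> X \<in> objs \<A>"
  using subcat by (auto simp: ext_closed_additive_subcategory_def)

lemma confI: "short_exact \<A> i p \<Longrightarrow> src \<A> i \<in> \<C> \<Longrightarrow> tgt \<A> p \<in> \<C> \<Longrightarrow> conflation \<A> \<C> i p"
  using subcat unfolding ext_closed_additive_subcategory_def conflation_def by meson

lemma conf_ses: "conf c \<Longrightarrow> short_exact \<A> (fst c) (snd c)"
  by (simp add: conflation_def)

lemma confD [simp]:
  assumes "conf c"
  shows "fst c \<in> arrs \<A>" "snd c \<in> arrs \<A>" "src \<A> (snd c) = mob c" "kob c \<in> \<C>" "mob c \<in> \<C>" "cob c \<in> \<C>"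
    "snd c \<cdot> fst c = zero_arr \<A> (kob c) (cob c)"
  using assms ses_arr[OF conf_ses[OF assms]] by (auto simp: conflation_def)

lemma ex_biprod_C:
  assumes "X \<in> \<C>" "Y \<in> \<C>"
  obtains S i j p q where "is_biproduct \<A> X Y S i j p q" "S \<in> \<C>"
  using subcat assms unfolding ext_closed_additive_subcategory_def by meson

lemma biprod_C: "is_biproduct \<A> X Y S i j p q \<Longrightarrow> X \<in> \<C> \<Longrightarrow> Y \<in> \<C> \<Longrightarrow> S \<in> \<C>"
  using confI[OF ses_biproduct] biprodD(8,12,15)[of X Y S i j p q] by (auto simp: conflation_def)

lemma conf_biproduct: "is_biproduct \<A> X Y S i j p q \<Longrightarrow> X \<in> \<C> \<Longrightarrow> Y \<in> \<C> \<Longrightarrow> conflation \<A> \<C> i q"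
  using confI[OF ses_biproduct] biprodD(8,12,15)[of X Y S i j p q] by auto

definition cm :: "'m \<Rightarrow> 'm \<Rightarrow> 'm \<times> 'm \<Rightarrow> 'm \<times> 'm \<Rightarrow> bool" where
  "cm a b c d \<longleftrightarrow> conf c \<and> conf d \<and> a \<in> arrs \<A> \<and> src \<A> a = kob c \<and> tgt \<A> a = kob d \<and>
     b \<in> arrs \<A> \<and> src \<A> b = cob c \<and> tgt \<A> b = cob d \<and>
     (\<exists>m. m \<in> arrs \<A> \<and> src \<A> m = mob c \<and> tgt \<A> m = mob d \<and>
        m \<cdot> fst c = fst d \<cdot> a \<and> snd d \<cdot> m = b \<cdot> snd c)"

lemma cmD:
  assumes "cm a b c d"
  shows "conf c" "conf d" "a \<in> arrs \<A>" "src \<A> a = kob c" "tgt \<A> a = kob d"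
    "b \<in> arrs \<A>" "src \<A> b = cob c" "tgt \<A> b = cob d"
  using assms by (auto simp: cm_def)

lemma cmE:
  assumes "cm a b c d"
  obtains m where "m \<in> arrs \<A>" "src \<A> m = mob c" "tgt \<A> m = mob d" "m \<cdot> fst c = fst d \<cdot> a"
    "snd d \<cdot> m = b \<cdot> snd c"
  using assms by (auto simp: cm_def)

lemma cmI:
  assumes "conf c" "conf d" "a \<in> arrs \<A>" "src \<A> a = kob c" "tgt \<A> a = kob d"
    "b \<in> arrs \<A>" "src \<A> b = cob c" "tgt \<A> b = cob d"
    "m \<in> arrs \<A>" "src \<A> m = mob c" "tgt \<A> m = mob d" "m \<cdot> fst c = fst d \<cdot> a"
    "snd d \<cdot> m = b \<cdot> snd c"
  shows "cm a b c d"
  using assms by (auto simp: cm_def)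

lemma cm_opc: "ext_cat.cm (opc \<A>) \<C> b a (prod.swap d) (prod.swap c) = cm a b c d"
proof -
  interpret op: ext_cat "opc \<A>" \<C> by (rule ext_cat_opc)
  show ?thesis
    by (auto simp: cm_def op.cm_def conf_ses ses_arr)
qed

lemma cm_id: "conf c \<Longrightarrow> cm (idn \<A> (kob c)) (idn \<A> (cob c)) c c"
  by (rule cmI[of _ _ _ _ "idn \<A> (mob c)"]) simp_all

lemma cm_comp:
  assumes "cm a b c d" "cm a' b' d e"
  shows "cm (a' \<cdot> a) (b' \<cdot> b) c e"
proof -
  obtain m where m: "m \<in> arrs \<A>" "src \<A> m = mob c" "tgt \<A> m = mob d" "m \<cdot> fst c = fst d \<cdot> a" "snd d \<cdot> m = b \<cdot> snd c"
    by (rule cmE[OF assms(1)])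
  obtain m' where m': "m' \<in> arrs \<A>" "src \<A> m' = mob d" "tgt \<A> m' = mob e" "m' \<cdot> fst d = fst e \<cdot> a'" "snd e \<cdot> m' = b' \<cdot> snd d"
    by (rule cmE[OF assms(2)])
  note [simp] = m(1-3) m'(1-3) cmD(3-8)[OF assms(1)] cmD(3-8)[OF assms(2)] confD[OF cmD(1)[OF assms(1)]]
    confD[OF cmD(2)[OF assms(1)]]  confD[OF cmD(2)[OF assms(2)]]
  show ?thesis
    by (rule cmI[of _ _ _ _ "m' \<cdot> m"])
      (use cmD(1,2)[OF assms(1)] cmD(2)[OF assms(2)] m(4,5) cmp_eq_reassoc[OF m'(4), of a] cmp_eq_reassoc[OF m'(5), of m] in simp_all)
qed

lemma ex_conf_pull:
  assumes c: "conf c" and b: "b \<in> arrs \<A>" "tgt \<A> b = cob c" "src \<A> b \<in> \<C>"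
  obtains d where "kob d = kob c" "cob d = src \<A> b" "cm (idn \<A> (kob c)) b d c"
proof -
  obtain j q m where jq: "short_exact \<A> j q" "is_pullback \<A> (snd c) b m q" "src \<A> j = kob c" "m \<cdot> j = fst c"
    using ex_pullback_ses[OF conf_ses[OF c], of b] b by auto
  note d = is_pullbackD[OF jq(2)] 
  have "conflation \<A> \<C> j q" using confI[OF jq(1)] jq(3) b c d by simp
  moreover have "tgt \<A> j = src \<A> m" using d ses_arr[OF jq(1)] by simp
  ultimately have "cm (idn \<A> (kob c)) b (j, q) c"
    using d jq b c by (intro cmI[of _ _ _ _ m]) simp_all
  then show thesis using that[of "(j, q)"] jq d by simp
qed

lemma ex_conf_push:
  assumes c: "conf c" and a: "a \<in> arrs \<A>" "src \<A> a = kob c" "tgt \<A> a \<in> \<C>"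
  obtains d where "cob d = cob c" "kob d = tgt \<A> a" "cm a (idn \<A> (cob c)) c d"
proof -
  interpret op: ext_cat "opc \<A>" \<C> by (rule ext_cat_opc)
  obtain d where d: "op.kob d = op.kob (prod.swap c)" "op.cob d = src (opc \<A>) a"
    "op.cm (idn (opc \<A>) (op.kob (prod.swap c))) a d (prod.swap c)"
    by (rule op.ex_conf_pull[of "prod.swap c" a]) (use assms in simp_all)
  then have "cm a (idn \<A> (cob c)) c (prod.swap d)"
    using cm_opc[of "idn \<A> (cob c)" a "prod.swap d" c] by simp
  then show thesis using that[of "prod.swap d"] d by simp
qed

lemma cm_pullback:
  assumes "cm (idn \<A> (kob d)) b c d" "m \<in> arrs \<A>" "src \<A> m = mob c" "tgt \<A> m = mob d"
    "m \<cdot> fst c = fst d" "snd d \<cdot> m = b \<cdot> snd c"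
  shows "is_pullback \<A> (snd d) b m (snd c)"
  using pullback_of_ses_morphism[OF conf_ses[OF cmD(2)[OF assms(1)]] conf_ses[OF cmD(1)[OF assms(1)]], of b m]
    assms(2-) cmD[OF assms(1)] by simp

lemma cm_idE:
  assumes "cm (idn \<A> (kob d)) b c d"
  obtains m where "m \<in> arrs \<A>" "src \<A> m = mob c" "tgt \<A> m = mob d" "m \<cdot> fst c = fst d"
    "snd d \<cdot> m = b \<cdot> snd c" "kob c = kob d"
  using cmE[OF assms] cmD[OF assms] by (metis arr_idn(2) cmp_id confD(1) C_obj confD(4))

lemma cm_pull_factor:
  assumes "cm a b c d" "cm (idn \<A> (kob d)) b e d"
  shows "cm a (idn \<A> (cob c)) c e"
proof -
  obtain m where m: "m \<in> arrs \<A>" "src \<A> m = mob c" "tgt \<A> m = mob d" "m \<cdot> fst c = fst d \<cdot> a" "snd d \<cdot> m = b \<cdot> snd c"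
    by (rule cmE[OF assms(1)])
  obtain n where n: "n \<in> arrs \<A>" "src \<A> n = mob e" "tgt \<A> n = mob d" "n \<cdot> fst e = fst d" "snd d \<cdot> n = b \<cdot> snd e"
    and ke: "kob e = kob d"
    by (rule cm_idE[OF assms(2)])
  have pb: "is_pullback \<A> (snd d) b n (snd e)" by (rule cm_pullback[OF assms(2) n])
  note c = cmD[OF assms(1)] and e = cmD[OF assms(2)]
  note [simp] = m(1-3) n(1-3) c(3-8) confD[OF c(1)] confD[OF c(2)] confD(1-2,4-7)[OF e(1)]
  have ce: "cob e = cob c" "src \<A> (snd e) = mob e" using c(7) e(7) confD(3)[OF e(1)] by simp_all
  obtain w where w: "w \<in> arrs \<A>" "src \<A> w = mob c" "tgt \<A> w = mob e" "n \<cdot> w = m" "snd e \<cdot> w = snd c"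
    by (rule pullback_lift[OF pb, of m "snd c"]) (use m(5) in simp_all)
  note [simp] = w(1-3) ke ce
  have "w \<cdot> fst c = fst e \<cdot> a"
  proof (rule pullback_unique[OF pb])
    show "n \<cdot> (w \<cdot> fst c) = n \<cdot> (fst e \<cdot> a)"
      using cmp_eq_reassoc1[OF w(4), of "fst c"] cmp_eq_reassoc1[OF n(4), of a] m(4) by simp
    show "snd e \<cdot> (w \<cdot> fst c) = snd e \<cdot> (fst e \<cdot> a)"
      using cmp_eq_reassoc1[OF w(5), of "fst c"] ses_cmp0[OF conf_ses[OF e(1)], of a] by simp
  qed simp_all
  then show ?thesis
    using c(1) e(1) w(5) by (intro cmI[of _ _ _ _ w]) simp_all
qed

lemma cm_push_factor:
  assumes "cm a b c d" "cm a (idn \<A> (cob c)) c e"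
  shows "cm (idn \<A> (kob d)) b e d"
proof -
  interpret op: ext_cat "opc \<A>" \<C> by (rule ext_cat_opc)
  show ?thesis
    using op.cm_pull_factor[of b a "prod.swap d" "prod.swap c" "prod.swap e"] assms
      cm_opc[of b a d c] cm_opc[of "idn \<A> (cob c)" a e c] cm_opc[of b "idn \<A> (kob d)" d e]
    by simp
qed

subsection \<open>Lists of conflations\<close>

fun path :: "'o \<Rightarrow> 'o \<Rightarrow> ('m \<times> 'm) list \<Rightarrow> bool" where
  "path A B [] \<longleftrightarrow> A = B \<and> A \<in> \<C>"
| "path A B (c # cs) \<longleftrightarrow> conf c \<and> cob c = A \<and> path (kob c) B cs"

text \<open>\<open>lmor a b cs ds\<close>: there is a morphism from the long conflation \<open>cs\<close> to \<open>ds\<close> with left end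
  \<open>a\<close> and right end \<open>b\<close>.\<close>

fun lmor :: "'m \<Rightarrow> 'm \<Rightarrow> ('m \<times> 'm) list \<Rightarrow> ('m \<times> 'm) list \<Rightarrow> bool" where
  "lmor a b [] [] \<longleftrightarrow> a = b \<and> a \<in> arrs \<A> \<and> src \<A> a \<in> \<C> \<and> tgt \<A> a \<in> \<C>"
| "lmor a b (c # cs) (d # ds) \<longleftrightarrow> (\<exists>f. cm f b c d \<and> lmor a f cs ds)"
| "lmor a b [] (d # ds) \<longleftrightarrow> False"
| "lmor a b (c # cs) [] \<longleftrightarrow> False"

lemma path_append: "path A B (cs @ ds) \<longleftrightarrow> (\<exists>X. path A X cs \<and> path X B ds)"
proof (induction cs arbitrary: A)
  case Nil
  have "A \<in> \<C>" if "path A B ds"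
  proof (cases ds)
    case (Cons d ds')
    then show ?thesis using that confD(6)[of d] by auto
  qed (use that in auto)
  then show ?case by auto
qed auto

lemma path_C: "path A B cs \<Longrightarrow> A \<in> \<C> \<and> B \<in> \<C>"
proof (induction cs arbitrary: A)
  case (Cons c cs)
  then show ?case using confD(6)[of c] by auto
qed simp

lemma lmor_length: "lmor a b cs ds \<Longrightarrow> length ds = length cs"
  by (induction a b cs ds rule: lmor.induct) auto

lemma lmor_append:
  "length cs = length ds \<Longrightarrow> lmor a b (cs @ cs') (ds @ ds') \<longleftrightarrow> (\<exists>f. lmor f b cs ds \<and> lmor a f cs' ds')"
proof (induction cs ds arbitrary: b rule: list_induct2)
  case Nil
  have "b \<in> arrs \<A> \<and> src \<A> b \<in> \<C> \<and> tgt \<A> b \<in> \<C>" if l: "lmor a b cs' ds'"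
  proof (cases cs')
    case (Cons c cs'')
    obtain d ds'' f where "ds' = d # ds''" "cm f b c d" using l Cons by (cases ds') auto
    then show ?thesis using cmD[of f b c d] confD(6)[of c] confD(6)[of d] by simp
  qed (use l in \<open>cases ds'; simp\<close>)
  then show ?case by auto
next
  case (Cons c cs d ds)
  show ?case by (simp add: Cons.IH) blast
qed

lemma lmor_typed:
  "lmor a b cs ds \<Longrightarrow> cs \<noteq> [] \<Longrightarrow> path A B cs \<Longrightarrow> path A' B' ds \<Longrightarrow>
     a \<in> arrs \<A> \<and> src \<A> a = B \<and> tgt \<A> a = B' \<and> b \<in> arrs \<A> \<and> src \<A> b = A \<and> tgt \<A> b = A'"
proof (induction cs arbitrary: A A' b ds)
  case (Cons c cs)
  then obtain d ds' where ds: "ds = d # ds'" by (cases ds) auto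
  from Cons show ?case
  proof (cases "cs = []")
    case True
    then have "ds' = []" using Cons.prems(1) ds lmor_length by fastforce
    then show ?thesis using Cons.prems True by (auto simp: ds cmD)
  next
    case False
    obtain f where f: "cm f b c d" "lmor a f cs ds'" using Cons.prems(1) ds by auto
    show ?thesis using Cons.IH[OF f(2) False, of "kob c" "kob d"] Cons.prems ds cmD[OF f(1)] by auto
  qed
qed simp

lemma lmor_id: "path A B cs \<Longrightarrow> lmor (idn \<A> B) (idn \<A> A) cs cs"
  by (induction cs arbitrary: A) (auto intro: cm_id)

lemma lmor_comp: "lmor a b cs ds \<Longrightarrow> lmor a' b' ds es \<Longrightarrow> lmor (a' \<cdot> a) (b' \<cdot> b) cs es \<or> (cs = [] \<and> src \<A> a' \<noteq> tgt \<A> a)"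
proof (induction a b cs ds arbitrary: b' es rule: lmor.induct)
  case (1 a b)
  then show ?case by (cases es) auto
next
  case (2 a b c cs d ds)
  then obtain e es' where es: "es = e # es'" by (cases es) auto
  obtain f where f: "cm f b c d" "lmor a f cs ds" using 2(2) by auto
  obtain g where g: "cm g b' d e" "lmor a' g ds es'" using 2(3) es by auto
  have *: "lmor (a' \<cdot> a) (g \<cdot> f) cs es'"
  proof (cases "cs = []")
    case True
    then have "ds = []" using f(2) lmor_length by fastforce
    moreover from this have "es' = []" using g(2) lmor_length by fastforce
    ultimately show ?thesis using True f g cmD[OF f(1)] cmD[OF g(1)] by auto
  qed (use 2(1)[OF f(2) g(2)] in simp)
  then show ?case using cm_comp[OF f(1) g(1)] es by auto
qed auto

lemma lmor_comp':
  "lmor a b cs ds \<Longrightarrow> lmor a' b' ds es \<Longrightarrow> cs \<noteq> [] \<Longrightarrow> lmor (a' \<cdot> a) (b' \<cdot> b) cs es"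
  using lmor_comp by blast

lemma lmor_pull_factor:
  assumes "lmor a b cs (d # ds)" "cm (idn \<A> (kob d)) b e d" "path A B cs"
  shows "lmor a (idn \<A> A) cs (e # ds)"
proof -
  obtain c cs' where cs: "cs = c # cs'" using assms(1) by (cases cs) auto
  then obtain f where "cm f b c d" "lmor a f cs' ds" using assms(1) by auto
  then show ?thesis using cm_pull_factor[OF _ assms(2), of f c] assms(3) cs by auto
qed

lemma lmor_push_factor:
  assumes "lmor a b (cs @ [c]) ds" "cm a (idn \<A> (cob c)) c e" "path A B ds"
  shows "lmor (idn \<A> B) b (cs @ [e]) ds"
proof -
  have "ds \<noteq> []" using lmor_length[OF assms(1)] by auto
  then obtain ds' d where ds: "ds = ds' @ [d]" using rev_exhaust by blast
  have l: "length cs = length ds'" using lmor_length[OF assms(1)] ds by auto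
  obtain f where f: "lmor f b cs ds'" "cm a f c d" using assms(1) ds l by (auto simp: lmor_append)
  have "cm (idn \<A> (kob d)) f e d" by (rule cm_push_factor[OF f(2) assms(2)])
  moreover have "B = kob d" "B \<in> \<C>" using assms(3) ds path_C by (auto simp: path_append)
  ultimately show ?thesis using f(1) ds l by (auto simp: lmor_append)
qed

abbreviation opl :: "('m \<times> 'm) list \<Rightarrow> ('m \<times> 'm) list" where
  "opl cs \<equiv> rev (map prod.swap cs)"

lemma path_opc: "ext_cat.path (opc \<A>) \<C> B A (opl cs) \<longleftrightarrow> path A B cs"
proof -
  interpret op: ext_cat "opc \<A>" \<C> by (rule ext_cat_opc)
  show ?thesis
  proof (induction cs arbitrary: A)
    case (Cons c cs)
    show ?case using path_C[of "kob c" B cs] by (auto simp: op.path_append Cons.IH)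
  qed auto
qed

lemma lmor_opc: "ext_cat.lmor (opc \<A>) \<C> b a (opl ds) (opl cs) \<longleftrightarrow> lmor a b cs ds"
proof -
  interpret op: ext_cat "opc \<A>" \<C> by (rule ext_cat_opc)
  show ?thesis
  proof (induction a b cs ds rule: lmor.induct)
    case (2 a b c cs d ds)
    show ?case
    proof (cases "length cs = length ds")
      case True
      then show ?thesis using 2
        by (auto simp: op.lmor_append cm_opc) (auto simp: cm_def)
    next
      case False
      then show ?thesis using lmor_length[of a _ cs ds] op.lmor_length[of b a "opl (d # ds)" "opl (c # cs)"] by auto
    qed
  qed (auto dest: op.lmor_length)
qed

end

section \<open>Yoneda classes of lists of conflations\<close>

context abelian_category
begin

lemma is_pushoutD:
  assumes "is_pushout \<A> f g u v"
  shows "f \<in> arrs \<A>" "g \<in> arrs \<A>" "u \<in> arrs \<A>" "v \<in> arrs \<A>" "src \<A> g = src \<A> f"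
    "tgt \<A> v = tgt \<A> u" "src \<A> u = tgt \<A> f" "src \<A> v = tgt \<A> g" "u \<cdot> f = v \<cdot> g"
  using abelian_category.is_pullbackD[OF abelian_opc, of f g u v] assms by simp_all

lemma pushout_colift:
  assumes "is_pushout \<A> f g u v" "x \<in> arrs \<A>" "y \<in> arrs \<A>" "tgt \<A> y = tgt \<A> x"
    "src \<A> x = tgt \<A> f" "src \<A> y = tgt \<A> g" "x \<cdot> f = y \<cdot> g"
  obtains w where "w \<in> arrs \<A>" "tgt \<A> w = tgt \<A> x" "src \<A> w = tgt \<A> u" "w \<cdot> u = x" "w \<cdot> v = y"
  by (rule abelian_category.pullback_lift[OF abelian_opc, of f g u v x y]) (use assms that in simp_all)

lemma pushout_unique:
  assumes "is_pushout \<A> f g u v" "w \<in> arrs \<A>" "w' \<in> arrs \<A>" "tgt \<A> w = tgt \<A> w'"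
    "src \<A> w = tgt \<A> u" "src \<A> w' = tgt \<A> u" "w \<cdot> u = w' \<cdot> u" "w \<cdot> v = w' \<cdot> v"
  shows "w = w'"
  by (rule abelian_category.pullback_unique[OF abelian_opc, of f g u v]) (use assms in simp_all)

lemma pushout_ses:
  assumes "short_exact \<A> i p" "is_pushout \<A> i a m j"
    "q \<in> arrs \<A>" "tgt \<A> q = tgt \<A> p" "src \<A> q = tgt \<A> j" "q \<cdot> j = zero_arr \<A> (src \<A> j) (tgt \<A> p)" "q \<cdot> m = p"
  shows "short_exact \<A> j q"
  using abelian_category.pullback_ses[OF abelian_opc, of p i a m j q] assms by simp

end

lemma splice_Cons:
  "splice_conflations \<A> (c # cs) = (if cs = [] then [snd c, fst c]
     else snd c # (fst c \<cdot>\<^bsub>\<A>\<^esub> hd (splice_conflations \<A> cs)) # tl (splice_conflations \<A> cs))"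
proof (cases cs)
  case (Cons d ds)
  then show ?thesis by (cases c; cases d; cases ds) auto
qed (cases c; simp)

lemma length_splice [simp]: "cs \<noteq> [] \<Longrightarrow> length (splice_conflations \<A> cs) = Suc (length cs)"
  by (induction cs) (auto simp: splice_Cons)

lemma splice_eq_Nil [simp]: "splice_conflations \<A> cs = [] \<longleftrightarrow> cs = []"
  by (cases cs) (auto simp: splice_Cons)

lemma hd_splice: "cs \<noteq> [] \<Longrightarrow> hd (splice_conflations \<A> cs) = snd (hd cs)"
  by (cases cs) (auto simp: splice_Cons)

lemma last_splice: "cs \<noteq> [] \<Longrightarrow> last (splice_conflations \<A> cs) = fst (last cs)"
proof (induction cs)
  case (Cons c cs)
  show ?case
  proof (cases "cs = []")
    case False
    then have "tl (splice_conflations \<A> cs) \<noteq> []"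
      using length_splice[of cs \<A>] by (metis length_tl diff_Suc_1 length_0_conv)
    then show ?thesis using Cons False by (simp add: splice_Cons last_tl)
  qed (simp add: splice_Cons)
qed simp

lemma splice_nth_0: "cs \<noteq> [] \<Longrightarrow> splice_conflations \<A> cs ! 0 = snd (cs ! 0)"
  by (cases cs) (auto simp: splice_Cons)

lemma splice_nth_Suc: "Suc k < length cs \<Longrightarrow> splice_conflations \<A> cs ! Suc k = fst (cs ! k) \<cdot>\<^bsub>\<A>\<^esub> snd (cs ! Suc k)"
proof (induction cs arbitrary: k)
  case (Cons c cs)
  then have ne: "cs \<noteq> []" by auto
  show ?case
  proof (cases k)
    case 0
    then show ?thesis using ne by (cases cs) (auto simp: splice_Cons hd_splice)
  next
    case (Suc l)
    then show ?thesis using ne Cons by (auto simp: splice_Cons nth_tl)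
  qed
qed simp

lemma splice_nth_last: "length cs = Suc k \<Longrightarrow> splice_conflations \<A> cs ! Suc k = fst (cs ! k)"
  using last_splice[of cs \<A>] last_conv_nth[of "splice_conflations \<A> cs"] last_conv_nth[of cs]
    length_splice[of cs \<A>] splice_eq_Nil[of \<A> cs]
  by (metis diff_Suc_1 length_0_conv nat.distinct(1))

definition pre_splice :: "('o, 'm) category_data \<Rightarrow> ('m \<times> 'm) list \<Rightarrow> 'm \<Rightarrow> 'm" where
  "pre_splice \<A> cs p = (if cs = [] then p else fst (last cs) \<cdot>\<^bsub>\<A>\<^esub> p)"

definition post_splice :: "('o, 'm) category_data \<Rightarrow> ('m \<times> 'm) list \<Rightarrow> 'm \<Rightarrow> 'm" where
  "post_splice \<A> cs i = (if cs = [] then i else i \<cdot>\<^bsub>\<A>\<^esub> snd (hd cs))"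

lemma splice_Cons':
  "splice_conflations \<A> (c # cs) = snd c # post_splice \<A> cs (fst c) # tl (splice_conflations \<A> cs)"
  by (simp add: splice_Cons post_splice_def hd_splice)

lemma splice_snoc:
  "splice_conflations \<A> (cs @ [c]) = butlast (splice_conflations \<A> cs) @ [pre_splice \<A> cs (snd c), fst c]"
proof (induction cs)
  case (Cons d cs)
  show ?case
  proof (cases "cs = []")
    case False
    then have ne: "tl (splice_conflations \<A> cs) \<noteq> []" "butlast (splice_conflations \<A> cs) \<noteq> []"
      using length_splice[of cs \<A>] by (metis length_tl length_butlast diff_Suc_1 length_0_conv)+
    have "hd (butlast (splice_conflations \<A> cs)) = hd (splice_conflations \<A> cs)"
      "tl (butlast (splice_conflations \<A> cs)) = butlast (tl (splice_conflations \<A> cs))"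
      using ne by (cases "splice_conflations \<A> cs"; simp)+
    then show ?thesis using ne False Cons by (simp add: splice_Cons[of _ d] pre_splice_def)
  qed (simp add: splice_Cons pre_splice_def)
qed (simp add: splice_Cons pre_splice_def)

context ext_cat
begin

abbreviation spl where "spl \<equiv> splice_conflations \<A>"

lemma path_iff_spliceable:
  "cs \<noteq> [] \<Longrightarrow> path A B cs \<longleftrightarrow> spliceable \<A> \<C> cs \<and> tgt \<A> (snd (hd cs)) = A \<and> src \<A> (fst (last cs)) = B"
proof (induction cs arbitrary: A)
  case (Cons c cs)
  have *: "spliceable \<A> \<C> (c # cs) \<longleftrightarrow> conf c \<and> spliceable \<A> \<C> cs \<and> (cs \<noteq> [] \<longrightarrow> cob (hd cs) = kob c)"
  proof (cases cs)
    case (Cons d ds)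
    have "(\<forall>k. Suc k < length (c # cs) \<longrightarrow> cob ((c # cs) ! Suc k) = kob ((c # cs) ! k)) \<longleftrightarrow>
      cob d = kob c \<and> (\<forall>k. Suc k < length cs \<longrightarrow> cob (cs ! Suc k) = kob (cs ! k))" (is "?l \<longleftrightarrow> ?r")
    proof
      assume l: ?l
      show ?r using l[rule_format, of 0] l[rule_format, of "Suc _"] Cons by simp
    next
      assume r: ?r
      show ?l
      proof (intro allI impI)
        fix k assume "Suc k < length (c # cs)"
        then show "cob ((c # cs) ! Suc k) = kob ((c # cs) ! k)" using r Cons by (cases k) auto
      qed
    qed
    then show ?thesis using Cons by (auto simp: spliceable_def split: prod.splits)
  qed (cases c, auto simp: spliceable_def)
  show ?case
  proof (cases "cs = []")
    case True
    moreover have "spliceable \<A> \<C> []" by (simp add: spliceable_def)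
    ultimately show ?thesis using * True by auto
  next
    case False
    then show ?thesis using Cons by (auto simp: *)
  qed
qed simp

lemma long_conflation_iff:
  "long_conflation \<A> \<C> t A B E \<longleftrightarrow> (\<exists>cs. cs \<noteq> [] \<and> length cs = t \<and> path A B cs \<and> E = spl cs)"
  unfolding long_conflation_def using path_iff_spliceable by blast

lemma path_nth:
  "path A B cs \<Longrightarrow> k < length cs \<Longrightarrow> conf (cs ! k) \<and> cob (cs ! k) = (if k = 0 then A else kob (cs ! (k - 1))) \<and>
     (Suc k = length cs \<longrightarrow> kob (cs ! k) = B)"
proof (induction cs arbitrary: A k)
  case (Cons c cs)
  show ?case
  proof (cases k)
    case 0
    then show ?thesis using Cons by auto
  next
    case (Suc l)
    then show ?thesis using Cons.IH[of "kob c" l] Cons.prems unfolding Suc nth_Cons_Suc by (cases l) simp_all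
  qed
qed simp

lemma lmor_ex_maps:
  "lmor a b cs ds \<Longrightarrow> cs \<noteq> [] \<Longrightarrow> \<exists>f. f 0 = b \<and> f (length cs) = a \<and> (\<forall>k<length cs. cm (f (Suc k)) (f k) (cs ! k) (ds ! k))"
proof (induction a b cs ds rule: lmor.induct)
  case (2 a b c cs d ds)
  obtain g where g: "cm g b c d" "lmor a g cs ds" using 2(2) by auto
  show ?case
  proof (cases "cs = []")
    case True
    then have "a = g" using g(2) by (cases ds) auto
    then show ?thesis using True g by (intro exI[of _ "case_nat b (\<lambda>_. g)"]) auto
  next
    case False
    obtain f where f: "f 0 = g" "f (length cs) = a" "\<forall>k<length cs. cm (f (Suc k)) (f k) (cs ! k) (ds ! k)"
      using 2(1)[OF g(2) False] by auto
    show ?thesis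
    proof (intro exI[of _ "case_nat b f"] conjI allI impI)
      fix k assume "k < length (c # cs)"
      then show "cm (case_nat b f (Suc k)) (case_nat b f k) ((c # cs) ! k) ((d # ds) ! k)"
        using f g(1) by (cases k) auto
    qed (use f in simp_all)
  qed
qed auto

lemma seq_obj_splice:
  assumes "path A B cs" "cs \<noteq> []"
  shows "seq_obj \<A> (spl cs) 0 = A" "k < length cs \<Longrightarrow> seq_obj \<A> (spl cs) (Suc k) = mob (cs ! k)"
    "k = length cs \<Longrightarrow> seq_obj \<A> (spl cs) (Suc k) = B"
proof -
  note p = path_nth[OF assms(1)]
  show "seq_obj \<A> (spl cs) 0 = A" using p[of 0] assms(2) by (simp add: seq_obj_def splice_nth_0)
  show "seq_obj \<A> (spl cs) (Suc k) = mob (cs ! k)" if "k < length cs"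
  proof (cases k)
    case 0
    then show ?thesis using p[of 0] assms(2) by (simp add: seq_obj_def splice_nth_0)
  next
    case (Suc l)
    then show ?thesis using p[of k] p[of l] that by (simp add: seq_obj_def splice_nth_Suc)
  qed
  show "seq_obj \<A> (spl cs) (Suc k) = B" if "k = length cs"
  proof -
    obtain j where j: "length cs = Suc j" using assms(2) by (cases cs) auto
    then show ?thesis using p[of j] that splice_nth_last[OF j, of \<A>] by (simp add: seq_obj_def)
  qed
qed

lemma yoneda_morphism_if_lmor:
  assumes cs: "path A B cs" "cs \<noteq> []" and ds: "path A B ds" and l: "lmor (idn \<A> B) (idn \<A> A) cs ds"
  shows "yoneda_morphism \<A> (spl cs) (spl ds)"
proof -
  have len: "length ds = length cs" "ds \<noteq> []" using lmor_length[OF l] cs(2) by auto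
  obtain f where f: "f 0 = idn \<A> A" "f (length cs) = idn \<A> B"
    "\<forall>k<length cs. cm (f (Suc k)) (f k) (cs ! k) (ds ! k)"
    using lmor_ex_maps[OF l cs(2)] by auto
  have "\<exists>m. \<forall>k<length cs. m k \<in> arrs \<A> \<and> src \<A> (m k) = mob (cs ! k) \<and> tgt \<A> (m k) = mob (ds ! k) \<and>
      m k \<cdot> fst (cs ! k) = fst (ds ! k) \<cdot> f (Suc k) \<and> snd (ds ! k) \<cdot> m k = f k \<cdot> snd (cs ! k)"
    using f(3) by (intro choice) (metis cmE)
  then obtain m where m: "\<And>k. k < length cs \<Longrightarrow> m k \<in> arrs \<A> \<and> src \<A> (m k) = mob (cs ! k) \<and> tgt \<A> (m k) = mob (ds ! k) \<and>
      m k \<cdot> fst (cs ! k) = fst (ds ! k) \<cdot> f (Suc k) \<and> snd (ds ! k) \<cdot> m k = f k \<cdot> snd (cs ! k)" by auto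
  define F where "F k = (case k of 0 \<Rightarrow> idn \<A> A | Suc j \<Rightarrow> if j < length cs then m j else idn \<A> B)" for k
  note so = seq_obj_splice[OF cs] seq_obj_splice[OF ds len(2)]
  have C: "A \<in> \<C>" "B \<in> \<C>" using path_C[OF cs(1)] by auto
  have "F k \<in> Hom \<A> (seq_obj \<A> (spl cs) k) (seq_obj \<A> (spl ds) k)" if "k \<le> Suc (length cs)" for k
    using that so m C len by (cases k) (auto simp: F_def Hom_def le_Suc_eq)
  moreover have "spl ds ! k \<cdot> F (Suc k) = F k \<cdot> spl cs ! k" if k: "k < Suc (length cs)" for k
  proof (cases k)
    case 0
    then show ?thesis using m[of 0] cs len f(1) by (simp add: F_def splice_nth_0)
  next
    case (Suc j)
    then have j: "j < length cs" using k by simp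
    have c: "conf (cs ! j)" "conf (ds ! j)" using path_nth[OF cs(1)] path_nth[OF ds] j len by auto
    show ?thesis
    proof (cases "Suc j < length cs")
      case True
      have c': "conf (cs ! Suc j)" "conf (ds ! Suc j)" "cob (cs ! Suc j) = kob (cs ! j)" "cob (ds ! Suc j) = kob (ds ! j)"
        using path_nth[OF cs(1), of "Suc j"] path_nth[OF ds, of "Suc j"] True len by auto
      note fj = cmD[OF f(3)[rule_format, OF j]]
      have "fst (ds ! j) \<cdot> (snd (ds ! Suc j) \<cdot> m (Suc j)) = fst (ds ! j) \<cdot> (f (Suc j) \<cdot> snd (cs ! Suc j))"
        using m[OF True] by simp
      also have "\<dots> = m j \<cdot> (fst (cs ! j) \<cdot> snd (cs ! Suc j))"
        by (rule cmp_eq_reassoc) (use m[OF j] c c' fj in simp_all)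
      finally show ?thesis
        using Suc True len m[OF j] m[OF True] c c' by (simp add: F_def splice_nth_Suc)
    next
      case False
      then have [simp]: "length cs = Suc j" using j by simp
      show ?thesis
        using Suc len m[OF j] f(2) c path_nth[OF ds, of j] by (simp add: F_def splice_nth_last)
    qed
  qed
  ultimately show ?thesis
    unfolding yoneda_morphism_def using len so cs(2) by (intro conjI exI[of _ F]) (auto simp: F_def)
qed

lemma lmor_if_yoneda_morphism:
  assumes cs: "path A B cs" "cs \<noteq> []" and ds: "path A B ds" "ds \<noteq> []" and y: "yoneda_morphism \<A> (spl cs) (spl ds)"
  shows "lmor (idn \<A> B) (idn \<A> A) cs ds"
proof -
  have len: "length ds = length cs" using y cs(2) ds(2) by (simp add: yoneda_morphism_def)
  note so = seq_obj_splice[OF cs] seq_obj_splice[OF ds]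
  have C: "A \<in> \<C>" "B \<in> \<C>" using path_C[OF cs(1)] by auto
  obtain F where F: "\<And>k. k \<le> Suc (length cs) \<Longrightarrow> F k \<in> Hom \<A> (seq_obj \<A> (spl cs) k) (seq_obj \<A> (spl ds) k)"
    "\<And>k. k < Suc (length cs) \<Longrightarrow> spl ds ! k \<cdot> F (Suc k) = F k \<cdot> spl cs ! k" "F 0 = idn \<A> A" "F (Suc (length cs)) = idn \<A> B"
    using y cs(2) so by (auto simp: yoneda_morphism_def)
  define m where "m k = F (Suc k)" for k
  have m: "m k \<in> arrs \<A>" "src \<A> (m k) = mob (cs ! k)" "tgt \<A> (m k) = mob (ds ! k)" if "k < length cs" for k
    using F(1)[of "Suc k"] that so len by (auto simp: m_def Hom_def)
  have "\<exists>f. lmor f (idn \<A> A) (take k cs) (take k ds) \<and> (0 < k \<longrightarrow> m (k - 1) \<cdot> fst (cs ! (k - 1)) = fst (ds ! (k - 1)) \<cdot> f) \<and>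
     (k < length cs \<longrightarrow> snd (ds ! k) \<cdot> m k = f \<cdot> snd (cs ! k) \<and> f \<in> arrs \<A> \<and> src \<A> f = cob (cs ! k) \<and> tgt \<A> f = cob (ds ! k))"
    if "k \<le> length cs" for k
    using that
  proof (induction k)
    case 0
    have "snd (ds ! 0) \<cdot> m 0 = idn \<A> A \<cdot> snd (cs ! 0)"
      using F(2)[of 0] F(3) cs(2) ds(2) by (simp add: m_def splice_nth_0)
    then show ?case using C cs path_nth[OF cs(1), of 0] path_nth[OF ds(1), of 0] len
      by (intro exI[of _ "idn \<A> A"]) auto
  next
    case (Suc k)
    then have k: "k < length cs" by simp
    obtain f where f: "lmor f (idn \<A> A) (take k cs) (take k ds)" "snd (ds ! k) \<cdot> m k = f \<cdot> snd (cs ! k)"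
      "f \<in> arrs \<A>" "src \<A> f = cob (cs ! k)" "tgt \<A> f = cob (ds ! k)"
      using Suc by auto
    have c: "conf (cs ! k)" "conf (ds ! k)" using path_nth[OF cs(1), of k] path_nth[OF ds(1), of k] k len by auto
    note [simp] = confD[OF c(1)] confD[OF c(2)] m[OF k] f(3-5)
    have "snd (ds ! k) \<cdot> (m k \<cdot> fst (cs ! k)) = zero_arr \<A> (kob (cs ! k)) (cob (ds ! k))"
      using cmp_eq_reassoc1[OF f(2), of "fst (cs ! k)"] by simp
    then obtain g where g: "g \<in> arrs \<A>" "src \<A> g = kob (cs ! k)" "tgt \<A> g = kob (ds ! k)" "fst (ds ! k) \<cdot> g = m k \<cdot> fst (cs ! k)"
      by - (rule ses_lift[OF conf_ses[OF c(2)], of "m k \<cdot> fst (cs ! k)"], simp_all)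
    have "cm g f (cs ! k) (ds ! k)"
      by (rule cmI[of _ _ _ _ "m k"]) (use c g f in simp_all)
    then have l: "lmor g (idn \<A> A) (take (Suc k) cs) (take (Suc k) ds)"
      using k len f(1) C g by (auto simp: take_Suc_conv_app_nth lmor_append)
    moreover have "snd (ds ! Suc k) \<cdot> m (Suc k) = g \<cdot> snd (cs ! Suc k) \<and> src \<A> g = cob (cs ! Suc k) \<and> tgt \<A> g = cob (ds ! Suc k)"
      if k': "Suc k < length cs"
    proof -
      have c': "conf (cs ! Suc k)" "conf (ds ! Suc k)" "cob (cs ! Suc k) = kob (cs ! k)" "cob (ds ! Suc k) = kob (ds ! k)"
        using path_nth[OF cs(1), of "Suc k"] path_nth[OF ds(1), of "Suc k"] k' len by auto
      note [simp] = confD[OF c'(1)] confD[OF c'(2)] c'(3,4) m[OF k'] g(1-3)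
      have "fst (ds ! k) \<cdot> (snd (ds ! Suc k) \<cdot> m (Suc k)) = m k \<cdot> (fst (cs ! k) \<cdot> snd (cs ! Suc k))"
        using F(2)[of "Suc k"] k' len by (simp add: m_def[symmetric] splice_nth_Suc)
      also have "\<dots> = fst (ds ! k) \<cdot> (g \<cdot> snd (cs ! Suc k))"
        by (rule cmp_eq_reassoc[OF g(4)[symmetric]]) simp_all
      finally have "snd (ds ! Suc k) \<cdot> m (Suc k) = g \<cdot> snd (cs ! Suc k)"
        by - (rule ses_mono[OF conf_ses[OF c(2)]], simp_all)
      then show ?thesis using g by simp
    qed
    ultimately show ?case using g by (intro exI[of _ g]) auto
  qed
  from this[of "length cs"] obtain f where f: "lmor f (idn \<A> A) cs ds"
    "m (length cs - 1) \<cdot> fst (cs ! (length cs - 1)) = fst (ds ! (length cs - 1)) \<cdot> f"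
    using len cs(2) by auto
  obtain k where k: "length cs = Suc k" using cs(2) by (cases cs) auto
  have c: "conf (cs ! k)" "conf (ds ! k)" "kob (cs ! k) = B" "kob (ds ! k) = B"
    using path_nth[OF cs(1), of k] path_nth[OF ds(1), of k] k len by auto
  have ft: "f \<in> arrs \<A>" "src \<A> f = B" "tgt \<A> f = B" using lmor_typed[OF f(1) cs(2,1) ds(1)] by auto
  have "fst (ds ! k) \<cdot> f = fst (ds ! k) \<cdot> idn \<A> B"
    using F(2)[of "Suc k"] F(4) k len f(2) by (simp add: splice_nth_last m_def)
  then have "f = idn \<A> B"
    using ft c C by - (rule ses_mono[OF conf_ses[OF c(2)]], simp_all)
  then show ?thesis using f(1) by simp
qed

definition lstep :: "'o \<Rightarrow> 'o \<Rightarrow> ('m \<times> 'm) list \<Rightarrow> ('m \<times> 'm) list \<Rightarrow> bool" where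
  "lstep A B cs ds \<longleftrightarrow> path A B cs \<and> path A B ds \<and> lmor (idn \<A> B) (idn \<A> A) cs ds"

definition eqv :: "'o \<Rightarrow> 'o \<Rightarrow> ('m \<times> 'm) list \<Rightarrow> ('m \<times> 'm) list \<Rightarrow> bool" where
  "eqv A B = (\<lambda>cs ds. lstep A B cs ds \<or> lstep A B ds cs)\<^sup>*\<^sup>*"

lemma eqv_length: "eqv A B cs ds \<Longrightarrow> length ds = length cs"
  unfolding eqv_def by (induction rule: rtranclp_induct) (auto simp: lstep_def dest!: lmor_length)

lemma eqv_path: "eqv A B cs ds \<Longrightarrow> path A B cs \<Longrightarrow> path A B ds"
  unfolding eqv_def by (induction rule: rtranclp_induct) (auto simp: lstep_def)

lemma eqv_trans: "eqv A B cs ds \<Longrightarrow> eqv A B ds es \<Longrightarrow> eqv A B cs es"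
  unfolding eqv_def by simp

lemma eqv_sym: "eqv A B cs ds \<Longrightarrow> eqv A B ds cs"
  unfolding eqv_def
  by (rule sympD[OF symp_rtranclp]) (auto intro!: sympI)

lemma eqv_step: "lstep A B cs ds \<Longrightarrow> eqv A B cs ds"
  unfolding eqv_def by auto

lemma splice_inj_eqv:
  assumes "path A B cs" "cs \<noteq> []" "path A B ds" "spl cs = spl ds"
  shows "lstep A B cs ds"
proof -
  have "yoneda_morphism \<A> (spl cs) (spl cs)"
    by (rule yoneda_morphism_if_lmor[OF assms(1,2,1) lmor_id[OF assms(1)]])
  moreover have "ds \<noteq> []" using assms(2,4) splice_eq_Nil by metis
  ultimately show ?thesis
    using lmor_if_yoneda_morphism[OF assms(1,2,3)] assms by (simp add: lstep_def)
qed

lemma yoneda_class_splice: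
  assumes p: "path A B cs" and ne: "cs \<noteq> []"
  shows "yoneda_class \<A> \<C> (spl cs) = spl ` {ds. eqv A B cs ds}"
proof -
  define R where "R = yoneda_step \<A> \<C> (length cs) A B"
  have A: "tgt \<A> (hd (spl cs)) = A" "src \<A> (last (spl cs)) = B"
    using p ne path_iff_spliceable by (simp_all add: hd_splice last_splice)
  have R: "(E, F) \<in> R \<longleftrightarrow> (\<exists>es fs. es \<noteq> [] \<and> length es = length cs \<and> E = spl es \<and> F = spl fs \<and> lstep A B es fs)" for E F
  proof
    assume "(E, F) \<in> R"
    then show "\<exists>es fs. es \<noteq> [] \<and> length es = length cs \<and> E = spl es \<and> F = spl fs \<and> lstep A B es fs"
      unfolding R_def yoneda_step_def long_conflation_iff lstep_def using lmor_if_yoneda_morphism by blast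
  next
    assume "\<exists>es fs. es \<noteq> [] \<and> length es = length cs \<and> E = spl es \<and> F = spl fs \<and> lstep A B es fs"
    then obtain es fs where *: "es \<noteq> []" "length es = length cs" "E = spl es" "F = spl fs" "lstep A B es fs" by blast
    then have "fs \<noteq> []" "length fs = length cs" using lmor_length[of _ _ es fs] by (auto simp: lstep_def)
    then show "(E, F) \<in> R"
      unfolding R_def yoneda_step_def long_conflation_iff using * yoneda_morphism_if_lmor
      by (auto simp: lstep_def)
  qed
  have 1: "\<exists>ds. eqv A B cs ds \<and> E = spl ds" if "(spl cs, E) \<in> (R \<union> R\<inverse>)\<^sup>*" for E
    using that
  proof (induction rule: rtrancl_induct)
    case base
    show ?case by (intro exI[of _ cs]) (simp add: eqv_def)
  next
    case (step E F)
    then obtain ds where ds: "eqv A B cs ds" "E = spl ds" by auto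
    have dsp: "path A B ds" "ds \<noteq> []" using eqv_path[OF ds(1) p] eqv_length[OF ds(1)] ne by auto
    from step(2) obtain es fs where ef: "E = spl es" "F = spl fs" "lstep A B es fs \<or> lstep A B fs es"
      using R by blast
    then have "path A B es" by (auto simp: lstep_def)
    then have "lstep A B ds es" using splice_inj_eqv dsp ds ef by metis
    then have "eqv A B cs fs"
      using ds(1) ef(3) by (meson eqv_step eqv_sym eqv_trans)
    then show ?case using ef by auto
  qed
  have 2: "(spl cs, spl ds) \<in> (R \<union> R\<inverse>)\<^sup>*" if "eqv A B cs ds" for ds
    using that unfolding eqv_def
  proof (induction rule: rtranclp_induct)
    case (step ds es)
    have l: "length ds = length cs" using step(1) eqv_length by (auto simp: eqv_def)
    have "eqv A B cs es"
      unfolding eqv_def using step(1,2) by (rule rtranclp.rtrancl_into_rtrancl)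
    then have l2: "length es = length cs" by (rule eqv_length)
    have "(spl ds, spl es) \<in> R \<union> R\<inverse>"
      using step(2) ne l l2 R by (metis UnCI converseI length_0_conv)
    then show ?case using step(3) by (meson rtrancl.rtrancl_into_rtrancl)
  qed simp
  have "yoneda_class \<A> \<C> (spl cs) = (R \<union> R\<inverse>)\<^sup>* `` {spl cs}"
    unfolding yoneda_class_def Let_def R_def using A ne by simp
  then show ?thesis using 1 2 by auto
qed

definition cl :: "('m \<times> 'm) list \<Rightarrow> 'm ext" where
  "cl cs = ext_of \<A> \<C> (spl cs)"

lemma cl_eq_iff:
  assumes "path A B cs" "cs \<noteq> []" "path A B ds"
  shows "cl cs = cl ds \<longleftrightarrow> eqv A B cs ds"
proof (cases "ds = []")
  case True
  have "eqv A B cs ds \<Longrightarrow> False" using True assms(2) eqv_length by fastforce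
  moreover have "cl cs \<noteq> cl ds"
  proof
    assume "cl cs = cl ds"
    then have "yoneda_class \<A> \<C> (spl cs) = yoneda_class \<A> \<C> (spl ds)" by (simp add: cl_def ext_of_def)
    moreover have "spl ds \<in> yoneda_class \<A> \<C> (spl ds)" by (simp add: yoneda_class_def Let_def)
    ultimately have "spl ds \<in> spl ` {es. eqv A B cs es}"
      using yoneda_class_splice[OF assms(1,2)] by simp
    then obtain es where es: "spl ds = spl es" "es \<in> {es. eqv A B cs es}" by (rule imageE)
    then have "eqv A B cs es" "es = []" using es(1)[symmetric] True by simp_all
    then show False using assms(2) eqv_length[of A B cs es] by auto
  qed
  ultimately show ?thesis by auto
next
  case False
  have *: "eqv A B cs ds \<Longrightarrow> {es. eqv A B cs es} = {es. eqv A B ds es}"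
    by (auto intro: eqv_trans eqv_sym)
  have **: "eqv A B cs ds" if "spl ` {es. eqv A B cs es} = spl ` {es. eqv A B ds es}"
  proof -
    have "eqv A B ds ds" by (simp add: eqv_def)
    then have "spl ds \<in> spl ` {es. eqv A B cs es}" using that by simp
    then obtain es where es: "eqv A B cs es" "spl es = spl ds" by auto
    then have "lstep A B ds es" using splice_inj_eqv[OF assms(3) False, of es] eqv_path[OF es(1) assms(1)] by simp
    then show ?thesis using es(1) by (meson eqv_step eqv_sym eqv_trans)
  qed
  have "cl cs = cl ds \<longleftrightarrow> spl ` {es. eqv A B cs es} = spl ` {es. eqv A B ds es}"
    by (simp add: cl_def ext_of_def yoneda_class_splice[OF assms(1,2)] yoneda_class_splice[OF assms(3) False])
  then show ?thesis using * ** by metis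
qed

lemma cl_eqI: "lmor (idn \<A> B) (idn \<A> A) cs ds \<Longrightarrow> path A B cs \<Longrightarrow> cs \<noteq> [] \<Longrightarrow> path A B ds \<Longrightarrow> cl cs = cl ds"
  using cl_eq_iff eqv_step by (simp add: lstep_def)

lemma Ext_pos: "0 < t \<Longrightarrow> x \<in> Ext \<A> \<C> t A B \<longleftrightarrow> (\<exists>cs. path A B cs \<and> length cs = t \<and> x = cl cs)"
  unfolding Ext_def long_conflation_iff cl_def by auto

lemma class_union_eq:
  assumes "path A B cs" "cs \<noteq> []" "\<And>es F. eqv A B cs es \<Longrightarrow> T (spl es) F \<Longrightarrow> yoneda_class \<A> \<C> F = Y" "T (spl cs) F0"
  shows "\<Union>{yoneda_class \<A> \<C> F | E F. E \<in> yoneda_class \<A> \<C> (spl cs) \<and> T E F} = Y"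
proof -
  have "eqv A B cs cs" by (simp add: eqv_def)
  then show ?thesis unfolding yoneda_class_splice[OF assms(1,2)] using assms(3,4) by blast
qed

lemma pushout_seq_splice:
  assumes p: "path A B (es @ [c])" and a: "a \<in> arrs \<A>" "src \<A> a = B" "tgt \<A> a \<in> \<C>"
  shows "pushout_seq \<A> a (spl (es @ [c])) F \<longleftrightarrow> (\<exists>d. F = spl (es @ [d]) \<and> cm a (idn \<A> (cob c)) c d)"
proof -
  have c: "conf c" "B = kob c" using p by (auto simp: path_append)
  define I where "I = butlast (spl es)"
  have spl: "spl (es @ [d]) = I @ [pre_splice \<A> es (snd d), fst d]" for d by (simp add: splice_snoc I_def)
  have pre: "pre_splice \<A> es q \<in> arrs \<A> \<and> src \<A> (pre_splice \<A> es q) = src \<A> q \<and>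
      pre_splice \<A> es q \<cdot> u = pre_splice \<A> es (q \<cdot> u) \<and> tgt \<A> (pre_splice \<A> es q) = tgt \<A> (pre_splice \<A> es (snd c))"
    if "q \<in> arrs \<A>" "u \<in> arrs \<A>" "tgt \<A> u = src \<A> q" "tgt \<A> q = cob c" for q u
  proof (cases "es = []")
    case True
    then show ?thesis using that by (simp add: pre_splice_def)
  next
    case False
    then obtain es' e where es: "es = es' @ [e]" using rev_exhaust by blast
    then have "conf e" "kob e = cob c" using p by (auto simp: path_append)
    then show ?thesis using that c by (simp add: pre_splice_def es)
  qed
  have pre0: "pre_splice \<A> es (zero_arr \<A> X (cob c)) = zero_arr \<A> X (tgt \<A> (pre_splice \<A> es (snd c)))" if "X \<in> objs \<A>" for X
  proof (cases "es = []")
    case True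
    then show ?thesis using that by (simp add: pre_splice_def)
  next
    case False
    then obtain es' e where es: "es = es' @ [e]" using rev_exhaust by blast
    then have "conf e" "kob e = cob c" using p by (auto simp: path_append)
    then show ?thesis using that c by (simp add: pre_splice_def es)
  qed
  note [simp] = confD[OF c(1)] a(1)
  have sa [simp]: "src \<A> a = kob c" "tgt \<A> a \<in> \<C>" using a c by simp_all
  let ?x = "pre_splice \<A> es (snd c)"
  have x: "?x \<in> arrs \<A>" "src \<A> ?x = mob c" using pre[of "snd c" "fst c"] by simp_all
  show ?thesis
  proof
    assume ps: "pushout_seq \<A> a (spl (es @ [c])) F"
    let ?t = "Suc (length I)"
    have l: "length F = Suc ?t" "\<forall>k<length I. F ! k = (I @ [?x, fst c]) ! k"
      using ps by (simp_all add: pushout_seq_def spl)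
    define y j where "y = F ! length I" and "j = F ! ?t"
    have F: "F = I @ [y, j]"
    proof (rule nth_equalityI)
      fix k assume "k < length F"
      then consider "k < length I" | "k = length I" | "k = ?t" using l by force
      then show "F ! k = (I @ [y, j]) ! k"
        by cases (use l in \<open>auto simp: y_def j_def nth_append\<close>)
    qed (use l in simp)
    obtain u where u: "is_pushout \<A> (fst c) a u j" "y \<cdot> u = ?x" "y \<in> Hom \<A> (tgt \<A> j) (tgt \<A> ?x)"
      "y \<cdot> j = zero_arr \<A> (src \<A> j) (tgt \<A> ?x)"
      using ps by (auto simp: pushout_seq_def spl F nth_append)
    note d = is_pushoutD[OF u(1)]
    obtain q where q: "q \<in> arrs \<A>" "tgt \<A> q = cob c" "src \<A> q = tgt \<A> u" "q \<cdot> u = snd c" "q \<cdot> j = zero_arr \<A> (src \<A> j) (cob c)"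
      by (rule pushout_colift[OF u(1), of "snd c" "zero_arr \<A> (src \<A> j) (cob c)"]) (use d in simp_all)
    have "short_exact \<A> j q"
      by (rule pushout_ses[OF conf_ses[OF c(1)] u(1)]) (use d q in simp_all)
    then have cj: "conflation \<A> \<C> j q" by (rule confI) (use q d in simp_all)
    have "cm a (idn \<A> (cob c)) c (j, q)"
      by (rule cmI[of _ _ _ _ u]) (use cj c d q in simp_all)
    moreover have "y = pre_splice \<A> es q"
    proof (rule pushout_unique[OF u(1)])
      show "y \<in> arrs \<A>" "src \<A> y = tgt \<A> u" using u(3) d by (simp_all add: Hom_def)
      show "pre_splice \<A> es q \<in> arrs \<A>" "src \<A> (pre_splice \<A> es q) = tgt \<A> u" "tgt \<A> y = tgt \<A> (pre_splice \<A> es q)"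
        using pre[of q u] q d u(3) by (simp_all add: Hom_def)
      show "y \<cdot> u = pre_splice \<A> es q \<cdot> u" using u(2) pre[of q u] q d by simp
      show "y \<cdot> j = pre_splice \<A> es q \<cdot> j" using u(4) pre[of q j] pre0[of "src \<A> j"] q d by simp
    qed
    ultimately show "\<exists>d. F = spl (es @ [d]) \<and> cm a (idn \<A> (cob c)) c d"
      by (intro exI[of _ "(j, q)"]) (simp add: spl F)
  next
    assume "\<exists>d. F = spl (es @ [d]) \<and> cm a (idn \<A> (cob c)) c d"
    then obtain d where d: "F = spl (es @ [d])" "cm a (idn \<A> (cob c)) c d" by blast
    obtain m where m: "m \<in> arrs \<A>" "src \<A> m = mob c" "tgt \<A> m = mob d" "m \<cdot> fst c = fst d \<cdot> a" "snd d \<cdot> m = idn \<A> (cob c) \<cdot> snd c"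
      by (rule cmE[OF d(2)])
    note t = cmD[OF d(2)]
    note [simp] = confD[OF t(2)]
    have [simp]: "cob d = cob c" "kob d = tgt \<A> a" using t(5,8) by simp_all
    have "is_pullback (opc \<A>) (fst c) a m (fst d)"
      by (rule abelian_category.pullback_of_ses_morphism[OF abelian_opc, of "snd c" "fst c" "snd d"])
        (use m conf_ses[OF t(1)] conf_ses[OF t(2)] in simp_all)
    then have "is_pushout \<A> (fst c) a m (fst d)" by simp
    then show "pushout_seq \<A> a (spl (es @ [c])) F"
      using pre[of "snd d" m] pre[of "snd d" "fst d"] pre[of "snd c" "fst c"] pre0[of "kob d"] m
      by (simp add: pushout_seq_def spl d nth_append Hom_def) blast
  qed
qed

lemma pullback_seq_splice:
  assumes p: "path A B (c # es)" and a: "h \<in> arrs \<A>" "tgt \<A> h = A" "src \<A> h \<in> \<C>"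
  shows "pullback_seq \<A> h (spl (c # es)) F \<longleftrightarrow> (\<exists>d. F = spl (d # es) \<and> cm (idn \<A> (kob c)) h d c)"
proof -
  have c: "conf c" "A = cob c" using p by auto
  define J where "J = tl (spl es)"
  have spl: "spl (d # es) = snd d # post_splice \<A> es (fst d) # J" for d by (simp add: splice_Cons' J_def)
  have post: "post_splice \<A> es j \<in> arrs \<A> \<and> tgt \<A> (post_splice \<A> es j) = tgt \<A> j \<and>
      u \<cdot> post_splice \<A> es j = post_splice \<A> es (u \<cdot> j) \<and> src \<A> (post_splice \<A> es j) = src \<A> (post_splice \<A> es (fst c))"
    if "j \<in> arrs \<A>" "u \<in> arrs \<A>" "src \<A> u = tgt \<A> j" "src \<A> j = kob c" for j u
  proof (cases es)
    case Nil
    then show ?thesis using that by (simp add: post_splice_def)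
  next
    case (Cons e es')
    then have "conf e" "cob e = kob c" using p by auto
    then show ?thesis using that c by (simp add: post_splice_def Cons)
  qed
  have post0: "post_splice \<A> es (zero_arr \<A> (kob c) X) = zero_arr \<A> (src \<A> (post_splice \<A> es (fst c))) X" if "X \<in> objs \<A>" for X
  proof (cases es)
    case Nil
    then show ?thesis using that by (simp add: post_splice_def)
  next
    case (Cons e es')
    then have "conf e" "cob e = kob c" using p by auto
    then show ?thesis using that c by (simp add: post_splice_def Cons)
  qed
  note [simp] = confD[OF c(1)] a(1)
  have sa [simp]: "tgt \<A> h = cob c" "src \<A> h \<in> \<C>" using a c by simp_all
  let ?z = "post_splice \<A> es (fst c)"
  have z: "?z \<in> arrs \<A>" "tgt \<A> ?z = mob c" using post[of "fst c" "snd c"] by simp_all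
  show ?thesis
  proof
    assume ps: "pullback_seq \<A> h (spl (c # es)) F"
    have l: "length F = Suc (Suc (length J))" "\<And>k. 2 \<le> k \<and> k < Suc (Suc (length J)) \<Longrightarrow> F ! k = (snd c # ?z # J) ! k"
      using ps by (simp_all add: pullback_seq_def spl)
    define q y where "q = F ! 0" and "y = F ! 1"
    have F: "F = q # y # J"
    proof (rule nth_equalityI)
      fix k assume k: "k < length F"
      show "F ! k = (q # y # J) ! k"
      proof (cases "2 \<le> k")
        case True
        then obtain k' where "k = Suc (Suc k')" by (metis add_2_eq_Suc le_Suc_ex)
        then show ?thesis using l(2)[of k] k l(1) by simp
      next
        case False
        then have "k = 0 \<or> k = 1" by auto
        then show ?thesis by (auto simp: q_def y_def)
      qed
    qed (use l in simp)
    obtain v where u: "is_pullback \<A> (snd c) h v q" "v \<cdot> y = ?z" "y \<in> Hom \<A> (src \<A> ?z) (src \<A> q)"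
      "q \<cdot> y = zero_arr \<A> (src \<A> ?z) (tgt \<A> q)"
      using ps by (auto simp: pullback_seq_def spl F)
    note d = is_pullbackD[OF u(1)]
    obtain j where j: "j \<in> arrs \<A>" "src \<A> j = kob c" "tgt \<A> j = src \<A> v" "v \<cdot> j = fst c" "q \<cdot> j = zero_arr \<A> (kob c) (src \<A> h)"
      by (rule pullback_lift[OF u(1), of "fst c" "zero_arr \<A> (kob c) (src \<A> h)"]) (use d in simp_all)
    have "short_exact \<A> j q"
      by (rule pullback_ses[OF conf_ses[OF c(1)] u(1)]) (use d j in simp_all)
    then have cj: "conflation \<A> \<C> j q" by (rule confI) (use j d in simp_all)
    have "cm (idn \<A> (kob c)) h (j, q) c"
      by (rule cmI[of _ _ _ _ v]) (use cj c d j in simp_all)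
    moreover have "y = post_splice \<A> es j"
    proof (rule pullback_unique[OF u(1)])
      show "y \<in> arrs \<A>" "tgt \<A> y = src \<A> v" using u(3) d by (simp_all add: Hom_def)
      show "post_splice \<A> es j \<in> arrs \<A>" "tgt \<A> (post_splice \<A> es j) = src \<A> v" "src \<A> y = src \<A> (post_splice \<A> es j)"
        using post[of j v] j d u(3) by (simp_all add: Hom_def)
      show "v \<cdot> y = v \<cdot> post_splice \<A> es j" using u(2) post[of j v] j d by simp
      show "q \<cdot> y = q \<cdot> post_splice \<A> es j" using u(4) post[of j q] post0[of "src \<A> h"] j d by simp
    qed
    ultimately show "\<exists>d. F = spl (d # es) \<and> cm (idn \<A> (kob c)) h d c"
      by (intro exI[of _ "(j, q)"]) (simp add: spl F)
  next
    assume "\<exists>d. F = spl (d # es) \<and> cm (idn \<A> (kob c)) h d c"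
    then obtain d where d: "F = spl (d # es)" "cm (idn \<A> (kob c)) h d c" by blast
    obtain m where m: "m \<in> arrs \<A>" "src \<A> m = mob d" "tgt \<A> m = mob c" "m \<cdot> fst d = fst c" "snd c \<cdot> m = h \<cdot> snd d"
      and [simp]: "kob d = kob c"
      by (rule cm_idE[OF d(2)])
    note t = cmD[OF d(2)]
    note [simp] = confD[OF t(1)]
    have [simp]: "cob d = src \<A> h" using t(7) by simp
    have "is_pullback \<A> (snd c) h m (snd d)" by (rule cm_pullback[OF d(2) m])
    moreover have "(snd d # post_splice \<A> es (fst d) # J) ! k = (snd c # post_splice \<A> es (fst c) # J) ! k" if "2 \<le> k" for k
      using that by (cases k; cases "k - 1") auto
    ultimately show "pullback_seq \<A> h (spl (c # es)) F"
      using post[of "fst d" m] post[of "fst d" "snd d"] post[of "fst c" "snd c"] post0[of "src \<A> h"] m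
      by (simp add: pullback_seq_def spl d Hom_def) blast
  qed
qed

lemma push_std_eq:
  assumes l: "lmor (idn \<A> B) (idn \<A> A) cs es" and p: "path A B cs" "path A B es"
    and cs: "cs = cs' @ [c]" "cm a (idn \<A> (cob c)) c d"
    and es: "lmor a (idn \<A> A) es gs" "path A B' gs"
  shows "lmor (idn \<A> B') (idn \<A> A) (cs' @ [d]) gs"
proof (rule lmor_push_factor[OF _ cs(2) es(2)])
  have ne: "es \<noteq> []" using lmor_length[OF l] cs by auto
  have "lmor (a \<cdot> idn \<A> B) (idn \<A> A \<cdot> idn \<A> A) cs gs" by (rule lmor_comp'[OF l es(1)]) (simp add: cs)
  moreover have "a \<in> arrs \<A>" "src \<A> a = B" using lmor_typed[OF es(1) ne p(2) es(2)] by auto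
  moreover have "A \<in> \<C>" using path_C[OF p(1)] by simp
  ultimately show "lmor a (idn \<A> A) (cs' @ [c]) gs" using cs by simp
qed

lemma path_push_std: "path A B (cs @ [c]) \<Longrightarrow> cm a (idn \<A> (cob c)) c d \<Longrightarrow> path A (tgt \<A> a) (cs @ [d])"
  using cmD[of a "idn \<A> (cob c)" c d] by (auto simp: path_append)

lemma lmor_push_std:
  "path A B (cs @ [c]) \<Longrightarrow> cm a (idn \<A> (cob c)) c d \<Longrightarrow> lmor a (idn \<A> A) (cs @ [c]) (cs @ [d])"
proof -
  assume p: "path A B (cs @ [c])" and c: "cm a (idn \<A> (cob c)) c d"
  have "path A (cob c) cs" using p by (auto simp: path_append)
  then have "lmor (idn \<A> (cob c)) (idn \<A> A) cs cs" by (rule lmor_id)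
  then show ?thesis using c cmD(3)[OF c] cmD[OF c] by (auto simp: lmor_append)
qed

lemma push_cl:
  assumes cs: "path A B cs" "cs \<noteq> []" and l: "lmor a (idn \<A> A) cs ds" and ds: "path A B' ds"
  shows "ext_push \<A> \<C> a (cl cs) = cl ds"
proof -
  have a: "a \<in> arrs \<A>" "src \<A> a = B" "tgt \<A> a = B'" "B' \<in> \<C>" "A \<in> \<C>" "B \<in> \<C>"
    using lmor_typed[OF l cs(2,1) ds] path_C[OF ds] path_C[OF cs(1)] by auto
  have key: "cl (es' @ [d]) = cl ds" if "eqv A B cs es" "es = es' @ [c]" "cm a (idn \<A> (cob c)) c d" for es es' c d
    using that(1)[unfolded eqv_def] that(2,3)
  proof (induction arbitrary: es' c d rule: rtranclp_induct)
    case base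
    have "lmor (idn \<A> B') (idn \<A> A) (es' @ [d]) ds"
      by (rule push_std_eq[OF lmor_id[OF cs(1)] cs(1) cs(1) base l ds])
    moreover have "path A B' (es' @ [d])" using path_push_std[of A B es' c a d] base cs a by simp
    ultimately show ?case by (intro cl_eqI[OF _ _ _ ds]) auto
  next
    case (step fs es)
    have lf: "length es = length fs" and p: "path A B fs" "path A B es" using step(2) lmor_length by (auto simp: lstep_def)
    have "fs \<noteq> []" using lf step(4) by auto
    then obtain fs' e where fs: "fs = fs' @ [e]" using rev_exhaust by blast
    have e: "conf e" "kob e = B" using p fs by (auto simp: path_append)
    obtain e' where e': "cm a (idn \<A> (cob e)) e e'"
      using ex_conf_push[OF e(1), of a] a e by metis
    have 1: "cl (fs' @ [e']) = cl ds" by (rule step(3)[OF fs e'])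
    have q: "path A B' (fs' @ [e'])" "path A B' (es' @ [d])"
      using path_push_std[of A B fs' e a e'] path_push_std[of A B es' c a d] p fs e' step(4,5) a by simp_all
    have m: "lmor a (idn \<A> A) fs (fs' @ [e'])" "lmor a (idn \<A> A) es (es' @ [d])"
      using lmor_push_std[of A B fs' e a e'] lmor_push_std[of A B es' c a d] p fs e' step(4,5) by simp_all
    from step(2) have "cl (fs' @ [e']) = cl (es' @ [d])"
    proof
      assume "lstep A B fs es"
      then show ?thesis
        using push_std_eq[OF _ p fs e' m(2) q(2)] by (intro cl_eqI[OF _ q(1) _ q(2)]) (auto simp: lstep_def)
    next
      assume "lstep A B es fs"
      then show ?thesis
        using push_std_eq[OF _ p(2,1) step(4,5) m(1) q(1)] by (intro cl_eqI[OF _ q(2) _ q(1), symmetric]) (auto simp: lstep_def)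
    qed
    then show ?case using 1 by simp
  qed
  obtain cs' c where csc: "cs = cs' @ [c]" using cs(2) rev_exhaust by blast
  have c: "conf c" "kob c = B" using cs csc by (auto simp: path_append)
  obtain d where d: "cm a (idn \<A> (cob c)) c d" using ex_conf_push[OF c(1), of a] a c by metis
  have "\<Union>{yoneda_class \<A> \<C> F | E F. E \<in> yoneda_class \<A> \<C> (spl cs) \<and> pushout_seq \<A> a E F} = yoneda_class \<A> \<C> (spl ds)"
  proof (rule class_union_eq[OF cs])
    fix es F assume es: "eqv A B cs es" and ps: "pushout_seq \<A> a (spl es) F"
    have p: "path A B es" "es \<noteq> []" using eqv_path[OF es cs(1)] eqv_length[OF es] cs(2) by auto
    then obtain es' e where e: "es = es' @ [e]" using rev_exhaust by blast
    obtain d where "F = spl (es' @ [d])" "cm a (idn \<A> (cob e)) e d"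
      using pushout_seq_splice[of A B es' e a F] p e a ps by auto
    then show "yoneda_class \<A> \<C> F = yoneda_class \<A> \<C> (spl ds)"
      using key[OF es e] by (simp add: cl_def ext_of_def)
  next
    show "pushout_seq \<A> a (spl cs) (spl (cs' @ [d]))"
    proof -
      have "\<exists>d'. spl (cs' @ [d]) = spl (cs' @ [d']) \<and> cm a (idn \<A> (cob c)) c d'" using d by blast
      then show ?thesis using pushout_seq_splice[of A B cs' c a] cs csc a by simp
    qed
  qed
  then show ?thesis by (simp add: cl_def ext_of_def)
qed

lemma pull_std_eq:
  assumes l: "lmor (idn \<A> B) (idn \<A> A) es (c # cs)" and p: "path A B es"
    and c: "cm (idn \<A> (kob c)) h d c"
    and es: "lmor (idn \<A> B) h gs es" "path A' B gs" "gs \<noteq> []"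
  shows "lmor (idn \<A> B) (idn \<A> A') gs (d # cs)"
proof (rule lmor_pull_factor[OF _ c es(2)])
  have "lmor (idn \<A> B \<cdot> idn \<A> B) (idn \<A> A \<cdot> h) gs (c # cs)" by (rule lmor_comp'[OF es(1) l es(3)])
  moreover have "h \<in> arrs \<A>" "tgt \<A> h = A" using lmor_typed[OF es(1) es(3,2) p] by auto
  moreover have "B \<in> \<C>" using path_C[OF p(1)] by simp
  ultimately show "lmor (idn \<A> B) h gs (c # cs)" by simp
qed

lemma path_pull_std: "path A B (c # cs) \<Longrightarrow> cm (idn \<A> (kob c)) h d c \<Longrightarrow> path (src \<A> h) B (d # cs)"
  using cmD[of "idn \<A> (kob c)" h d c] by auto

lemma lmor_pull_std:
  "path A B (c # cs) \<Longrightarrow> cm (idn \<A> (kob c)) h d c \<Longrightarrow> lmor (idn \<A> B) h (d # cs) (c # cs)"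
  using lmor_id[of "kob c" B cs] by auto

lemma pull_cl:
  assumes cs: "path A B cs" "cs \<noteq> []" and l: "lmor (idn \<A> B) h ds cs" and ds: "path A' B ds"
  shows "ext_pull \<A> \<C> h (cl cs) = cl ds"
proof -
  have dne: "ds \<noteq> []" using cs(2) lmor_length[OF l] by auto
  have a: "h \<in> arrs \<A>" "tgt \<A> h = A" "src \<A> h = A'" "A' \<in> \<C>" "A \<in> \<C>" "B \<in> \<C>"
    using lmor_typed[OF l dne ds cs(1)] path_C[OF ds] path_C[OF cs(1)] by auto
  have key: "cl (d # es') = cl ds" if "eqv A B cs es" "es = c # es'" "cm (idn \<A> (kob c)) h d c" for es es' c d
    using that(1)[unfolded eqv_def] that(2,3)
  proof (induction arbitrary: es' c d rule: rtranclp_induct)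
    case base
    have "lmor (idn \<A> B) (idn \<A> A) cs (c # es')" using lmor_id[OF cs(1)] base by simp
    then have "lmor (idn \<A> B) (idn \<A> A') ds (d # es')"
      by (rule pull_std_eq[OF _ cs(1) base(2) l ds dne])
    moreover have "path A' B (d # es')" using path_pull_std[of A B c es' h d] base cs a by simp
    ultimately show ?case using dne by (intro cl_eqI[OF _ ds _, symmetric]) auto
  next
    case (step fs es)
    have lf: "length es = length fs" and p: "path A B fs" "path A B es" using step(2) lmor_length by (auto simp: lstep_def)
    obtain fs' e where fs: "fs = e # fs'" using lf step(4) by (cases fs) auto
    have e: "conf e" "cob e = A" using p fs by auto
    obtain e' where e': "cm (idn \<A> (kob e)) h e' e"
      using ex_conf_pull[OF e(1), of h] a e by metis
    have 1: "cl (e' # fs') = cl ds" by (rule step(3)[OF fs e'])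
    have q: "path A' B (e' # fs')" "path A' B (d # es')"
      using path_pull_std[of A B e fs' h e'] path_pull_std[of A B c es' h d] p fs e' step(4,5) a by simp_all
    have m: "lmor (idn \<A> B) h (e' # fs') fs" "lmor (idn \<A> B) h (d # es') es"
      using lmor_pull_std[of A B e fs' h e'] lmor_pull_std[of A B c es' h d] p fs e' step(4,5) by simp_all
    from step(2) have "cl (e' # fs') = cl (d # es')"
    proof
      assume "lstep A B fs es"
      then have "lmor (idn \<A> B) (idn \<A> A) fs (c # es')" using step(4) by (simp add: lstep_def)
      from pull_std_eq[OF this p(1) step(5) m(1) q(1)] show ?thesis
        by (intro cl_eqI[OF _ q(1) _ q(2)]) auto
    next
      assume "lstep A B es fs"
      then have "lmor (idn \<A> B) (idn \<A> A) es (e # fs')" using fs by (simp add: lstep_def)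
      from pull_std_eq[OF this p(2) e' m(2) q(2)] show ?thesis
        by (intro cl_eqI[OF _ q(2) _ q(1), symmetric]) auto
    qed
    then show ?case using 1 by simp
  qed
  obtain c cs' where csc: "cs = c # cs'" using cs(2) by (cases cs) auto
  have c: "conf c" "cob c = A" using cs csc by auto
  obtain d where d: "cm (idn \<A> (kob c)) h d c" using ex_conf_pull[OF c(1), of h] a c by metis
  have "\<Union>{yoneda_class \<A> \<C> F | E F. E \<in> yoneda_class \<A> \<C> (spl cs) \<and> pullback_seq \<A> h E F} = yoneda_class \<A> \<C> (spl ds)"
  proof (rule class_union_eq[OF cs])
    fix es F assume es: "eqv A B cs es" and ps: "pullback_seq \<A> h (spl es) F"
    have p: "path A B es" "es \<noteq> []" using eqv_path[OF es cs(1)] eqv_length[OF es] cs(2) by auto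
    then obtain e es' where e: "es = e # es'" by (cases es) auto
    obtain d where "F = spl (d # es')" "cm (idn \<A> (kob e)) h d e"
      using pullback_seq_splice[of A B e es' h F] p e a ps by auto
    then show "yoneda_class \<A> \<C> F = yoneda_class \<A> \<C> (spl ds)"
      using key[OF es e] by (simp add: cl_def ext_of_def)
  next
    show "pullback_seq \<A> h (spl cs) (spl (d # cs'))"
    proof -
      have "\<exists>d'. spl (d # cs') = spl (d' # cs') \<and> cm (idn \<A> (kob c)) h d' c" using d by blast
      then show ?thesis using pullback_seq_splice[of A B c cs' h] cs csc a by simp
    qed
  qed
  then show ?thesis by (simp add: cl_def ext_of_def)
qed

lemma cov_cl:
  assumes cs: "path A C cs" "cs \<noteq> []" and c: "conf c" "cob c = C"
  shows "connecting_cov \<A> \<C> c (cl cs) = cl (cs @ [c])"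
proof -
  have f: "butlast (spl es) @ [last (spl es) \<cdot> snd c, fst c] = spl (es @ [c])" if "es \<noteq> []" for es
    using that by (simp add: splice_snoc pre_splice_def last_splice)
  have "(\<Union>E\<in>yoneda_class \<A> \<C> (spl cs). yoneda_class \<A> \<C> (butlast E @ [last E \<cdot> snd c, fst c])) =
    \<Union>{yoneda_class \<A> \<C> F | E F. E \<in> yoneda_class \<A> \<C> (spl cs) \<and> F = butlast E @ [last E \<cdot> snd c, fst c]}" by auto
  also have "\<dots> = yoneda_class \<A> \<C> (spl (cs @ [c]))"
  proof (rule class_union_eq[OF cs])
    fix es F assume es: "eqv A C cs es" and F: "F = butlast (spl es) @ [last (spl es) \<cdot> snd c, fst c]"
    have ne: "es \<noteq> []" using eqv_length[OF es] cs by auto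
    have "cl (es @ [c]) = cl (cs @ [c])"
      using es[unfolded eqv_def]
    proof (induction rule: rtranclp_induct)
      case (step fs gs)
      have "cl (fs @ [c]) = cl (gs @ [c])" if "lstep A C fs gs" "length fs = length cs" for fs gs
      proof (rule cl_eqI)
        have "lmor (idn \<A> C) (idn \<A> A) fs gs" using that by (simp add: lstep_def)
        then show "lmor (idn \<A> (kob c)) (idn \<A> A) (fs @ [c]) (gs @ [c])"
          using cm_id[OF c(1)] c by (auto simp: lmor_append lmor_length)
        show "path A (kob c) (fs @ [c])" "path A (kob c) (gs @ [c])" using that c by (auto simp: lstep_def path_append)
      qed simp
      moreover have "length fs = length cs" using step(1) eqv_length by (auto simp: eqv_def)
      moreover have "length gs = length fs" using step(2) by (auto simp: lstep_def dest: lmor_length)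
      ultimately show ?case using step(2,3) by metis
    qed simp
    then show "yoneda_class \<A> \<C> F = yoneda_class \<A> \<C> (spl (cs @ [c]))"
      unfolding F f[OF ne] by (simp add: cl_def ext_of_def)
  qed simp
  finally show ?thesis by (cases c) (simp add: cl_def ext_of_def)
qed

lemma con_cl:
  assumes cs: "path C B cs" "cs \<noteq> []" and c: "conf c" "kob c = C"
  shows "connecting_con \<A> \<C> c (cl cs) = cl (c # cs)"
proof -
  have f: "snd c # (fst c \<cdot> hd (spl es)) # tl (spl es) = spl (c # es)" if "es \<noteq> []" for es
    using that by (simp add: splice_Cons)
  have "(\<Union>E\<in>yoneda_class \<A> \<C> (spl cs). yoneda_class \<A> \<C> (snd c # (fst c \<cdot> hd E) # tl E)) =
    \<Union>{yoneda_class \<A> \<C> F | E F. E \<in> yoneda_class \<A> \<C> (spl cs) \<and> F = snd c # (fst c \<cdot> hd E) # tl E}" by auto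
  also have "\<dots> = yoneda_class \<A> \<C> (spl (c # cs))"
  proof (rule class_union_eq[OF cs])
    fix es F assume es: "eqv C B cs es" and F: "F = snd c # (fst c \<cdot> hd (spl es)) # tl (spl es)"
    have ne: "es \<noteq> []" using eqv_length[OF es] cs by auto
    have "cl (c # es) = cl (c # cs)"
      using es[unfolded eqv_def]
    proof (induction rule: rtranclp_induct)
      case (step fs gs)
      have "cl (c # fs) = cl (c # gs)" if "lstep C B fs gs" for fs gs
        by (rule cl_eqI[of B "cob c"]) (use that c cm_id[OF c(1)] in \<open>auto simp: lstep_def\<close>)
      then show ?case using step(2,3) by metis
    qed simp
    then show "yoneda_class \<A> \<C> F = yoneda_class \<A> \<C> (spl (c # cs))"
      unfolding F f[OF ne] by (simp add: cl_def ext_of_def)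
  qed simp
  finally show ?thesis by (cases c) (simp add: cl_def ext_of_def)
qed

section \<open>Operations on Yoneda Ext\<close>

abbreviation push where "push \<equiv> ext_push \<A> \<C>"
abbreviation pull where "pull \<equiv> ext_pull \<A> \<C>"
abbreviation cov where "cov \<equiv> connecting_cov \<A> \<C>"
abbreviation con where "con \<equiv> connecting_con \<A> \<C>"
abbreviation plus where "plus \<equiv> ext_plus \<A> \<C>"
abbreviation EXT where "EXT \<equiv> Ext \<A> \<C>"

lemma Ext_0: "x \<in> EXT 0 A B \<longleftrightarrow> (\<exists>f. f \<in> arrs \<A> \<and> src \<A> f = A \<and> tgt \<A> f = B \<and> x = Ext_arr f)"
  by (auto simp: Ext_def Hom_def)

lemma ExtE:
  assumes "x \<in> EXT t A B"
  obtains (arr) f where "t = 0" "f \<in> arrs \<A>" "src \<A> f = A" "tgt \<A> f = B" "x = Ext_arr f"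
  | (seq) cs where "0 < t" "path A B cs" "cs \<noteq> []" "length cs = t" "x = cl cs"
proof (cases "t = 0")
  case True
  then show ?thesis using assms arr by (auto simp: Ext_0)
next
  case False
  then show ?thesis using assms seq by (auto simp: Ext_pos)
qed

lemma cl_Ext: "path A B cs \<Longrightarrow> cs \<noteq> [] \<Longrightarrow> cl cs \<in> EXT (length cs) A B"
  by (auto simp: Ext_pos)

lemma lmor_push_ex:
  assumes "path A B cs" "cs \<noteq> []" "a \<in> arrs \<A>" "src \<A> a = B" "tgt \<A> a \<in> \<C>"
  obtains ds where "path A (tgt \<A> a) ds" "length ds = length cs" "lmor a (idn \<A> A) cs ds"
proof -
  obtain cs' c where csc: "cs = cs' @ [c]" using assms(2) rev_exhaust by blast
  have c: "conf c" "kob c = B" using assms csc by (auto simp: path_append)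
  obtain d where "cm a (idn \<A> (cob c)) c d" using ex_conf_push[OF c(1), of a] assms c by metis
  then show thesis
    using that[of "cs' @ [d]"] path_push_std lmor_push_std assms csc by auto
qed

lemma lmor_pull_ex:
  assumes "path A B cs" "cs \<noteq> []" "h \<in> arrs \<A>" "tgt \<A> h = A" "src \<A> h \<in> \<C>"
  obtains ds where "path (src \<A> h) B ds" "length ds = length cs" "lmor (idn \<A> B) h ds cs"
proof -
  obtain cs' c where csc: "cs = c # cs'" using assms(2) by (cases cs) auto
  have c: "conf c" "cob c = A" using assms csc by auto
  obtain d where "cm (idn \<A> (kob c)) h d c" using ex_conf_pull[OF c(1), of h] assms c by metis
  then show thesis
    using that[of "d # cs'"] path_pull_std lmor_pull_std assms(1) csc by (metis length_Cons)
qed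

lemma push_pull_cl:
  assumes l: "lmor a b cs ds" and cs: "path A B cs" "cs \<noteq> []" and ds: "path A' B' ds"
  shows "push a (cl cs) = pull b (cl ds)"
proof -
  obtain cs' c where csc: "cs = cs' @ [c]" using cs(2) rev_exhaust by blast
  have c: "conf c" "kob c = B" using cs csc by (auto simp: path_append)
  have t: "a \<in> arrs \<A>" "src \<A> a = B" "tgt \<A> a = B'" using lmor_typed[OF l cs(2,1) ds] by auto
  have C: "B' \<in> \<C>" using path_C[OF ds] by simp
  obtain d where d: "cm a (idn \<A> (cob c)) c d" using ex_conf_push[OF c(1), of a] t C c by metis
  have p: "path A B' (cs' @ [d])" using path_push_std d cs csc t by metis
  have "lmor (idn \<A> B') b (cs' @ [d]) ds"
    by (rule lmor_push_factor[OF _ d ds]) (use l csc in simp)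
  then have "pull b (cl ds) = cl (cs' @ [d])"
    using ds lmor_length[OF l] cs(2) by (intro pull_cl[OF _ _ _ p]) auto
  moreover have "push a (cl cs) = cl (cs' @ [d])"
    by (rule push_cl[OF cs _ p]) (use lmor_push_std d cs csc in auto)
  ultimately show ?thesis by simp
qed

lemma push_Ext:
  assumes "x \<in> EXT t A B" "a \<in> arrs \<A>" "src \<A> a = B" "tgt \<A> a = B'" "B' \<in> \<C>"
  shows "push a x \<in> EXT t A B'"
  using assms(1)
proof (cases rule: ExtE)
  case (arr f)
  then show ?thesis using assms by (auto simp: Ext_0)
next
  case (seq cs)
  obtain ds where "path A (tgt \<A> a) ds" "length ds = length cs" "lmor a (idn \<A> A) cs ds"
    using lmor_push_ex[of A B cs a] seq assms by auto
  then show ?thesis using push_cl[of A B cs a ds B'] cl_Ext[of A B' ds] seq assms by force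
qed

lemma pull_Ext:
  assumes "x \<in> EXT t A B" "h \<in> arrs \<A>" "src \<A> h = A'" "tgt \<A> h = A" "A' \<in> \<C>"
  shows "pull h x \<in> EXT t A' B"
  using assms(1)
proof (cases rule: ExtE)
  case (arr f)
  then show ?thesis using assms by (auto simp: Ext_0)
next
  case (seq cs)
  obtain ds where "path (src \<A> h) B ds" "length ds = length cs" "lmor (idn \<A> B) h ds cs"
    using lmor_pull_ex[of A B cs h] seq assms by auto
  then show ?thesis using pull_cl[of A B cs h ds A'] cl_Ext[of A' B ds] seq assms by force
qed

lemma push_id:
  assumes "x \<in> EXT t A B" "B \<in> \<C>"
  shows "push (idn \<A> B) x = x"
  using assms(1)
proof (cases rule: ExtE)
  case (seq cs)
  then show ?thesis using push_cl[OF seq(2,3) lmor_id[OF seq(2)] seq(2)] by simp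
qed (use assms in simp)

lemma pull_id:
  assumes "x \<in> EXT t A B" "A \<in> \<C>"
  shows "pull (idn \<A> A) x = x"
  using assms(1)
proof (cases rule: ExtE)
  case (seq cs)
  then show ?thesis using pull_cl[OF seq(2,3) lmor_id[OF seq(2)] seq(2)] by simp
qed (use assms in simp)

lemma push_push:
  assumes "x \<in> EXT t A B" "a \<in> arrs \<A>" "src \<A> a = B" "tgt \<A> a \<in> \<C>" "b \<in> arrs \<A>" "src \<A> b = tgt \<A> a" "tgt \<A> b \<in> \<C>"
  shows "push b (push a x) = push (b \<cdot> a) x"
  using assms(1)
proof (cases rule: ExtE)
  case (seq cs)
  obtain ds where ds: "path A (tgt \<A> a) ds" "length ds = length cs" "lmor a (idn \<A> A) cs ds"
    using lmor_push_ex[of A B cs a] seq assms by auto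
  obtain es where es: "path A (tgt \<A> b) es" "length es = length ds" "lmor b (idn \<A> A) ds es"
    by (rule lmor_push_ex[of A "tgt \<A> a" ds b]) (use seq assms ds in auto)
  have "ds \<noteq> []" using ds(2) seq(3) by auto
  moreover have "lmor (b \<cdot> a) (idn \<A> A) cs es"
    using lmor_comp'[OF ds(3) es(3) seq(3)] path_C[OF ds(1)] by simp
  ultimately show ?thesis
    using push_cl[OF seq(2,3) _ es(1)] push_cl[OF seq(2,3) ds(3,1)] push_cl[OF ds(1) _ es(3,1)] seq by simp
qed (use assms in simp)

lemma pull_pull:
  assumes "x \<in> EXT t A B" "a \<in> arrs \<A>" "tgt \<A> a = A" "src \<A> a \<in> \<C>" "b \<in> arrs \<A>" "tgt \<A> b = src \<A> a" "src \<A> b \<in> \<C>"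
  shows "pull b (pull a x) = pull (a \<cdot> b) x"
  using assms(1)
proof (cases rule: ExtE)
  case (seq cs)
  obtain ds where ds: "path (src \<A> a) B ds" "length ds = length cs" "lmor (idn \<A> B) a ds cs"
    using lmor_pull_ex[of A B cs a] seq assms by auto
  have dn: "ds \<noteq> []" using ds(2) seq(3) by auto
  obtain es where es: "path (src \<A> b) B es" "length es = length ds" "lmor (idn \<A> B) b es ds"
    by (rule lmor_pull_ex[of "src \<A> a" B ds b]) (use seq assms ds in auto)
  have en: "es \<noteq> []" using es(2) dn by auto
  have "lmor (idn \<A> B) (a \<cdot> b) es cs"
    using lmor_comp'[OF es(3) ds(3) en] path_C[OF ds(1)] by simp
  then show ?thesis
    using pull_cl[OF seq(2,3) _ es(1)] pull_cl[OF seq(2,3) ds(3,1)] pull_cl[OF ds(1) dn es(3,1)] seq by simp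
qed (use assms in simp)

lemma push_pull:
  assumes "x \<in> EXT t A B" "a \<in> arrs \<A>" "src \<A> a = B" "tgt \<A> a \<in> \<C>" "b \<in> arrs \<A>" "tgt \<A> b = A" "src \<A> b \<in> \<C>"
  shows "push a (pull b x) = pull b (push a x)"
  using assms(1)
proof (cases rule: ExtE)
  case (seq cs)
  obtain ds where ds: "path (src \<A> b) B ds" "length ds = length cs" "lmor (idn \<A> B) b ds cs"
    using lmor_pull_ex[of A B cs b] seq assms by auto
  have dn: "ds \<noteq> []" using ds(2) seq(3) by auto
  obtain es where es: "path A (tgt \<A> a) es" "length es = length cs" "lmor a (idn \<A> A) cs es"
    using lmor_push_ex[of A B cs a] seq assms by auto
  have "lmor a b ds es"
    using lmor_comp'[OF ds(3) es(3) dn] assms path_C[OF seq(2)] by simp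
  from push_pull_cl[OF this ds(1) dn es(1)] show ?thesis
    using pull_cl[OF seq(2,3) ds(3,1)] push_cl[OF seq(2,3) es(3,1)] seq by simp
qed (use assms in simp)

lemma cl_single: "conf c \<Longrightarrow> cl [c] \<in> EXT 1 (cob c) (kob c)"
  using cl_Ext[of "cob c" "kob c" "[c]"] by simp

lemma cov_arr: "cov c (Ext_arr f) = pull f (cl [c])"
  by (cases c) (simp add: cl_def)

lemma con_arr: "con c (Ext_arr f) = push f (cl [c])"
  by (cases c) (simp add: cl_def)

lemma cov_Ext:
  assumes "x \<in> EXT t A X" "conf c" "cob c = X" "A \<in> \<C>"
  shows "cov c x \<in> EXT (Suc t) A (kob c)"
  using assms(1)
proof (cases rule: ExtE)
  case (arr f)
  then show ?thesis using pull_Ext[OF cl_single[OF assms(2)], of f A] assms by (simp add: cov_arr)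
next
  case (seq cs)
  then show ?thesis using cov_cl[OF seq(2,3) assms(2,3)] cl_Ext[of A "kob c" "cs @ [c]"] assms
    by (auto simp: path_append)
qed

lemma con_Ext:
  assumes "x \<in> EXT t X B" "conf c" "kob c = X" "B \<in> \<C>"
  shows "con c x \<in> EXT (Suc t) (cob c) B"
  using assms(1)
proof (cases rule: ExtE)
  case (arr f)
  then show ?thesis using push_Ext[OF cl_single[OF assms(2)], of f B] assms by (simp add: con_arr)
next
  case (seq cs)
  then show ?thesis using con_cl[OF seq(2,3) assms(2,3)] cl_Ext[of "cob c" B "c # cs"] assms
    by auto
qed

lemma push_cl_single: "cm a b c d \<Longrightarrow> push a (cl [c]) = pull b (cl [d])"
  by (rule push_pull_cl[of a b "[c]" "[d]" "cob c" "kob c" "cob d" "kob d"]) (auto simp: cmD dest: cmD)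

lemma push_cov:
  assumes x: "x \<in> EXT t A (cob c)" and c: "cm a b c d" and A: "A \<in> \<C>"
  shows "push a (cov c x) = cov d (push b x)"
  using x
proof (cases rule: ExtE)
  case (arr f)
  note t = cmD[OF c]
  have "push a (pull f (cl [c])) = pull f (push a (cl [c]))"
    by (rule push_pull[OF cl_single]) (use t arr A in auto)
  also have "\<dots> = pull f (pull b (cl [d]))" by (simp only: push_cl_single[OF c])
  also have "\<dots> = pull (b \<cdot> f) (cl [d])"
    by (rule pull_pull[OF cl_single]) (use t arr A in auto)
  finally show ?thesis using arr by (simp add: cov_arr)
next
  case (seq cs)
  note t = cmD[OF c]
  obtain ds where ds: "path A (tgt \<A> b) ds" "length ds = length cs" "lmor b (idn \<A> A) cs ds"
    using lmor_push_ex[of A "cob c" cs b] seq t confD(6)[OF t(2)] by auto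
  have dn: "ds \<noteq> []" using ds(2) seq(3) by auto
  have "lmor a b [c] [d]" using c t by auto
  then have "lmor a (idn \<A> A) (cs @ [c]) (ds @ [d])" using ds lmor_append[OF ds(2)[symmetric]] by blast
  moreover have p: "path A (kob c) (cs @ [c])" "path A (kob d) (ds @ [d])" using seq ds t by (auto simp: path_append)
  ultimately have "push a (cl (cs @ [c])) = cl (ds @ [d])" by (intro push_cl) auto
  then show ?thesis
    using cov_cl[OF seq(2,3) t(1)] cov_cl[OF ds(1) dn t(2)] push_cl[OF seq(2,3) ds(3,1)] seq t by simp
qed

lemma pull_cov:
  assumes x: "x \<in> EXT t A (cob c)" and c: "conf c" and h: "h \<in> arrs \<A>" "tgt \<A> h = A" "src \<A> h \<in> \<C>" and A: "A \<in> \<C>"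
  shows "pull h (cov c x) = cov c (pull h x)"
  using x
proof (cases rule: ExtE)
  case (arr f)
  have "pull h (pull f (cl [c])) = pull (f \<cdot> h) (cl [c])"
    by (rule pull_pull[OF cl_single]) (use arr A c h in auto)
  then show ?thesis using arr by (simp add: cov_arr)
next
  case (seq cs)
  obtain ds where ds: "path (src \<A> h) (cob c) ds" "length ds = length cs" "lmor (idn \<A> (cob c)) h ds cs"
    using lmor_pull_ex[of A "cob c" cs h] seq h by auto
  have dn: "ds \<noteq> []" using ds(2) seq(3) by auto
  have "lmor (idn \<A> (kob c)) (idn \<A> (cob c)) [c] [c]" using lmor_id[of "cob c" "kob c" "[c]"] c by simp
  then have "lmor (idn \<A> (kob c)) h (ds @ [c]) (cs @ [c])" using ds lmor_append[OF ds(2)] by blast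
  moreover have p: "path A (kob c) (cs @ [c])" "path (src \<A> h) (kob c) (ds @ [c])" using seq ds c by (auto simp: path_append)
  ultimately have "pull h (cl (cs @ [c])) = cl (ds @ [c])" by (intro pull_cl) auto
  then show ?thesis
    using cov_cl[OF seq(2,3) c] cov_cl[OF ds(1) dn c] pull_cl[OF seq(2,3) ds(3,1)] seq by simp
qed

lemma push_con:
  assumes x: "x \<in> EXT t (kob c) B" and c: "conf c" and h: "h \<in> arrs \<A>" "src \<A> h = B" "tgt \<A> h \<in> \<C>" and B: "B \<in> \<C>"
  shows "push h (con c x) = con c (push h x)"
  using x
proof (cases rule: ExtE)
  case (arr f)
  have "push h (push f (cl [c])) = push (h \<cdot> f) (cl [c])"
    by (rule push_push[OF cl_single]) (use arr B c h in auto)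
  then show ?thesis using arr by (simp add: con_arr)
next
  case (seq cs)
  obtain ds where ds: "path (kob c) (tgt \<A> h) ds" "length ds = length cs" "lmor h (idn \<A> (kob c)) cs ds"
    using lmor_push_ex[of "kob c" B cs h] seq h by auto
  have dn: "ds \<noteq> []" using ds(2) seq(3) by auto
  have "lmor h (idn \<A> (cob c)) (c # cs) (c # ds)" using ds cm_id[OF c] by auto
  moreover have p: "path (cob c) B (c # cs)" "path (cob c) (tgt \<A> h) (c # ds)" using seq ds c by auto
  ultimately have "push h (cl (c # cs)) = cl (c # ds)" by (intro push_cl) auto
  then show ?thesis
    using con_cl[OF seq(2,3) c] con_cl[OF ds(1) dn c] push_cl[OF seq(2,3) ds(3,1)] seq by simp
qed

lemma Ext_Suc_cov:
  assumes "z \<in> EXT (Suc t) A B" "A \<in> \<C>"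
  obtains e w where "conf e" "kob e = B" "w \<in> EXT t A (cob e)" "z = cov e w"
proof -
  obtain cs where cs: "path A B cs" "length cs = Suc t" "z = cl cs" using assms(1) by (auto simp: Ext_pos)
  then obtain cs' e where e: "cs = cs' @ [e]" by (metis length_Suc_conv_rev)
  have p: "path A (cob e) cs'" "conf e" "kob e = B" using cs e by (auto simp: path_append)
  show thesis
  proof (cases "cs' = []")
    case True
    have "cov e (Ext_arr (idn \<A> A)) = z"
      using pull_id[OF cl_single[OF p(2)]] True cs e p by (simp add: cov_arr)
    then show ?thesis using that[of e "Ext_arr (idn \<A> A)"] True cs e p assms(2) by (auto simp: Ext_0)
  next
    case False
    then show ?thesis using that[of e "cl cs'"] cov_cl[OF p(1) False p(2)] cl_Ext[OF p(1) False] cs e p by auto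
  qed
qed

section \<open>Baer sums\<close>

lemma cm_plus:
  assumes "cm a b c d" "cm a' b' c d"
  shows "cm (a \<boxplus> a') (b \<boxplus> b') c d"
proof -
  obtain m where m: "m \<in> arrs \<A>" "src \<A> m = mob c" "tgt \<A> m = mob d" "m \<cdot> fst c = fst d \<cdot> a" "snd d \<cdot> m = b \<cdot> snd c"
    by (rule cmE[OF assms(1)])
  obtain n where n: "n \<in> arrs \<A>" "src \<A> n = mob c" "tgt \<A> n = mob d" "n \<cdot> fst c = fst d \<cdot> a'" "snd d \<cdot> n = b' \<cdot> snd c"
    by (rule cmE[OF assms(2)])
  note t = cmD[OF assms(1)] cmD[OF assms(2)]
  show ?thesis
    by (rule cmI[of _ _ _ _ "m \<boxplus> n"]) (use t m n confD[OF t(1)] confD[OF t(2)] in simp_all)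
qed

lemma lmor_plus:
  "lmor a b cs ds \<Longrightarrow> lmor a' b' cs ds \<Longrightarrow> cs \<noteq> [] \<Longrightarrow> lmor (a \<boxplus> a') (b \<boxplus> b') cs ds"
proof (induction a b cs ds arbitrary: b' rule: lmor.induct)
  case (2 a b c cs d ds)
  obtain f g where f: "cm f b c d" "lmor a f cs ds" and g: "cm g b' c d" "lmor a' g cs ds"
    using 2(2,3) by auto
  have "lmor (a \<boxplus> a') (f \<boxplus> g) cs ds"
  proof (cases "cs = []")
    case True
    then have "ds = []" using lmor_length[OF f(2)] by simp
    with True f g show ?thesis using cmD[OF f(1)] cmD[OF g(1)] by simp
  qed (use 2(1)[OF f(2) g(2)] in simp)
  then show ?case using cm_plus[OF f(1) g(1)] by auto
qed auto

lemma lmor_of_maps: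
  "cs \<noteq> [] \<Longrightarrow> length ds = length cs \<Longrightarrow> \<forall>k<length cs. cm (f (Suc k)) (f k) (cs ! k) (ds ! k) \<Longrightarrow>
     lmor (f (length cs)) (f 0) cs ds"
proof (induction cs arbitrary: ds f)
  case (Cons c cs)
  then obtain d ds' where ds: "ds = d # ds'" by (cases ds) auto
  have 1: "cm (f 1) (f 0) c d" using Cons.prems(3) ds by force
  have 2: "\<forall>k<length cs. cm (f (Suc (Suc k))) (f (Suc k)) (cs ! k) (ds' ! k)"
  proof (intro allI impI)
    fix k assume "k < length cs"
    then show "cm (f (Suc (Suc k))) (f (Suc k)) (cs ! k) (ds' ! k)"
      using Cons.prems(3)[rule_format, of "Suc k"] ds by simp
  qed
  show ?case
  proof (cases "cs = []")
    case True
    then show ?thesis using 1 ds Cons.prems cmD[OF 1] confD[of c] confD[of d] by auto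
  next
    case False
    from Cons.IH[OF False, of ds' "\<lambda>k. f (Suc k)"] 1 2 ds Cons.prems show ?thesis by auto
  qed
qed simp

lemma dsum_conf:
  assumes c: "conf c" "conf c'"
    and K: "is_biproduct \<A> (kob c) (kob c') SK iK jK pK qK"
    and X: "is_biproduct \<A> (mob c) (mob c') SX iX jX pX qX"
    and A: "is_biproduct \<A> (cob c) (cob c') SA iA jA pA qA"
  obtains d where "conf d" "kob d = SK" "mob d = SX" "cob d = SA"
    "fst d \<cdot> iK = iX \<cdot> fst c" "fst d \<cdot> jK = jX \<cdot> fst c'" "snd d \<cdot> iX = iA \<cdot> snd c" "snd d \<cdot> jX = jA \<cdot> snd c'"
    "cm iK iA c d" "cm jK jA c' d" "cm pK pA d c" "cm qK qA d c'"
proof -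
  note [simp] = confD[OF c(1)] confD[OF c(2)] biprodD(1-19)[OF K] biprodD(1-19)[OF X] biprodD(1-19)[OF A]
    biprod_cmp[OF K] biprod_cmp[OF X] biprod_cmp[OF A]
  let ?i = "((iX \<cdot> fst c) \<cdot> pK) \<boxplus> ((jX \<cdot> fst c') \<cdot> qK)" and ?p = "((iA \<cdot> snd c) \<cdot> pX) \<boxplus> ((jA \<cdot> snd c') \<cdot> qX)"
  have "short_exact \<A> ?i ?p"
    by (rule ses_direct_sum[OF conf_ses[OF c(1)] conf_ses[OF c(2)] K X A])
  then have d: "conflation \<A> \<C> ?i ?p"
    using biprod_C[OF K] biprod_C[OF A] by (intro confI) simp_all
  let ?d = "(?i, ?p)"
  show thesis
  proof (rule that[of ?d])
    show "cm iK iA c ?d" by (rule cmI[of _ _ _ _ iX]) (use c d in simp_all)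
    show "cm jK jA c' ?d" by (rule cmI[of _ _ _ _ jX]) (use c d in simp_all)
    show "cm pK pA ?d c" by (rule cmI[of _ _ _ _ pX]) (use c d in simp_all)
    show "cm qK qA ?d c'" by (rule cmI[of _ _ _ _ qX]) (use c d in simp_all)
  qed (use d in simp_all)
qed

lemma path_nthI:
  assumes "cs \<noteq> []" "\<And>k. k < length cs \<Longrightarrow> conf (cs ! k)" "cob (cs ! 0) = A"
    "\<And>k. Suc k < length cs \<Longrightarrow> cob (cs ! Suc k) = kob (cs ! k)" "kob (cs ! (length cs - 1)) = B"
  shows "path A B cs"
  unfolding path_iff_spliceable[OF assms(1)] spliceable_def
  using assms by (auto simp: hd_conv_nth last_conv_nth in_set_conv_nth) (metis fst_conv snd_conv)

definition dsum where
  "dsum A A' SA iA jA pA qA B B' SB iB jB pB qB cs cs' ds \<longleftrightarrow> path A B cs \<and> path A' B' cs' \<and> path SA SB ds \<and>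
     is_biproduct \<A> A A' SA iA jA pA qA \<and> is_biproduct \<A> B B' SB iB jB pB qB \<and>
     lmor iB iA cs ds \<and> lmor jB jA cs' ds \<and> lmor pB pA ds cs \<and> lmor qB qA ds cs'"

lemma ex_direct_sum:
  assumes p: "path A B cs" "path A' B' cs'" "cs \<noteq> []" "length cs' = length cs"
    and bp: "\<And>k. k \<le> Suc (length cs) \<Longrightarrow>
      is_biproduct \<A> (seq_obj \<A> (spl cs) k) (seq_obj \<A> (spl cs') k) (S k) (i k) (j k) (p k) (q k)"
  obtains ds where "direct_sum_seq \<A> (spl cs) (spl cs') (spl ds) i j p q"
    "dsum A A' (S 0) (i 0) (j 0) (p 0) (q 0) B B' (S (Suc (length cs))) (i (Suc (length cs))) (j (Suc (length cs)))
       (p (Suc (length cs))) (q (Suc (length cs))) cs cs' ds"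
proof -
  let ?t = "length cs"
  have ne: "cs' \<noteq> []" using p by auto
  note so = seq_obj_splice[OF p(1,3)] seq_obj_splice[OF p(2) ne]
  note n = path_nth[OF p(1)] path_nth[OF p(2)]
  define ko where "ko X xs k = (if k = 0 then X else kob (xs ! (k - 1)))" for X :: 'o and xs :: "('m \<times> 'm) list" and k
  have ko: "k < ?t \<Longrightarrow> ko A cs k = cob (cs ! k)" "k < ?t \<Longrightarrow> ko A' cs' k = cob (cs' ! k)"
    "ko A cs (Suc k) = kob (cs ! k)" "ko A' cs' (Suc k) = kob (cs' ! k)" for k
    using n[of k] p(4) by (auto simp: ko_def)
  have koB: "ko A cs ?t = B" "ko A' cs' ?t = B'"
    using n[of "?t - 1"] p(3,4) by (auto simp: ko_def)
  have "\<exists>T. is_biproduct \<A> (ko A cs k) (ko A' cs' k) (fst T) (fst (snd T)) (fst (snd (snd T)))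
         (fst (snd (snd (snd T)))) (snd (snd (snd (snd T))))
       \<and> (k = 0 \<longrightarrow> T = (S 0, i 0, j 0, p 0, q 0)) \<and> (k = ?t \<longrightarrow> T = (S (Suc ?t), i (Suc ?t), j (Suc ?t), p (Suc ?t), q (Suc ?t)))"
    if "k \<le> ?t" for k
  proof -
    consider "k = 0" | "k = ?t" "0 < k" | "0 < k" "k < ?t" using \<open>k \<le> ?t\<close> by linarith
    then show ?thesis
    proof cases
      case 1
      then show ?thesis using bp[of 0] so p(3) by (intro exI[of _ "(S 0, i 0, j 0, p 0, q 0)"]) (simp add: ko_def)
    next
      case 2
      then show ?thesis using bp[of "Suc ?t"] so p(3,4) koB
        by (intro exI[of _ "(S (Suc ?t), i (Suc ?t), j (Suc ?t), p (Suc ?t), q (Suc ?t))"]) simp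
    next
      case 3
      then have "conf (cs ! k)" "conf (cs' ! k)" using n[of k] p(4) by simp_all
      then have C: "ko A cs k \<in> \<C>" "ko A' cs' k \<in> \<C>" using ko[of k] 3 by simp_all
      obtain T i' j' p' q' where "is_biproduct \<A> (ko A cs k) (ko A' cs' k) T i' j' p' q'"
        by (rule ex_biprod_C[OF C])
      then show ?thesis using 3 by (intro exI[of _ "(T, i', j', p', q')"]) simp
    qed
  qed
  then obtain T where T: "\<And>k. k \<le> ?t \<Longrightarrow> is_biproduct \<A> (ko A cs k) (ko A' cs' k) (fst (T k)) (fst (snd (T k))) (fst (snd (snd (T k))))
         (fst (snd (snd (snd (T k))))) (snd (snd (snd (snd (T k)))))
       \<and> (k = 0 \<longrightarrow> T k = (S 0, i 0, j 0, p 0, q 0)) \<and> (k = ?t \<longrightarrow> T k = (S (Suc ?t), i (Suc ?t), j (Suc ?t), p (Suc ?t), q (Suc ?t)))"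
    by metis
  define KS KI KJ KP KQ where K: "KS k = fst (T k)" "KI k = fst (snd (T k))" "KJ k = fst (snd (snd (T k)))"
    "KP k = fst (snd (snd (snd (T k))))" "KQ k = snd (snd (snd (snd (T k))))" for k
  have KT: "is_biproduct \<A> (ko A cs k) (ko A' cs' k) (KS k) (KI k) (KJ k) (KP k) (KQ k)" if "k \<le> ?t" for k
    using T[OF that] by (simp add: K)
  have K0: "KS 0 = S 0" "KI 0 = i 0" "KJ 0 = j 0" "KP 0 = p 0" "KQ 0 = q 0" using T[of 0] by (simp_all add: K)
  have Kt: "KS ?t = S (Suc ?t)" "KI ?t = i (Suc ?t)" "KJ ?t = j (Suc ?t)" "KP ?t = p (Suc ?t)" "KQ ?t = q (Suc ?t)"
    using T[of ?t] by (simp_all add: K)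
  have "\<exists>d. conf d \<and> kob d = KS (Suc k) \<and> mob d = S (Suc k) \<and> cob d = KS k \<and>
    fst d \<cdot> KI (Suc k) = i (Suc k) \<cdot> fst (cs ! k) \<and> fst d \<cdot> KJ (Suc k) = j (Suc k) \<cdot> fst (cs' ! k) \<and>
    snd d \<cdot> i (Suc k) = KI k \<cdot> snd (cs ! k) \<and> snd d \<cdot> j (Suc k) = KJ k \<cdot> snd (cs' ! k) \<and>
    cm (KI (Suc k)) (KI k) (cs ! k) d \<and> cm (KJ (Suc k)) (KJ k) (cs' ! k) d \<and>
    cm (KP (Suc k)) (KP k) d (cs ! k) \<and> cm (KQ (Suc k)) (KQ k) d (cs' ! k)" if k: "k < ?t" for k
  proof -
    have c: "conf (cs ! k)" "conf (cs' ! k)" using n[of k] p(4) k by simp_all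
    have X: "is_biproduct \<A> (mob (cs ! k)) (mob (cs' ! k)) (S (Suc k)) (i (Suc k)) (j (Suc k)) (p (Suc k)) (q (Suc k))"
      using bp[of "Suc k"] k so p(4) by simp
    show ?thesis
      by (rule dsum_conf[OF c KT[of "Suc k", unfolded ko(3,4)] X KT[of k, unfolded ko(1,2)[OF k]]])
        (blast | use k in simp)+
  qed
  then obtain d where d: "\<And>k. k < ?t \<Longrightarrow> conf (d k) \<and> kob (d k) = KS (Suc k) \<and> mob (d k) = S (Suc k) \<and> cob (d k) = KS k \<and>
    fst (d k) \<cdot> KI (Suc k) = i (Suc k) \<cdot> fst (cs ! k) \<and> fst (d k) \<cdot> KJ (Suc k) = j (Suc k) \<cdot> fst (cs' ! k) \<and>
    snd (d k) \<cdot> i (Suc k) = KI k \<cdot> snd (cs ! k) \<and> snd (d k) \<cdot> j (Suc k) = KJ k \<cdot> snd (cs' ! k) \<and>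
    cm (KI (Suc k)) (KI k) (cs ! k) (d k) \<and> cm (KJ (Suc k)) (KJ k) (cs' ! k) (d k) \<and>
    cm (KP (Suc k)) (KP k) (d k) (cs ! k) \<and> cm (KQ (Suc k)) (KQ k) (d k) (cs' ! k)"
    by metis
  define ds where "ds = map d [0..<?t]"
  have ds: "length ds = ?t" "ds \<noteq> []" "\<And>k. k < ?t \<Longrightarrow> ds ! k = d k" using p(3) by (auto simp: ds_def)
  obtain t' where t': "?t = Suc t'" using p(3) by (cases ?t) auto
  have pd: "path (S 0) (S (Suc ?t)) ds"
    by (rule path_nthI) (use ds d K0 Kt t' in auto)
  have l: "lmor (i (Suc ?t)) (i 0) cs ds" "lmor (j (Suc ?t)) (j 0) cs' ds" "lmor (p (Suc ?t)) (p 0) ds cs" "lmor (q (Suc ?t)) (q 0) ds cs'"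
    using lmor_of_maps[of cs ds KI] lmor_of_maps[of cs' ds KJ] lmor_of_maps[of ds cs KP] lmor_of_maps[of ds cs' KQ]
      ds d p(3,4) ne K0 Kt by auto
  have "is_biproduct \<A> A A' (S 0) (i 0) (j 0) (p 0) (q 0)"
    "is_biproduct \<A> B B' (S (Suc ?t)) (i (Suc ?t)) (j (Suc ?t)) (p (Suc ?t)) (q (Suc ?t))"
    using bp[of 0] bp[of "Suc ?t"] so p(4) by simp_all
  then have D: "dsum A A' (S 0) (i 0) (j 0) (p 0) (q 0) B B' (S (Suc ?t)) (i (Suc ?t)) (j (Suc ?t))
       (p (Suc ?t)) (q (Suc ?t)) cs cs' ds"
    unfolding dsum_def using p pd l by auto
  note sd = seq_obj_splice[OF pd ds(2)]
  have sS: "seq_obj \<A> (spl ds) k = S k" if "k \<le> Suc ?t" for k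
    using that sd ds d by (cases k) (auto simp: le_Suc_eq less_Suc_eq)
  have E: "spl ds ! k \<in> Hom \<A> (S (Suc k)) (S k) \<and> spl ds ! k \<cdot> i (Suc k) = i k \<cdot> spl cs ! k \<and>
      spl ds ! k \<cdot> j (Suc k) = j k \<cdot> spl cs' ! k" if "k < Suc ?t" for k
  proof (cases k)
    case 0
    have "conf (d 0)" using d[of 0] t' by simp
    then show ?thesis using d[of 0] t' ds K0 p 0 ne by (simp add: splice_nth_0 Hom_def)
  next
    case (Suc l)
    then have l: "l < ?t" using that by simp
    have cl: "conf (d l)" "conf (cs ! l)" "conf (cs' ! l)" using d[OF l] n[of l] l p(4) by auto
    note [simp] = confD[OF cl(1)] confD[OF cl(2)] confD[OF cl(3)]
    have Kl: "is_biproduct \<A> (kob (cs ! l)) (kob (cs' ! l)) (KS (Suc l)) (KI (Suc l)) (KJ (Suc l)) (KP (Suc l)) (KQ (Suc l))"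
      using KT[of "Suc l", unfolded ko(3,4)] l by simp
    have Xl: "is_biproduct \<A> (mob (cs ! l)) (mob (cs' ! l)) (S (Suc l)) (i (Suc l)) (j (Suc l)) (p (Suc l)) (q (Suc l))"
      using bp[of "Suc l"] l so p(4) by simp
    note [simp] = biprodD(1-15)[OF Kl] biprodD(1-15)[OF Xl]
    have dl: "kob (d l) = KS (Suc l)" "mob (d l) = S (Suc l)" using d[OF l] by auto
    show ?thesis
    proof (cases "Suc l < ?t")
      case True
      have cl': "conf (d (Suc l))" "conf (cs ! Suc l)" "conf (cs' ! Suc l)" "cob (cs ! Suc l) = kob (cs ! l)" "cob (cs' ! Suc l) = kob (cs' ! l)"
        using d[OF True] n[of "Suc l"] True p(4) by auto
      note [simp] = confD[OF cl'(1)] confD[OF cl'(2)] confD[OF cl'(3)] cl'(4,5)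
      have Xl': "is_biproduct \<A> (mob (cs ! Suc l)) (mob (cs' ! Suc l)) (S (Suc (Suc l))) (i (Suc (Suc l))) (j (Suc (Suc l))) (p (Suc (Suc l))) (q (Suc (Suc l)))"
        using bp[of "Suc (Suc l)"] True so p(4) by simp
      note [simp] = biprodD(1-15)[OF Xl']
      have dl': "mob (d (Suc l)) = S (Suc (Suc l))" "cob (d (Suc l)) = KS (Suc l)" using d[OF True] by auto
      have 1: "fst (d l) \<cdot> (KI (Suc l) \<cdot> snd (cs ! Suc l)) = i (Suc l) \<cdot> (fst (cs ! l) \<cdot> snd (cs ! Suc l))"
        by (rule cmp_eq_reassoc) (use d[OF l] dl in simp_all)
      have 2: "fst (d l) \<cdot> (KJ (Suc l) \<cdot> snd (cs' ! Suc l)) = j (Suc l) \<cdot> (fst (cs' ! l) \<cdot> snd (cs' ! Suc l))"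
        by (rule cmp_eq_reassoc) (use d[OF l] dl in simp_all)
      show ?thesis
        using Suc True ds l p(4) dl dl' d[OF True] 1 2 by (simp add: splice_nth_Suc Hom_def)
    next
      case False
      then have tl: "?t = Suc l" using l by simp
      have t2: "length ds = Suc l" "length cs' = Suc l" using ds(1) p(4) tl by auto
      show ?thesis
        using Suc tl d[OF l] Kt ds(3)[OF l] dl splice_nth_last[OF tl, of \<A>] splice_nth_last[OF t2(1), of \<A>] splice_nth_last[OF t2(2), of \<A>]
        by (simp add: Hom_def)
    qed
  qed
  have "direct_sum_seq \<A> (spl cs) (spl cs') (spl ds) i j p q"
    unfolding direct_sum_seq_def using bp sS E p(3,4) ne ds(1,2) by auto
  then show thesis using that D by blast
qed

lemma direct_sum_unique:
  assumes p: "path A B cs" "path A' B' cs'" "cs \<noteq> []" "length cs' = length cs"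
    and D: "direct_sum_seq \<A> (spl cs) (spl cs') S i j p q"
  obtains ds where "S = spl ds"
    "dsum A A' (seq_obj \<A> S 0) (i 0) (j 0) (p 0) (q 0) B B' (seq_obj \<A> S (Suc (length cs))) (i (Suc (length cs))) (j (Suc (length cs)))
       (p (Suc (length cs))) (q (Suc (length cs))) cs cs' ds"
proof -
  have ne: "cs' \<noteq> []" using p by auto
  have bp: "is_biproduct \<A> (seq_obj \<A> (spl cs) k) (seq_obj \<A> (spl cs') k) (seq_obj \<A> S k) (i k) (j k) (p k) (q k)"
    if "k \<le> Suc (length cs)" for k
    using D that p(3) by (auto simp: direct_sum_seq_def)
  obtain ds where ds: "direct_sum_seq \<A> (spl cs) (spl cs') (spl ds) i j p q"
    "dsum A A' (seq_obj \<A> S 0) (i 0) (j 0) (p 0) (q 0) B B' (seq_obj \<A> S (Suc (length cs))) (i (Suc (length cs))) (j (Suc (length cs)))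
       (p (Suc (length cs))) (q (Suc (length cs))) cs cs' ds"
    by (rule ex_direct_sum[OF p bp]) auto
  have "S = spl ds"
  proof (rule nth_equalityI)
    show "length S = length (spl ds)" using D ds(1) by (simp add: direct_sum_seq_def)
    fix k assume "k < length S"
    then have k: "k < Suc (length cs)" using D p(3) by (simp add: direct_sum_seq_def)
    have b: "is_biproduct \<A> (seq_obj \<A> (spl cs) (Suc k)) (seq_obj \<A> (spl cs') (Suc k)) (seq_obj \<A> S (Suc k)) (i (Suc k)) (j (Suc k)) (p (Suc k)) (q (Suc k))"
      using bp[of "Suc k"] k by simp
    have b2: "is_biproduct \<A> (seq_obj \<A> (spl cs) (Suc k)) (seq_obj \<A> (spl cs') (Suc k)) (seq_obj \<A> (spl ds) (Suc k)) (i (Suc k)) (j (Suc k)) (p (Suc k)) (q (Suc k))"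
      using ds(1) k p(3) by (auto simp: direct_sum_seq_def)
    have o: "seq_obj \<A> S (Suc k) = seq_obj \<A> (spl ds) (Suc k)" using biprodD(12)[OF b] biprodD(12)[OF b2] by simp
    show "S ! k = spl ds ! k"
      by (rule biprod_coeqI[OF b]) (use D ds(1) k p(3) o in \<open>auto simp: direct_sum_seq_def Hom_def\<close>)
  qed
  then show thesis using that ds(2) by blast
qed

lemma ex_dsum:
  assumes p: "path A B cs" "path A' B' cs'" "cs \<noteq> []" "length cs' = length cs"
    and bA: "is_biproduct \<A> A A' SA iA jA pA qA" and bB: "is_biproduct \<A> B B' SB iB jB pB qB"
  obtains ds i j p q where "dsum A A' SA iA jA pA qA B B' SB iB jB pB qB cs cs' ds"
    "direct_sum_seq \<A> (spl cs) (spl cs') (spl ds) i j p q"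
    "i 0 = iA" "j 0 = jA" "p 0 = pA" "q 0 = qA"
    "i (Suc (length cs)) = iB" "j (Suc (length cs)) = jB" "p (Suc (length cs)) = pB" "q (Suc (length cs)) = qB"
proof -
  let ?t = "length cs"
  have ne: "cs' \<noteq> []" using p by auto
  note so = seq_obj_splice[OF p(1,3)] seq_obj_splice[OF p(2) ne]
  have "\<exists>T. is_biproduct \<A> (seq_obj \<A> (spl cs) k) (seq_obj \<A> (spl cs') k) (fst T) (fst (snd T)) (fst (snd (snd T)))
         (fst (snd (snd (snd T)))) (snd (snd (snd (snd T))))
       \<and> (k = 0 \<longrightarrow> T = (SA, iA, jA, pA, qA)) \<and> (k = Suc ?t \<longrightarrow> T = (SB, iB, jB, pB, qB))"
    if "k \<le> Suc ?t" for k
  proof -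
    consider "k = 0" | "k = Suc ?t" | l where "k = Suc l" "l < ?t" using \<open>k \<le> Suc ?t\<close> by (cases k) (auto simp: le_eq_less_or_eq)
    then show ?thesis
    proof cases
      case 1
      then show ?thesis using bA so by (intro exI[of _ "(SA, iA, jA, pA, qA)"]) simp
    next
      case 2
      then show ?thesis using bB so p by (intro exI[of _ "(SB, iB, jB, pB, qB)"]) simp
    next
      case 3
      then have "conf (cs ! l)" "conf (cs' ! l)" using path_nth[OF p(1), of l] path_nth[OF p(2), of l] p(4) by simp_all
      then have C: "seq_obj \<A> (spl cs) k \<in> \<C>" "seq_obj \<A> (spl cs') k \<in> \<C>" using so 3 p(4) by simp_all
      obtain T i' j' p' q' where "is_biproduct \<A> (seq_obj \<A> (spl cs) k) (seq_obj \<A> (spl cs') k) T i' j' p' q'"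
        by (rule ex_biprod_C[OF C])
      then show ?thesis using 3 by (intro exI[of _ "(T, i', j', p', q')"]) simp
    qed
  qed
  then obtain T where T: "\<And>k. k \<le> Suc ?t \<Longrightarrow> is_biproduct \<A> (seq_obj \<A> (spl cs) k) (seq_obj \<A> (spl cs') k) (fst (T k)) (fst (snd (T k))) (fst (snd (snd (T k))))
         (fst (snd (snd (snd (T k))))) (snd (snd (snd (snd (T k)))))
       \<and> (k = 0 \<longrightarrow> T k = (SA, iA, jA, pA, qA)) \<and> (k = Suc ?t \<longrightarrow> T k = (SB, iB, jB, pB, qB))"
    by metis
  have bp: "is_biproduct \<A> (seq_obj \<A> (spl cs) k) (seq_obj \<A> (spl cs') k) (fst (T k)) (fst (snd (T k))) (fst (snd (snd (T k))))
         (fst (snd (snd (snd (T k))))) (snd (snd (snd (snd (T k)))))" if "k \<le> Suc ?t" for k using T[OF that] by blast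
  obtain ds where ds: "direct_sum_seq \<A> (spl cs) (spl cs') (spl ds) (\<lambda>k. fst (snd (T k))) (\<lambda>k. fst (snd (snd (T k))))
      (\<lambda>k. fst (snd (snd (snd (T k))))) (\<lambda>k. snd (snd (snd (snd (T k)))))"
    "dsum A A' (fst (T 0)) (fst (snd (T 0))) (fst (snd (snd (T 0)))) (fst (snd (snd (snd (T 0))))) (snd (snd (snd (snd (T 0)))))
      B B' (fst (T (Suc ?t))) (fst (snd (T (Suc ?t)))) (fst (snd (snd (T (Suc ?t))))) (fst (snd (snd (snd (T (Suc ?t))))))
      (snd (snd (snd (snd (T (Suc ?t)))))) cs cs' ds"
    by (rule ex_direct_sum[OF p bp]) auto
  show thesis
    by (rule that[OF _ ds(1)]) (use ds(2) T[of 0] T[of "Suc ?t"] in auto)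
qed

lemma pushout_seqD:
  assumes "pushout_seq \<A> a (spl cs) F" "path A B cs" "cs \<noteq> []" "a \<in> arrs \<A>" "src \<A> a = B" "tgt \<A> a \<in> \<C>"
  obtains ds where "F = spl ds" "path A (tgt \<A> a) ds" "lmor a (idn \<A> A) cs ds"
proof -
  obtain cs' c where csc: "cs = cs' @ [c]" using assms(3) rev_exhaust by blast
  then obtain d where "F = spl (cs' @ [d])" "cm a (idn \<A> (cob c)) c d"
    using pushout_seq_splice[of A B cs' c a F] assms by auto
  then show thesis using that path_push_std[of A B cs' c a d] lmor_push_std[of A B cs' c a d] assms csc by auto
qed

lemma pullback_seqD:
  assumes "pullback_seq \<A> h (spl cs) F" "path A B cs" "cs \<noteq> []" "h \<in> arrs \<A>" "tgt \<A> h = A" "src \<A> h \<in> \<C>"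
  obtains ds where "F = spl ds" "path (src \<A> h) B ds" "lmor (idn \<A> B) h ds cs"
proof -
  obtain cs' c where csc: "cs = c # cs'" using assms(3) by (cases cs) auto
  then obtain d where "F = spl (d # cs')" "cm (idn \<A> (kob c)) h d c"
    using pullback_seq_splice[of A B c cs' h F] assms by auto
  then show thesis using that path_pull_std[of A B c cs' h d] lmor_pull_std[of A B c cs' h d] assms(2) unfolding csc by blast
qed

lemma ex_pushout_seq:
  assumes "path A B cs" "cs \<noteq> []" "a \<in> arrs \<A>" "src \<A> a = B" "tgt \<A> a \<in> \<C>"
  shows "\<exists>F. pushout_seq \<A> a (spl cs) F"
proof -
  obtain cs' c where csc: "cs = cs' @ [c]" using assms(2) rev_exhaust by blast
  have c: "conf c" "kob c = B" using assms csc by (auto simp: path_append)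
  obtain d where "cm a (idn \<A> (cob c)) c d" using ex_conf_push[OF c(1), of a] assms c by metis
  then show ?thesis using pushout_seq_splice[of A B cs' c a] assms csc by blast
qed

lemma ex_pullback_seq:
  assumes "path A B cs" "cs \<noteq> []" "h \<in> arrs \<A>" "tgt \<A> h = A" "src \<A> h \<in> \<C>"
  shows "\<exists>F. pullback_seq \<A> h (spl cs) F"
proof -
  obtain cs' c where csc: "cs = c # cs'" using assms(2) by (cases cs) auto
  have c: "conf c" "cob c = A" using assms csc by auto
  obtain d where "cm (idn \<A> (kob c)) h d c" using ex_conf_pull[OF c(1), of h] assms c by metis
  then show ?thesis using pullback_seq_splice[of A B c cs' h] assms csc by blast
qed

definition baer_val :: "'o \<Rightarrow> 'o \<Rightarrow> ('m \<times> 'm) list \<Rightarrow> ('m \<times> 'm) list \<Rightarrow> 'm ext \<Rightarrow> bool" where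
  "baer_val A B cs cs' x \<longleftrightarrow> (\<exists>SA iA jA pA qA SB iB jB pB qB ds.
     dsum A A SA iA jA pA qA B B SB iB jB pB qB cs cs' ds \<and> x = pull (iA \<boxplus> jA) (push (pB \<boxplus> qB) (cl ds)))"

lemma baer_val_step:
  assumes "lstep A B cs es" "lstep A B cs' es'" "baer_val A B cs cs' x" "baer_val A B es es' y" "cs \<noteq> []"
  shows "x = y"
proof -
  obtain SA iA jA pA qA SB iB jB pB qB ds where d: "dsum A A SA iA jA pA qA B B SB iB jB pB qB cs cs' ds"
    and x: "x = pull (iA \<boxplus> jA) (push (pB \<boxplus> qB) (cl ds))" using assms(3) by (auto simp: baer_val_def)
  obtain SA' iA' jA' pA' qA' SB' iB' jB' pB' qB' fs where e: "dsum A A SA' iA' jA' pA' qA' B B SB' iB' jB' pB' qB' es es' fs"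
    and y: "y = pull (iA' \<boxplus> jA') (push (pB' \<boxplus> qB') (cl fs))" using assms(4) by (auto simp: baer_val_def)
  have bA: "is_biproduct \<A> A A SA iA jA pA qA" and bB: "is_biproduct \<A> B B SB iB jB pB qB"
    and bA': "is_biproduct \<A> A A SA' iA' jA' pA' qA'" and bB': "is_biproduct \<A> B B SB' iB' jB' pB' qB'"
    and p: "path A B cs" "path SA SB ds" "path SA' SB' fs"
    and l: "lmor pB pA ds cs" "lmor qB qA ds cs'" "lmor iB' iA' es fs" "lmor jB' jA' es' fs"
    using d e by (simp_all add: dsum_def)
  have C: "A \<in> \<C>" "B \<in> \<C>" using path_C[OF p(1)] by auto
  have CS: "SA \<in> \<C>" "SB \<in> \<C>" "SA' \<in> \<C>" "SB' \<in> \<C>" using path_C[OF p(2)] path_C[OF p(3)] by auto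
  note [simp] = biprodD(3-19)[OF bA] biprodD(3-19)[OF bB] biprodD(3-19)[OF bA'] biprodD(3-19)[OF bB']
    biprod_cmp[OF bA] biprod_cmp[OF bB] biprod_cmp[OF bA'] biprod_cmp[OF bB'] C CS
  have ln: "length ds = length cs" "length cs' = length cs" using lmor_length[OF l(1)] lmor_length[OF l(2)] by auto
  have st: "lmor (idn \<A> B) (idn \<A> A) cs es" "lmor (idn \<A> B) (idn \<A> A) cs' es'"
    using assms(1,2) by (auto simp: lstep_def)
  have ne: "ds \<noteq> []" "cs' \<noteq> []" "fs \<noteq> []" using ln assms(5) lmor_length[OF st(1)] lmor_length[OF l(3)] by auto
  let ?b = "(iB' \<cdot> pB) \<boxplus> (jB' \<cdot> qB)" and ?a = "(iA' \<cdot> pA) \<boxplus> (jA' \<cdot> qA)"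
  have "lmor iB' iA' cs fs" "lmor jB' jA' cs' fs"
    using lmor_comp'[OF st(1) l(3) assms(5)] lmor_comp'[OF st(2) l(4) ne(2)] by simp_all
  then have "lmor (iB' \<cdot> pB) (iA' \<cdot> pA) ds fs" "lmor (jB' \<cdot> qB) (jA' \<cdot> qA) ds fs"
    using lmor_comp'[OF l(1) _ ne(1)] lmor_comp'[OF l(2) _ ne(1)] by blast+
  then have m: "lmor ?b ?a ds fs" by (rule lmor_plus[OF _ _ ne(1)])
  have E: "cl ds \<in> EXT (length ds) SA SB" "cl fs \<in> EXT (length fs) SA' SB'" using cl_Ext p ne by auto
  have "push (pB \<boxplus> qB) (cl ds) = push ((pB' \<boxplus> qB') \<cdot> ?b) (cl ds)" by simp
  also have "\<dots> = push (pB' \<boxplus> qB') (push ?b (cl ds))"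
    by (rule push_push[OF E(1), symmetric]) (simp_all add: C(2))
  also have "push ?b (cl ds) = pull ?a (cl fs)"
    by (rule push_pull_cl[OF m p(2) ne(1) p(3)])
  also have "push (pB' \<boxplus> qB') \<dots> = pull ?a (push (pB' \<boxplus> qB') (cl fs))"
    by (rule push_pull[OF E(2)]) (simp_all add: C)
  finally have "x = pull (iA \<boxplus> jA) (pull ?a (push (pB' \<boxplus> qB') (cl fs)))" unfolding x by simp
  also have "\<dots> = pull (?a \<cdot> (iA \<boxplus> jA)) (push (pB' \<boxplus> qB') (cl fs))"
    by (rule pull_pull[OF push_Ext[OF E(2), where B' = B]]) (simp_all add: C)
  also have "?a \<cdot> (iA \<boxplus> jA) = iA' \<boxplus> jA'" by simp
  finally show ?thesis unfolding y .
qed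

lemma ex_baer_val:
  assumes "path A B cs" "path A B cs'" "length cs' = length cs" "cs \<noteq> []"
  obtains x where "baer_val A B cs cs' x"
proof -
  have C: "A \<in> \<C>" "B \<in> \<C>" using path_C[OF assms(1)] by auto
  obtain SA iA jA pA qA where bA: "is_biproduct \<A> A A SA iA jA pA qA" by (rule ex_biprod_C[OF C(1) C(1)])
  obtain SB iB jB pB qB where bB: "is_biproduct \<A> B B SB iB jB pB qB" by (rule ex_biprod_C[OF C(2) C(2)])
  obtain ds where "dsum A A SA iA jA pA qA B B SB iB jB pB qB cs cs' ds"
    by (rule ex_dsum[OF assms(1,2,4,3) bA bB])
  then show thesis using that unfolding baer_val_def by blast
qed

lemma baer_val_eqv:
  assumes "eqv A B cs es" "path A B cs" "path A B cs'" "length cs' = length cs" "cs \<noteq> []"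
    "baer_val A B cs cs' x" "baer_val A B es cs' y"
  shows "x = y"
  using assms(1)[unfolded eqv_def] assms(7)
proof (induction arbitrary: y rule: rtranclp_induct)
  case base
  show ?case
    by (rule baer_val_step[of A B cs cs cs' cs']) (use base assms lmor_id in \<open>auto simp: lstep_def\<close>)
next
  case (step fs es)
  have f: "eqv A B cs fs" using step(1) by (simp add: eqv_def)
  have pf: "path A B fs" "length fs = length cs" using eqv_path[OF f assms(2)] eqv_length[OF f] by auto
  have fn: "fs \<noteq> []" using pf assms(5) by auto
  obtain z where z: "baer_val A B fs cs' z" by (rule ex_baer_val[OF pf(1) assms(3)]) (use pf fn assms in auto)
  have s: "lstep A B cs' cs'" using assms(3) lmor_id by (simp add: lstep_def)
  have en: "es \<noteq> []" using step(2) fn lmor_length by (fastforce simp: lstep_def)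
  from step(2) have "z = y"
    using baer_val_step[OF _ s z step(4) fn] baer_val_step[OF _ s step(4) z en] by blast
  then show ?case using step(3)[OF z] by simp
qed

lemma dsum_swap: "dsum A A' SA iA jA pA qA B B' SB iB jB pB qB cs cs' ds \<Longrightarrow>
  dsum A' A SA jA iA qA pA B' B SB jB iB qB pB cs' cs ds"
proof -
  have b: "is_biproduct \<A> Y X S j i q p" if b: "is_biproduct \<A> X Y S i j p q" for X Y S i j p q
    using b biprodD[OF b] plus_comm[of "i \<cdot> p" "j \<cdot> q"] by (simp add: is_biproduct_def)
  show "dsum A A' SA iA jA pA qA B B' SB iB jB pB qB cs cs' ds \<Longrightarrow> ?thesis"
    by (auto simp: dsum_def intro: b)
qed

lemma baer_val_swap: "baer_val A B cs cs' x \<Longrightarrow> baer_val A B cs' cs x"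
proof -
  assume "baer_val A B cs cs' x"
  then obtain SA iA jA pA qA SB iB jB pB qB ds where d: "dsum A A SA iA jA pA qA B B SB iB jB pB qB cs cs' ds"
    and x: "x = pull (iA \<boxplus> jA) (push (pB \<boxplus> qB) (cl ds))" by (auto simp: baer_val_def)
  have b: "is_biproduct \<A> A A SA iA jA pA qA" "is_biproduct \<A> B B SB iB jB pB qB" using d by (auto simp: dsum_def)
  have "iA \<boxplus> jA = jA \<boxplus> iA" "pB \<boxplus> qB = qB \<boxplus> pB"
    using plus_comm[of iA jA] plus_comm[of pB qB] biprodD[OF b(1)] biprodD[OF b(2)] by simp_all
  then show ?thesis using dsum_swap[OF d] x unfolding baer_val_def by metis
qed

lemma plus_cl:
  assumes p: "path A B cs" "path A B cs'" "length cs' = length cs" "cs \<noteq> []" and v: "baer_val A B cs cs' x"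
  shows "plus (cl cs) (cl cs') = x"
proof -
  have ne: "cs' \<noteq> []" using p by auto
  have C: "A \<in> \<C>" "B \<in> \<C>" using path_C[OF p(1)] by auto
  have key: "\<exists>fs. F = spl fs \<and> path A B fs \<and> cl fs = x"
    if E: "eqv A B cs es" "eqv A B cs' es'" and F: "is_baer_sum \<A> (spl es) (spl es') F" for es es' F
  proof -
    have pe: "path A B es" "path A B es'" "length es = length cs" "length es' = length cs" "es \<noteq> []" "length es' = length es"
      using eqv_path[OF E(1) p(1)] eqv_path[OF E(2) p(2)] eqv_length[OF E(1)] eqv_length[OF E(2)] p by auto
    have ne': "es' \<noteq> []" using pe by auto
    let ?t = "Suc (length es)"
    have s0: "seq_obj \<A> (spl es) 0 = A" "seq_obj \<A> (spl es) ?t = B"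
      using seq_obj_splice[OF pe(1,5)] by auto
    obtain S i j p q g h G where D: "direct_sum_seq \<A> (spl es) (spl es') S i j p q"
      and g: "g \<in> Hom \<A> (seq_obj \<A> S ?t) B" "g \<cdot> i ?t = idn \<A> B" "g \<cdot> j ?t = idn \<A> B"
      and h: "h \<in> Hom \<A> A (seq_obj \<A> S 0)" "p 0 \<cdot> h = idn \<A> A" "q 0 \<cdot> h = idn \<A> A"
      and G: "pushout_seq \<A> g S G" and Fp: "pullback_seq \<A> h G F"
      using F pe(5) s0 unfolding is_baer_sum_def by auto
    obtain ds where S: "S = spl ds" and ds: "dsum A A (seq_obj \<A> S 0) (i 0) (j 0) (p 0) (q 0) B B (seq_obj \<A> S ?t) (i ?t) (j ?t) (p ?t) (q ?t) es es' ds"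
      by (rule direct_sum_unique[OF pe(1,2,5,6) D])
    let ?S0 = "seq_obj \<A> S 0" and ?St = "seq_obj \<A> S ?t"
    have b: "is_biproduct \<A> A A ?S0 (i 0) (j 0) (p 0) (q 0)" "is_biproduct \<A> B B ?St (i ?t) (j ?t) (p ?t) (q ?t)"
      and pd: "path ?S0 ?St ds" and l: "lmor (i ?t) (i 0) es ds" using ds by (auto simp: dsum_def)
    have dn: "ds \<noteq> []" using lmor_length[OF l] pe by auto
    note b1 = biprodD(1-19)[OF b(1)] and b2 = biprodD(1-19)[OF b(2)]
    have gg: "g = p ?t \<boxplus> q ?t"
      by (rule biprod_coeqI[OF b(2)]) (use g b2 in \<open>simp_all add: Hom_def\<close>)
    have hh: "h = i 0 \<boxplus> j 0"
      by (rule biprod_eqI[OF b(1)]) (use h b1 in \<open>simp_all add: Hom_def\<close>)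
    obtain gs where gs: "G = spl gs" "path ?S0 B gs" "lmor g (idn \<A> ?S0) ds gs"
      by (rule pushout_seqD[OF G[unfolded S] pd dn]) (use g C in \<open>auto simp: Hom_def\<close>)
    have gn: "gs \<noteq> []" using lmor_length[OF gs(3)] dn by auto
    obtain fs where fs: "F = spl fs" "path A B fs" "lmor (idn \<A> B) h fs gs"
      by (rule pullback_seqD[OF Fp[unfolded gs(1)] gs(2) gn]) (use h C in \<open>auto simp: Hom_def\<close>)
    have "cl fs = pull h (cl gs)" by (rule pull_cl[OF gs(2) gn fs(3,2), symmetric])
    also have "cl gs = push g (cl ds)" by (rule push_cl[OF pd dn gs(3,2), symmetric])
    finally have "baer_val A B es es' (cl fs)" using ds unfolding baer_val_def gg hh by blast
    moreover obtain y where y: "baer_val A B es cs' y" by (rule ex_baer_val[OF pe(1) p(2)]) (use pe p in auto)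
    ultimately have "y = cl fs"
      using baer_val_eqv[OF E(2) p(2) pe(1) _ ne baer_val_swap[OF y] baer_val_swap] pe p by auto
    moreover have "x = y" by (rule baer_val_eqv[OF E(1) p(1,2,3,4) v y])
    ultimately show ?thesis using fs by auto
  qed
  have "\<exists>F. is_baer_sum \<A> (spl cs) (spl cs') F"
  proof -
    obtain SA iA jA pA qA where bA: "is_biproduct \<A> A A SA iA jA pA qA" and SA: "SA \<in> \<C>" by (rule ex_biprod_C[OF C(1) C(1)])
    obtain SB iB jB pB qB where bB: "is_biproduct \<A> B B SB iB jB pB qB" and SB: "SB \<in> \<C>" by (rule ex_biprod_C[OF C(2) C(2)])
    obtain ds i j p' q where ds: "dsum A A SA iA jA pA qA B B SB iB jB pB qB cs cs' ds"
      and D: "direct_sum_seq \<A> (spl cs) (spl cs') (spl ds) i j p' q"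
      and e: "i 0 = iA" "j 0 = jA" "p' 0 = pA" "q 0 = qA"
       "i (Suc (length cs)) = iB" "j (Suc (length cs)) = jB" "p' (Suc (length cs)) = pB" "q (Suc (length cs)) = qB"
      by (rule ex_dsum[OF p(1,2,4,3) bA bB])
    have pd: "path SA SB ds" and l: "lmor iB iA cs ds" using ds by (auto simp: dsum_def)
    have dn: "ds \<noteq> []" "length ds = length cs" using lmor_length[OF l] p by auto
    note b1 = biprodD(1-19)[OF bA] and b2 = biprodD(1-19)[OF bB]
    obtain G where G: "pushout_seq \<A> (pB \<boxplus> qB) (spl ds) G"
      using ex_pushout_seq[OF pd dn(1), of "pB \<boxplus> qB"] b2 C by auto
    obtain gs where gs: "G = spl gs" "path SA B gs" "lmor (pB \<boxplus> qB) (idn \<A> SA) ds gs"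
      by (rule pushout_seqD[OF G pd dn(1)]) (use b2 C in auto)
    have gn: "gs \<noteq> []" using lmor_length[OF gs(3)] dn by auto
    obtain F where F: "pullback_seq \<A> (iA \<boxplus> jA) (spl gs) F"
      using ex_pullback_seq[OF gs(2) gn, of "iA \<boxplus> jA"] b1 C by auto
    have so: "seq_obj \<A> (spl cs) 0 = A" "seq_obj \<A> (spl cs) (Suc (length cs)) = B"
       "seq_obj \<A> (spl ds) 0 = SA" "seq_obj \<A> (spl ds) (Suc (length cs)) = SB"
      using seq_obj_splice[OF p(1,4)] seq_obj_splice[OF pd dn(1)] dn(2) by auto
    have "is_baer_sum \<A> (spl cs) (spl cs') F"
      unfolding is_baer_sum_def length_splice[OF p(4)] so
      by (rule exI[of _ "spl ds"], rule exI[of _ i], rule exI[of _ j], rule exI[of _ p'], rule exI[of _ q],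
          rule exI[of _ "pB \<boxplus> qB"], rule exI[of _ "iA \<boxplus> jA"], rule exI[of _ G])
        (use D e b1 b2 G F gs(1) so in \<open>simp add: Hom_def\<close>)
    then show ?thesis by blast
  qed
  then obtain F0 where F0: "is_baer_sum \<A> (spl cs) (spl cs') F0" ..
  obtain f0 where f0: "F0 = spl f0" "path A B f0" "cl f0 = x"
    using key[OF _ _ F0] by (auto simp: eqv_def)
  have "yoneda_class \<A> \<C> F = yoneda_class \<A> \<C> (spl f0)"
    if E: "E \<in> yoneda_class \<A> \<C> (spl cs)" "E' \<in> yoneda_class \<A> \<C> (spl cs')" "is_baer_sum \<A> E E' F" for E E' F
  proof -
    obtain es es' where "eqv A B cs es" "E = spl es" "eqv A B cs' es'" "E' = spl es'"
      using E(1,2) unfolding yoneda_class_splice[OF p(1,4)] yoneda_class_splice[OF p(2) ne] by auto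
    then obtain fs where fs: "F = spl fs" "cl fs = x" using key E(3) by blast
    then have "cl fs = cl f0" using f0(3) by simp
    then show ?thesis using fs(1) by (simp add: cl_def ext_of_def)
  qed
  moreover have "spl cs \<in> yoneda_class \<A> \<C> (spl cs)" "spl cs' \<in> yoneda_class \<A> \<C> (spl cs')"
    by (simp_all add: yoneda_class_def Let_def)
  ultimately have "\<Union>{yoneda_class \<A> \<C> F | E E' F. E \<in> yoneda_class \<A> \<C> (spl cs) \<and> E' \<in> yoneda_class \<A> \<C> (spl cs') \<and> is_baer_sum \<A> E E' F}
      = yoneda_class \<A> \<C> (spl f0)"
    using F0 by blast
  then show ?thesis using f0(3) by (simp add: cl_def ext_of_def)
qed

section \<open>Ext groups\<close>

abbreviation grp where "grp t A B \<equiv> ext_group \<A> \<C> t A B"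
abbreviation zr where "zr t A B \<equiv> \<one>\<^bsub>grp t A B\<^esub>"

lemma carrier_grp [simp]: "carrier (grp t A B) = EXT t A B" "mult (grp t A B) = plus"
  by (simp_all add: ext_group_def)

lemma plus_dsum:
  assumes d: "dsum A A SA iA jA pA qA B B SB iB jB pB qB cs cs' ds" and ne: "cs \<noteq> []"
  shows "plus (cl cs) (cl cs') = pull (iA \<boxplus> jA) (push (pB \<boxplus> qB) (cl ds))"
proof -
  have p: "path A B cs" "path A B cs'" "lmor pB pA ds cs" "lmor qB qA ds cs'" using d by (auto simp: dsum_def)
  have "length cs' = length cs" using lmor_length[OF p(3)] lmor_length[OF p(4)] by simp
  then show ?thesis using plus_cl[OF p(1,2) _ ne] d unfolding baer_val_def by blast
qed

text \<open>All group laws follow from this identity: a class \<open>w\<close> with values in \<open>B \<oplus> B\<close> is the pair of its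
  components, and the sum of the components is the image of \<open>w\<close> under the codiagonal.\<close>

lemma plus_components:
  assumes w: "w \<in> EXT t A S" and b: "is_biproduct \<A> B B S i j p q" and C: "A \<in> \<C>" "B \<in> \<C>"
  shows "plus (push p w) (push q w) = push (p \<boxplus> q) w"
  using w
proof (cases rule: ExtE)
  case (arr f)
  then show ?thesis using biprodD[OF b] by simp
next
  case (seq ws)
  note b1 = biprodD(1-19)[OF b]
  have S: "S \<in> \<C>" by (rule biprod_C[OF b C(2) C(2)])
  obtain SA iA jA pA qA where bA: "is_biproduct \<A> A A SA iA jA pA qA" and SA: "SA \<in> \<C>" by (rule ex_biprod_C[OF C(1) C(1)])
  note a1 = biprodD(1-19)[OF bA]
  obtain cs where cs: "path A (tgt \<A> p) cs" "length cs = length ws" "lmor p (idn \<A> A) ws cs"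
    by (rule lmor_push_ex[OF seq(2,3), of p]) (use b1 C in auto)
  obtain cs' where cs': "path A (tgt \<A> q) cs'" "length cs' = length ws" "lmor q (idn \<A> A) ws cs'"
    by (rule lmor_push_ex[OF seq(2,3), of q]) (use b1 C in auto)
  have p: "path A B cs" "path A B cs'" using cs cs' b1 by auto
  have ne: "cs \<noteq> []" "length cs' = length cs" using cs(2) cs'(2) seq(3) by auto
  obtain ds i' j' p' q' where ds: "dsum A A SA iA jA pA qA B B S i j p q cs cs' ds"
    by (rule ex_dsum[OF p ne bA b])
  then have l: "lmor i iA cs ds" "lmor j jA cs' ds" and pd: "path SA S ds" by (auto simp: dsum_def)
  have dn: "ds \<noteq> []" using lmor_length[OF l(1)] ne by auto
  have "lmor ((i \<cdot> p) \<boxplus> (j \<cdot> q)) ((iA \<cdot> idn \<A> A) \<boxplus> (jA \<cdot> idn \<A> A)) ws ds"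
    using lmor_comp'[OF cs(3) l(1) seq(3)] lmor_comp'[OF cs'(3) l(2) seq(3)] by (intro lmor_plus) (use seq in auto)
  then have "lmor (idn \<A> S) (iA \<boxplus> jA) ws ds" using biprodD(20)[OF b] a1 by simp
  then have "pull (iA \<boxplus> jA) (cl ds) = cl ws" by (rule pull_cl[OF pd dn _ seq(2)])
  moreover have "push p w = cl cs" "push q w = cl cs'"
    using push_cl[OF seq(2,3) cs(3) p(1)] push_cl[OF seq(2,3) cs'(3) p(2)] seq(5) by auto
  moreover have "pull (iA \<boxplus> jA) (push (p \<boxplus> q) (cl ds)) = push (p \<boxplus> q) (pull (iA \<boxplus> jA) (cl ds))"
    by (rule push_pull[OF cl_Ext[OF pd dn], symmetric]) (use b1 a1 C in auto)
  ultimately show ?thesis using plus_dsum[OF ds ne(1)] seq(5) by simp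
qed

lemma ex_pair:
  assumes x: "x \<in> EXT t A B" and y: "y \<in> EXT t A B'" and b: "is_biproduct \<A> B B' S i j p q"
    and C: "A \<in> \<C>" "B \<in> \<C>" "B' \<in> \<C>"
  obtains w where "w \<in> EXT t A S" "push p w = x" "push q w = y"
  using x
proof (cases rule: ExtE)
  case (arr f)
  obtain g where g: "g \<in> arrs \<A>" "src \<A> g = A" "tgt \<A> g = B'" "y = Ext_arr g" using y arr(1) by (auto simp: Ext_0)
  note [simp] = biprodD(1-19)[OF b] biprod_cmp[OF b] arr g
  show thesis
    by (rule that[of "Ext_arr ((i \<cdot> f) \<boxplus> (j \<cdot> g))"]) (simp_all add: Ext_0)
next
  case (seq cs)
  obtain cs' where cs': "path A B' cs'" "length cs' = t" "y = cl cs'" using y seq(1) by (auto simp: Ext_pos)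
  note b1 = biprodD(1-19)[OF b]
  have S: "S \<in> \<C>" by (rule biprod_C[OF b C(2) C(3)])
  obtain SA iA jA pA qA where bA: "is_biproduct \<A> A A SA iA jA pA qA" and SA: "SA \<in> \<C>" by (rule ex_biprod_C[OF C(1) C(1)])
  note a1 = biprodD(1-19)[OF bA]
  have l0: "length cs' = length cs" using cs' seq by simp
  then have ne': "cs' \<noteq> []" using seq by auto
  obtain ds i' j' p' q' where ds: "dsum A A SA iA jA pA qA B B' S i j p q cs cs' ds"
    by (rule ex_dsum[OF seq(2) cs'(1) seq(3) l0 bA b])
  then have l: "lmor p pA ds cs" "lmor q qA ds cs'" and pd: "path SA S ds" by (auto simp: dsum_def)
  have dn: "ds \<noteq> []" "length ds = t" using lmor_length[OF l(1)] seq by auto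
  have E: "cl ds \<in> EXT t SA S" using cl_Ext[OF pd dn(1)] dn by simp
  let ?h = "iA \<boxplus> jA"
  have "push p (pull ?h (cl ds)) = pull ?h (push p (cl ds))"
    by (rule push_pull[OF E]) (use a1 b1 C in auto)
  also have "\<dots> = pull ?h (pull pA (cl cs))" using push_pull_cl[OF l(1) pd dn(1) seq(2)] by simp
  also have "\<dots> = pull (pA \<cdot> ?h) x" unfolding seq(5)
    by (rule pull_pull[OF cl_Ext[OF seq(2,3)]]) (use a1 SA C in auto)
  also have "\<dots> = x" using pull_id[OF x C(1)] a1 by simp
  finally have 1: "push p (pull ?h (cl ds)) = x" .
  have "push q (pull ?h (cl ds)) = pull ?h (push q (cl ds))"
    by (rule push_pull[OF E]) (use a1 b1 C in auto)
  also have "\<dots> = pull ?h (pull qA (cl cs'))" using push_pull_cl[OF l(2) pd dn(1) cs'(1)] by simp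
  also have "\<dots> = pull (qA \<cdot> ?h) y" unfolding cs'(3)
    by (rule pull_pull[OF cl_Ext[OF cs'(1) ne']]) (use a1 SA C in auto)
  also have "\<dots> = y" using pull_id[OF y C(1)] a1 by simp
  finally have 2: "push q (pull ?h (cl ds)) = y" .
  have "pull ?h (cl ds) \<in> EXT t A S" by (rule pull_Ext[OF E]) (use a1 C in auto)
  then show thesis using that 1 2 by blast
qed

lemma push_add:
  assumes x: "x \<in> EXT t A B" and a: "a \<in> arrs \<A>" "a' \<in> arrs \<A>" "src \<A> a = B" "src \<A> a' = B" "tgt \<A> a = B'" "tgt \<A> a' = B'"
    and C: "A \<in> \<C>" "B \<in> \<C>" "B' \<in> \<C>"
  shows "push (a \<boxplus> a') x = plus (push a x) (push a' x)"
proof -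
  obtain S i j p q where b: "is_biproduct \<A> B' B' S i j p q" and S: "S \<in> \<C>" by (rule ex_biprod_C[OF C(3) C(3)])
  note [simp] = biprodD(3-19)[OF b] biprod_cmp[OF b] a
  let ?u = "(i \<cdot> a) \<boxplus> (j \<cdot> a')"
  have w: "push ?u x \<in> EXT t A S" by (rule push_Ext[OF x]) (use S in simp_all)
  have "push p (push ?u x) = push (p \<cdot> ?u) x" "push q (push ?u x) = push (q \<cdot> ?u) x"
    "push (p \<boxplus> q) (push ?u x) = push ((p \<boxplus> q) \<cdot> ?u) x"
    by (rule push_push[OF x]; use S C in simp)+
  then show ?thesis using plus_components[OF w b C(1,3)] by simp
qed

lemma pull_add:
  assumes x: "x \<in> EXT t A B" and a: "a \<in> arrs \<A>" "a' \<in> arrs \<A>" "src \<A> a = A'" "src \<A> a' = A'" "tgt \<A> a = A" "tgt \<A> a' = A"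
    and C: "A \<in> \<C>" "B \<in> \<C>" "A' \<in> \<C>"
  shows "pull (a \<boxplus> a') x = plus (pull a x) (pull a' x)"
  using x
proof (cases rule: ExtE)
  case (arr f)
  then show ?thesis using a by simp
next
  case (seq cs)
  obtain SB i j p q where b: "is_biproduct \<A> B B SB i j p q" and SB: "SB \<in> \<C>" by (rule ex_biprod_C[OF C(2) C(2)])
  obtain SA iA jA pA qA where bA: "is_biproduct \<A> A A SA iA jA pA qA" and SA: "SA \<in> \<C>" by (rule ex_biprod_C[OF C(1) C(1)])
  note [simp] = biprodD(3-19)[OF b] biprod_cmp[OF b] a biprodD(3-19)[OF bA] biprod_cmp[OF bA] C SA SB
  obtain ds i' j' p' q' where ds: "dsum A A SA iA jA pA qA B B SB i j p q cs cs ds"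
    by (rule ex_dsum[OF seq(2) seq(2) seq(3) refl bA b])
  then have l: "lmor p pA ds cs" "lmor q qA ds cs" and pd: "path SA SB ds" by (auto simp: dsum_def)
  have dn: "ds \<noteq> []" "length ds = t" using lmor_length[OF l(1)] seq by auto
  have l3: "lmor (p \<boxplus> q) (pA \<boxplus> qA) ds cs" by (rule lmor_plus[OF l dn(1)])
  have E: "cl ds \<in> EXT t SA SB" using cl_Ext[OF pd dn(1)] dn by simp
  let ?u = "(iA \<cdot> a) \<boxplus> (jA \<cdot> a')"
  have w: "pull ?u (cl ds) \<in> EXT t A' SB" by (rule pull_Ext[OF E]) simp_all
  have "push h (pull ?u (cl ds)) = pull (g \<cdot> ?u) x"
    if "lmor h g ds cs" "h \<in> arrs \<A>" "src \<A> h = SB" "tgt \<A> h = B" "g \<in> arrs \<A>" "src \<A> g = SA" "tgt \<A> g = A" for h g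
  proof -
    have "push h (pull ?u (cl ds)) = pull ?u (push h (cl ds))"
      by (rule push_pull[OF E]) (use that in simp_all)
    also have "\<dots> = pull ?u (pull g (cl cs))" using push_pull_cl[OF that(1) pd dn(1) seq(2)] by simp
    also have "\<dots> = pull (g \<cdot> ?u) x" unfolding seq(5)
      by (rule pull_pull[OF cl_Ext[OF seq(2,3)]]) (use that in simp_all)
    finally show ?thesis .
  qed
  note 1 = this
  have "push p (pull ?u (cl ds)) = pull a x" "push q (pull ?u (cl ds)) = pull a' x"
    "push (p \<boxplus> q) (pull ?u (cl ds)) = pull (a \<boxplus> a') x"
    using 1[OF l(1)] 1[OF l(2)] 1[OF l3] by simp_all
  then show ?thesis using plus_components[OF w b C(3,2)] by simp
qed

lemma plusE:
  assumes x: "x \<in> EXT t A B" and y: "y \<in> EXT t A B" and C: "A \<in> \<C>" "B \<in> \<C>"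
  obtains S i j p q w where "is_biproduct \<A> B B S i j p q" "S \<in> \<C>" "w \<in> EXT t A S" "push p w = x" "push q w = y"
    "plus x y = push (p \<boxplus> q) w"
proof -
  obtain S i j p q where b: "is_biproduct \<A> B B S i j p q" and S: "S \<in> \<C>" by (rule ex_biprod_C[OF C(2) C(2)])
  obtain w where "w \<in> EXT t A S" "push p w = x" "push q w = y" by (rule ex_pair[OF x y b C C(2)])
  then show thesis using that[OF b S, of w] plus_components[OF _ b C, of w t] by simp
qed

lemma plus_Ext:
  assumes x: "x \<in> EXT t A B" and y: "y \<in> EXT t A B" and C: "A \<in> \<C>" "B \<in> \<C>"
  shows "plus x y \<in> EXT t A B"
proof -
  obtain S i j p q w where b: "is_biproduct \<A> B B S i j p q" and w: "w \<in> EXT t A S" "plus x y = push (p \<boxplus> q) w"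
    by (rule plusE[OF x y C])
  show ?thesis unfolding w(2) by (rule push_Ext[OF w(1)]) (use biprodD[OF b] C in simp_all)
qed

lemma push_plus:
  assumes x: "x \<in> EXT t A B" and y: "y \<in> EXT t A B" and C: "A \<in> \<C>" "B \<in> \<C>" "B' \<in> \<C>"
    and a: "a \<in> arrs \<A>" "src \<A> a = B" "tgt \<A> a = B'"
  shows "push a (plus x y) = plus (push a x) (push a y)"
proof -
  obtain S i j p q w where b: "is_biproduct \<A> B B S i j p q" and S: "S \<in> \<C>" and w: "w \<in> EXT t A S" "push p w = x" "push q w = y" "plus x y = push (p \<boxplus> q) w"
    by (rule plusE[OF x y C(1,2)])
  note [simp] = biprodD(3-19)[OF b] a C S
  have "push a (push (p \<boxplus> q) w) = push (a \<cdot> (p \<boxplus> q)) w" "push a (push p w) = push (a \<cdot> p) w" "push a (push q w) = push (a \<cdot> q) w"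
    by (rule push_push[OF w(1)]; simp)+
  moreover have "push ((a \<cdot> p) \<boxplus> (a \<cdot> q)) w = plus (push (a \<cdot> p) w) (push (a \<cdot> q) w)"
    by (rule push_add[OF w(1), where B' = B']) simp_all
  ultimately show ?thesis using w by simp
qed

lemma pull_plus:
  assumes x: "x \<in> EXT t A B" and y: "y \<in> EXT t A B" and C: "A \<in> \<C>" "B \<in> \<C>" "A' \<in> \<C>"
    and a: "a \<in> arrs \<A>" "tgt \<A> a = A" "src \<A> a = A'"
  shows "pull a (plus x y) = plus (pull a x) (pull a y)"
proof -
  obtain S i j p q w where b: "is_biproduct \<A> B B S i j p q" and S: "S \<in> \<C>" and w: "w \<in> EXT t A S" "push p w = x" "push q w = y" "plus x y = push (p \<boxplus> q) w"
    by (rule plusE[OF x y C(1,2)])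
  note [simp] = biprodD(3-19)[OF b] a C S
  have "push p (pull a w) = pull a (push p w)" "push q (pull a w) = pull a (push q w)" "push (p \<boxplus> q) (pull a w) = pull a (push (p \<boxplus> q) w)"
    by (rule push_pull[OF w(1)]; simp)+
  moreover have "pull a w \<in> EXT t A' S" by (rule pull_Ext[OF w(1)]) simp_all
  ultimately show ?thesis using plus_components[OF _ b C(3,2), of "pull a w" t] w by simp
qed

lemma cov_plus:
  assumes x: "x \<in> EXT t A (cob c)" and y: "y \<in> EXT t A (cob c)" and c: "conf c" and C: "A \<in> \<C>"
  shows "cov c (plus x y) = plus (cov c x) (cov c y)"
proof -
  have C2: "cob c \<in> \<C>" "mob c \<in> \<C>" "kob c \<in> \<C>" using c by simp_all
  obtain S i j p q w where b: "is_biproduct \<A> (cob c) (cob c) S i j p q" and S: "S \<in> \<C>" and w: "w \<in> EXT t A S" "push p w = x" "push q w = y" "plus x y = push (p \<boxplus> q) w"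
    by (rule plusE[OF x y C C2(1)])
  obtain SX iX jX pX qX where bX: "is_biproduct \<A> (mob c) (mob c) SX iX jX pX qX" by (rule ex_biprod_C[OF C2(2) C2(2)])
  obtain SK iK jK pK qK where bK: "is_biproduct \<A> (kob c) (kob c) SK iK jK pK qK" by (rule ex_biprod_C[OF C2(3) C2(3)])
  obtain d where d: "conf d" "kob d = SK" "cob d = S" "cm pK p d c" "cm qK q d c"
    by (rule dsum_conf[OF c c bK bX b])
  have w': "w \<in> EXT t A (cob d)" using w d by simp
  have "cov c (push p w) = push pK (cov d w)" "cov c (push q w) = push qK (cov d w)"
    "cov c (push (p \<boxplus> q) w) = push (pK \<boxplus> qK) (cov d w)"
    using push_cov[OF w' d(4) C] push_cov[OF w' d(5) C] push_cov[OF w' cm_plus[OF d(4,5)] C] by simp_all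
  moreover have "push (pK \<boxplus> qK) (cov d w) = plus (push pK (cov d w)) (push qK (cov d w))"
    by (rule push_add[OF cov_Ext[OF w' d(1) refl C], where B' = "kob c"]) (use biprodD[OF bK] d C C2 biprod_C[OF bK] in auto)
  ultimately show ?thesis using w by simp
qed

lemma con_plus:
  assumes x: "x \<in> EXT t (kob c) B" and y: "y \<in> EXT t (kob c) B" and c: "conf c" and C: "B \<in> \<C>"
  shows "con c (plus x y) = plus (con c x) (con c y)"
proof -
  have C2: "cob c \<in> \<C>" "kob c \<in> \<C>" using c by simp_all
  obtain S i j p q w where b: "is_biproduct \<A> B B S i j p q" and S: "S \<in> \<C>" and w: "w \<in> EXT t (kob c) S" "push p w = x" "push q w = y" "plus x y = push (p \<boxplus> q) w"
    by (rule plusE[OF x y C2(2) C])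
  note [simp] = biprodD(3-19)[OF b] C S
  have "push p (con c w) = con c (push p w)" "push q (con c w) = con c (push q w)" "push (p \<boxplus> q) (con c w) = con c (push (p \<boxplus> q) w)"
    by (rule push_con[OF w(1) c]; simp)+
  moreover have "con c w \<in> EXT (Suc t) (cob c) S" by (rule con_Ext[OF w(1) c]) simp_all
  ultimately show ?thesis using plus_components[OF _ b C2(1) C, of "con c w" "Suc t"] w by simp
qed

lemma ex_Ext: "A \<in> \<C> \<Longrightarrow> B \<in> \<C> \<Longrightarrow> \<exists>x. x \<in> EXT t A B"
proof (induction t arbitrary: B)
  case 0
  then show ?case using Ext_0[of "Ext_arr (zero_arr \<A> A B)" A B] by auto
next
  case (Suc t)
  obtain S i j p q where b: "is_biproduct \<A> B B S i j p q" by (rule ex_biprod_C[OF Suc(3) Suc(3)])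
  have c: "conf (i, q)" "cob (i, q) = B" "kob (i, q) = B" using conf_biproduct[OF b] biprodD[OF b] Suc by simp_all
  obtain w where "w \<in> EXT t A B" using Suc by blast
  then show ?case using cov_Ext[of w t A B "(i, q)"] c Suc by auto
qed

lemma comm_group_grp:
  assumes C: "A \<in> \<C>" "B \<in> \<C>"
  shows "comm_group (grp t A B)"
proof -
  define z where "z = zero_arr \<A> B B"
  have z: "z \<in> arrs \<A>" "src \<A> z = B" "tgt \<A> z = B" using C by (simp_all add: z_def)
  have comm: "plus x y = plus y x" if x: "x \<in> EXT t A B" and y: "y \<in> EXT t A B" for x y
  proof -
    obtain S i j p q w where b: "is_biproduct \<A> B B S i j p q" and S: "S \<in> \<C>" and w: "w \<in> EXT t A S" "push p w = x" "push q w = y" "plus x y = push (p \<boxplus> q) w"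
      by (rule plusE[OF x y C])
    note [simp] = biprodD(3-19)[OF b] C S
    have "plus y x = push (q \<boxplus> p) w" using push_add[OF w(1), of q p B] w by simp
    then show ?thesis using w(4) plus_comm[of p q] by simp
  qed
  have asc: "plus (plus x y) v = plus x (plus y v)" if x: "x \<in> EXT t A B" and y: "y \<in> EXT t A B" and v: "v \<in> EXT t A B" for x y v
  proof -
    obtain S i j p q w where b: "is_biproduct \<A> B B S i j p q" and S: "S \<in> \<C>" and w: "w \<in> EXT t A S" "push p w = y" "push q w = v" "plus y v = push (p \<boxplus> q) w"
      by (rule plusE[OF y v C])
    obtain T i' j' p' q' where b': "is_biproduct \<A> B S T i' j' p' q'" and T: "T \<in> \<C>" by (rule ex_biprod_C[OF C(2) S])
    obtain u where u: "u \<in> EXT t A T" "push p' u = x" "push q' u = w" by (rule ex_pair[OF x w(1) b' C S])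
    note [simp] = biprodD(3-19)[OF b] biprodD(3-19)[OF b'] C S T
    have y': "push (p \<cdot> q') u = y" "push (q \<cdot> q') u = v"
      using push_push[OF u(1), of q' p] push_push[OF u(1), of q' q] u w by simp_all
    have ap: "push (a \<boxplus> a') u = plus (push a u) (push a' u)"
      if "a \<in> arrs \<A>" "a' \<in> arrs \<A>" "src \<A> a = T" "src \<A> a' = T" "tgt \<A> a = B" "tgt \<A> a' = B" for a a'
      by (rule push_add[OF u(1), where B' = B]) (use that in simp_all)
    have "plus (plus x y) v = push ((p' \<boxplus> (p \<cdot> q')) \<boxplus> (q \<cdot> q')) u" using ap y' u by simp
    also have "\<dots> = push (p' \<boxplus> ((p \<cdot> q') \<boxplus> (q \<cdot> q'))) u" by (simp add: plus_assoc)
    also have "\<dots> = plus x (plus y v)" using ap y' u by simp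
    finally show ?thesis .
  qed
  have zE: "push z x \<in> EXT t A B" if "x \<in> EXT t A B" for x by (rule push_Ext[OF that]) (use z C in simp_all)
  have zz: "push z x = push z y" if x: "x \<in> EXT t A B" and y: "y \<in> EXT t A B" for x y
  proof -
    obtain S i j p q w where b: "is_biproduct \<A> B B S i j p q" and S: "S \<in> \<C>" and w: "w \<in> EXT t A S" "push p w = x" "push q w = y"
      by (rule plusE[OF x y C])
    note [simp] = biprodD(3-19)[OF b] C S z
    have "push z (push p w) = push (z \<cdot> p) w" "push z (push q w) = push (z \<cdot> q) w" by (rule push_push[OF w(1)]; simp)+
    moreover have "z \<cdot> p = z \<cdot> q" by (simp add: z_def)
    ultimately show ?thesis using w by simp
  qed
  have nz: "plus (push z x) y = y" if x: "x \<in> EXT t A B" and y: "y \<in> EXT t A B" for x y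
  proof -
    have "plus (push z y) (push (idn \<A> B) y) = push (z \<boxplus> idn \<A> B) y"
      by (rule push_add[OF y, where B' = B, symmetric]) (use z C in simp_all)
    then show ?thesis using zz[OF x y] push_id[OF y C(2)] C push_id[OF y] by (simp add: z_def)
  qed
  obtain x0 where x0: "x0 \<in> EXT t A B" using ex_Ext[OF C] by blast
  have one: "zr t A B = push z x0"
    unfolding ext_group_def monoid.simps
  proof (rule the_equality)
    fix e assume e: "e \<in> EXT t A B \<and> (\<forall>x\<in>EXT t A B. plus e x = x)"
    then have "plus e (push z x0) = push z x0" using zE[OF x0] by blast
    then show "e = push z x0" using nz[OF x0] e comm zE[OF x0] by metis
  qed (use zE[OF x0] nz[OF x0] in auto)
  show ?thesis
  proof (rule comm_groupI, unfold carrier_grp one)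
    fix x assume x: "x \<in> EXT t A B"
    have e: "push (ng (idn \<A> B)) x \<in> EXT t A B" by (rule push_Ext[OF x]) (use C in simp_all)
    have "plus (push (ng (idn \<A> B)) x) (push (idn \<A> B) x) = push (ng (idn \<A> B) \<boxplus> idn \<A> B) x"
      by (rule push_add[OF x, where B' = B, symmetric]) (use C in simp_all)
    then have "plus (push (ng (idn \<A> B)) x) x = push z x0"
      using push_id[OF x C(2)] C zz[OF x x0] by (simp add: z_def)
    then show "\<exists>y\<in>EXT t A B. plus y x = push z x0" using e by blast
  qed (use plus_Ext C asc comm zE x0 nz in auto)
qed

lemma zr_Ext: "A \<in> \<C> \<Longrightarrow> B \<in> \<C> \<Longrightarrow> zr t A B \<in> EXT t A B"
  using monoid.one_closed[of "grp t A B"] comm_group_grp[of A B t] by (simp add: comm_group_def comm_monoid_def)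

lemma zr_plus:
  assumes "A \<in> \<C>" "B \<in> \<C>" "x \<in> EXT t A B"
  shows "plus (zr t A B) x = x" "plus x (zr t A B) = x"
proof -
  interpret G: comm_group "grp t A B" by (rule comm_group_grp[OF assms(1,2)])
  show "plus (zr t A B) x = x" "plus x (zr t A B) = x" using G.l_one[of x] G.r_one[of x] assms by simp_all
qed

lemma idem_zr:
  assumes "A \<in> \<C>" "B \<in> \<C>" "x \<in> EXT t A B" "plus x x = x"
  shows "x = zr t A B"
proof -
  interpret G: comm_group "grp t A B" by (rule comm_group_grp[OF assms(1,2)])
  show ?thesis using G.l_cancel_one'[of x x] assms by simp
qed

lemma push_zero_arr:
  assumes "x \<in> EXT t A B" "A \<in> \<C>" "B \<in> \<C>" "B' \<in> \<C>"
  shows "push (zero_arr \<A> B B') x = zr t A B'"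
proof (rule idem_zr[OF assms(2,4)])
  show "push (zero_arr \<A> B B') x \<in> EXT t A B'" by (rule push_Ext[OF assms(1)]) (use assms in simp_all)
  have "push (zero_arr \<A> B B' \<boxplus> zero_arr \<A> B B') x = plus (push (zero_arr \<A> B B') x) (push (zero_arr \<A> B B') x)"
    by (rule push_add[OF assms(1), where B' = B']) (use assms in simp_all)
  then show "plus (push (zero_arr \<A> B B') x) (push (zero_arr \<A> B B') x) = push (zero_arr \<A> B B') x" using assms by simp
qed

lemma push_zr:
  assumes "A \<in> \<C>" "a \<in> arrs \<A>" "src \<A> a = B" "tgt \<A> a = B'" "B \<in> \<C>" "B' \<in> \<C>"
  shows "push a (zr t A B) = zr t A B'"
proof (rule idem_zr[OF assms(1,6)])
  have z: "zr t A B \<in> EXT t A B" using zr_Ext assms by simp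
  show "push a (zr t A B) \<in> EXT t A B'" by (rule push_Ext[OF z]) (use assms in simp_all)
  show "plus (push a (zr t A B)) (push a (zr t A B)) = push a (zr t A B)"
    using push_plus[OF z z assms(1,5,6,2,3,4)] zr_plus[OF assms(1,5) z] by simp
qed

lemma pull_zr:
  assumes "B \<in> \<C>" "a \<in> arrs \<A>" "src \<A> a = A'" "tgt \<A> a = A" "A \<in> \<C>" "A' \<in> \<C>"
  shows "pull a (zr t A B) = zr t A' B"
proof (rule idem_zr[OF assms(6,1)])
  have z: "zr t A B \<in> EXT t A B" using zr_Ext assms by simp
  show "pull a (zr t A B) \<in> EXT t A' B" by (rule pull_Ext[OF z]) (use assms in simp_all)
  show "plus (pull a (zr t A B)) (pull a (zr t A B)) = pull a (zr t A B)"
    using pull_plus[OF z z assms(5,1,6,2,4,3)] zr_plus[OF assms(5,1) z] by simp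
qed

lemma cov_zr:
  assumes "A \<in> \<C>" "conf c"
  shows "cov c (zr t A (cob c)) = zr (Suc t) A (kob c)"
proof (rule idem_zr)
  have z: "zr t A (cob c) \<in> EXT t A (cob c)" using zr_Ext assms by simp
  show "cov c (zr t A (cob c)) \<in> EXT (Suc t) A (kob c)" by (rule cov_Ext[OF z]) (use assms in simp_all)
  show "plus (cov c (zr t A (cob c))) (cov c (zr t A (cob c))) = cov c (zr t A (cob c))"
    using cov_plus[OF z z assms(2,1)] zr_plus[OF assms(1) _ z] assms by simp
qed (use assms in simp_all)

lemma con_zr:
  assumes "B \<in> \<C>" "conf c"
  shows "con c (zr t (kob c) B) = zr (Suc t) (cob c) B"
proof (rule idem_zr)
  have z: "zr t (kob c) B \<in> EXT t (kob c) B" using zr_Ext assms by simp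
  show "con c (zr t (kob c) B) \<in> EXT (Suc t) (cob c) B" by (rule con_Ext[OF z]) (use assms in simp_all)
  show "plus (con c (zr t (kob c) B)) (con c (zr t (kob c) B)) = con c (zr t (kob c) B)"
    using con_plus[OF z z assms(2,1)] zr_plus[OF _ assms(1) z] assms by simp
qed (use assms in simp_all)

lemma hom_push:
  "A \<in> \<C> \<Longrightarrow> B \<in> \<C> \<Longrightarrow> B' \<in> \<C> \<Longrightarrow> a \<in> arrs \<A> \<Longrightarrow> src \<A> a = B \<Longrightarrow> tgt \<A> a = B' \<Longrightarrow>
    push a \<in> hom (grp t A B) (grp t A B')"
  by (auto simp: hom_def push_Ext push_plus)

lemma hom_cov: "A \<in> \<C> \<Longrightarrow> conf c \<Longrightarrow> cov c \<in> hom (grp t A (cob c)) (grp (Suc t) A (kob c))"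
  by (auto simp: hom_def cov_Ext cov_plus)

lemma hom_con: "B \<in> \<C> \<Longrightarrow> conf c \<Longrightarrow> con c \<in> hom (grp t (kob c) B) (grp (Suc t) (cob c) B)"
  by (auto simp: hom_def con_Ext con_plus)

section \<open>Exact sequences\<close>

lemma ex_zero_C:
  obtains Z where "Z \<in> \<C>" "zero_arr \<A> Z Z = idn \<A> Z"
proof -
  obtain Z where Z: "Z \<in> \<C>" "is_zero_object \<A> Z"
    using subcat unfolding ext_closed_additive_subcategory_def by meson
  then have "\<exists>!f. f \<in> Hom \<A> Z Z" by (simp add: is_zero_object_def)
  moreover have "zero_arr \<A> Z Z \<in> Hom \<A> Z Z" "idn \<A> Z \<in> Hom \<A> Z Z" using Z(1) by (simp_all add: Hom_def)
  ultimately show thesis using that Z(1) by blast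
qed

lemma cov_push_deflation:
  assumes y: "y \<in> EXT t A (mob c)" and c: "conf c" and A: "A \<in> \<C>"
  shows "cov c (push (snd c) y) = zr (Suc t) A (kob c)"
proof -
  obtain Z where Z: "Z \<in> \<C>" "zero_arr \<A> Z Z = idn \<A> Z" by (rule ex_zero_C)
  note [simp] = Z confD[OF c]
  let ?d = "(zero_arr \<A> Z (mob c), idn \<A> (mob c))"
  have "is_biproduct \<A> Z (mob c) (mob c) (zero_arr \<A> Z (mob c)) (idn \<A> (mob c)) (zero_arr \<A> (mob c) Z) (idn \<A> (mob c))"
    by (simp add: is_biproduct_def Hom_def)
  then have d: "conf ?d" using conf_biproduct by simp
  have m: "cm (zero_arr \<A> Z (kob c)) (snd c) ?d c"
    by (rule cmI[of _ _ _ _ "idn \<A> (mob c)"]) (use c d in simp_all)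
  have y': "y \<in> EXT t A (cob ?d)" using y by simp
  have "cov c (push (snd c) y) = push (zero_arr \<A> Z (kob c)) (cov ?d y)"
    by (rule push_cov[OF y' m A, symmetric])
  also have "\<dots> = zr (Suc t) A (kob c)"
    by (rule push_zero_arr[OF cov_Ext[OF y' d refl A, simplified]]) (use A in simp_all)
  finally show ?thesis .
qed

lemma cl_single_eq:
  assumes "conf c" "conf d" "cob d = cob c" "kob d = kob c" "cl [c] = cl [d]"
  shows "cm (idn \<A> (kob c)) (idn \<A> (cob c)) c d"
proof -
  have p: "path (cob c) (kob c) [c]" "path (cob c) (kob c) [d]" using assms by auto
  have "eqv (cob c) (kob c) [c] [d]" using cl_eq_iff[OF p(1) _ p(2)] assms(5) by simp
  then have "\<exists>e. [d] = [e] \<and> cm (idn \<A> (kob c)) (idn \<A> (cob c)) c e"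
    unfolding eqv_def
  proof (induction rule: rtranclp_induct)
    case base
    then show ?case using cm_id[OF assms(1)] by auto
  next
    case (step fs es)
    obtain f where f: "fs = [f]" "cm (idn \<A> (kob c)) (idn \<A> (cob c)) c f" using step(3) by auto
    have "length es = 1" using step(2) f(1) lmor_length by (force simp: lstep_def)
    then obtain e where e: "es = [e]" by (auto simp: length_Suc_conv)
    from step(2) have "cm (idn \<A> (kob c)) (idn \<A> (cob c)) c e"
    proof
      assume "lstep (cob c) (kob c) fs es"
      then have "cm (idn \<A> (kob c)) (idn \<A> (cob c)) f e" using f e by (auto simp: lstep_def)
      then show ?thesis using cm_comp[OF f(2)] assms(1) by fastforce
    next
      assume "lstep (cob c) (kob c) es fs"
      then have "cm (idn \<A> (kob c)) (idn \<A> (cob c)) e f" using f e by (auto simp: lstep_def)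
      moreover have "kob f = kob c" using cmD[OF f(2)] assms(1) by simp
      ultimately show ?thesis using cm_pull_factor[OF f(2), of e] by simp
    qed
    then show ?case using e by auto
  qed
  then show ?thesis by auto
qed

lemma cl_single_cov: "conf c \<Longrightarrow> cov c (Ext_arr (idn \<A> (cob c))) = cl [c]"
  using pull_id[OF cl_single, of c] by (simp add: cov_arr)

lemma split_cov:
  assumes c: "conf c" and s: "s \<in> arrs \<A>" "src \<A> s = cob c" "tgt \<A> s = mob c" "snd c \<cdot> s = idn \<A> (cob c)"
    and x: "x \<in> EXT t A (cob c)" and A: "A \<in> \<C>"
  shows "cov c x = zr (Suc t) A (kob c)"
proof -
  note [simp] = confD[OF c] s(1-3)
  have "push (snd c) (push s x) = push (snd c \<cdot> s) x" by (rule push_push[OF x]) simp_all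
  then have "push (snd c) (push s x) = x" using s(4) push_id[OF x] by simp
  moreover have "push s x \<in> EXT t A (mob c)" by (rule push_Ext[OF x]) simp_all
  ultimately show ?thesis using cov_push_deflation[OF _ c A, of "push s x" t] by simp
qed

lemma ex_split:
  assumes "A \<in> \<C>" "B \<in> \<C>"
  obtains e s where "conf e" "kob e = B" "cob e = A" "s \<in> arrs \<A>" "src \<A> s = A" "tgt \<A> s = mob e" "snd e \<cdot> s = idn \<A> A"
proof -
  obtain S i j p q where b: "is_biproduct \<A> B A S i j p q" by (rule ex_biprod_C[OF assms(2,1)])
  show thesis
    by (rule that[of "(i, q)" j]) (use conf_biproduct[OF b] biprodD[OF b] assms in simp_all)
qed

lemma section_if_zero:
  assumes c: "conf c" and z: "cl [c] = zr 1 (cob c) (kob c)"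
  obtains s where "s \<in> arrs \<A>" "src \<A> s = cob c" "tgt \<A> s = mob c" "snd c \<cdot> s = idn \<A> (cob c)"
proof -
  have C: "cob c \<in> \<C>" "kob c \<in> \<C>" using c by simp_all
  obtain e s where e: "conf e" "kob e = kob c" "cob e = cob c" and s: "s \<in> arrs \<A>" "src \<A> s = cob c" "tgt \<A> s = mob e" "snd e \<cdot> s = idn \<A> (cob c)"
    by (rule ex_split[OF C])
  have "cov e (Ext_arr (idn \<A> (cob e))) = zr (Suc 0) (cob c) (kob e)"
    by (rule split_cov[of e s]) (use e s C in \<open>simp_all add: Ext_0\<close>)
  then have "cl [e] = cl [c]" using cl_single_cov[OF e(1)] z e by simp
  then have "cm (idn \<A> (kob c)) (idn \<A> (cob c)) e c" using cl_single_eq[OF e(1) c] e by simp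
  then obtain m where m: "m \<in> arrs \<A>" "src \<A> m = mob e" "tgt \<A> m = mob c" "snd c \<cdot> m = idn \<A> (cob c) \<cdot> snd e"
    by (rule cmE)
  have "snd c \<cdot> (m \<cdot> s) = idn \<A> (cob c) \<cdot> (snd e \<cdot> s)"
    by (rule cmp_eq_reassoc[OF m(4)]) (use m s e c in simp_all)
  then show thesis using that[of "m \<cdot> s"] m s c by simp
qed

lemma retraction_if_section:
  assumes c: "conf c" and s: "s \<in> arrs \<A>" "src \<A> s = cob c" "tgt \<A> s = mob c" "snd c \<cdot> s = idn \<A> (cob c)"
  obtains r where "r \<in> arrs \<A>" "src \<A> r = mob c" "tgt \<A> r = kob c" "r \<cdot> fst c = idn \<A> (kob c)"
proof -
  note [simp] = confD[OF c] s(1-3)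
  let ?d = "idn \<A> (mob c) \<boxplus> ng (s \<cdot> snd c)"
  have "snd c \<cdot> (s \<cdot> snd c) = snd c" using cmp_eq_reassoc1[OF s(4), of "snd c"] by simp
  then have "snd c \<cdot> ?d = zero_arr \<A> (mob c) (cob c)" by simp
  then obtain r where r: "r \<in> arrs \<A>" "src \<A> r = mob c" "tgt \<A> r = kob c" "fst c \<cdot> r = ?d"
    by - (rule ses_lift[OF conf_ses[OF c], of ?d], simp_all)
  have "fst c \<cdot> (r \<cdot> fst c) = ?d \<cdot> fst c" using cmp_eq_reassoc1[OF r(4), of "fst c"] r(1-3) by simp
  also have "\<dots> = fst c \<cdot> idn \<A> (kob c)" by simp
  finally have "r \<cdot> fst c = idn \<A> (kob c)"
    using r(1-3) by - (rule ses_mono[OF conf_ses[OF c]], simp_all)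
  then show thesis using that r by blast
qed

lemma lift_if_cov_zero:
  assumes c: "conf c" and f: "f \<in> arrs \<A>" "tgt \<A> f = cob c" "src \<A> f \<in> \<C>" and z: "pull f (cl [c]) = zr 1 (src \<A> f) (kob c)"
  obtains g where "g \<in> arrs \<A>" "src \<A> g = src \<A> f" "tgt \<A> g = mob c" "snd c \<cdot> g = f"
proof -
  obtain d where d: "kob d = kob c" "cob d = src \<A> f" "cm (idn \<A> (kob c)) f d c"
    by (rule ex_conf_pull[OF c f])
  have cd: "conf d" using cmD[OF d(3)] by simp
  have "pull f (cl [c]) = push (idn \<A> (kob c)) (cl [d])" using push_cl_single[OF d(3)] by simp
  then have "cl [d] = zr 1 (cob d) (kob d)" using push_id[OF cl_single[OF cd]] d z c by simp
  then obtain s where s: "s \<in> arrs \<A>" "src \<A> s = cob d" "tgt \<A> s = mob d" "snd d \<cdot> s = idn \<A> (cob d)"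
    by (rule section_if_zero[OF cd])
  obtain m where m: "m \<in> arrs \<A>" "src \<A> m = mob d" "tgt \<A> m = mob c" "snd c \<cdot> m = f \<cdot> snd d"
    by (rule cmE[OF d(3)])
  have "snd c \<cdot> (m \<cdot> s) = f \<cdot> (snd d \<cdot> s)"
    by (rule cmp_eq_reassoc[OF m(4)]) (use m s cd c f d in simp_all)
  then show thesis using that[of "m \<cdot> s"] m s c d f by simp
qed

lemma Ext1_push_inflation_zero:
  assumes c: "conf c" and d: "conf d" "kob d = kob c" and z: "push (fst c) (cl [d]) = zr 1 (cob d) (mob c)"
  obtains f where "f \<in> arrs \<A>" "src \<A> f = cob d" "tgt \<A> f = cob c" "cm (idn \<A> (kob c)) f d c"
proof -
  note [simp] = confD[OF c] confD[OF d(1)] d(2)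
  obtain e where e: "cob e = cob d" "kob e = mob c" "cm (fst c) (idn \<A> (cob d)) d e"
    by (rule ex_conf_push[OF d(1), of "fst c"]) simp_all
  have ce: "conf e" using cmD[OF e(3)] by simp
  note [simp] = confD[OF ce] e(1,2)
  have "push (fst c) (cl [d]) = pull (idn \<A> (cob d)) (cl [e])" by (rule push_cl_single[OF e(3)])
  then have "cl [e] = zr 1 (cob e) (kob e)" using pull_id[OF cl_single[OF ce]] z by simp
  then obtain s where s: "s \<in> arrs \<A>" "src \<A> s = cob e" "tgt \<A> s = mob e" "snd e \<cdot> s = idn \<A> (cob e)"
    by (rule section_if_zero[OF ce])
  then obtain r where r: "r \<in> arrs \<A>" "src \<A> r = mob e" "tgt \<A> r = kob e" "r \<cdot> fst e = idn \<A> (kob e)"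
    by (rule retraction_if_section[OF ce])
  obtain m where m: "m \<in> arrs \<A>" "src \<A> m = mob d" "tgt \<A> m = mob e" "m \<cdot> fst d = fst e \<cdot> fst c"
    by (rule cmE[OF e(3)])
  note [simp] = r(1-3) m(1-3)
  have rm: "r \<cdot> (m \<cdot> fst d) = fst c"
    unfolding m(4) using cmp_eq_reassoc1[OF r(4), of "fst c"] by simp
  have "(snd c \<cdot> (r \<cdot> m)) \<cdot> fst d = zero_arr \<A> (kob d) (cob c)" using rm by simp
  then obtain f where f: "f \<in> arrs \<A>" "src \<A> f = cob d" "tgt \<A> f = cob c" "f \<cdot> snd d = snd c \<cdot> (r \<cdot> m)"
    by - (rule ses_colift[OF conf_ses[OF d(1)], of "snd c \<cdot> (r \<cdot> m)"], simp_all)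
  have "cm (idn \<A> (kob c)) f d c"
    by (rule cmI[of _ _ _ _ "r \<cdot> m"]) (use c d f rm in simp_all)
  then show thesis using that f by blast
qed

lemma conf_push_deflation:
  assumes c: "conf c" and e: "kob e = mob c" and e': "cm (snd c) (idn \<A> (cob e)) e e'"
    and m: "m \<in> arrs \<A>" "src \<A> m = mob e" "tgt \<A> m = mob e'" "m \<cdot> fst e = fst e' \<cdot> snd c"
      "snd e' \<cdot> m = idn \<A> (cob e) \<cdot> snd e"
  shows "conf (fst e \<cdot> fst c, m)"
proof -
  note t = cmD[OF e']
  note [simp] = confD[OF c] confD[OF t(1)] confD[OF t(2)] e m(1-3)
  have [simp]: "cob e' = cob e" "kob e' = cob c" using t(5,8) by simp_all
  have "short_exact (opc \<A>) m (fst c \<cdot>\<^bsub>opc \<A>\<^esub> fst e)"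
    by (rule abelian_category.ses_along_inflation[OF abelian_opc, of "snd e" "fst e" "snd e'" "fst e'" "snd c"])
      (use m conf_ses[OF t(1)] conf_ses[OF t(2)] conf_ses[OF c] in simp_all)
  then show ?thesis using confI by simp
qed

lemma Ext1_push_deflation_zero:
  assumes c: "conf c" and e: "conf e" "kob e = mob c" and z: "push (snd c) (cl [e]) = zr 1 (cob e) (cob c)"
  obtains g where "conf g" "kob g = kob c" "cob g = cob e" "cm (fst c) (idn \<A> (cob e)) g e"
proof -
  note [simp] = confD[OF c] confD[OF e(1)] e(2)
  obtain e' where e': "cob e' = cob e" "kob e' = cob c" "cm (snd c) (idn \<A> (cob e)) e e'"
    by (rule ex_conf_push[OF e(1), of "snd c"]) simp_all
  have ce: "conf e'" using cmD[OF e'(3)] by simp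
  note [simp] = confD[OF ce] e'(1,2)
  have "push (snd c) (cl [e]) = pull (idn \<A> (cob e)) (cl [e'])" by (rule push_cl_single[OF e'(3)])
  then have "cl [e'] = zr 1 (cob e') (kob e')" using pull_id[OF cl_single[OF ce]] z by simp
  then obtain s where s: "s \<in> arrs \<A>" "src \<A> s = cob e'" "tgt \<A> s = mob e'" "snd e' \<cdot> s = idn \<A> (cob e')"
    by (rule section_if_zero[OF ce])
  obtain m where m: "m \<in> arrs \<A>" "src \<A> m = mob e" "tgt \<A> m = mob e'" "m \<cdot> fst e = fst e' \<cdot> snd c"
    "snd e' \<cdot> m = idn \<A> (cob e) \<cdot> snd e"
    by (rule cmE[OF e'(3)])
  note [simp] = m(1-3) s(1-3)
  have k: "conf (fst e \<cdot> fst c, m)" by (rule conf_push_deflation[OF c e(2) e'(3) m])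
  obtain g where g: "kob g = kob c" "cob g = cob e" "cm (idn \<A> (kob c)) s g (fst e \<cdot> fst c, m)"
    by (rule ex_conf_pull[OF k, of s]) simp_all
  have cg: "conf g" using cmD[OF g(3)] by simp
  note [simp] = confD[OF cg] g(1,2)
  obtain n where n: "n \<in> arrs \<A>" "src \<A> n = mob g" "tgt \<A> n = mob e" "n \<cdot> fst g = (fst e \<cdot> fst c) \<cdot> idn \<A> (kob c)" "m \<cdot> n = s \<cdot> snd g"
    by (rule cmE[OF g(3)]) simp
  note [simp] = n(1-3)
  have "snd e \<cdot> n = snd e' \<cdot> (m \<cdot> n)" using cmp_eq_reassoc1[OF m(5), of n] by simp
  also have "\<dots> = snd g" unfolding n(5) using cmp_eq_reassoc1[OF s(4), of "snd g"] by simp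
  finally have "cm (fst c) (idn \<A> (cob e)) g e"
    using n(4) e cg by - (rule cmI[of _ _ _ _ n], simp_all)
  then show thesis using that cg g by blast
qed

text \<open>The induction runs \<open>exact1 t \<Longrightarrow> exact3 (Suc t) \<Longrightarrow> exact1 (Suc t)\<close>.\<close>

definition exact1 :: "nat \<Rightarrow> bool" where
  "exact1 t \<longleftrightarrow> (\<forall>c A x. conf c \<longrightarrow> A \<in> \<C> \<longrightarrow> x \<in> EXT t A (cob c) \<longrightarrow> cov c x = zr (Suc t) A (kob c) \<longrightarrow>
     (\<exists>y\<in>EXT t A (mob c). push (snd c) y = x))"

definition exact3 :: "nat \<Rightarrow> bool" where
  "exact3 t \<longleftrightarrow> (\<forall>c A x. conf c \<longrightarrow> A \<in> \<C> \<longrightarrow> x \<in> EXT t A (mob c) \<longrightarrow> push (snd c) x = zr t A (cob c) \<longrightarrow>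
     (\<exists>y\<in>EXT t A (kob c). push (fst c) y = x))"

lemma exact1_0: "exact1 0"
  unfolding exact1_def
proof (intro allI impI)
  fix c A x assume c: "conf c" "A \<in> \<C>" "x \<in> EXT 0 A (cob c)" "cov c x = zr (Suc 0) A (kob c)"
  then obtain f where f: "f \<in> arrs \<A>" "src \<A> f = A" "tgt \<A> f = cob c" "x = Ext_arr f" by (auto simp: Ext_0)
  obtain g where "g \<in> arrs \<A>" "src \<A> g = src \<A> f" "tgt \<A> g = mob c" "snd c \<cdot> g = f"
    by (rule lift_if_cov_zero[of c f]) (use c f in \<open>simp_all add: cov_arr\<close>)
  then show "\<exists>y\<in>EXT 0 A (mob c). push (snd c) y = x"
    using f by (intro bexI[of _ "Ext_arr g"]) (simp_all add: Ext_0)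
qed

lemma factor_through_pushed_deflation:
  assumes X: "exact1 t" and A: "A \<in> \<C>" and e: "conf e" and a: "a \<in> arrs \<A>" "src \<A> a = kob e" "tgt \<A> a \<in> \<C>"
    and w: "w \<in> EXT t A (cob e)" and z: "push a (cov e w) = zr (Suc t) A (tgt \<A> a)"
  obtains d v where "conf d" "kob d = kob e" "v \<in> EXT t A (cob d)" "cov d v = cov e w"
    "push a (cl [d]) = zr 1 (cob d) (tgt \<A> a)"
proof -
  note [simp] = confD[OF e] a
  obtain e' where e': "cob e' = cob e" "kob e' = tgt \<A> a" "cm a (idn \<A> (cob e)) e e'"
    by (rule ex_conf_push[OF e a])
  have ce: "conf e'" using cmD[OF e'(3)] by simp
  note [simp] = confD[OF ce] e'(1,2)
  have "push a (cov e w) = cov e' (push (idn \<A> (cob e)) w)" by (rule push_cov[OF w e'(3) A])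
  then have "cov e' w = zr (Suc t) A (kob e')" using z push_id[OF w] by simp
  then obtain v where v: "v \<in> EXT t A (mob e')" "push (snd e') v = w"
    using X ce A w unfolding exact1_def by fastforce
  obtain d where d: "kob d = kob e" "cob d = mob e'" "cm (idn \<A> (kob e)) (snd e') d e"
    by (rule ex_conf_pull[OF e, of "snd e'"]) simp_all
  have cd: "conf d" using cmD[OF d(3)] by simp
  note [simp] = d(1,2)
  have v': "v \<in> EXT t A (cob d)" using v by simp
  have "cov e w = push (idn \<A> (kob e)) (cov d v)" using push_cov[OF v' d(3) A] v by simp
  then have 1: "cov d v = cov e w" using push_id[OF cov_Ext[OF v' cd refl A]] by simp
  have pe: "push a (cl [e]) = cl [e']" using push_cl_single[OF e'(3)] pull_id[OF cl_single[OF ce]] by simp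
  have pd: "cl [d] = pull (snd e') (cl [e])" using push_cl_single[OF d(3)] push_id[OF cl_single[OF cd]] by simp
  have "push a (pull (snd e') (cl [e])) = pull (snd e') (push a (cl [e]))"
    by (rule push_pull[OF cl_single[OF e]]) simp_all
  then have "push a (cl [d]) = cov e' (push (snd e') (Ext_arr (idn \<A> (mob e'))))"
    unfolding pd pe by (simp add: cov_arr)
  also have "\<dots> = zr (Suc 0) (mob e') (kob e')"
    by (rule cov_push_deflation[OF _ ce]) (simp_all add: Ext_0)
  finally have "push a (cl [d]) = zr 1 (cob d) (tgt \<A> a)" by simp
  then show thesis using that[of d v] cd v' 1 by simp
qed

lemma exact3_Suc:
  assumes X: "exact1 t" shows "exact3 (Suc t)"
  unfolding exact3_def
proof (intro allI impI)
  fix c A y assume c: "conf c" and A: "A \<in> \<C>" and y: "y \<in> EXT (Suc t) A (mob c)" and z: "push (snd c) y = zr (Suc t) A (cob c)"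
  note [simp] = confD[OF c]
  obtain e w where e: "conf e" "kob e = mob c" "w \<in> EXT t A (cob e)" "y = cov e w"
    by (rule Ext_Suc_cov[OF y A])
  obtain d v where d: "conf d" "kob d = kob e" "v \<in> EXT t A (cob d)" "cov d v = cov e w"
    "push (snd c) (cl [d]) = zr 1 (cob d) (tgt \<A> (snd c))"
    by (rule factor_through_pushed_deflation[OF X A e(1) _ _ _ e(3), of "snd c"]) (use e z in simp_all)
  obtain g where g: "conf g" "kob g = kob c" "cob g = cob d" "cm (fst c) (idn \<A> (cob d)) g d"
    by (rule Ext1_push_deflation_zero[OF c d(1)]) (use d e in simp_all)
  have v: "v \<in> EXT t A (cob g)" using d(3) g(3) by simp
  have "push (fst c) (cov g v) = cov d (push (idn \<A> (cob d)) v)" by (rule push_cov[OF v g(4) A])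
  then have "push (fst c) (cov g v) = y" using push_id[OF d(3)] d(1,4) e(4) by simp
  then show "\<exists>z\<in>EXT (Suc t) A (kob c). push (fst c) z = y"
    using cov_Ext[OF v g(1) refl A] g(2) by auto
qed

lemma exact2:
  assumes X: "exact1 t" and c: "conf c" and A: "A \<in> \<C>" and z: "z \<in> EXT (Suc t) A (kob c)" "push (fst c) z = zr (Suc t) A (mob c)"
  shows "\<exists>x\<in>EXT t A (cob c). cov c x = z"
proof -
  note [simp] = confD[OF c]
  obtain e w where e: "conf e" "kob e = kob c" "w \<in> EXT t A (cob e)" "z = cov e w"
    by (rule Ext_Suc_cov[OF z(1) A])
  obtain d v where d: "conf d" "kob d = kob e" "v \<in> EXT t A (cob d)" "cov d v = cov e w"
    "push (fst c) (cl [d]) = zr 1 (cob d) (tgt \<A> (fst c))"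
    by (rule factor_through_pushed_deflation[OF X A e(1) _ _ _ e(3), of "fst c"]) (use e z in simp_all)
  obtain f where f: "f \<in> arrs \<A>" "src \<A> f = cob d" "tgt \<A> f = cob c" "cm (idn \<A> (kob c)) f d c"
    by (rule Ext1_push_inflation_zero[OF c d(1)]) (use d e in simp_all)
  have "cov c (push f v) = push (idn \<A> (kob c)) (cov d v)" using push_cov[OF d(3) f(4) A] by simp
  also have "\<dots> = z" using push_id[OF z(1)] d(4) e(4) by simp
  finally show ?thesis using push_Ext[OF d(3) f(1-3)] by auto
qed

text \<open>If \<open>es @ [e]\<close> represents zero, then the class of \<open>es\<close> lies in the image of the deflation of \<open>e\<close>: this
  holds for split \<open>e\<close> and is invariant under the moves generating Yoneda equivalence. Against the
  direction of a move, the Mayer-Vietoris conflation of the pullback and \<open>exact3 t\<close> are needed.\<close>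

lemma exact1_Suc:
  assumes X: "exact3 t" and t: "0 < t" shows "exact1 t"
  unfolding exact1_def
proof (intro allI impI)
  fix c A x assume c: "conf c" and A: "A \<in> \<C>" and x: "x \<in> EXT t A (cob c)" and z: "cov c x = zr (Suc t) A (kob c)"
  obtain cs where cs: "path A (cob c) cs" "length cs = t" "x = cl cs" using x t by (auto simp: Ext_pos)
  have ne: "cs \<noteq> []" using cs t by auto
  have C: "cob c \<in> \<C>" "kob c \<in> \<C>" using c by simp_all
  obtain e s where e: "conf e" "kob e = kob c" "cob e = cob c" and s: "s \<in> arrs \<A>" "src \<A> s = cob c" "tgt \<A> s = mob e" "snd e \<cdot> s = idn \<A> (cob c)"
    by (rule ex_split[OF C])
  have "cov e x = zr (Suc t) A (kob c)" using split_cov[of e s x t A] e s x A by simp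
  then have "cl (cs @ [e]) = cl (cs @ [c])"
    using cov_cl[OF cs(1) ne e(1,3)] cov_cl[OF cs(1) ne c refl] z cs(3) by simp
  moreover have p: "path A (kob c) (cs @ [e])" "path A (kob c) (cs @ [c])" using cs e c by (auto simp: path_append)
  ultimately have E: "eqv A (kob c) (cs @ [e]) (cs @ [c])" using cl_eq_iff[OF p(1) _ p(2)] by simp
  define good where "good es \<longleftrightarrow> (\<exists>ds d y. es = ds @ [d] \<and> y \<in> EXT t A (mob d) \<and> push (snd d) y = cl ds)" for es
  have fwd: "good (es @ [e])" if l: "lstep A (kob c) (ds @ [d]) (es @ [e])" and y: "y \<in> EXT t A (mob d)" "push (snd d) y = cl ds" and ne: "ds \<noteq> []"
    for ds d es e y
  proof -
    have ll: "lmor (idn \<A> (kob c)) (idn \<A> A) (ds @ [d]) (es @ [e])" and pd: "path A (kob c) (ds @ [d])" "path A (kob c) (es @ [e])"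
      using l by (auto simp: lstep_def)
    have "length ds = length es" using lmor_length[OF ll] by simp
    then obtain f where f: "lmor f (idn \<A> A) ds es" "cm (idn \<A> (kob c)) f d e" using ll by (auto simp: lmor_append)
    note fd = cmD[OF f(2)]
    have pd': "path A (cob d) ds" "path A (cob e) es" using pd by (auto simp: path_append)
    note [simp] = confD[OF fd(1)] confD[OF fd(2)] fd(6-8)
    have "push f (cl ds) = cl es" by (rule push_cl[OF pd'(1) ne f(1) pd'(2)])
    moreover obtain m where m: "m \<in> arrs \<A>" "src \<A> m = mob d" "tgt \<A> m = mob e" "snd e \<cdot> m = f \<cdot> snd d"
      by (rule cmE[OF f(2)])
    moreover have "push (snd e) (push m y) = push (snd e \<cdot> m) y" "push f (push (snd d) y) = push (f \<cdot> snd d) y"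
      by (rule push_push[OF y(1)]; use m in simp)+
    moreover have "push m y \<in> EXT t A (mob e)" by (rule push_Ext[OF y(1)]) (use m in simp_all)
    ultimately show ?thesis using y(2) unfolding good_def by fastforce
  qed
  have bwd: "good (ds @ [d])" if l: "lstep A (kob c) (ds @ [d]) (es @ [e])" and y: "y \<in> EXT t A (mob e)" "push (snd e) y = cl es"
    and ne: "ds \<noteq> []" "length ds = t"
    for ds d es e y
  proof -
    have ll: "lmor (idn \<A> (kob c)) (idn \<A> A) (ds @ [d]) (es @ [e])" and pd: "path A (kob c) (ds @ [d])" "path A (kob c) (es @ [e])"
      using l by (auto simp: lstep_def)
    have "length ds = length es" using lmor_length[OF ll] by simp
    then obtain f where f: "lmor f (idn \<A> A) ds es" "cm (idn \<A> (kob c)) f d e" using ll by (auto simp: lmor_append)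
    note fd = cmD[OF f(2)]
    have pd': "path A (cob d) ds" "path A (cob e) es" "kob e = kob c" using pd by (auto simp: path_append)
    note [simp] = confD[OF fd(1)] confD[OF fd(2)] fd(6-8)
    have pf: "push f (cl ds) = cl es" by (rule push_cl[OF pd'(1) ne(1) f(1) pd'(2)])
    have f2: "cm (idn \<A> (kob e)) f d e" using f(2) pd' by simp
    obtain m where m: "m \<in> arrs \<A>" "src \<A> m = mob d" "tgt \<A> m = mob e" "m \<cdot> fst d = fst e" "snd e \<cdot> m = f \<cdot> snd d"
      by (rule cm_idE[OF f2])
    have pb: "is_pullback \<A> (snd e) f m (snd d)" by (rule cm_pullback[OF f2 m])
    have CC: "mob e \<in> \<C>" "cob d \<in> \<C>" by simp_all
    obtain S i1 i2 p1 p2 where b: "is_biproduct \<A> (mob e) (cob d) S i1 i2 p1 p2" and S: "S \<in> \<C>" by (rule ex_biprod_C[OF CC])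
    note [simp] = biprodD(3-19)[OF b] biprod_cmp[OF b] m(1-3)
    let ?k = "(i1 \<cdot> m) \<boxplus> (i2 \<cdot> snd d)" and ?q = "(snd e \<cdot> p1) \<boxplus> ng (f \<cdot> p2)"
    have "short_exact \<A> ?k ?q"
      by (rule pullback_MV[OF pb _ ses_is_epi[OF conf_ses[OF fd(2)]]]) (use b in simp)
    then have g: "conf (?k, ?q)" using confI by simp
    have dE: "cl ds \<in> EXT t A (cob d)" using cl_Ext[OF pd'(1) ne(1)] ne(2) by simp
    obtain u where u: "u \<in> EXT t A S" "push p1 u = y" "push p2 u = cl ds" by (rule ex_pair[OF y(1) dE b A CC])
    have "push ?q u = plus (push (snd e \<cdot> p1) u) (push (ng (f \<cdot> p2)) u)"
      by (rule push_add[OF u(1), where B' = "cob e"]) (use A S in simp_all)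
    also have "push (snd e \<cdot> p1) u = push f (cl ds)"
      using push_push[OF u(1), of p1 "snd e"] u(2) y(2) pf by simp
    also have "push (ng (f \<cdot> p2)) u = push (ng f) (cl ds)"
      using push_push[OF u(1), of p2 "ng f"] u(3) by simp
    also have "plus (push f (cl ds)) (push (ng f) (cl ds)) = push (f \<boxplus> ng f) (cl ds)"
      by (rule push_add[OF dE, where B' = "cob e", symmetric]) (use A in simp_all)
    also have "\<dots> = zr t A (cob e)" using push_zero_arr[OF dE A] by simp
    finally have "push ?q u = zr t A (cob e)" .
    then obtain v where v: "v \<in> EXT t A (mob d)" "push ?k v = u"
      using X[unfolded exact3_def, rule_format, OF g A, of u] u(1) by auto
    have "push p2 (push ?k v) = push (p2 \<cdot> ?k) v" by (rule push_push[OF v(1)]) (use S in simp_all)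
    then have "push (snd d) v = cl ds" using v u(3) by simp
    then show ?thesis using v(1) unfolding good_def by blast
  qed
  have "good (cs @ [c])"
    using E[unfolded eqv_def]
  proof (induction rule: rtranclp_induct)
    case base
    have "push (snd e) (push s x) = push (snd e \<cdot> s) x" by (rule push_push[OF x]) (use s e C in simp_all)
    moreover have "push s x \<in> EXT t A (mob e)" by (rule push_Ext[OF x]) (use s e in simp_all)
    ultimately show ?case using push_id[OF x C(1)] s cs unfolding good_def by fastforce
  next
    case (step fs es)
    have "eqv A (kob c) (cs @ [e]) fs" using step(1) by (simp add: eqv_def)
    from eqv_length[OF this] have lf: "length fs = Suc t" using cs by simp
    have le: "length es = Suc t" using step(2) lf lmor_length by (fastforce simp: lstep_def)
    obtain ds d y where d: "fs = ds @ [d]" "y \<in> EXT t A (mob d)" "push (snd d) y = cl ds" using step(3) good_def by auto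
    obtain es' e' where e': "es = es' @ [e']" using le by (metis length_Suc_conv_rev)
    have "es' \<noteq> []" "length es' = t" "ds \<noteq> []" using le lf d(1) e' t by auto
    then show ?case using step(2) fwd[of ds d es' e' y] bwd[of es' e' ds d y] d e' by auto
  qed
  then show "\<exists>y\<in>EXT t A (mob c). push (snd c) y = x" unfolding good_def using cs(3) by auto
qed

lemma exact1_all: "exact1 t"
proof (induction t)
  case (Suc t)
  then show ?case using exact3_Suc exact1_Suc by blast
qed (rule exact1_0)

lemma cov_exact1:
  assumes "conf c" "A \<in> \<C>" "x \<in> EXT t A (cob c)" "cov c x = zr (Suc t) A (kob c)"
  obtains y where "y \<in> EXT t A (mob c)" "push (snd c) y = x"
  using exact1_all assms unfolding exact1_def by blast

lemma cov_exact2: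
  assumes "conf c" "A \<in> \<C>" "z \<in> EXT (Suc t) A (kob c)" "push (fst c) z = zr (Suc t) A (mob c)"
  obtains x where "x \<in> EXT t A (cob c)" "cov c x = z"
  using exact2[OF exact1_all] assms by blast

subsection \<open>Duality\<close>

definition dl :: "nat \<Rightarrow> 'o \<Rightarrow> 'o \<Rightarrow> 'm ext \<Rightarrow> 'm ext \<Rightarrow> bool" where
  "dl t A B x x' \<longleftrightarrow> (t = 0 \<and> x \<in> EXT 0 A B \<and> x' = x) \<or>
     (0 < t \<and> (\<exists>cs. path A B cs \<and> length cs = t \<and> x = cl cs \<and> x' = ext_cat.cl (opc \<A>) \<C> (opl cs)))"

lemma opl_opl [simp]: "opl (opl cs) = cs"
  by (simp add: rev_map comp_def)

lemma lstep_opc: "ext_cat.lstep (opc \<A>) \<C> B A (opl ds) (opl cs) \<longleftrightarrow> lstep A B cs ds"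
proof -
  interpret op: ext_cat "opc \<A>" \<C> by (rule ext_cat_opc)
  show ?thesis
    unfolding lstep_def op.lstep_def using path_opc[of B A cs] path_opc[of B A ds] lmor_opc[of "idn \<A> A" "idn \<A> B" ds cs] by auto
qed

lemma eqv_opc: "ext_cat.eqv (opc \<A>) \<C> B A (opl cs) (opl ds) \<longleftrightarrow> eqv A B cs ds"
proof -
  interpret op: ext_cat "opc \<A>" \<C> by (rule ext_cat_opc)
  have 1: "op.eqv B A (opl cs) (opl ds)" if "eqv A B cs ds"
    using that unfolding eqv_def
  proof (induction rule: rtranclp_induct)
    case (step fs es)
    then have "op.lstep B A (opl fs) (opl es) \<or> op.lstep B A (opl es) (opl fs)" using lstep_opc by blast
    then have "op.eqv B A (opl fs) (opl es)" using op.eqv_step op.eqv_sym by blast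
    then show ?case using step(3) op.eqv_trans by blast
  qed (simp add: op.eqv_def)
  have 2: "eqv A B cs (opl es)" if "op.eqv B A (opl cs) es" for es
    using that unfolding op.eqv_def
  proof (induction rule: rtranclp_induct)
    case (step fs es)
    then have "lstep A B (opl fs) (opl es) \<or> lstep A B (opl es) (opl fs)"
      using lstep_opc[of B A "opl fs" "opl es"] lstep_opc[of B A "opl es" "opl fs"] by (simp only: opl_opl) blast
    then have "eqv A B (opl fs) (opl es)" using eqv_step eqv_sym by blast
    then show ?case using step(3) eqv_trans by blast
  qed (simp only: opl_opl, simp add: eqv_def)
  show ?thesis using 1 2[of "opl ds"] by (simp only: opl_opl) blast
qed

lemma dl_Ext: "dl t A B x x' \<Longrightarrow> x \<in> EXT t A B \<and> x' \<in> Ext (opc \<A>) \<C> t B A"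
proof -
  interpret op: ext_cat "opc \<A>" \<C> by (rule ext_cat_opc)
  assume "dl t A B x x'"
  then consider "t = 0" "x \<in> EXT 0 A B" "x' = x"
    | cs where "0 < t" "path A B cs" "length cs = t" "x = cl cs" "x' = op.cl (opl cs)"
    unfolding dl_def by blast
  then show ?thesis
  proof cases
    case 1
    then show ?thesis by (simp add: Ext_def)
  next
    case 2
    then have "op.path B A (opl cs)" "length (opl cs) = t" using path_opc by auto
    note 3 = this
    have "x \<in> EXT t A B" using 2 Ext_pos by blast
    moreover have "x' \<in> op.EXT t B A" using 3 2(1,5) op.Ext_pos[of t x' B A] by blast
    ultimately show ?thesis ..
  qed
qed

lemma ex_dl: "x \<in> EXT t A B \<Longrightarrow> \<exists>x'. dl t A B x x'"
  by (cases "t = 0") (auto simp: dl_def Ext_pos)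

lemma ex_dl': "x' \<in> Ext (opc \<A>) \<C> t B A \<Longrightarrow> \<exists>x. dl t A B x x'"
proof -
  interpret op: ext_cat "opc \<A>" \<C> by (rule ext_cat_opc)
  assume x: "x' \<in> op.EXT t B A"
  show ?thesis
  proof (cases "t = 0")
    case True
    then have "x' \<in> EXT 0 A B" using x by (simp add: Ext_def)
    then show ?thesis using True by (auto simp: dl_def)
  next
    case False
    then obtain cs where "op.path B A cs" "length cs = t" "x' = op.cl cs" using x op.Ext_pos by auto
    note 1 = this
    then have "path A B (opl cs)" "length (opl cs) = t" using path_opc[of B A "opl cs"] by (simp_all only: opl_opl length_rev length_map)
    moreover have "x' = op.cl (opl (opl cs))" using 1 by (simp only: opl_opl)
    ultimately show ?thesis using False unfolding dl_def by blast
  qed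
qed

lemma dl_eq:
  assumes "dl t A B x x'" "dl t A B y y'"
  shows "x = y \<longleftrightarrow> x' = y'"
proof -
  interpret op: ext_cat "opc \<A>" \<C> by (rule ext_cat_opc)
  show ?thesis
  proof (cases "t = 0")
    case True
    then show ?thesis using assms by (simp add: dl_def)
  next
    case False
    then obtain cs ds where *: "path A B cs" "length cs = t" "x = cl cs" "x' = op.cl (opl cs)"
      "path A B ds" "length ds = t" "y = cl ds" "y' = op.cl (opl ds)" using assms unfolding dl_def by blast
    have ne: "cs \<noteq> []" "opl cs \<noteq> []" using * False by auto
    have p: "op.path B A (opl cs)" "op.path B A (opl ds)" using * path_opc by auto
    show ?thesis
      using cl_eq_iff[OF *(1) ne(1) *(5)] op.cl_eq_iff[OF p(1) ne(2) p(2)] eqv_opc[of B A cs ds] * by simp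
  qed
qed

lemma dl_pull:
  assumes d: "dl t A B x x'" and h: "h \<in> arrs \<A>" "tgt \<A> h = A" "src \<A> h = A'" "A' \<in> \<C>"
  shows "dl t A' B (pull h x) (ext_push (opc \<A>) \<C> h x')"
proof -
  interpret op: ext_cat "opc \<A>" \<C> by (rule ext_cat_opc)
  show ?thesis
  proof (cases "t = 0")
    case True
    then show ?thesis using d h by (auto simp: dl_def Ext_0)
  next
    case False
    then obtain cs where *: "path A B cs" "length cs = t" "x = cl cs" "x' = op.cl (opl cs)"
      using d unfolding dl_def by blast
    have ne: "cs \<noteq> []" "opl cs \<noteq> []" using * False by auto
    obtain ds where ds: "path A' B ds" "length ds = length cs" "lmor (idn \<A> B) h ds cs"
      by (rule lmor_pull_ex[OF *(1) ne(1), of h]) (use h in auto)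
    have p: "op.path B A (opl cs)" "op.path B A' (opl ds)" using * ds path_opc by auto
    have "op.lmor h (idn (opc \<A>) B) (opl cs) (opl ds)" using lmor_opc[of h "idn \<A> B" cs ds] ds(3) by simp
    from op.push_cl[OF p(1) ne(2) this p(2)] have "op.push h x' = op.cl (opl ds)" using * by simp
    moreover have "pull h x = cl ds" using pull_cl[OF *(1) ne(1) ds(3,1)] * by simp
    ultimately show ?thesis using False ds * unfolding dl_def by auto
  qed
qed

lemma dl_push:
  assumes d: "dl t A B x x'" and h: "h \<in> arrs \<A>" "src \<A> h = B" "tgt \<A> h = B'" "B' \<in> \<C>"
  shows "dl t A B' (push h x) (ext_pull (opc \<A>) \<C> h x')"
proof -
  interpret op: ext_cat "opc \<A>" \<C> by (rule ext_cat_opc)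
  show ?thesis
  proof (cases "t = 0")
    case True
    then show ?thesis using d h by (auto simp: dl_def Ext_0)
  next
    case False
    then obtain cs where *: "path A B cs" "length cs = t" "x = cl cs" "x' = op.cl (opl cs)"
      using d unfolding dl_def by blast
    have ne: "cs \<noteq> []" "opl cs \<noteq> []" using * False by auto
    obtain ds where ds: "path A B' ds" "length ds = length cs" "lmor h (idn \<A> A) cs ds"
      by (rule lmor_push_ex[OF *(1) ne(1), of h]) (use h in auto)
    have p: "op.path B A (opl cs)" "op.path B' A (opl ds)" using * ds path_opc by auto
    have "op.lmor (idn (opc \<A>) A) h (opl ds) (opl cs)" using lmor_opc[of "idn \<A> A" h ds cs] ds(3) by simp
    from op.pull_cl[OF p(1) ne(2) this p(2)] have "op.pull h x' = op.cl (opl ds)" using * by simp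
    moreover have "push h x = cl ds" using push_cl[OF *(1) ne(1) ds(3,1)] * by simp
    ultimately show ?thesis using False ds * unfolding dl_def by auto
  qed
qed

lemma dl_con:
  assumes d: "dl t (kob c) B x x'" and c: "conf c" and B: "B \<in> \<C>"
  shows "dl (Suc t) (cob c) B (con c x) (connecting_cov (opc \<A>) \<C> (prod.swap c) x')"
proof -
  interpret op: ext_cat "opc \<A>" \<C> by (rule ext_cat_opc)
  have pc: "path (cob c) (kob c) [c]" using c by simp
  have oc: "op.conf (prod.swap c)" using c by simp
  show ?thesis
  proof (cases "t = 0")
    case True
    then obtain f where f: "f \<in> arrs \<A>" "src \<A> f = kob c" "tgt \<A> f = B" "x = Ext_arr f" "x' = x"
      using d by (auto simp: dl_def Ext_0)
    have "dl (Suc 0) (cob c) (kob c) (cl [c]) (op.cl [prod.swap c])"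
      unfolding dl_def using pc by (intro disjI2 conjI exI[of _ "[c]"]) simp_all
    from dl_push[OF this f(1,2,3) B] show ?thesis using f True by (simp add: con_arr op.cov_arr)
  next
    case False
    then obtain cs where *: "path (kob c) B cs" "length cs = t" "x = cl cs" "x' = op.cl (opl cs)"
      using d unfolding dl_def by blast
    have ne: "cs \<noteq> []" "opl cs \<noteq> []" using * False by auto
    have p: "op.path B (kob c) (opl cs)" using * path_opc by auto
    have "con c x = cl (c # cs)" using con_cl[OF *(1) ne(1) c refl] * by simp
    moreover have "op.cov (prod.swap c) x' = op.cl (opl (c # cs))"
      using op.cov_cl[OF p ne(2) oc] * by simp
    ultimately show ?thesis using * c unfolding dl_def by (intro disjI2 conjI exI[of _ "c # cs"]) simp_all
  qed
qed

lemma dl_zr: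
  assumes C: "A \<in> \<C>" "B \<in> \<C>" and z: "dl t A B x x'"
  shows "x = zr t A B \<longleftrightarrow> x' = \<one>\<^bsub>ext_group (opc \<A>) \<C> t B A\<^esub>"
proof -
  interpret op: ext_cat "opc \<A>" \<C> by (rule ext_cat_opc)
  have x: "x \<in> EXT t A B" "x' \<in> op.EXT t B A" using dl_Ext[OF z] by auto
  have "dl t A B (push (zero_arr \<A> B B) x) (op.pull (zero_arr \<A> B B) x')"
    by (rule dl_push[OF z]) (use C in simp_all)
  moreover have "push (zero_arr \<A> B B) x = zr t A B" by (rule push_zero_arr[OF x(1) C C(2)])
  moreover have "op.pull (zero_arr \<A> B B) x' = op.zr t B A"
  proof -
    have "op.pull (zero_arr \<A> B B \<boxplus> zero_arr \<A> B B) x' = op.plus (op.pull (zero_arr \<A> B B) x') (op.pull (zero_arr \<A> B B) x')"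
      using op.pull_add[OF x(2), of "zero_arr \<A> B B" "zero_arr \<A> B B" B] C by simp
    moreover have "op.pull (zero_arr \<A> B B) x' \<in> op.EXT t B A" by (rule op.pull_Ext[OF x(2)]) (use C in simp_all)
    ultimately show ?thesis using C by (intro op.idem_zr) simp_all
  qed
  ultimately show ?thesis using dl_eq[OF z] by simp
qed

lemma con_exact1:
  assumes c: "conf c" and B: "B \<in> \<C>" and x: "x \<in> EXT t (kob c) B" "con c x = zr (Suc t) (cob c) B"
  obtains y where "y \<in> EXT t (mob c) B" "pull (fst c) y = x"
proof -
  interpret op: ext_cat "opc \<A>" \<C> by (rule ext_cat_opc)
  note [simp] = confD[OF c]
  obtain x' where x': "dl t (kob c) B x x'" using ex_dl[OF x(1)] by blast
  have oc: "op.conf (prod.swap c)" using c by simp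
  have k: "op.cov (prod.swap c) x' = op.zr (Suc t) B (cob c)"
    using dl_zr[OF _ B dl_con[OF x' c B]] x(2) by simp
  obtain y' where y': "y' \<in> op.EXT t B (op.mob (prod.swap c))" "op.push (snd (prod.swap c)) y' = x'"
    by (rule op.cov_exact1[OF oc B, of x' t]) (use dl_Ext[OF x'] k in simp_all)
  obtain y where y: "dl t (mob c) B y y'" using ex_dl'[of y' t B "mob c"] y' by auto
  have "dl t (kob c) B (pull (fst c) y) (op.push (fst c) y')"
    by (rule dl_pull[OF y]) simp_all
  from dl_eq[OF this x'] have "pull (fst c) y = x" using y'(2) by simp
  then show thesis using that dl_Ext[OF y] by blast
qed

lemma con_exact2:
  assumes c: "conf c" and B: "B \<in> \<C>" and z: "z \<in> EXT (Suc t) (cob c) B" "pull (snd c) z = zr (Suc t) (mob c) B"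
  obtains x where "x \<in> EXT t (kob c) B" "con c x = z"
proof -
  interpret op: ext_cat "opc \<A>" \<C> by (rule ext_cat_opc)
  note [simp] = confD[OF c]
  obtain z' where z': "dl (Suc t) (cob c) B z z'" using ex_dl[OF z(1)] by blast
  have oc: "op.conf (prod.swap c)" using c by simp
  have "dl (Suc t) (mob c) B (pull (snd c) z) (op.push (snd c) z')"
    by (rule dl_pull[OF z']) simp_all
  from dl_zr[OF _ B this] have k: "op.push (snd c) z' = op.zr (Suc t) B (mob c)" using z(2) by simp
  obtain x' where x': "x' \<in> op.EXT t B (op.cob (prod.swap c))" "op.cov (prod.swap c) x' = z'"
    by (rule op.cov_exact2[OF oc B, of z' t]) (use dl_Ext[OF z'] k in simp_all)
  obtain x where x: "dl t (kob c) B x x'" using ex_dl'[of x' t B "kob c"] x' by auto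
  have "con c x = z" using dl_eq[OF dl_con[OF x c B] z'] x'(2) by simp
  then show thesis using that dl_Ext[OF x] by blast
qed

end

section \<open>Frobenius categories\<close>

lemma (in group_hom) the_elem_coset:
  assumes "x \<in> carrier G" "N = kernel G H h"
  shows "the_elem (h ` (N #> x)) = h x"
proof -
  have "h ` (N #> x) = {h x}"
    using assms by (auto simp: r_coset_def kernel_def image_iff intro!: bexI[of _ "\<one>"])
  then show ?thesis by simp
qed

locale frobenius_cat = ext_cat \<A> \<C> for \<A> :: "('o, 'm) category_data" (structure) and \<C> :: "'o set" +
  fixes n :: nat
  assumes frob: "n_Frobenius \<A> \<C> n"
begin

abbreviation proj where "proj P \<equiv> n_projective \<A> \<C> n P"
abbreviation PS where "PS X Y \<equiv> proj_subgroup \<A> \<C> n X Y"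

lemma proj_C [simp]: "proj P \<Longrightarrow> P \<in> \<C>"
  by (simp add: n_projective_def)

lemma proj_Ext: "proj P \<Longrightarrow> n < t \<Longrightarrow> X \<in> \<C> \<Longrightarrow> x \<in> EXT t P X \<Longrightarrow> x = zr t P X"
  using carrier_grp(1) unfolding n_projective_def by blast

lemma inj_Ext: "proj P \<Longrightarrow> n < t \<Longrightarrow> X \<in> \<C> \<Longrightarrow> x \<in> EXT t X P \<Longrightarrow> x = zr t X P"
proof -
  assume *: "proj P" "n < t" "X \<in> \<C>" "x \<in> EXT t X P"
  have "\<forall>X\<in>\<C>. proj X = n_injective \<A> \<C> n X" using frob unfolding n_Frobenius_def by (elim conjE)
  then have "n_injective \<A> \<C> n P" using *(1) proj_C[OF *(1)] by blast
  then have "carrier (grp t X P) = {zr t X P}" using *(2,3) by (simp add: n_injective_def)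
  then show ?thesis using *(4) by simp
qed

lemma ex_cover:
  assumes "X \<in> \<C>"
  obtains c where "conf c" "cob c = X" "proj (mob c)"
proof -
  obtain i p where "conflation \<A> \<C> i p" "tgt \<A> p = X" "proj (src \<A> p)"
    using frob assms unfolding n_Frobenius_def by blast
  then show thesis using that[of "(i, p)"] confD(3)[of "(i, p)"] by simp
qed

lemma ex_hull:
  assumes "X \<in> \<C>"
  obtains c where "conf c" "kob c = X" "proj (mob c)"
proof -
  obtain i p where c: "conflation \<A> \<C> i p" "src \<A> i = X" "n_injective \<A> \<C> n (tgt \<A> i)"
    using frob assms unfolding n_Frobenius_def by blast
  then have "tgt \<A> i \<in> \<C>" by (simp add: conflation_def)
  then have "proj (tgt \<A> i)" using c frob unfolding n_Frobenius_def by blast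
  then show thesis using that[of "(i, p)"] c by simp
qed

lemma cov_surj:
  assumes c: "conf c" "proj (mob c)" and M: "M \<in> \<C>" and t: "n \<le> t" and z: "z \<in> EXT (Suc t) M (kob c)"
  obtains x where "x \<in> EXT t M (cob c)" "cov c x = z"
proof -
  have "push (fst c) z \<in> EXT (Suc t) M (mob c)" by (rule push_Ext[OF z]) (use c in simp_all)
  then have "push (fst c) z = zr (Suc t) M (mob c)" using inj_Ext[OF c(2) _ M] t by simp
  then show thesis using cov_exact2[OF c(1) M z] that by blast
qed

lemma con_surj:
  assumes c: "conf c" "proj (mob c)" and B: "B \<in> \<C>" and t: "n \<le> t" and z: "z \<in> EXT (Suc t) (cob c) B"
  obtains x where "x \<in> EXT t (kob c) B" "con c x = z"
proof -
  have "pull (snd c) z \<in> EXT (Suc t) (mob c) B" by (rule pull_Ext[OF z]) (use c in simp_all)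
  then have "pull (snd c) z = zr (Suc t) (mob c) B" using proj_Ext[OF c(2) _ B] t by simp
  then show thesis using con_exact2[OF c(1) B z] that by blast
qed

lemma cov_kernel_trivial:
  assumes c: "conf c" "proj (mob c)" and M: "M \<in> \<C>" and t: "n < t" and x: "x \<in> EXT t M (cob c)" "cov c x = zr (Suc t) M (kob c)"
  shows "x = zr t M (cob c)"
proof -
  obtain y where y: "y \<in> EXT t M (mob c)" "push (snd c) y = x" by (rule cov_exact1[OF c(1) M x])
  have "y = zr t M (mob c)" by (rule inj_Ext[OF c(2) t M y(1)])
  then show ?thesis using push_zr[OF M, of "snd c" "mob c" "cob c" t] y(2) c(1) by simp
qed

lemma con_kernel_trivial:
  assumes c: "conf c" "proj (mob c)" and B: "B \<in> \<C>" and t: "n < t" and x: "x \<in> EXT t (kob c) B" "con c x = zr (Suc t) (cob c) B"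
  shows "x = zr t (kob c) B"
proof -
  obtain y where y: "y \<in> EXT t (mob c) B" "pull (fst c) y = x" by (rule con_exact1[OF c(1) B x])
  have "y = zr t (mob c) B" by (rule proj_Ext[OF c(2) t B y(1)])
  then show ?thesis using pull_zr[OF B, of "fst c" "kob c" "mob c" t] y(2) c(1) by simp
qed

lemma PS_cov_kernel:
  assumes c: "conf c" "proj (mob c)" and M: "M \<in> \<C>"
  shows "PS M (cob c) = {x \<in> EXT n M (cob c). cov c x = zr (Suc n) M (kob c)}"
proof (intro equalityI subsetI)
  note [simp] = confD[OF c(1)]
  fix x assume "x \<in> PS M (cob c)"
  then obtain f e P where x: "x = pull f e" "proj P" "f \<in> arrs \<A>" "src \<A> f = M" "tgt \<A> f = P" "e \<in> EXT n P (cob c)"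
    unfolding proj_subgroup_def Hom_def by blast
  have P: "P \<in> \<C>" using x by simp
  have "cov c e = zr (Suc n) P (kob c)"
    by (rule proj_Ext[OF x(2)]) (use cov_Ext[OF x(6) c(1) refl P] in simp_all)
  then have "cov c x = pull f (zr (Suc n) P (kob c))"
    using pull_cov[OF x(6) c(1) x(3,5)] x M P by simp
  then have "cov c x = zr (Suc n) M (kob c)" using pull_zr x M P by simp
  moreover have "x \<in> EXT n M (cob c)" unfolding x(1) by (rule pull_Ext[OF x(6,3,4,5) M])
  ultimately show "x \<in> {x \<in> EXT n M (cob c). cov c x = zr (Suc n) M (kob c)}" by simp
next
  note [simp] = confD[OF c(1)]
  fix x assume "x \<in> {x \<in> EXT n M (cob c). cov c x = zr (Suc n) M (kob c)}"
  then have x: "x \<in> EXT n M (cob c)" "cov c x = zr (Suc n) M (kob c)" by simp_all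
  obtain y where y: "y \<in> EXT n M (mob c)" "push (snd c) y = x" by (rule cov_exact1[OF c(1) M x])
  obtain d where d: "conf d" "kob d = M" "proj (mob d)" by (rule ex_hull[OF M])
  note [simp] = confD[OF d(1)]
  have yd: "y \<in> EXT n (kob d) (mob c)" using y d by simp
  have mc: "mob c \<in> \<C>" by simp
  have "con d y = zr (Suc n) (cob d) (mob c)"
    by (rule inj_Ext[OF c(2)]) (use con_Ext[OF yd d(1) refl mc] in simp_all)
  then obtain y' where y': "y' \<in> EXT n (mob d) (mob c)" "pull (fst d) y' = y"
    by (rule con_exact1[OF d(1) mc yd])
  have "x = pull (fst d) (push (snd c) y')"
    using push_pull[OF y'(1), of "snd c" "fst d"] y(2) y'(2) d M by simp
  moreover have "push (snd c) y' \<in> EXT n (mob d) (cob c)" by (rule push_Ext[OF y'(1)]) simp_all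
  ultimately have "x = pull (fst d) (push (snd c) y') \<and> proj (mob d) \<and> fst d \<in> Hom \<A> M (mob d) \<and>
      push (snd c) y' \<in> EXT n (mob d) (cob c)"
    using d by (simp add: Hom_def)
  then show "x \<in> PS M (cob c)" unfolding proj_subgroup_def by blast
qed

lemma PS_con_kernel:
  assumes c: "conf c" "proj (mob c)" and B: "B \<in> \<C>"
  shows "PS (kob c) B = {x \<in> EXT n (kob c) B. con c x = zr (Suc n) (cob c) B}"
proof (intro equalityI subsetI)
  note [simp] = confD[OF c(1)]
  fix x assume "x \<in> PS (kob c) B"
  then obtain f e P where x: "x = pull f e" "proj P" "f \<in> arrs \<A>" "src \<A> f = kob c" "tgt \<A> f = P" "e \<in> EXT n P B"
    unfolding proj_subgroup_def Hom_def by blast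
  have P: "P \<in> \<C>" using x by simp
  obtain d where d: "conf d" "cob d = B" "proj (mob d)" by (rule ex_cover[OF B])
  note [simp] = confD[OF d(1)]
  have ed: "e \<in> EXT n P (cob d)" using x d by simp
  have "cov d e = zr (Suc n) P (kob d)"
    by (rule proj_Ext[OF x(2)]) (use cov_Ext[OF ed d(1) refl P] in simp_all)
  then obtain e' where e': "e' \<in> EXT n P (mob d)" "push (snd d) e' = e"
    by (rule cov_exact1[OF d(1) P ed])
  have pe: "pull f e' \<in> EXT n (kob c) (mob d)" by (rule pull_Ext[OF e'(1) x(3,4,5)]) simp
  have "con c (pull f e') = zr (Suc n) (cob c) (mob d)"
    by (rule inj_Ext[OF d(3)]) (use con_Ext[OF pe c(1) refl] in simp_all)
  moreover have "x = push (snd d) (pull f e')"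
    unfolding x(1) e'(2)[symmetric] by (rule push_pull[OF e'(1), symmetric]) (use x P d B in simp_all)
  ultimately have "con c x = push (snd d) (zr (Suc n) (cob c) (mob d))"
    using push_con[OF pe c(1), of "snd d"] by simp
  moreover have "push (snd d) (zr (Suc n) (cob c) (mob d)) = zr (Suc n) (cob c) B"
    by (rule push_zr) (use d B in simp_all)
  ultimately have "con c x = zr (Suc n) (cob c) B" by simp
  moreover have "x \<in> EXT n (kob c) B" unfolding x(1) by (rule pull_Ext[OF x(6,3,4,5)]) simp
  ultimately show "x \<in> {x \<in> EXT n (kob c) B. con c x = zr (Suc n) (cob c) B}" by simp
next
  note [simp] = confD[OF c(1)]
  fix x assume "x \<in> {x \<in> EXT n (kob c) B. con c x = zr (Suc n) (cob c) B}"
  then have x: "x \<in> EXT n (kob c) B" "con c x = zr (Suc n) (cob c) B" by simp_all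
  obtain y where "y \<in> EXT n (mob c) B" "pull (fst c) y = x" by (rule con_exact1[OF c(1) B x])
  then show "x \<in> PS (kob c) B"
    unfolding proj_subgroup_def Hom_def using c by force
qed

lemma group_grp: "A \<in> \<C> \<Longrightarrow> B \<in> \<C> \<Longrightarrow> group (grp t A B)"
  using comm_group_grp by (simp add: comm_group_def)

lemma group_hom_cov: "M \<in> \<C> \<Longrightarrow> conf c \<Longrightarrow> group_hom (grp t M (cob c)) (grp (Suc t) M (kob c)) (cov c)"
  by (intro group_hom.intro group_hom_axioms.intro group_grp hom_cov) simp_all

lemma group_hom_con: "B \<in> \<C> \<Longrightarrow> conf c \<Longrightarrow> group_hom (grp t (kob c) B) (grp (Suc t) (cob c) B) (con c)"
  by (intro group_hom.intro group_hom_axioms.intro group_grp hom_con) simp_all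

lemma induced_cov:
  assumes c: "conf c" "proj (mob c)" and M: "M \<in> \<C>"
  shows "x \<in> EXT n M (cob c) \<Longrightarrow> induced_on_cosets (cov c) (ext_bar \<A> \<C> n M (cob c) x) = cov c x"
    "induced_on_cosets (cov c) \<in> iso (ext_mod_proj \<A> \<C> n M (cob c)) (grp (Suc n) M (kob c))"
proof -
  interpret h: group_hom "grp n M (cob c)" "grp (Suc n) M (kob c)" "cov c" by (rule group_hom_cov[OF M c(1)])
  have k: "PS M (cob c) = kernel (grp n M (cob c)) (grp (Suc n) M (kob c)) (cov c)"
    unfolding PS_cov_kernel[OF c M] kernel_def by simp
  show "x \<in> EXT n M (cob c) \<Longrightarrow> induced_on_cosets (cov c) (ext_bar \<A> \<C> n M (cob c) x) = cov c x"
    unfolding induced_on_cosets_def ext_bar_def using h.the_elem_coset[OF _ k] by simp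
  have "cov c ` EXT n M (cob c) = EXT (Suc n) M (kob c)"
    using cov_surj[OF c M le_refl] cov_Ext[OF _ c(1) refl M] by (auto simp: image_iff)
  then show "induced_on_cosets (cov c) \<in> iso (ext_mod_proj \<A> \<C> n M (cob c)) (grp (Suc n) M (kob c))"
    using h.FactGroup_iso_set unfolding induced_on_cosets_def[abs_def] ext_mod_proj_def k by simp
qed

lemma induced_con:
  assumes c: "conf c" "proj (mob c)" and B: "B \<in> \<C>"
  shows "x \<in> EXT n (kob c) B \<Longrightarrow> induced_on_cosets (con c) (ext_bar \<A> \<C> n (kob c) B x) = con c x"
    "induced_on_cosets (con c) \<in> iso (ext_mod_proj \<A> \<C> n (kob c) B) (grp (Suc n) (cob c) B)"
proof -
  interpret h: group_hom "grp n (kob c) B" "grp (Suc n) (cob c) B" "con c" by (rule group_hom_con[OF B c(1)])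
  have k: "PS (kob c) B = kernel (grp n (kob c) B) (grp (Suc n) (cob c) B) (con c)"
    unfolding PS_con_kernel[OF c B] kernel_def by simp
  show "x \<in> EXT n (kob c) B \<Longrightarrow> induced_on_cosets (con c) (ext_bar \<A> \<C> n (kob c) B x) = con c x"
    unfolding induced_on_cosets_def ext_bar_def using h.the_elem_coset[OF _ k] by simp
  have "con c ` EXT n (kob c) B = EXT (Suc n) (cob c) B"
    using con_surj[OF c B le_refl] con_Ext[OF _ c(1) refl B] by (auto simp: image_iff)
  then show "induced_on_cosets (con c) \<in> iso (ext_mod_proj \<A> \<C> n (kob c) B) (grp (Suc n) (cob c) B)"
    using h.FactGroup_iso_set unfolding induced_on_cosets_def[abs_def] ext_mod_proj_def k by simp
qed

lemma PS_normal: "X \<in> \<C> \<Longrightarrow> Y \<in> \<C> \<Longrightarrow> PS X Y \<lhd> grp n X Y"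
proof -
  assume X: "X \<in> \<C>" and Y: "Y \<in> \<C>"
  obtain c where c: "conf c" "cob c = Y" "proj (mob c)" by (rule ex_cover[OF Y])
  interpret h: group_hom "grp n X (cob c)" "grp (Suc n) X (kob c)" "cov c" by (rule group_hom_cov[OF X c(1)])
  have "PS X Y = kernel (grp n X (cob c)) (grp (Suc n) X (kob c)) (cov c)"
    unfolding PS_cov_kernel[OF c(1,3) X, unfolded c(2)] kernel_def c(2) by simp
  then show ?thesis using h.normal_kernel c by simp
qed

end

section \<open>Unit conflations\<close>

context ext_cat
begin

fun covs :: "('m \<times> 'm) list \<Rightarrow> 'm ext \<Rightarrow> 'm ext" where
  "covs [] x = x"
| "covs (c # cs) x = covs cs (cov c x)"

fun cons :: "('m \<times> 'm) list \<Rightarrow> 'm ext \<Rightarrow> 'm ext" where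
  "cons [] x = x"
| "cons (c # cs) x = cons cs (con c x)"

fun copath :: "'o \<Rightarrow> 'o \<Rightarrow> ('m \<times> 'm) list \<Rightarrow> bool" where
  "copath A B [] \<longleftrightarrow> A = B \<and> A \<in> \<C>"
| "copath A B (c # cs) \<longleftrightarrow> conf c \<and> kob c = A \<and> copath (cob c) B cs"

lemma copath_C: "copath A B cs \<Longrightarrow> A \<in> \<C> \<and> B \<in> \<C>"
proof (induction cs arbitrary: A)
  case (Cons c cs)
  then show ?case using confD(4)[of c] by auto
qed simp

lemma covs_Ext: "path N K cs \<Longrightarrow> X \<in> \<C> \<Longrightarrow> x \<in> EXT t X N \<Longrightarrow> covs cs x \<in> EXT (t + length cs) X K"
proof (induction cs arbitrary: N t x)
  case (Cons c cs)
  then have "cov c x \<in> EXT (Suc t) X (kob c)" using cov_Ext[of x t X N c] by simp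
  then show ?case using Cons.IH[of "kob c" "cov c x" "Suc t"] Cons.prems by simp
qed simp

lemma cons_Ext: "copath M L cs \<Longrightarrow> B \<in> \<C> \<Longrightarrow> x \<in> EXT t M B \<Longrightarrow> cons cs x \<in> EXT (t + length cs) L B"
proof (induction cs arbitrary: M t x)
  case (Cons c cs)
  then have "con c x \<in> EXT (Suc t) (cob c) B" using con_Ext[of x t M B c] by simp
  then show ?case using Cons.IH[of "cob c" "con c x" "Suc t"] Cons.prems by simp
qed simp

lemma covs_plus: "path N K cs \<Longrightarrow> X \<in> \<C> \<Longrightarrow> x \<in> EXT t X N \<Longrightarrow> y \<in> EXT t X N \<Longrightarrow>
    covs cs (plus x y) = plus (covs cs x) (covs cs y)"
proof (induction cs arbitrary: N t x y)
  case (Cons c cs)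
  then have "cov c x \<in> EXT (Suc t) X (kob c)" "cov c y \<in> EXT (Suc t) X (kob c)" using cov_Ext[of _ t X N c] by simp_all
  then show ?case using Cons.IH[of "kob c" "cov c x" "Suc t" "cov c y"] Cons.prems cov_plus[of x t X c y] by auto
qed simp

lemma cons_plus: "copath M L cs \<Longrightarrow> B \<in> \<C> \<Longrightarrow> x \<in> EXT t M B \<Longrightarrow> y \<in> EXT t M B \<Longrightarrow>
    cons cs (plus x y) = plus (cons cs x) (cons cs y)"
proof (induction cs arbitrary: M t x y)
  case (Cons c cs)
  then have "con c x \<in> EXT (Suc t) (cob c) B" "con c y \<in> EXT (Suc t) (cob c) B" using con_Ext[of _ t M B c] by simp_all
  then show ?case using Cons.IH[of "cob c" "con c x" "Suc t" "con c y"] Cons.prems con_plus[of x t c B y] by auto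
qed simp

lemma covs_lmor: "lmor a b cs ds \<Longrightarrow> path N K cs \<Longrightarrow> X \<in> \<C> \<Longrightarrow> x \<in> EXT t X N \<Longrightarrow>
    push a (covs cs x) = covs ds (push b x)"
proof (induction a b cs ds arbitrary: N t x rule: lmor.induct)
  case (2 a b c cs d ds)
  obtain f where f: "cm f b c d" "lmor a f cs ds" using 2(2) by auto
  have x: "x \<in> EXT t X (cob c)" "conf c" "path (kob c) K cs" using 2(3,5) by auto
  have "cov c x \<in> EXT (Suc t) X (kob c)" by (rule cov_Ext[OF x(1,2) refl 2(4)])
  from 2(1)[OF f(2) x(3) 2(4) this] show ?case using push_cov[OF x(1) f(1) 2(4)] by simp
qed auto

lemma cons_push: "copath M L cs \<Longrightarrow> B \<in> \<C> \<Longrightarrow> x \<in> EXT t M B \<Longrightarrow> a \<in> arrs \<A> \<Longrightarrow> src \<A> a = B \<Longrightarrow> tgt \<A> a \<in> \<C> \<Longrightarrow>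
    push a (cons cs x) = cons cs (push a x)"
proof (induction cs arbitrary: M t x)
  case (Cons c cs)
  then have "con c x \<in> EXT (Suc t) (cob c) B" using con_Ext[of x t M B c] by simp
  then show ?case using Cons.IH[of "cob c" "con c x" "Suc t"] Cons.prems push_con[of x t c B a] by auto
qed simp

lemma covs_cl_cong:
  assumes "path N K cs" "cs \<noteq> []" "path N K ds" "cl cs = cl ds" "X \<in> \<C>" "x \<in> EXT t X N"
  shows "covs cs x = covs ds x"
proof -
  have C: "N \<in> \<C>" "K \<in> \<C>" using path_C[OF assms(1)] by auto
  have st: "covs es x = covs fs x" if "lstep N K es fs" for es fs
  proof -
    have p: "path N K es" "lmor (idn \<A> K) (idn \<A> N) es fs" using that by (auto simp: lstep_def)
    show ?thesis
      using covs_lmor[OF p(2,1) assms(5,6)] push_id[OF covs_Ext[OF p(1) assms(5,6)] C(2)] push_id[OF assms(6) C(1)] by simp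
  qed
  have "eqv N K cs ds" using cl_eq_iff[OF assms(1-3)] assms(4) by simp
  then show ?thesis
    unfolding eqv_def by (induction rule: rtranclp_induct) (use st in metis)+
qed

lemma covs_push_cl:
  assumes "path N K cs" "cs \<noteq> []" "path N Z ds" "push a (cl cs) = cl ds" "X \<in> \<C>" "x \<in> EXT t X N"
    and a: "a \<in> arrs \<A>" "src \<A> a = K" "tgt \<A> a = Z"
  shows "push a (covs cs x) = covs ds x"
proof -
  have C: "N \<in> \<C>" "Z \<in> \<C>" using path_C[OF assms(3)] by auto
  obtain es where es: "path N Z es" "length es = length cs" "lmor a (idn \<A> N) cs es"
    using lmor_push_ex[OF assms(1,2) a(1,2)] a C by auto
  have "es \<noteq> []" using es(2) assms(2) by auto
  then have "covs es x = covs ds x"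
    using push_cl[OF assms(1,2) es(3,1)] assms by (intro covs_cl_cong[OF es(1) _ assms(3)]) simp_all
  then show ?thesis using covs_lmor[OF es(3) assms(1,5,6)] push_id[OF assms(6) C(1)] by simp
qed

lemma conf_comp:
  assumes c: "conf c" and e: "conf e" "kob e = mob c"
  obtains m where "conf (fst e \<cdot> fst c, m)"
proof -
  obtain e' where e': "cm (snd c) (idn \<A> (cob e)) e e'"
    by (rule ex_conf_push[OF e(1), of "snd c"]) (use c e in simp_all)
  obtain m where m: "m \<in> arrs \<A>" "src \<A> m = mob e" "tgt \<A> m = mob e'" "m \<cdot> fst e = fst e' \<cdot> snd c"
    "snd e' \<cdot> m = idn \<A> (cob e) \<cdot> snd e"
    by (rule cmE[OF e'])
  show thesis by (rule that, rule conf_push_deflation[OF c e(2) e' m])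
qed

text \<open>A cover of \<open>Z\<close> is enlarged by \<open>mob c\<close>; the new kernel is an extension of \<open>mob h\<close> by \<open>kob c\<close>, where
  \<open>h\<close> is the pullback of the given cover along \<open>a\<close> up to sign.\<close>

lemma enlarge_cover:
  assumes c: "conf c" and e: "conf e" and a: "a \<in> arrs \<A>" "src \<A> a = cob c" "tgt \<A> a = cob e"
  obtains e' k l i1 i2 p1 p2 where "conf e'" "cob e' = cob e" "is_biproduct \<A> (mob e) (mob c) (mob e') i1 i2 p1 p2"
    "cm k a c e'" "inflation \<A> \<C> k" "cm l (idn \<A> (cob e)) e e'" "inflation \<A> \<C> l"
proof -
  note [simp] = confD[OF c] confD[OF e] a
  let ?g = "ng (a \<cdot> snd c)"
  obtain d where d: "kob d = kob e" "cob d = mob c" "cm (idn \<A> (kob e)) ?g d e"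
    by (rule ex_conf_pull[OF e, of ?g]) simp_all
  have cd: "conf d" using cmD[OF d(3)] by simp
  note [simp] = confD[OF cd] d(1,2)
  obtain m where m: "m \<in> arrs \<A>" "src \<A> m = mob d" "tgt \<A> m = mob e" "m \<cdot> fst d = fst e" "snd e \<cdot> m = ?g \<cdot> snd d"
    by (rule cm_idE[OF d(3)])
  have pd: "is_pullback \<A> (snd e) ?g m (snd d)" by (rule cm_pullback[OF d(3) m])
  obtain h where h: "kob h = kob e" "cob h = cob c" "cm (idn \<A> (kob e)) (ng a) h e"
    by (rule ex_conf_pull[OF e, of "ng a"]) simp_all
  have ch: "conf h" using cmD[OF h(3)] by simp
  note [simp] = confD[OF ch] h(1,2)
  obtain r where r: "r \<in> arrs \<A>" "src \<A> r = mob h" "tgt \<A> r = mob e" "r \<cdot> fst h = fst e" "snd e \<cdot> r = ng a \<cdot> snd h"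
    by (rule cm_idE[OF h(3)])
  have ph: "is_pullback \<A> (snd e) (ng a) r (snd h)" by (rule cm_pullback[OF h(3) r])
  note [simp] = m(1-3) r(1-3)
  have CC: "mob e \<in> \<C>" "mob c \<in> \<C>" by simp_all
  obtain S i1 i2 p1 p2 where b: "is_biproduct \<A> (mob e) (mob c) S i1 i2 p1 p2" by (rule ex_biprod_C[OF CC])
  note [simp] = biprodD(3-19)[OF b] biprod_cmp[OF b]
  let ?z = "(i1 \<cdot> m) \<boxplus> (i2 \<cdot> snd d)" and ?s = "(snd e \<cdot> p1) \<boxplus> ng (?g \<cdot> p2)"
  have "short_exact \<A> ?z ?s"
    by (rule pullback_MV[OF pd _ ses_is_epi[OF conf_ses[OF e]]]) (use b in simp)
  then have e': "conf (?z, ?s)" using confI by simp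
  have l: "cm (fst d) (idn \<A> (cob e)) e (?z, ?s)"
    by (rule cmI[of _ _ _ _ i1]) (use e e' m(4) in simp_all)
  obtain k where k: "k \<in> arrs \<A>" "src \<A> k = kob c" "tgt \<A> k = mob d" "m \<cdot> k = zero_arr \<A> (kob c) (mob e)" "snd d \<cdot> k = fst c"
    by (rule pullback_lift[OF pd, of "zero_arr \<A> (kob c) (mob e)" "fst c"]) simp_all
  note [simp] = k(1-3)
  have kc: "cm k a c (?z, ?s)"
    by (rule cmI[of _ _ _ _ i2]) (use c e' k(4,5) in simp_all)
  obtain w where w: "w \<in> arrs \<A>" "src \<A> w = mob d" "tgt \<A> w = mob h" "r \<cdot> w = m" "snd h \<cdot> w = snd c \<cdot> snd d"
    by (rule pullback_lift[OF ph, of m "snd c \<cdot> snd d"]) (use m(5) in simp_all)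
  note [simp] = w(1-3)
  have pw: "is_pullback \<A> (snd c) (snd h) (snd d) w"
  proof (rule is_pullbackI)
    show "snd c \<cdot> snd d = snd h \<cdot> w" using w(5) by simp
  next
    fix x y assume xy [simp]: "x \<in> arrs \<A>" "y \<in> arrs \<A>" "src \<A> y = src \<A> x" "tgt \<A> x = src \<A> (snd c)" "tgt \<A> y = src \<A> (snd h)"
      and eq: "snd c \<cdot> x = snd h \<cdot> y"
    have [simp]: "tgt \<A> x = mob c" "tgt \<A> y = mob h" using xy by simp_all
    have "snd e \<cdot> (r \<cdot> y) = ng a \<cdot> (snd h \<cdot> y)" by (rule cmp_eq_reassoc[OF r(5)]) simp_all
    also have "\<dots> = ?g \<cdot> x" using eq[symmetric] by simp
    finally obtain t where t: "t \<in> arrs \<A>" "src \<A> t = src \<A> x" "tgt \<A> t = mob d" "m \<cdot> t = r \<cdot> y" "snd d \<cdot> t = x"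
      by - (rule pullback_lift[OF pd, of "r \<cdot> y" x], simp_all)
    note [simp] = t(1-3)
    have "w \<cdot> t = y"
    proof (rule pullback_unique[OF ph])
      show "r \<cdot> (w \<cdot> t) = r \<cdot> y" using cmp_eq_reassoc1[OF w(4), of t] t(4) by simp
      show "snd h \<cdot> (w \<cdot> t) = snd h \<cdot> y" using cmp_eq_reassoc[OF w(5), of t] t(5) eq by simp
    qed simp_all
    then show "\<exists>w'. w' \<in> arrs \<A> \<and> src \<A> w' = src \<A> x \<and> tgt \<A> w' = src \<A> (snd d) \<and> snd d \<cdot> w' = x \<and> w \<cdot> w' = y"
      using t(5) by (intro exI[of _ t]) simp
  next
    fix x y assume xy [simp]: "x \<in> arrs \<A>" "y \<in> arrs \<A>" "src \<A> x = src \<A> y" "tgt \<A> x = src \<A> (snd d)" "tgt \<A> y = src \<A> (snd d)"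
      and eq: "snd d \<cdot> x = snd d \<cdot> y" "w \<cdot> x = w \<cdot> y"
    have [simp]: "tgt \<A> x = mob d" "tgt \<A> y = mob d" using xy by simp_all
    have "m \<cdot> x = m \<cdot> y" using cmp_eq_reassoc1[OF w(4), of x] cmp_eq_reassoc1[OF w(4), of y] eq(2) by simp
    then show "x = y" using eq(1) by - (rule pullback_unique[OF pd], simp_all)
  qed simp_all
  have "w \<cdot> k = zero_arr \<A> (kob c) (mob h)"
  proof (rule pullback_unique[OF ph])
    show "r \<cdot> (w \<cdot> k) = r \<cdot> zero_arr \<A> (kob c) (mob h)" using cmp_eq_reassoc1[OF w(4), of k] k(4) by simp
    show "snd h \<cdot> (w \<cdot> k) = snd h \<cdot> zero_arr \<A> (kob c) (mob h)" using cmp_eq_reassoc[OF w(5), of k] k(5) by simp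
  qed simp_all
  then have "short_exact \<A> k w"
    using k(5) by - (rule pullback_ses[OF conf_ses[OF c] pw], simp_all)
  then have ki: "conf (k, w)" using confI by simp
  show thesis
    by (rule that[of "(?z, ?s)" i1 i2 p1 p2 k "fst d"]) (use e' b kc l ki cd in \<open>auto simp: inflation_def\<close>)
qed

end

context frobenius_cat
begin

lemma projI:
  assumes "P \<in> \<C>" "\<And>t X x. n < t \<Longrightarrow> X \<in> \<C> \<Longrightarrow> x \<in> EXT t P X \<Longrightarrow> x = zr t P X"
  shows "proj P"
  unfolding n_projective_def carrier_grp using assms zr_Ext by blast

lemma proj_biproduct:
  assumes b: "is_biproduct \<A> P Q S i j p q" and P: "proj P" "proj Q"
  shows "proj S"
proof (rule projI)
  note [simp] = biprodD(3-19)[OF b]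
  have C: "P \<in> \<C>" "Q \<in> \<C>" using P by simp_all
  show S: "S \<in> \<C>" by (rule biprod_C[OF b C])
  fix t X x assume t: "n < t" and X: "X \<in> \<C>" and x: "x \<in> EXT t S X"
  have *: "pull (i' \<cdot> p') x = zr t S X" if "proj P'" "i' \<in> arrs \<A>" "p' \<in> arrs \<A>" "src \<A> i' = P'" "tgt \<A> i' = S" "src \<A> p' = S" "tgt \<A> p' = P'"
    for i' p' P'
  proof -
    have P': "P' \<in> \<C>" using that by simp
    have "pull i' x \<in> EXT t P' X" by (rule pull_Ext[OF x]) (use that P' in simp_all)
    then have "pull i' x = zr t P' X" by (rule proj_Ext[OF that(1) t X])
    moreover have "pull p' (pull i' x) = pull (i' \<cdot> p') x" by (rule pull_pull[OF x]) (use that S P' in simp_all)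
    ultimately show ?thesis using pull_zr[OF X, of p' S P' t] that S P' by simp
  qed
  have "x = pull ((i \<cdot> p) \<boxplus> (j \<cdot> q)) x" using biprodD(20)[OF b] pull_id[OF x S] by simp
  also have "\<dots> = plus (pull (i \<cdot> p) x) (pull (j \<cdot> q) x)"
    by (rule pull_add[OF x, where A' = S]) (use S X in simp_all)
  also have "\<dots> = zr t S X" using *[OF P(1), of i p] *[OF P(2), of j q] zr_plus[OF S X zr_Ext[OF S X]] by simp
  finally show "x = zr t S X" .
qed

lemma cov_bij:
  assumes c: "conf c" "proj (mob c)" and M: "M \<in> \<C>" and t: "n < t"
  shows "bij_betw (cov c) (EXT t M (cob c)) (EXT (Suc t) M (kob c))"
proof -
  interpret h: group_hom "grp t M (cob c)" "grp (Suc t) M (kob c)" "cov c" by (rule group_hom_cov[OF M c(1)])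
  have "kernel (grp t M (cob c)) (grp (Suc t) M (kob c)) (cov c) = {zr t M (cob c)}"
    unfolding kernel_def carrier_grp
    using cov_kernel_trivial[OF c M t] zr_Ext[OF M confD(6)[OF c(1)]] cov_zr[OF M c(1)] by blast
  then have "inj_on (cov c) (EXT t M (cob c))" using h.inj_iff_trivial_ker by simp
  moreover have "EXT (Suc t) M (kob c) \<subseteq> cov c ` EXT t M (cob c)"
  proof
    fix z assume "z \<in> EXT (Suc t) M (kob c)"
    then obtain x where "x \<in> EXT t M (cob c)" "cov c x = z" using cov_surj[OF c M less_imp_le[OF t]] by blast
    then show "z \<in> cov c ` EXT t M (cob c)" by blast
  qed
  moreover have "cov c ` EXT t M (cob c) \<subseteq> EXT (Suc t) M (kob c)" using cov_Ext[OF _ c(1) refl M] by blast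
  ultimately show ?thesis unfolding bij_betw_def by blast
qed

lemma con_bij:
  assumes c: "conf c" "proj (mob c)" and B: "B \<in> \<C>" and t: "n < t"
  shows "bij_betw (con c) (EXT t (kob c) B) (EXT (Suc t) (cob c) B)"
proof -
  interpret h: group_hom "grp t (kob c) B" "grp (Suc t) (cob c) B" "con c" by (rule group_hom_con[OF B c(1)])
  have "kernel (grp t (kob c) B) (grp (Suc t) (cob c) B) (con c) = {zr t (kob c) B}"
    unfolding kernel_def carrier_grp
    using con_kernel_trivial[OF c B t] zr_Ext[OF confD(4)[OF c(1)] B] con_zr[OF B c(1)] by blast
  then have "inj_on (con c) (EXT t (kob c) B)" using h.inj_iff_trivial_ker by simp
  moreover have "EXT (Suc t) (cob c) B \<subseteq> con c ` EXT t (kob c) B"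
  proof
    fix z assume "z \<in> EXT (Suc t) (cob c) B"
    then obtain x where "x \<in> EXT t (kob c) B" "con c x = z" using con_surj[OF c B less_imp_le[OF t]] by blast
    then show "z \<in> con c ` EXT t (kob c) B" by blast
  qed
  moreover have "con c ` EXT t (kob c) B \<subseteq> EXT (Suc t) (cob c) B" using con_Ext[OF _ c(1) refl B] by blast
  ultimately show ?thesis unfolding bij_betw_def by blast
qed

abbreviation projs where "projs cs \<equiv> \<forall>c\<in>set cs. proj (mob c)"

lemma covs_bij:
  "path N K cs \<Longrightarrow> projs cs \<Longrightarrow> X \<in> \<C> \<Longrightarrow> n < t \<Longrightarrow> bij_betw (covs cs) (EXT t X N) (EXT (t + length cs) X K)"
proof (induction cs arbitrary: N t)
  case Nil
  then show ?case by (simp add: bij_betw_def inj_on_def)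
next
  case (Cons c cs)
  have "bij_betw (cov c) (EXT t X N) (EXT (Suc t) X (kob c))" using cov_bij[of c X t] Cons.prems by auto
  moreover have "bij_betw (covs cs) (EXT (Suc t) X (kob c)) (EXT (Suc t + length cs) X K)"
    by (rule Cons.IH) (use Cons.prems in auto)
  ultimately have "bij_betw (covs cs \<circ> cov c) (EXT t X N) (EXT (Suc t + length cs) X K)" by (rule bij_betw_trans)
  moreover have "covs cs \<circ> cov c = covs (c # cs)" by auto
  ultimately show ?case by (simp del: covs.simps)
qed

lemma cons_bij:
  "copath M L cs \<Longrightarrow> projs cs \<Longrightarrow> B \<in> \<C> \<Longrightarrow> n < t \<Longrightarrow> bij_betw (cons cs) (EXT t M B) (EXT (t + length cs) L B)"
proof (induction cs arbitrary: M t)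
  case Nil
  then show ?case by (simp add: bij_betw_def inj_on_def)
next
  case (Cons c cs)
  have "bij_betw (con c) (EXT t M B) (EXT (Suc t) (cob c) B)" using con_bij[of c B t] Cons.prems by auto
  moreover have "bij_betw (cons cs) (EXT (Suc t) (cob c) B) (EXT (Suc t + length cs) L B)"
    by (rule Cons.IH) (use Cons.prems in auto)
  ultimately have "bij_betw (cons cs \<circ> con c) (EXT t M B) (EXT (Suc t + length cs) L B)" by (rule bij_betw_trans)
  moreover have "cons cs \<circ> con c = cons (c # cs)" by auto
  ultimately show ?case by (simp del: cons.simps)
qed

lemma ex_coresolution: "M \<in> \<C> \<Longrightarrow> \<exists>cs L. copath M L cs \<and> length cs = k \<and> projs cs"
proof (induction k arbitrary: M)
  case 0
  then show ?case by (intro exI[of _ "[]"] exI[of _ M]) simp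
next
  case (Suc k)
  obtain c where c: "conf c" "kob c = M" "proj (mob c)" by (rule ex_hull[OF Suc(2)])
  obtain cs L where "copath (cob c) L cs" "length cs = k" "projs cs" using Suc(1)[of "cob c"] c by auto
  then show ?case using c by (intro exI[of _ "c # cs"] exI[of _ L]) simp
qed

lemma quasi_invertible_if_lmor:
  assumes l: "lmor a (idn \<A> N) cs ds" and p: "path N K cs" "path N Z ds" and P: "projs cs" "projs ds" and ne: "cs \<noteq> []"
  shows "quasi_invertible \<A> \<C> n a"
proof -
  have a: "a \<in> arrs \<A>" "src \<A> a = K" "tgt \<A> a = Z" using lmor_typed[OF l ne p] by auto
  have C: "N \<in> \<C>" "K \<in> \<C>" "Z \<in> \<C>" using path_C[OF p(1)] path_C[OF p(2)] by auto
  have len: "length ds = length cs" by (rule lmor_length[OF l])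
  have "push a \<in> iso (grp (n + 1) X K) (grp (n + 1) X Z)" if X: "X \<in> \<C>" for X
  proof -
    obtain es L where es: "copath X L es" "length es = length cs" "projs es" using ex_coresolution[OF X] by blast
    have L: "L \<in> \<C>" using copath_C[OF es(1)] by simp
    let ?t = "n + 1 + length cs"
    have b1: "bij_betw (covs cs) (EXT (n + 1) L N) (EXT ?t L K)" by (rule covs_bij[OF p(1) P(1) L]) simp
    have b2: "bij_betw (covs ds) (EXT (n + 1) L N) (EXT ?t L Z)" using covs_bij[OF p(2) P(2) L, of "n + 1"] len by simp
    have b3: "bij_betw (cons es) (EXT (n + 1) X K) (EXT ?t L K)" using cons_bij[OF es(1,3) C(2), of "n + 1"] es(2) by simp
    have b4: "bij_betw (cons es) (EXT (n + 1) X Z) (EXT ?t L Z)" using cons_bij[OF es(1,3) C(3), of "n + 1"] es(2) by simp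
    have "bij_betw (push a) (EXT ?t L K) (EXT ?t L Z)"
    proof -
      have "bij_betw (push a \<circ> covs cs) (EXT (n + 1) L N) (EXT ?t L Z)"
      proof (rule iffD1[OF bij_betw_cong b2])
        fix x assume x: "x \<in> EXT (n + 1) L N"
        show "covs ds x = (push a \<circ> covs cs) x" using covs_lmor[OF l p(1) L x] push_id[OF x C(1)] by simp
      qed
      then show ?thesis using bij_betw_comp_iff[OF b1] by blast
    qed
    then have "bij_betw (push a \<circ> cons es) (EXT (n + 1) X K) (EXT ?t L Z)" using b3 by (rule bij_betw_trans[rotated])
    moreover have "(push a \<circ> cons es) x = (cons es \<circ> push a) x" if "x \<in> EXT (n + 1) X K" for x
      using cons_push[OF es(1) C(2) that a(1,2)] a C by simp
    ultimately have "bij_betw (cons es \<circ> push a) (EXT (n + 1) X K) (EXT ?t L Z)"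
      using bij_betw_cong[of "EXT (n + 1) X K" "push a \<circ> cons es" "cons es \<circ> push a"] by blast
    moreover have "push a ` EXT (n + 1) X K \<subseteq> EXT (n + 1) X Z" using push_Ext[OF _ a C(3)] by blast
    ultimately have "bij_betw (push a) (EXT (n + 1) X K) (EXT (n + 1) X Z)" using bij_betw_comp_iff2[OF b4] by blast
    then show ?thesis using hom_push[OF X C(2,3) a] by (simp add: iso_def)
  qed
  then show ?thesis unfolding quasi_invertible_def using a C by simp
qed

lemma common_refinement:
  "path N K cs \<Longrightarrow> path N L ds \<Longrightarrow> projs cs \<Longrightarrow> projs ds \<Longrightarrow> length cs = length ds \<Longrightarrow>
    \<exists>Z es a b. path N Z es \<and> projs es \<and> lmor a (idn \<A> N) cs es \<and> lmor b (idn \<A> N) ds es \<and>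
      (cs \<noteq> [] \<longrightarrow> inflation \<A> \<C> a \<and> inflation \<A> \<C> b)"
proof (induction cs arbitrary: K L ds rule: rev_induct)
  case Nil
  then show ?case by (intro exI[of _ N] exI[of _ "[]"] exI[of _ "idn \<A> N"]) auto
next
  case (snoc c cs)
  obtain ds' d where ds: "ds = ds' @ [d]" using snoc.prems(5) by (metis Nil_is_append_conv length_0_conv not_Cons_self rev_exhaust)
  have p: "path N (cob c) cs" "conf c" "kob c = K" "path N (cob d) ds'" "conf d" "kob d = L"
    using snoc.prems(1,2) ds by (auto simp: path_append)
  have P: "projs cs" "proj (mob c)" "projs ds'" "proj (mob d)" "length cs = length ds'" using snoc.prems ds by auto
  obtain Z es a b where IH: "path N Z es" "projs es" "lmor a (idn \<A> N) cs es" "lmor b (idn \<A> N) ds' es"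
    using snoc.IH[OF p(1,4) P(1,3,5)] by blast
  have Z: "Z \<in> \<C>" using path_C[OF IH(1)] by simp
  have N: "N \<in> \<C>" using path_C[OF IH(1)] by simp
  have a: "a \<in> arrs \<A> \<and> src \<A> a = cob c \<and> tgt \<A> a = Z"
  proof (cases "cs = []")
    case True
    then have "es = []" using lmor_length[OF IH(3)] by simp
    then show ?thesis using True IH(1,3) p(1) by auto
  qed (use lmor_typed[OF IH(3) _ p(1) IH(1)] in simp)
  have b: "b \<in> arrs \<A> \<and> src \<A> b = cob d \<and> tgt \<A> b = Z"
  proof (cases "ds' = []")
    case True
    then have "es = []" using lmor_length[OF IH(4)] by simp
    then show ?thesis using True IH(1,4) p(4) by auto
  qed (use lmor_typed[OF IH(4) _ p(4) IH(1)] in simp)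
  obtain e where e: "conf e" "cob e = Z" "proj (mob e)" by (rule ex_cover[OF Z])
  obtain e1 k l i1 i2 p1 p2 where e1: "conf e1" "cob e1 = Z" "is_biproduct \<A> (mob e) (mob c) (mob e1) i1 i2 p1 p2"
    "cm k a c e1" "inflation \<A> \<C> k"
    by (rule enlarge_cover[OF p(2) e(1), of a]) (use a e in auto)
  have P1: "proj (mob e1)" by (rule proj_biproduct[OF e1(3) e(3) P(2)])
  obtain e2 k' l' i1 i2 p1 p2 where e2: "conf e2" "cob e2 = Z" "is_biproduct \<A> (mob e1) (mob d) (mob e2) i1 i2 p1 p2"
    "cm k' b d e2" "inflation \<A> \<C> k'" "cm l' (idn \<A> Z) e1 e2" "inflation \<A> \<C> l'"
    by (rule enlarge_cover[OF p(5) e1(1), of b]) (use b e1 in auto)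
  have P2: "proj (mob e2)" by (rule proj_biproduct[OF e2(3) P1 P(4)])
  have ka: "cm (l' \<cdot> k) a c e2" using cm_comp[OF e1(4) e2(6)] a by simp
  obtain u v where u: "conf (k, u)" and v: "conf (l', v)" using e1(5) e2(7) by (auto simp: inflation_def)
  obtain m where "conf (l' \<cdot> k, m)"
    using conf_comp[OF u v] cmD[OF e1(4)] cmD[OF e2(6)] by auto
  then have i: "inflation \<A> \<C> (l' \<cdot> k)" by (auto simp: inflation_def)
  have le: "length cs = length es" "length ds' = length es" using lmor_length[OF IH(3)] lmor_length[OF IH(4)] by auto
  have "lmor (l' \<cdot> k) a [c] [e2]" "lmor k' b [d] [e2]" using ka e2(4) cmD[OF ka] cmD[OF e2(4)] by auto
  then have "lmor (l' \<cdot> k) (idn \<A> N) (cs @ [c]) (es @ [e2])" "lmor k' (idn \<A> N) ds (es @ [e2])"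
    unfolding ds lmor_append[OF le(1)] lmor_append[OF le(2)] using IH by blast+
  moreover have "path N (kob e2) (es @ [e2])" "projs (es @ [e2])" using IH e2 P2 by (auto simp: path_append)
  ultimately show ?case using i e2(5) by blast
qed

end

section \<open>Morphisms in the phantom stable category\<close>

lemma iso_transport:
  assumes G: "group G" and f: "f \<in> iso G P" and h: "h \<in> iso G P'" and k: "\<And>x. x \<in> carrier G \<Longrightarrow> k (f x) = h x"
  shows "k \<in> iso P P'"
proof -
  interpret group G by fact
  have b: "bij_betw f (carrier G) (carrier P)" using f by (simp add: iso_def)
  have "bij_betw (k \<circ> f) (carrier G) (carrier P')"
    using h k bij_betw_cong[of "carrier G" "k \<circ> f" h "carrier P'"] by (simp add: iso_def)
  then have bk: "bij_betw k (carrier P) (carrier P')" using bij_betw_comp_iff[OF b] by blast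
  moreover have "k (u \<otimes>\<^bsub>P\<^esub> v) = k u \<otimes>\<^bsub>P'\<^esub> k v" if uv: "u \<in> carrier P" "v \<in> carrier P" for u v
  proof -
    obtain x y where xy: "x \<in> carrier G" "y \<in> carrier G" "u = f x" "v = f y" using uv b unfolding bij_betw_def by blast
    then have "u \<otimes>\<^bsub>P\<^esub> v = f (x \<otimes>\<^bsub>G\<^esub> y)" "h (x \<otimes>\<^bsub>G\<^esub> y) = h x \<otimes>\<^bsub>P'\<^esub> h y" using f h by (simp_all add: iso_def hom_def)
    then show ?thesis using k xy by simp
  qed
  ultimately show ?thesis by (auto simp: iso_def hom_def bij_betw_def)
qed

context frobenius_cat
begin

abbreviation bar where "bar X Y \<gamma> \<equiv> ext_bar \<A> \<C> n X Y \<gamma>"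
abbreviation EP where "EP X Y \<equiv> ext_mod_proj \<A> \<C> n X Y"

lemma group_EP: "X \<in> \<C> \<Longrightarrow> Y \<in> \<C> \<Longrightarrow> group (EP X Y)"
  unfolding ext_mod_proj_def by (rule normal.factorgroup_is_group[OF PS_normal])

lemma carrier_EP: "x \<in> carrier (EP X Y) \<longleftrightarrow> (\<exists>\<gamma>\<in>EXT n X Y. x = bar X Y \<gamma>)"
  by (auto simp: ext_mod_proj_def ext_bar_def FactGroup_def RCOSETS_def)

lemma bar_self:
  assumes "X \<in> \<C>" "Y \<in> \<C>" "\<gamma> \<in> EXT n X Y"
  shows "\<gamma> \<in> bar X Y \<gamma>" "\<gamma>' \<in> bar X Y \<gamma> \<Longrightarrow> \<gamma>' \<in> EXT n X Y \<and> bar X Y \<gamma>' = bar X Y \<gamma>"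
proof -
  interpret N: normal "PS X Y" "grp n X Y" by (rule PS_normal[OF assms(1,2)])
  show "\<gamma> \<in> bar X Y \<gamma>" unfolding ext_bar_def
    using N.rcos_self[of \<gamma>] N.is_subgroup assms(3) by simp
  assume g: "\<gamma>' \<in> bar X Y \<gamma>"
  have "bar X Y \<gamma> = bar X Y \<gamma>'" unfolding ext_bar_def
    by (rule N.repr_independence) (use g assms(3) N.is_subgroup in \<open>simp_all add: ext_bar_def\<close>)
  moreover have "bar X Y \<gamma> \<subseteq> EXT n X Y"
    unfolding ext_bar_def using N.r_coset_subset_G[OF N.subset] assms(3) by simp
  ultimately show "\<gamma>' \<in> EXT n X Y \<and> bar X Y \<gamma>' = bar X Y \<gamma>" using g by blast
qed

lemma cons_group_hom:
  assumes es: "copath M L es" "projs es" "es \<noteq> []" and B: "B \<in> \<C>"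
  shows "group_hom (grp n M B) (grp (n + length es) L B) (cons es)"
    "kernel (grp n M B) (grp (n + length es) L B) (cons es) = PS M B"
    "cons es ` EXT n M B = EXT (n + length es) L B"
proof -
  have C: "M \<in> \<C>" "L \<in> \<C>" using copath_C[OF es(1)] by auto
  show gh: "group_hom (grp n M B) (grp (n + length es) L B) (cons es)"
    by (intro group_hom.intro group_hom_axioms.intro group_grp C B)
      (auto simp: hom_def cons_Ext[OF es(1) B] cons_plus[OF es(1) B])
  obtain d es' where e: "es = d # es'" using es(3) by (cases es) auto
  have d: "conf d" "kob d = M" "proj (mob d)" "copath (cob d) L es'" "projs es'" using es e by auto
  have b: "bij_betw (cons es') (EXT (Suc n) (cob d) B) (EXT (n + length es) L B)"
    using cons_bij[OF d(4,5) B, of "Suc n"] e by simp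
  have z: "zr (Suc n) (cob d) B \<in> EXT (Suc n) (cob d) B" using zr_Ext B d(1) by simp
  have cz: "cons es' (zr (Suc n) (cob d) B) = zr (n + length es) L B"
  proof (rule idem_zr[OF C(2) B])
    show "cons es' (zr (Suc n) (cob d) B) \<in> EXT (n + length es) L B" using cons_Ext[OF d(4) B z] e by simp
    show "plus (cons es' (zr (Suc n) (cob d) B)) (cons es' (zr (Suc n) (cob d) B)) = cons es' (zr (Suc n) (cob d) B)"
      using cons_plus[OF d(4) B z z] zr_plus[OF _ B z] d(1) by simp
  qed
  have "cons es x = zr (n + length es) L B \<longleftrightarrow> con d x = zr (Suc n) (cob d) B" if x: "x \<in> EXT n M B" for x
  proof -
    have "con d x \<in> EXT (Suc n) (cob d) B" using con_Ext[OF x d(1,2) B] .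
    then have "cons es' (con d x) = cons es' (zr (Suc n) (cob d) B) \<longleftrightarrow> con d x = zr (Suc n) (cob d) B"
      using bij_betw_imp_inj_on[OF b] z by (simp add: inj_on_eq_iff)
    then show ?thesis using cz e by simp
  qed
  then show "kernel (grp n M B) (grp (n + length es) L B) (cons es) = PS M B"
    using PS_con_kernel[OF d(1,3) B] d(2) unfolding kernel_def by auto
  have "con d ` EXT n M B = EXT (Suc n) (cob d) B"
  proof
    show "con d ` EXT n M B \<subseteq> EXT (Suc n) (cob d) B" using con_Ext[OF _ d(1,2) B] by blast
    show "EXT (Suc n) (cob d) B \<subseteq> con d ` EXT n M B"
    proof
      fix z assume z: "z \<in> EXT (Suc n) (cob d) B"
      obtain x where "x \<in> EXT n M B" "con d x = z" using con_surj[OF d(1,3) B le_refl z] d(2) by metis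
      then show "z \<in> con d ` EXT n M B" by blast
    qed
  qed
  moreover have "cons es' ` EXT (Suc n) (cob d) B = EXT (n + length es) L B" using b by (simp add: bij_betw_def)
  ultimately show "cons es ` EXT n M B = EXT (n + length es) L B"
    unfolding e by (metis (no_types, lifting) cons.simps(2) image_cong image_image)
qed

lemma cons_diff:
  assumes es: "copath M L es" "projs es" "es \<noteq> []" and B: "B \<in> \<C>" and x: "x \<in> EXT n M B" "y \<in> EXT n M B"
  shows "x \<otimes>\<^bsub>grp n M B\<^esub> inv\<^bsub>grp n M B\<^esub> y \<in> PS M B \<longleftrightarrow> cons es x = cons es y"
proof -
  interpret h: group_hom "grp n M B" "grp (n + length es) L B" "cons es" by (rule cons_group_hom(1)[OF es B])
  have c: "x \<in> carrier (grp n M B)" "y \<in> carrier (grp n M B)" using x by simp_all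
  have "x \<otimes>\<^bsub>grp n M B\<^esub> inv\<^bsub>grp n M B\<^esub> y \<in> kernel (grp n M B) (grp (n + length es) L B) (cons es) \<longleftrightarrow>
    cons es x \<otimes>\<^bsub>grp (n + length es) L B\<^esub> inv\<^bsub>grp (n + length es) L B\<^esub> cons es y = \<one>\<^bsub>grp (n + length es) L B\<^esub>"
    using c h.G.m_closed[OF c(1) h.G.inv_closed[OF c(2)]]
    by (simp only: kernel_def mem_Collect_eq h.hom_mult[OF c(1) h.G.inv_closed[OF c(2)]] h.hom_inv[OF c(2)] simp_thms)
  also have "\<dots> \<longleftrightarrow> cons es x = cons es y"
    using h.H.inv_equality h.hom_closed[OF c(1)] h.hom_closed[OF c(2)]
    by (metis h.H.inv_closed h.H.inv_inv h.H.r_inv)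
  finally show ?thesis unfolding cons_group_hom(2)[OF es B] .
qed

lemma unit_conflation_iff:
  assumes "0 < k"
  shows "unit_conflation \<A> \<C> n k N K d \<longleftrightarrow> (\<exists>cs. path N K cs \<and> projs cs \<and> length cs = k \<and> spl cs = d)"
proof -
  have *: "(\<forall>j<length cs. proj (src \<A> (spl cs ! j))) \<longleftrightarrow> projs cs" if "path N K cs" "cs \<noteq> []" for cs
  proof -
    have "src \<A> (spl cs ! j) = mob (cs ! j)" if "j < length cs" for j
      using seq_obj_splice(2)[OF \<open>path N K cs\<close> \<open>cs \<noteq> []\<close> that] by (simp add: seq_obj_def)
    then show ?thesis by (auto simp: all_set_conv_all_nth)
  qed
  show ?thesis
  proof
    assume "unit_conflation \<A> \<C> n k N K d"
    then obtain cs where "cs \<noteq> []" "length cs = k" "path N K cs" "d = spl cs" "\<forall>j<k. proj (src \<A> (d ! j))"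
      unfolding unit_conflation_def long_conflation_iff by blast
    then show "\<exists>cs. path N K cs \<and> projs cs \<and> length cs = k \<and> spl cs = d" using * by metis
  next
    assume "\<exists>cs. path N K cs \<and> projs cs \<and> length cs = k \<and> spl cs = d"
    then obtain cs where cs: "path N K cs" "projs cs" "length cs = k" "spl cs = d" by blast
    then have "cs \<noteq> []" using assms by auto
    then show "unit_conflation \<A> \<C> n k N K d"
      unfolding unit_conflation_def long_conflation_iff using cs * by metis
  qed
qed

lemma syzygy_splice: "path N K cs \<Longrightarrow> syzygy \<A> N (spl cs) = K"
  using path_iff_spliceable[of cs N K] by (cases "cs = []") (auto simp: syzygy_def last_splice)

definition unit_seqs :: "'o \<Rightarrow> 'm list set" where
  "unit_seqs N = {spl cs | cs K. path N K cs \<and> projs cs \<and> length cs = n}"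

lemma unit_seqs_0: "n = 0 \<Longrightarrow> N \<in> \<C> \<Longrightarrow> unit_seqs N = {[]}"
  unfolding unit_seqs_def by auto

lemma unit_seqsE:
  assumes "d \<in> unit_seqs N"
  obtains cs where "path N (syzygy \<A> N d) cs" "projs cs" "length cs = n" "d = spl cs" "syzygy \<A> N d \<in> \<C>"
proof -
  obtain cs K where cs: "path N K cs" "projs cs" "length cs = n" "d = spl cs" using assms by (auto simp: unit_seqs_def)
  then show thesis using that[of cs] syzygy_splice[OF cs(1)] path_C[OF cs(1)] by simp
qed

lemma phantom_pairs_iff:
  assumes N: "N \<in> \<C>"
  shows "(x, d) \<in> phantom_pairs \<A> \<C> n M N \<longleftrightarrow> d \<in> unit_seqs N \<and> x \<in> carrier (EP M (syzygy \<A> N d))"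
proof (cases "n = 0")
  case True
  then have "d \<in> unit_seqs N \<longleftrightarrow> d = []" using unit_seqs_0[OF _ N] by blast
  then show ?thesis using True by (auto simp: phantom_pairs_def)
next
  case False
  have "d \<in> unit_seqs N \<longleftrightarrow> unit_conflation \<A> \<C> n n N (syzygy \<A> N d) d"
    using unit_conflation_iff[of n N "syzygy \<A> N d" d] False syzygy_splice by (auto simp: unit_seqs_def)
  then show ?thesis using False by (auto simp: phantom_pairs_def)
qed

text \<open>A complete invariant: \<open>(\<gamma>, \<delta>)\<close> is sent to the unique \<open>z \<in> Ext\<^sup>n\<^sup>+\<^sup>1(L, N)\<close> with \<open>\<delta> z = \<gamma> \<nu>\<close>, where \<open>\<nu>\<close> is
  a fixed unit conflation \<open>M \<rightarrow> \<dots> \<rightarrow> L\<close> of length \<open>n + 1\<close>.\<close>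

lemma invariant_pos:
  assumes C: "M \<in> \<C>" "N \<in> \<C>" and n: "0 < n"
  obtains iv L where "group (grp (Suc n) L N)"
    "\<forall>d\<in>unit_seqs N. (\<lambda>x. iv (x, d)) \<in> iso (EP M (syzygy \<A> N d)) (grp (Suc n) L N)"
    "phantom_rel \<A> \<C> n M N = {(r, r'). r \<in> phantom_pairs \<A> \<C> n M N \<and> r' \<in> phantom_pairs \<A> \<C> n M N \<and> iv r = iv r'}"
proof -
  obtain es L where es: "copath M L es" "length es = Suc n" "projs es" using ex_coresolution[OF C(1)] by blast
  have ne: "es \<noteq> []" using es(2) by auto
  have L: "L \<in> \<C>" using copath_C[OF es(1)] by simp
  define csel where "csel d = (SOME cs. path N (syzygy \<A> N d) cs \<and> projs cs \<and> length cs = n \<and> d = spl cs)" for d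
  have csel: "path N (syzygy \<A> N d) (csel d) \<and> projs (csel d) \<and> length (csel d) = n \<and> d = spl (csel d)"
    if d: "d \<in> unit_seqs N" for d
  proof -
    have "\<exists>cs. path N (syzygy \<A> N d) cs \<and> projs cs \<and> length cs = n \<and> d = spl cs"
      using unit_seqsE[OF d] by metis
    then show ?thesis unfolding csel_def by (rule someI_ex)
  qed
  define iv where "iv r = inv_into (EXT (Suc n) L N) (covs (csel (snd r))) (induced_on_cosets (cons es) (fst r))" for r
  have sK: "syzygy \<A> N d \<in> \<C>" if d: "d \<in> unit_seqs N" for d using unit_seqsE[OF d] by metis
  have bij: "bij_betw (covs cs) (EXT (Suc n) L N) (EXT (n + Suc n) L K)" if "path N K cs" "projs cs" "length cs = n" for cs K
    using covs_bij[OF that(1,2) L, of "Suc n"] that(3) by (simp add: add.commute)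
  have iso1: "induced_on_cosets (cons es) \<in> iso (EP M K) (grp (n + Suc n) L K)"
    and val: "\<And>\<gamma>. \<gamma> \<in> EXT n M K \<Longrightarrow> induced_on_cosets (cons es) (bar M K \<gamma>) = cons es \<gamma>" if K: "K \<in> \<C>" for K
  proof -
    note gh = cons_group_hom[OF es(1,3) ne K, unfolded es(2)]
    interpret h: group_hom "grp n M K" "grp (n + Suc n) L K" "cons es" by (rule gh(1))
    show "induced_on_cosets (cons es) \<in> iso (EP M K) (grp (n + Suc n) L K)"
      using h.FactGroup_iso_set gh(3) unfolding induced_on_cosets_def[abs_def] ext_mod_proj_def gh(2) by simp
    show "induced_on_cosets (cons es) (bar M K \<gamma>) = cons es \<gamma>" if "\<gamma> \<in> EXT n M K" for \<gamma>
      unfolding induced_on_cosets_def ext_bar_def using h.the_elem_coset[OF _ gh(2)[symmetric]] that by simp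
  qed
  have gH: "group (grp (Suc n) L N)" by (rule group_grp[OF L C(2)])
  have iso: "(\<lambda>x. iv (x, d)) \<in> iso (EP M (syzygy \<A> N d)) (grp (Suc n) L N)" if d: "d \<in> unit_seqs N" for d
  proof -
    have c: "path N (syzygy \<A> N d) (csel d)" "projs (csel d)" "length (csel d) = n" using csel[OF d] by auto
    have "covs (csel d) \<in> iso (grp (Suc n) L N) (grp (n + Suc n) L (syzygy \<A> N d))"
      using bij[OF c] covs_plus[OF c(1) L] by (auto simp: iso_def hom_def bij_betw_def)
    from group.iso_set_sym[OF gH this]
    have "inv_into (EXT (Suc n) L N) (covs (csel d)) \<in> iso (grp (n + Suc n) L (syzygy \<A> N d)) (grp (Suc n) L N)" by simp
    from iso_set_trans[OF iso1[OF sK[OF d]] this] show ?thesis by (simp add: iv_def comp_def)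
  qed
  have ivD: "iv (bar M (syzygy \<A> N (spl cs)) \<gamma>, spl cs) \<in> EXT (Suc n) L N"
      "covs cs (iv (bar M (syzygy \<A> N (spl cs)) \<gamma>, spl cs)) = cons es \<gamma>"
    if cs: "path N K cs" "projs cs" "length cs = n" and g: "\<gamma> \<in> EXT n M K" for cs K \<gamma>
  proof -
    have K: "syzygy \<A> N (spl cs) = K" by (rule syzygy_splice[OF cs(1)])
    have KC: "K \<in> \<C>" using path_C[OF cs(1)] by simp
    have d: "spl cs \<in> unit_seqs N" using cs by (auto simp: unit_seqs_def)
    have c: "path N K (csel (spl cs))" "projs (csel (spl cs))" "length (csel (spl cs)) = n" "spl cs = spl (csel (spl cs))"
      using csel[OF d] K by auto
    have 1: "cons es \<gamma> \<in> EXT (n + Suc n) L K" using cons_Ext[OF es(1) KC g] es(2) by simp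
    have s: "covs (csel (spl cs)) ` EXT (Suc n) L N = EXT (n + Suc n) L K" using bij[OF c(1-3)] by (simp add: bij_betw_def)
    have iv: "iv (bar M K \<gamma>, spl cs) = inv_into (EXT (Suc n) L N) (covs (csel (spl cs))) (cons es \<gamma>)"
      using val[OF KC g] by (simp add: iv_def)
    show 2: "iv (bar M (syzygy \<A> N (spl cs)) \<gamma>, spl cs) \<in> EXT (Suc n) L N"
      unfolding K iv by (rule inv_into_into) (use s 1 in simp)
    have "covs (csel (spl cs)) (iv (bar M K \<gamma>, spl cs)) = cons es \<gamma>"
      unfolding iv by (rule f_inv_into_f) (use s 1 in simp)
    moreover have "covs cs (iv (bar M K \<gamma>, spl cs)) = covs (csel (spl cs)) (iv (bar M K \<gamma>, spl cs))"
      using covs_cl_cong[OF cs(1) _ c(1) _ L 2[unfolded K]] c(4) cs(3) n unfolding cl_def by fastforce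
    ultimately show "covs cs (iv (bar M (syzygy \<A> N (spl cs)) \<gamma>, spl cs)) = cons es \<gamma>" unfolding K by simp
  qed
  have rel: "((x, d), (x', d')) \<in> phantom_rel \<A> \<C> n M N \<longleftrightarrow> iv (x, d) = iv (x', d')"
    if P: "(x, d) \<in> phantom_pairs \<A> \<C> n M N" "(x', d') \<in> phantom_pairs \<A> \<C> n M N" for x d x' d'
  proof -
    have d: "d \<in> unit_seqs N" "x \<in> carrier (EP M (syzygy \<A> N d))" "d' \<in> unit_seqs N" "x' \<in> carrier (EP M (syzygy \<A> N d'))"
      using P phantom_pairs_iff[OF C(2)] by auto
    obtain cs where cs: "path N (syzygy \<A> N d) cs" "projs cs" "length cs = n" "d = spl cs" and KC: "syzygy \<A> N d \<in> \<C>" by (rule unit_seqsE[OF d(1)])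
    obtain ds where ds: "path N (syzygy \<A> N d') ds" "projs ds" "length ds = n" "d' = spl ds" and KC': "syzygy \<A> N d' \<in> \<C>" by (rule unit_seqsE[OF d(3)])
    let ?K = "syzygy \<A> N d" and ?K' = "syzygy \<A> N d'"
    have nes: "cs \<noteq> []" "ds \<noteq> []" using cs(3) ds(3) n by auto
    have iv1: "iv (x, d) \<in> EXT (Suc n) L N" "covs cs (iv (x, d)) = cons es \<gamma>" "\<gamma> \<in> EXT n M ?K" if "\<gamma> \<in> x" for \<gamma>
    proof -
      obtain \<gamma>0 where g0: "\<gamma>0 \<in> EXT n M ?K" "x = bar M ?K \<gamma>0" using d(2) carrier_EP by blast
      then have g: "\<gamma> \<in> EXT n M ?K" "x = bar M ?K \<gamma>" using bar_self(2)[OF C(1) KC g0(1)] that by auto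
      show "iv (x, d) \<in> EXT (Suc n) L N" "covs cs (iv (x, d)) = cons es \<gamma>"
        using ivD[OF cs(1-3) g(1)] g(2) cs(4) by auto
      show "\<gamma> \<in> EXT n M ?K" by (rule g(1))
    qed
    have iv2: "iv (x', d') \<in> EXT (Suc n) L N" "covs ds (iv (x', d')) = cons es \<gamma>" "\<gamma> \<in> EXT n M ?K'" if "\<gamma> \<in> x'" for \<gamma>
    proof -
      obtain \<gamma>0 where g0: "\<gamma>0 \<in> EXT n M ?K'" "x' = bar M ?K' \<gamma>0" using d(4) carrier_EP by blast
      then have g: "\<gamma> \<in> EXT n M ?K'" "x' = bar M ?K' \<gamma>" using bar_self(2)[OF C(1) KC' g0(1)] that by auto
      show "iv (x', d') \<in> EXT (Suc n) L N" "covs ds (iv (x', d')) = cons es \<gamma>"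
        using ivD[OF ds(1-3) g(1)] g(2) ds(4) by auto
      show "\<gamma> \<in> EXT n M ?K'" by (rule g(1))
    qed
    show ?thesis
    proof
      assume "((x, d), (x', d')) \<in> phantom_rel \<A> \<C> n M N"
      then obtain Z a b e g g' where a: "a \<in> Hom \<A> ?K Z" and b: "b \<in> Hom \<A> ?K' Z"
        and e: "unit_conflation \<A> \<C> n n N Z e" "push a (ext_of \<A> \<C> d) = ext_of \<A> \<C> e" "push b (ext_of \<A> \<C> d') = ext_of \<A> \<C> e"
        and g: "g \<in> x" "g' \<in> x'" "push a g \<otimes>\<^bsub>grp n M Z\<^esub> inv\<^bsub>grp n M Z\<^esub> (push b g') \<in> PS M Z"
        using n unfolding phantom_rel_def by auto
      obtain fs where fs: "path N Z fs" "projs fs" "length fs = n" "spl fs = e" using e(1) unit_conflation_iff[OF n] by blast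
      have Z: "Z \<in> \<C>" using path_C[OF fs(1)] by simp
      have at: "a \<in> arrs \<A>" "src \<A> a = ?K" "tgt \<A> a = Z" "b \<in> arrs \<A>" "src \<A> b = ?K'" "tgt \<A> b = Z" using a b by (auto simp: Hom_def)
      have E: "push a g \<in> EXT n M Z" "push b g' \<in> EXT n M Z"
        using push_Ext[OF iv1(3)[OF g(1)] at(1-3) Z] push_Ext[OF iv2(3)[OF g(2)] at(4-6) Z] .
      have "cons es (push a g) = cons es (push b g')"
        using cons_diff[OF es(1,3) ne Z E] g(3) by simp
      then have "push a (cons es g) = push b (cons es g')"
        using cons_push[OF es(1) KC iv1(3)[OF g(1)] at(1,2)] cons_push[OF es(1) KC' iv2(3)[OF g(2)] at(4,5)] at(3,6) Z by simp
      then have "push a (covs cs (iv (x, d))) = push b (covs ds (iv (x', d')))"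
        using iv1(2)[OF g(1)] iv2(2)[OF g(2)] by simp
      moreover have "push a (covs cs (iv (x, d))) = covs fs (iv (x, d))"
        by (rule covs_push_cl[OF cs(1) nes(1) fs(1) _ L iv1(1)[OF g(1)] at(1-3)]) (use e(2) cs(4) fs(4) in \<open>simp add: cl_def\<close>)
      moreover have "push b (covs ds (iv (x', d'))) = covs fs (iv (x', d'))"
        by (rule covs_push_cl[OF ds(1) nes(2) fs(1) _ L iv2(1)[OF g(2)] at(4-6)]) (use e(3) ds(4) fs(4) in \<open>simp add: cl_def\<close>)
      ultimately have "covs fs (iv (x, d)) = covs fs (iv (x', d'))" by simp
      then show "iv (x, d) = iv (x', d')"
        using bij[OF fs(1-3)] iv1(1)[OF g(1)] iv2(1)[OF g(2)] unfolding bij_betw_def inj_on_def by blast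
    next
      assume eq: "iv (x, d) = iv (x', d')"
      obtain Z fs a b where fs: "path N Z fs" "projs fs" and l: "lmor a (idn \<A> N) cs fs" "lmor b (idn \<A> N) ds fs"
        and i: "inflation \<A> \<C> a" "inflation \<A> \<C> b"
        using common_refinement[OF cs(1) ds(1) cs(2) ds(2)] cs(3) ds(3) nes by auto
      have Z: "Z \<in> \<C>" using path_C[OF fs(1)] by simp
      have lf: "length fs = n" using lmor_length[OF l(1)] cs(3) by simp
      have at: "a \<in> arrs \<A>" "src \<A> a = ?K" "tgt \<A> a = Z" "b \<in> arrs \<A>" "src \<A> b = ?K'" "tgt \<A> b = Z"
        using lmor_typed[OF l(1) nes(1) cs(1) fs(1)] lmor_typed[OF l(2) nes(2) ds(1) fs(1)] by auto
      have q: "quasi_invertible \<A> \<C> n a" "quasi_invertible \<A> \<C> n b"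
        by (rule quasi_invertible_if_lmor[OF l(1) cs(1) fs(1) cs(2) fs(2) nes(1)],
            rule quasi_invertible_if_lmor[OF l(2) ds(1) fs(1) ds(2) fs(2) nes(2)])
      have u: "unit_conflation \<A> \<C> n n N Z (spl fs)" using unit_conflation_iff[OF n] fs lf by blast
      have pe: "push a (ext_of \<A> \<C> d) = ext_of \<A> \<C> (spl fs)" "push b (ext_of \<A> \<C> d') = ext_of \<A> \<C> (spl fs)"
        using push_cl[OF cs(1) nes(1) l(1) fs(1)] push_cl[OF ds(1) nes(2) l(2) fs(1)] cs(4) ds(4) by (simp_all add: cl_def)
      obtain g where g: "g \<in> x" using d(2) carrier_EP bar_self(1)[OF C(1) KC] by blast
      obtain g' where g': "g' \<in> x'" using d(4) carrier_EP bar_self(1)[OF C(1) KC'] by blast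
      have E: "push a g \<in> EXT n M Z" "push b g' \<in> EXT n M Z"
        using push_Ext[OF iv1(3)[OF g] at(1-3) Z] push_Ext[OF iv2(3)[OF g'] at(4-6) Z] .
      have "push a (cons es g) = push a (covs cs (iv (x, d)))" using iv1(2)[OF g] by simp
      also have "\<dots> = covs fs (iv (x, d))"
        using covs_lmor[OF l(1) cs(1) L iv1(1)[OF g]] push_id[OF iv1(1)[OF g] C(2)] by simp
      also have "\<dots> = push b (covs ds (iv (x', d')))"
        using covs_lmor[OF l(2) ds(1) L iv2(1)[OF g']] push_id[OF iv2(1)[OF g'] C(2)] eq by simp
      also have "\<dots> = push b (cons es g')" using iv2(2)[OF g'] by simp
      finally have "cons es (push a g) = cons es (push b g')"
        using cons_push[OF es(1) KC iv1(3)[OF g] at(1,2)] cons_push[OF es(1) KC' iv2(3)[OF g'] at(4,5)] at(3,6) Z by simp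
      then have "push a g \<otimes>\<^bsub>grp n M Z\<^esub> inv\<^bsub>grp n M Z\<^esub> (push b g') \<in> PS M Z"
        using cons_diff[OF es(1,3) ne Z E] by simp
      moreover have "a \<in> Hom \<A> ?K Z" "b \<in> Hom \<A> ?K' Z" using at by (auto simp: Hom_def)
      ultimately have "\<exists>Z a b \<epsilon>. a \<in> Hom \<A> ?K Z \<and> b \<in> Hom \<A> ?K' Z \<and>
           inflation \<A> \<C> a \<and> quasi_invertible \<A> \<C> n a \<and> inflation \<A> \<C> b \<and> quasi_invertible \<A> \<C> n b \<and>
           unit_conflation \<A> \<C> n n N Z \<epsilon> \<and> push a (ext_of \<A> \<C> d) = ext_of \<A> \<C> \<epsilon> \<and> push b (ext_of \<A> \<C> d') = ext_of \<A> \<C> \<epsilon> \<and>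
           (\<exists>\<gamma>\<in>x. \<exists>\<gamma>'\<in>x'. push a \<gamma> \<otimes>\<^bsub>grp n M Z\<^esub> inv\<^bsub>grp n M Z\<^esub> (push b \<gamma>') \<in> PS M Z)"
        using i q u pe g g' by blast
      then show "((x, d), (x', d')) \<in> phantom_rel \<A> \<C> n M N"
        unfolding phantom_rel_def using P n by simp
    qed
  qed
  have "phantom_rel \<A> \<C> n M N \<subseteq> phantom_pairs \<A> \<C> n M N \<times> phantom_pairs \<A> \<C> n M N"
    unfolding phantom_rel_def by auto
  with rel have "phantom_rel \<A> \<C> n M N = {(r, r'). r \<in> phantom_pairs \<A> \<C> n M N \<and> r' \<in> phantom_pairs \<A> \<C> n M N \<and> iv r = iv r'}"
    by auto
  then show thesis using that[of L iv] gH iso by blast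
qed

lemma phantom_hom_iso:
  assumes C: "M \<in> \<C>" "N \<in> \<C>" and d0: "d0 \<in> unit_seqs N" and H: "group H"
    and iso: "\<And>d. d \<in> unit_seqs N \<Longrightarrow> (\<lambda>x. iv (x, d)) \<in> iso (EP M (syzygy \<A> N d)) H"
    and rel: "phantom_rel \<A> \<C> n M N = {(r, r'). r \<in> phantom_pairs \<A> \<C> n M N \<and> r' \<in> phantom_pairs \<A> \<C> n M N \<and> iv r = iv r'}"
  shows "(\<lambda>x. phantom_class \<A> \<C> n M N (x, d0)) \<in> iso (EP M (syzygy \<A> N d0)) (phantom_hom \<A> \<C> n M N)"
    "\<And>x y. x \<in> carrier (EP M (syzygy \<A> N d0)) \<Longrightarrow> y \<in> carrier (EP M (syzygy \<A> N d0)) \<Longrightarrow>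
       (x, d0) \<in> phantom_class \<A> \<C> n M N (y, d0) \<longleftrightarrow> x = y"
proof -
  let ?P = "phantom_pairs \<A> \<C> n M N" and ?G = "EP M (syzygy \<A> N d0)"
  have cls: "phantom_class \<A> \<C> n M N r = {r' \<in> ?P. iv r' = iv r}" if "r \<in> ?P" for r
    using that unfolding phantom_class_def rel by auto
  have P: "(x, d) \<in> ?P \<longleftrightarrow> d \<in> unit_seqs N \<and> x \<in> carrier (EP M (syzygy \<A> N d))" for x d
    by (rule phantom_pairs_iff[OF C(2)])
  have grpd: "group (EP M (syzygy \<A> N d))" if d: "d \<in> unit_seqs N" for d
    by (rule unit_seqsE[OF d]) (rule group_EP[OF C(1)])
  have inj: "x = y" if "d \<in> unit_seqs N" "x \<in> carrier (EP M (syzygy \<A> N d))" "y \<in> carrier (EP M (syzygy \<A> N d))" "iv (x, d) = iv (y, d)" for x y d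
    using iso[OF that(1)] that(2-4) unfolding iso_def bij_betw_def inj_on_def by blast
  have mlt: "iv (x \<otimes>\<^bsub>EP M (syzygy \<A> N d)\<^esub> y, d) = iv (x, d) \<otimes>\<^bsub>H\<^esub> iv (y, d)"
    if "d \<in> unit_seqs N" "x \<in> carrier (EP M (syzygy \<A> N d))" "y \<in> carrier (EP M (syzygy \<A> N d))" for x y d
    using iso[OF that(1)] that(2,3) unfolding iso_def hom_def by blast
  show mem: "(x, d0) \<in> phantom_class \<A> \<C> n M N (y, d0) \<longleftrightarrow> x = y" if "x \<in> carrier ?G" "y \<in> carrier ?G" for x y
    using cls[of "(y, d0)"] P d0 that inj[OF d0 that] by auto
  have surj: "\<exists>x\<in>carrier ?G. iv (x, d0) = iv r" if r: "r \<in> ?P" for r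
  proof -
    obtain y d where yd: "r = (y, d)" by (cases r)
    have "iv r \<in> carrier H" using iso[of d] r P yd unfolding iso_def bij_betw_def by auto
    then show ?thesis using iso[OF d0] unfolding iso_def bij_betw_def by force
  qed
  have "bij_betw (\<lambda>x. phantom_class \<A> \<C> n M N (x, d0)) (carrier ?G) (?P // phantom_rel \<A> \<C> n M N)"
    unfolding bij_betw_def
  proof (intro conjI equalityI subsetI)
    show "inj_on (\<lambda>x. phantom_class \<A> \<C> n M N (x, d0)) (carrier ?G)"
    proof (rule inj_onI)
      fix x y assume xy: "x \<in> carrier ?G" "y \<in> carrier ?G" "phantom_class \<A> \<C> n M N (x, d0) = phantom_class \<A> \<C> n M N (y, d0)"
      then show "x = y" using mem[OF xy(1,1)] mem[OF xy(1,2)] by simp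
    qed
  next
    fix u assume "u \<in> (\<lambda>x. phantom_class \<A> \<C> n M N (x, d0)) ` carrier ?G"
    then show "u \<in> ?P // phantom_rel \<A> \<C> n M N"
      using P d0 unfolding phantom_class_def by (auto intro: quotientI)
  next
    fix u assume "u \<in> ?P // phantom_rel \<A> \<C> n M N"
    then obtain r where r: "r \<in> ?P" "u = phantom_class \<A> \<C> n M N r" unfolding phantom_class_def by (rule quotientE) blast
    obtain x where x: "x \<in> carrier ?G" "iv (x, d0) = iv r" using surj[OF r(1)] by blast
    have "u = phantom_class \<A> \<C> n M N (x, d0)" using cls[OF r(1)] cls[of "(x, d0)"] P d0 x r(2) by simp
    then show "u \<in> (\<lambda>x. phantom_class \<A> \<C> n M N (x, d0)) ` carrier ?G" using x by blast
  qed
  moreover have "phantom_class \<A> \<C> n M N (x \<otimes>\<^bsub>?G\<^esub> y, d0) =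
      phantom_class \<A> \<C> n M N (x, d0) \<otimes>\<^bsub>phantom_hom \<A> \<C> n M N\<^esub> phantom_class \<A> \<C> n M N (y, d0)"
    if xy: "x \<in> carrier ?G" "y \<in> carrier ?G" for x y
  proof -
    have c: "x' \<otimes>\<^bsub>EP M (syzygy \<A> N d)\<^esub> y' \<in> carrier (EP M (syzygy \<A> N d))"
      if "d \<in> unit_seqs N" "x' \<in> carrier (EP M (syzygy \<A> N d))" "y' \<in> carrier (EP M (syzygy \<A> N d))" for x' y' d
      using group.is_monoid[OF grpd[OF that(1)]] that(2,3) by (simp add: monoid.m_closed)
    have "phantom_class \<A> \<C> n M N (x' \<otimes>\<^bsub>EP M (syzygy \<A> N d)\<^esub> y', d) = phantom_class \<A> \<C> n M N (x \<otimes>\<^bsub>?G\<^esub> y, d0)"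
      if xd: "(x', d) \<in> phantom_class \<A> \<C> n M N (x, d0)" "(y', d) \<in> phantom_class \<A> \<C> n M N (y, d0)" for x' y' d
    proof -
      have 1: "d \<in> unit_seqs N" "x' \<in> carrier (EP M (syzygy \<A> N d))" "iv (x', d) = iv (x, d0)"
        using xd(1) cls[of "(x, d0)"] P d0 xy by auto
      have 2: "y' \<in> carrier (EP M (syzygy \<A> N d))" "iv (y', d) = iv (y, d0)"
        using xd(2) cls[of "(y, d0)"] P d0 xy by auto
      have "iv (x' \<otimes>\<^bsub>EP M (syzygy \<A> N d)\<^esub> y', d) = iv (x \<otimes>\<^bsub>?G\<^esub> y, d0)"
        using mlt[OF 1(1,2) 2(1)] mlt[OF d0 xy] 1(3) 2(2) by simp
      moreover have "(x' \<otimes>\<^bsub>EP M (syzygy \<A> N d)\<^esub> y', d) \<in> ?P" "(x \<otimes>\<^bsub>?G\<^esub> y, d0) \<in> ?P"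
        using P c[OF 1(1,2) 2(1)] c[OF d0 xy] 1(1) d0 by auto
      ultimately show ?thesis using cls by simp
    qed
    moreover have "(x, d0) \<in> phantom_class \<A> \<C> n M N (x, d0)" "(y, d0) \<in> phantom_class \<A> \<C> n M N (y, d0)"
      using mem xy by auto
    ultimately have "\<Union>{phantom_class \<A> \<C> n M N (x' \<otimes>\<^bsub>EP M (syzygy \<A> N d)\<^esub> y', d) | x' y' d.
        (x', d) \<in> phantom_class \<A> \<C> n M N (x, d0) \<and> (y', d) \<in> phantom_class \<A> \<C> n M N (y, d0)} = phantom_class \<A> \<C> n M N (x \<otimes>\<^bsub>?G\<^esub> y, d0)"
      by blast
    then show ?thesis by (simp add: phantom_hom_def)
  qed
  ultimately show "(\<lambda>x. phantom_class \<A> \<C> n M N (x, d0)) \<in> iso ?G (phantom_hom \<A> \<C> n M N)"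
    by (auto simp: iso_def hom_def phantom_hom_def bij_betw_def)
qed

lemma phantom_rep:
  assumes C: "M \<in> \<C>" "N \<in> \<C>" and d0: "d0 \<in> unit_seqs N"
  shows "(\<lambda>x. phantom_class \<A> \<C> n M N (x, d0)) \<in> iso (EP M (syzygy \<A> N d0)) (phantom_hom \<A> \<C> n M N)"
    "\<And>x y. x \<in> carrier (EP M (syzygy \<A> N d0)) \<Longrightarrow> y \<in> carrier (EP M (syzygy \<A> N d0)) \<Longrightarrow>
       (x, d0) \<in> phantom_class \<A> \<C> n M N (y, d0) \<longleftrightarrow> x = y"
proof -
  have "(\<lambda>x. phantom_class \<A> \<C> n M N (x, d0)) \<in> iso (EP M (syzygy \<A> N d0)) (phantom_hom \<A> \<C> n M N) \<and>
    (\<forall>x\<in>carrier (EP M (syzygy \<A> N d0)). \<forall>y\<in>carrier (EP M (syzygy \<A> N d0)).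
     (x, d0) \<in> phantom_class \<A> \<C> n M N (y, d0) \<longleftrightarrow> x = y)"
  proof (cases "n = 0")
    case True
    have d: "d = []" if "d \<in> unit_seqs N" for d using that unit_seqs_0[OF True C(2)] by blast
    have s: "syzygy \<A> N [] = N" by (simp add: syzygy_def)
    have i: "(\<lambda>x. fst (x, d)) \<in> iso (EP M (syzygy \<A> N d)) (EP M N)" if "d \<in> unit_seqs N" for d
      using d[OF that] by (simp add: s iso_def hom_def bij_betw_def group.is_monoid[OF group_EP[OF C]] monoid.m_closed)
    have r: "phantom_rel \<A> \<C> n M N = {(r, r'). r \<in> phantom_pairs \<A> \<C> n M N \<and> r' \<in> phantom_pairs \<A> \<C> n M N \<and> fst r = fst r'}"
      using True by (auto simp: phantom_rel_def phantom_pairs_def)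
    show ?thesis using phantom_hom_iso[OF C d0 group_EP[OF C] i r] by blast
  next
    case False
    then have "0 < n" by simp
    note n = this
    obtain iv L where inv: "group (grp (Suc n) L N)"
      "\<forall>d\<in>unit_seqs N. (\<lambda>x. iv (x, d)) \<in> iso (EP M (syzygy \<A> N d)) (grp (Suc n) L N)"
      "phantom_rel \<A> \<C> n M N = {(r, r'). r \<in> phantom_pairs \<A> \<C> n M N \<and> r' \<in> phantom_pairs \<A> \<C> n M N \<and> iv r = iv r'}"
      by (rule invariant_pos[OF C n]) (rule that)
    from phantom_hom_iso[OF C d0 inv(1) inv(2)[rule_format] inv(3)] show ?thesis by blast
  qed
  then show "(\<lambda>x. phantom_class \<A> \<C> n M N (x, d0)) \<in> iso (EP M (syzygy \<A> N d0)) (phantom_hom \<A> \<C> n M N)"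
    "\<And>x y. x \<in> carrier (EP M (syzygy \<A> N d0)) \<Longrightarrow> y \<in> carrier (EP M (syzygy \<A> N d0)) \<Longrightarrow>
       (x, d0) \<in> phantom_class \<A> \<C> n M N (y, d0) \<longleftrightarrow> x = y" by blast+
qed

end

lemma ext_catI: "abelian_category \<A> \<Longrightarrow> ext_closed_additive_subcategory \<A> \<C> \<Longrightarrow> ext_cat \<A> \<C>"
  by (simp add: ext_cat_def ext_cat_axioms_def)

theorem theorem9p13:
  fixes \<A> :: "('o, 'm) category_data" and \<C> :: "'o set" and n :: nat
    and M N \<Omega>M \<Omega>N Q P :: 'o and iM pM iN pN :: 'm and cs :: "('m \<times> 'm) list"
  assumes "abelian_category \<A>"
    and "ext_closed_additive_subcategory \<A> \<C>"
    and "n_Frobenius \<A> \<C> n"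
    and "M \<in> \<C>" and "N \<in> \<C>"
    and "conflation \<A> \<C> iM pM" and "iM \<in> Hom \<A> \<Omega>M Q" and "pM \<in> Hom \<A> Q M"
    and "n_projective \<A> \<C> n Q"
    and "conflation \<A> \<C> iN pN" and "iN \<in> Hom \<A> \<Omega>N P" and "pN \<in> Hom \<A> P N"
    and "n_projective \<A> \<C> n P"
    \<comment> \<open>\<open>cs\<close>: the chosen conflations \<open>\<Omega>\<^sup>i\<^sup>+\<^sup>1N \<rightarrow> P\<^sub>i \<rightarrow> \<Omega>\<^sup>iN\<close>, \<open>0 \<le> i \<le> n\<close>, the given one for \<open>i = 0\<close>\<close>
    and "length cs = n + 1" and "cs ! 0 = (iN, pN)" and "spliceable \<A> \<C> cs"
    and "\<forall>k\<le>n. n_projective \<A> \<C> n (tgt \<A> (fst (cs ! k)))"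
  defines "\<Omega>nN \<equiv> tgt \<A> (snd (cs ! n))"
    and "\<Omega>n1N \<equiv> src \<A> (fst (cs ! n))"
    and "\<delta>\<^sub>N \<equiv> splice_conflations \<A> (take n cs)"
    and "\<delta>\<^sub>\<Omega>\<^sub>N \<equiv> splice_conflations \<A> (tl cs)"
    and "conn1 \<equiv> connecting_cov \<A> \<C> (cs ! n)"
    and "conn2 \<equiv> connecting_con \<A> \<C> (iM, pM)"
    and "\<theta> \<equiv> theta \<A> \<C> n (iM, pM) cs"
    and "\<Omega> \<equiv> Omega_map \<A> \<C> n (iM, pM) cs"
  shows
    "(\<forall>\<gamma>\<in>Ext \<A> \<C> n M \<Omega>nN. induced_on_cosets conn1 (ext_bar \<A> \<C> n M \<Omega>nN \<gamma>) = conn1 \<gamma>) \<and>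
     induced_on_cosets conn1 \<in> iso (ext_mod_proj \<A> \<C> n M \<Omega>nN) (ext_group \<A> \<C> (n + 1) M \<Omega>n1N) \<and>
     (\<forall>\<eta>\<in>Ext \<A> \<C> n \<Omega>M \<Omega>n1N. induced_on_cosets conn2 (ext_bar \<A> \<C> n \<Omega>M \<Omega>n1N \<eta>) = conn2 \<eta>) \<and>
     induced_on_cosets conn2 \<in> iso (ext_mod_proj \<A> \<C> n \<Omega>M \<Omega>n1N) (ext_group \<A> \<C> (n + 1) M \<Omega>n1N) \<and>
     (\<forall>\<gamma>\<in>Ext \<A> \<C> n M \<Omega>nN.
        \<Omega> (phantom_class \<A> \<C> n M N (ext_bar \<A> \<C> n M \<Omega>nN \<gamma>, \<delta>\<^sub>N)) =
          phantom_class \<A> \<C> n \<Omega>M \<Omega>N (\<theta> (ext_bar \<A> \<C> n M \<Omega>nN \<gamma>), \<delta>\<^sub>\<Omega>\<^sub>N)) \<and>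
     \<Omega> \<in> iso (phantom_hom \<A> \<C> n M N) (phantom_hom \<A> \<C> n \<Omega>M \<Omega>N)"
proof -
  interpret frobenius_cat \<A> \<C> n
    using assms(1-3) by (simp add: frobenius_cat_def frobenius_cat_axioms_def ext_catI)
  let ?c = "(iM, pM)" and ?e = "cs ! n"
  have c: "conf ?c" "kob ?c = \<Omega>M" "cob ?c = M" "proj (mob ?c)"
    using assms(6-9) by (simp_all add: Hom_def)
  have ne: "cs \<noteq> []" using assms(14) by auto
  then have hd: "hd cs = (iN, pN)" and l: "last cs = ?e"
    using assms(14,15) hd_conv_nth[of cs] last_conv_nth[of cs] by auto
  have tN: "tgt \<A> pN = N" "src \<A> iN = \<Omega>N" using assms(11,12) by (auto simp: Hom_def)
  have p: "path N \<Omega>n1N cs"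
    using path_iff_spliceable[OF ne] assms(16) hd l tN by (simp add: \<Omega>n1N_def)
  have P: "projs cs" using assms(14,17) by (auto simp: all_set_conv_all_nth)
  have tk: "cs = take n cs @ [?e]" using assms(14) by (simp add: take_Suc_conv_app_nth[symmetric])
  then have "path N \<Omega>n1N (take n cs @ [?e])" using p by simp
  then have p1: "path N \<Omega>nN (take n cs)" "conf ?e" "kob ?e = \<Omega>n1N" "cob ?e = \<Omega>nN"
    by (auto simp: path_append \<Omega>nN_def)
  have tlc: "cs = (iN, pN) # tl cs" using ne hd by (cases cs) auto
  then have "path N \<Omega>n1N ((iN, pN) # tl cs)" using p by simp
  then have p2: "path \<Omega>N \<Omega>n1N (tl cs)" using tN by simp
  have Pe: "proj (mob ?e)" using assms(17) by simp
  have C: "M \<in> \<C>" "N \<in> \<C>" "\<Omega>M \<in> \<C>" "\<Omega>N \<in> \<C>" "\<Omega>nN \<in> \<C>" "\<Omega>n1N \<in> \<C>"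
    using assms(4,5) confD(4)[OF c(1)] c(2) path_C[OF p1(1)] path_C[OF p2] by auto
  have u1: "\<delta>\<^sub>N \<in> unit_seqs N"
    unfolding unit_seqs_def \<delta>\<^sub>N_def mem_Collect_eq
    by (rule exI[of _ "take n cs"]) (use p1(1) P assms(14) in \<open>auto dest: in_set_takeD\<close>)
  have u2: "\<delta>\<^sub>\<Omega>\<^sub>N \<in> unit_seqs \<Omega>N"
    unfolding unit_seqs_def \<delta>\<^sub>\<Omega>\<^sub>N_def mem_Collect_eq
    by (rule exI[of _ "tl cs"]) (use p2 P assms(14) ne in \<open>auto dest: list.set_sel(2)\<close>)
  have s: "syzygy \<A> N \<delta>\<^sub>N = \<Omega>nN" "syzygy \<A> \<Omega>N \<delta>\<^sub>\<Omega>\<^sub>N = \<Omega>n1N"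
    unfolding \<delta>\<^sub>N_def \<delta>\<^sub>\<Omega>\<^sub>N_def by (rule syzygy_splice[OF p1(1)], rule syzygy_splice[OF p2])
  have 1: "\<And>\<gamma>. \<gamma> \<in> EXT n M \<Omega>nN \<Longrightarrow> induced_on_cosets conn1 (bar M \<Omega>nN \<gamma>) = conn1 \<gamma>"
    and i1: "induced_on_cosets conn1 \<in> iso (EP M \<Omega>nN) (grp (Suc n) M \<Omega>n1N)"
    using induced_cov[OF p1(2) Pe C(1)] unfolding conn1_def p1(3,4) by blast+
  have 2: "\<And>\<eta>. \<eta> \<in> EXT n \<Omega>M \<Omega>n1N \<Longrightarrow> induced_on_cosets conn2 (bar \<Omega>M \<Omega>n1N \<eta>) = conn2 \<eta>"
    and i2: "induced_on_cosets conn2 \<in> iso (EP \<Omega>M \<Omega>n1N) (grp (Suc n) M \<Omega>n1N)"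
    using induced_con[OF c(1,4) C(6)] unfolding conn2_def c(2,3) by blast+
  let ?F = "\<lambda>x. phantom_class \<A> \<C> n M N (x, \<delta>\<^sub>N)" and ?F' = "\<lambda>x. phantom_class \<A> \<C> n \<Omega>M \<Omega>N (x, \<delta>\<^sub>\<Omega>\<^sub>N)"
  note r1 = phantom_rep[OF C(1,2) u1, unfolded s] and r2 = phantom_rep[OF C(3,4) u2, unfolded s]
  have "inv_into (carrier (EP \<Omega>M \<Omega>n1N)) (induced_on_cosets conn2) \<circ> induced_on_cosets conn1 \<in> iso (EP M \<Omega>nN) (EP \<Omega>M \<Omega>n1N)"
    by (rule iso_set_trans[OF i1 group.iso_set_sym[OF group_EP[OF C(3,6)] i2]])
  moreover have "\<theta> = inv_into (carrier (EP \<Omega>M \<Omega>n1N)) (induced_on_cosets conn2) \<circ> induced_on_cosets conn1"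
    using c(2) by (simp add: \<theta>_def theta_def[abs_def] conn1_def conn2_def \<Omega>n1N_def comp_def)
  ultimately have th: "\<theta> \<in> iso (EP M \<Omega>nN) (EP \<Omega>M \<Omega>n1N)" by simp
  have om: "\<Omega> (?F x) = ?F' (\<theta> x)" if x: "x \<in> carrier (EP M \<Omega>nN)" for x
  proof -
    have "(y, \<delta>\<^sub>N) \<in> ?F x \<longleftrightarrow> y = x" for y
    proof
      assume y: "(y, \<delta>\<^sub>N) \<in> ?F x"
      then have "(y, \<delta>\<^sub>N) \<in> phantom_pairs \<A> \<C> n M N" by (auto simp: phantom_class_def phantom_rel_def)
      then have "y \<in> carrier (EP M \<Omega>nN)" using phantom_pairs_iff[OF C(2)] s by simp
      then show "y = x" using r1(2) x y by blast
    qed (use r1(2)[OF x x] in simp)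
    then have "\<Omega> (?F x) = \<Union>{phantom_class \<A> \<C> n (src \<A> iM) (src \<A> (fst (cs ! 0))) (\<theta> y, \<delta>\<^sub>\<Omega>\<^sub>N) | y. y = x}"
      by (simp add: \<Omega>_def Omega_map_def \<theta>_def \<delta>\<^sub>N_def \<delta>\<^sub>\<Omega>\<^sub>N_def)
    then show ?thesis using c(2) assms(15) tN by simp
  qed
  have "?F' \<circ> \<theta> \<in> iso (EP M \<Omega>nN) (phantom_hom \<A> \<C> n \<Omega>M \<Omega>N)"
    by (rule iso_set_trans[OF th r2(1)])
  then have "\<Omega> \<in> iso (phantom_hom \<A> \<C> n M N) (phantom_hom \<A> \<C> n \<Omega>M \<Omega>N)"
    by (rule iso_transport[OF group_EP[OF C(1,5)] r1(1)]) (use om in simp)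
  then show ?thesis using 1 2 i1 i2 om carrier_EP by auto
qed

end
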